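(* Let $U_1\in\mathrm U(N)$ be a unitarily invariant random matrix drawn from a cyclic Pólya ensemble on $\mathrm U(N)$ associated to the weight $\omega\in\widetilde L_N^1(\mathbb S_1)$. (1) Let $U_2\in\mathrm U(N)$ be a second unitarily invariant random matrix, independent of $U_1$, drawn from a cyclic polynomial ensemble associated to the weights $\{w_j\}_{j=0,\ldots,N-1}\subset L_N^1(\mathbb S_1)$. Then $U=U_1U_2$ belongs to a cyclic polynomial ensemble associated to the weights $$\widetilde w_j(z')=w_j\ast\omega(z')=\int_{\mathbb S_1}\frac{d\widetilde z}{2\pi i\widetilde z}\,w_j\Big(\frac{z'}{\widetilde z}\Big)\omega(\widetilde z)\in L^1_N(\mathbb S_1)$$ for all $j=0,\ldots,N-1$ and $z'\in\mathbb S_1$. (2) Let $U_2\in\mathrm U(N)$ be a second unitarily invariant random matrix, independent of $U_1$, drawn from a cyclic Pólya ensemble associated to the weight $\widehat\omega\in\widetilde L_N^1(\mathbb S_1)$. Then $U=U_1U_2$ is a cyclic Pólya ensemble associated to the weight $$\widetilde\omega(z')=\widehat\omega\ast\omega(z')=\int_{\mathbb S_1}\frac{d\widetilde z}{2\pi i\widetilde z}\,\widehat\omega\Big(\frac{z'}{\widetilde z}\Big)\omega(\widetilde z)\in\widetilde L^1_N(\mathbb S_1)$$ for all $z'\in\mathbb S_1$. (3) Let $U_2\in\mathrm U(N)$ be fixed with pairwise different eigenvalues $x=\mathrm{diag}(x_1,\ldots,x_N)\in\mathbb S_1^N$, i.e. $x_a\neq x_b$ for $a\neq b$, and let $V\in\mathrm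 U(N)$ be Haar distributed and independent of $U_1$. Then the random matrix $U=U_1VU_2V^\dagger$ belongs to a cyclic polynomial ensemble associated to the weights $$\widetilde w_j(z')=\omega\Big(\frac{z'}{x_{j+1}}\Big)$$ for all $j=0,\ldots,N-1$ and $z'\in\mathbb S_1$. In particular, the joint probability density of the eigenvalues $z=\mathrm{diag}(z_1,\ldots,z_N)\in\mathbb S_1^N$ of $U$ is equal to $$p_N^{(U)}(z|x)=\frac{1}{N!\prod_{j=0}^{N-1}\mathcal S\omega(j)}\,\frac{\Delta_N(z)}{\Delta_N(x)}\det\Big[\omega\Big(\frac{z_a}{x_b}\Big)\Big]_{a,b=1,\ldots,N}.$$ For a degenerate spectrum of $U_2$, one needs to apply l'Hôpital's rule.
   Context: $\mathbb S_1=\{z\in\mathbb C: |z|=1\}$ carries the normalised Haar measure $\frac{dz'}{2\pi i z'}$ (i.e. $\frac{d\theta}{2\pi}$ for $z'=e^{i\theta}$). A star denotes complex conjugation. $\Delta_N(z)=\prod_{1\le a<b\le N}(z_b-z_a)$. For $w\in L^1(\mathbb S_1)$ and $s\in\mathbb Z$, $\mathcal Sw(s)=\int_{\mathbb S_1}\frac{dz'}{2\pi i z'}{z'}^{s}w(z')$. A random matrix $U\in\mathrm U(N)$ is unitarily invariant if its distribution is invariant under $U\mapsto VUV^\dagger$ for all $V\in\mathrm U(N)$. Densities of eigenvalues are with respect to $\prod_{j=1}^N\frac{dz_j}{2\pi i z_j}$ on $\mathbb S_1^N$. $L_N^1(\mathbb S_1)=\{w\in L^1(\mathbb S_1): [w(z)]^*=z^{N-1}w(z)\}$.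 $\widetilde L_N^1(\mathbb S_1)$ is the set of $w\in L_N^1(\mathbb S_1)$ that are $(N-1)$-times differentiable with $\partial^jw\in L^1(\mathbb S_1)$ for all $j=0,\ldots,N-1$; here the functions are $(N-2)$-times continuously differentiable, while the $(N-1)$-th derivative needs only to exist almost everywhere. Cyclic polynomial ensemble: a unitarily invariant random matrix $U\in\mathrm U(N)$ is a cyclic polynomial ensemble associated to the weights $\{w_j\}_{j=0,\ldots,N-1}\subset L_N^1(\mathbb S_1)$ iff the joint probability density of its eigenvalues has the form $$p_N^{(U)}(z)=\frac{1}{C_NN!}\,\frac{\Delta_N(z)}{i^{N(N-1)/2}}\det[w_{b-1}(z_a)]_{a,b=1,\ldots,N}\ge0,\qquad C_N=\det\Big[\int_{\mathbb S_1}\frac{dz'}{2\pi i z'}(-iz')^{a-1}w_{b-1}(z')\Big]_{a,b=1,\ldots,N}>0 .$$ Cyclic Pólya ensemble: a unitarily invariant random matrix $U\in\mathrm U(N)$ is drawn from a cyclic Pólya ensemble associated to the weight $\omega\in\widetilde L_N^1(\mathbb S_1)$ iff the joint probability density of its eigenvalues can be written as $$p_N^{(U)}(z)=\frac{1}{N!\prod_{j=0}^{N-1}[j!\,\mathcal S\omega(j)]}\,\Delta_N(z)\det[(-z_a\partial_{z_a})^{b-1}\omega(z_a)]_{a,b=1,\ldots,N}\ge0 ,$$ with positive normalisation $\prod_{j=0}^{N-1}j!\,\mathcal S\omega(j)>0$.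
   Formalization: In (3) the weights ω(z'/x_{j+1}) carry unimodular constants, since literally they miss L^1_N and C_N>0; the density with the exact weights is kept. In L̃^1_N the (N-2)-th derivative must be the integral of the (N-1)-th (absolute continuity), else (3) fails. *)

theory Defs
  imports
    "HOL-Probability.Probability"
    "HOL-Library.Complex_Order"
begin

(* The order on complex used for positivity statements is the one of Complex_Order:
   0 \<le> c means that c is real and nonnegative, 0 < c that c is real and positive.

   The matrix size N is CARD('n), where 'n is any finite linearly ordered index type; its elements
   in increasing order play the role of the indices 1, ..., N.  Hence pos b stands for b - 1, and a
   family of weights w_0, ..., w_(N-1) is a function on 'n, with w b standing for w_(b-1). *)

definition pos :: "'n::{finite,linorder} \<Rightarrow> nat" where
  "pos b = card {a. a < b}"

definition vandermonde :: "('n::{finite,linorder} \<Rightarrow> complex) \<Rightarrow> complex" where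
  "vandermonde z = (\<Prod>(a, b) \<in> {(a, b). a < b}. z b - z a)"


subsection \<open>Functions on the unit circle\<close>

abbreviation circle :: "complex set" where
  "circle \<equiv> sphere 0 1"

definition circle_haar :: "complex measure" where
  "circle_haar = distr (uniform_measure lborel {0..2 * pi}) (restrict_space borel circle) cis"

definition torus_haar :: "('n::finite \<Rightarrow> complex) measure" where
  "torus_haar = PiM UNIV (\<lambda>_. circle_haar)"

definition mellin :: "(complex \<Rightarrow> complex) \<Rightarrow> int \<Rightarrow> complex" where
  "mellin w s = (\<integral>z. z powi s * w z \<partial>circle_haar)"

definition circle_conv :: "(complex \<Rightarrow> complex) \<Rightarrow> (complex \<Rightarrow> complex) \<Rightarrow> complex \<Rightarrow> complex" where
  "circle_conv f g z = (\<integral>t. f (z / t) * g t \<partial>circle_haar)"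

(* The derivative d/dz of a function that matters only on the circle, taken along the circle. *)

definition has_circle_deriv :: "(complex \<Rightarrow> complex) \<Rightarrow> complex \<Rightarrow> complex \<Rightarrow> bool" where
  "has_circle_deriv f D z \<longleftrightarrow> (f has_field_derivative D) (at z within circle)"

definition circle_deriv :: "(complex \<Rightarrow> complex) \<Rightarrow> complex \<Rightarrow> complex" where
  "circle_deriv f z =
     (if \<exists>D. has_circle_deriv f D z then THE D. has_circle_deriv f D z else 0)"

definition neg_euler :: "(complex \<Rightarrow> complex) \<Rightarrow> complex \<Rightarrow> complex" where
  "neg_euler f z = - z * circle_deriv f z"

definition L1_cyclic :: "nat \<Rightarrow> (complex \<Rightarrow> complex) set" where
  "L1_cyclic N = {w. integrable circle_haar w \<and>
     (AE z in circle_haar. cnj (w z) = z ^ (N - 1) * w z)}"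

(* The last clause says that the derivative of order N - 2 is absolutely continuous, so that the
   almost everywhere derivative of order N - 1 is also the weak one.  Without it a singular part
   (as in the Cantor function) would be lost by the last differentiation.
   For N = 1 there is no condition beyond membership in L1_cyclic 1. *)

definition L1_cyclic_diff :: "nat \<Rightarrow> (complex \<Rightarrow> complex) set" where
  "L1_cyclic_diff N = {w \<in> L1_cyclic N.
     (\<forall>j<N. integrable circle_haar ((circle_deriv ^^ j) w)) \<and>
     (\<forall>j. j + 2 \<le> N \<longrightarrow> continuous_on circle ((circle_deriv ^^ j) w)) \<and>
     (\<forall>j. j + 3 \<le> N \<longrightarrow>
        (\<forall>z\<in>circle. has_circle_deriv ((circle_deriv ^^ j) w) ((circle_deriv ^^ (j + 1)) w z) z)) \<and>
     (2 \<le> N \<longrightarrow>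
        (AE z in circle_haar.
           has_circle_deriv ((circle_deriv ^^ (N - 2)) w) ((circle_deriv ^^ (N - 1)) w z) z) \<and>
        (\<forall>s t. s \<le> t \<longrightarrow>
           (circle_deriv ^^ (N - 2)) w (cis t) - (circle_deriv ^^ (N - 2)) w (cis s)
           = (LBINT \<theta>:{s..t}. \<i> * cis \<theta> * (circle_deriv ^^ (N - 1)) w (cis \<theta>))))}"


subsection \<open>Random unitary matrices\<close>

(* Square matrices; the notation complex ^ 'n ^ 'n would fix the sort of 'n to finite. *)

type_synonym 'n cmat = "((complex, 'n) vec, 'n) vec"

definition dagger :: "'n::finite cmat \<Rightarrow> 'n cmat" where
  "dagger A = (\<chi> i j. cnj (A $ j $ i))"

definition unitary_group :: "'n::finite cmat set" where
  "unitary_group = {A. A ** dagger A = mat 1 \<and> dagger A ** A = mat 1}"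

definition unitary_space :: "'n::finite cmat measure" where
  "unitary_space = restrict_space borel unitary_group"

definition unitarily_invariant :: "'a measure \<Rightarrow> ('a \<Rightarrow> 'n::finite cmat) \<Rightarrow> bool" where
  "unitarily_invariant M U \<longleftrightarrow> U \<in> measurable M unitary_space \<and>
     (\<forall>V\<in>unitary_group.
        distr M unitary_space (\<lambda>\<xi>. V ** U \<xi> ** dagger V) = distr M unitary_space U)"

(* Left invariance of the law suffices: on a compact group the invariant probability measure is
   unique and two-sided invariant. *)

definition haar_distributed :: "'a measure \<Rightarrow> ('a \<Rightarrow> 'n::finite cmat) \<Rightarrow> bool" where
  "haar_distributed M V \<longleftrightarrow> V \<in> measurable M unitary_space \<and>
     (\<forall>W\<in>unitary_group. distr M unitary_space (\<lambda>\<xi>. W ** V \<xi>) = distr M unitary_space V)"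

(* z lists the eigenvalues of A with algebraic multiplicity, in some order. *)

definition is_spectrum :: "'n::finite cmat \<Rightarrow> ('n \<Rightarrow> complex) \<Rightarrow> bool" where
  "is_spectrum A z \<longleftrightarrow> (\<forall>x. det (mat x - A) = (\<Prod>a\<in>UNIV. x - z a))"

definition some_spectrum :: "'n::finite cmat \<Rightarrow> 'n \<Rightarrow> complex" where
  "some_spectrum A = (SOME z. is_spectrum A z)"

definition symmetric_on_torus :: "(('n::finite \<Rightarrow> complex) \<Rightarrow> 'b) \<Rightarrow> bool" where
  "symmetric_on_torus f \<longleftrightarrow>
     (\<forall>\<pi>. bij \<pi> \<longrightarrow> (\<forall>z\<in>space torus_haar. f (z \<circ> \<pi>) = f z))"

(* The eigenvalues form an unordered N-tuple, so their joint density is a symmetric function and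
   is tested against symmetric functions; the choice made by some_spectrum is then irrelevant. *)

definition eigenvalue_density ::
  "'a measure \<Rightarrow> ('a \<Rightarrow> 'n::finite cmat) \<Rightarrow> (('n \<Rightarrow> complex) \<Rightarrow> complex) \<Rightarrow> bool" where
  "eigenvalue_density M U p \<longleftrightarrow>
     p \<in> borel_measurable torus_haar \<and> symmetric_on_torus p \<and> (AE z in torus_haar. 0 \<le> p z) \<and>
     (\<forall>f :: ('n \<Rightarrow> complex) \<Rightarrow> ennreal.
        f \<in> borel_measurable torus_haar \<longrightarrow> symmetric_on_torus f \<longrightarrow>
        (\<integral>\<^sup>+\<xi>. f (some_spectrum (U \<xi>)) \<partial>M) = (\<integral>\<^sup>+z. f z * ennreal (Re (p z)) \<partial>torus_haar))"


subsection \<open>Cyclic polynomial and cyclic Polya ensembles\<close>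

definition cyclic_const :: "('n::{finite,linorder} \<Rightarrow> complex \<Rightarrow> complex) \<Rightarrow> complex" where
  "cyclic_const w = det (\<chi> (a::'n) b. \<integral>z. (- \<i> * z) ^ pos a * w b z \<partial>circle_haar)"

definition cyclic_density ::
  "('n::{finite,linorder} \<Rightarrow> complex \<Rightarrow> complex) \<Rightarrow> ('n \<Rightarrow> complex) \<Rightarrow> complex" where
  "cyclic_density w z =
     1 / (cyclic_const w * fact CARD('n))
     * (vandermonde z / \<i> ^ (CARD('n) * (CARD('n) - 1) div 2))
     * det (\<chi> (a::'n) b. w b (z a))"

definition cyclic_polynomial_ensemble ::
  "'a measure \<Rightarrow> ('a \<Rightarrow> 'n::{finite,linorder} cmat) \<Rightarrow> ('n \<Rightarrow> complex \<Rightarrow> complex) \<Rightarrow> bool"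
where
  "cyclic_polynomial_ensemble M U w \<longleftrightarrow>
     unitarily_invariant M U \<and> (\<forall>b. w b \<in> L1_cyclic CARD('n)) \<and>
     0 < cyclic_const w \<and> eigenvalue_density M U (cyclic_density w)"

definition polya_density ::
  "(complex \<Rightarrow> complex) \<Rightarrow> ('n::{finite,linorder} \<Rightarrow> complex) \<Rightarrow> complex" where
  "polya_density \<omega> z =
     1 / (fact CARD('n) * (\<Prod>j<CARD('n). fact j * mellin \<omega> (int j)))
     * vandermonde z * det (\<chi> (a::'n) b. (neg_euler ^^ pos b) \<omega> (z a))"

definition cyclic_polya_ensemble ::
  "'a measure \<Rightarrow> ('a \<Rightarrow> 'n::{finite,linorder} cmat) \<Rightarrow> (complex \<Rightarrow> complex) \<Rightarrow> bool" where
  "cyclic_polya_ensemble M U \<omega> \<longleftrightarrow>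
     unitarily_invariant M U \<and> \<omega> \<in> L1_cyclic_diff CARD('n) \<and>
     0 < (\<Prod>j<CARD('n). fact j * mellin \<omega> (int j)) \<and>
     eigenvalue_density M U (polya_density \<omega>)"

(* The functions w b = (%z. \<omega> (z / x b)) satisfy the reflection symmetry of L1_cyclic only up to a
   unimodular constant depending on b, and cyclic_const w is nonzero but in general not positive.
   Multiplying each w b by a nonzero constant leaves cyclic_density w unchanged. *)

definition conditional_density ::
  "(complex \<Rightarrow> complex) \<Rightarrow> ('n::{finite,linorder} \<Rightarrow> complex) \<Rightarrow> ('n \<Rightarrow> complex) \<Rightarrow> complex" where
  "conditional_density \<omega> x z =
     1 / (fact CARD('n) * (\<Prod>j<CARD('n). mellin \<omega> (int j)))
     * (vandermonde z / vandermonde x) * det (\<chi> (a::'n) b. \<omega> (z a / x b))"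

(* L'Hopital's rule for conditional_density at a point x with coinciding entries.  Writing
   vandermonde x = det [x_b ^ (a - 1)], the k-th repetition of an entry requires k derivatives,
   with respect to that entry, of the corresponding column of numerator and denominator. *)

definition repetition :: "('n::{finite,linorder} \<Rightarrow> complex) \<Rightarrow> 'n \<Rightarrow> nat" where
  "repetition x b = card {a. a < b \<and> x a = x b}"

definition conditional_density_lhopital ::
  "(complex \<Rightarrow> complex) \<Rightarrow> ('n::{finite,linorder} \<Rightarrow> complex) \<Rightarrow> ('n \<Rightarrow> complex) \<Rightarrow> complex" where
  "conditional_density_lhopital \<omega> x z =
     1 / (fact CARD('n) * (\<Prod>j<CARD('n). mellin \<omega> (int j))) * vandermonde z
     * (det (\<chi> (a::'n) b. (circle_deriv ^^ repetition x b) (\<lambda>y. \<omega> (z a / y)) (x b))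
        / det (\<chi> (a::'n) b. (circle_deriv ^^ repetition x b) (\<lambda>y. y ^ pos a) (x b)))"

end

theory Submission
  imports Defs "HOL-Computational_Algebra.Fundamental_Theorem_Algebra"
begin

text \<open>
  All densities in question are a Vandermonde determinant times \<open>det [\<psi>\<^sub>b (z\<^sub>a)]\<close>.  By Andreief's
  identity their integrals against \<open>(z\<^sub>1 \<cdots> z\<^sub>N)\<^sup>-\<^sup>k s(z)\<close>, where \<open>s\<close> is a Schur polynomial, are
  determinants of Mellin transforms of the weights, and by the Stone-Weierstrass theorem these
  moments determine the law of the eigenvalues.

  On the matrix side, a second order differential operator commuting with left and right
  multiplications, the Casimir operator, has the Schur functions \<open>s(A)\<close> of the eigenvalues of \<open>A\<close> as
  eigenfunctions on the unitary group.  Separating its eigenvalues yields the functional equation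
  \<open>E [s(A U)] s(1) = s(A) E [s(U)]\<close> for unitarily invariant \<open>U\<close> and unitary \<open>A\<close>, also with a power of
  \<open>det U\<close> inside the expectations; no Haar measure on the unitary group is needed.  Hence the moments
  of a product of independent unitarily invariant matrices are products of moments, up to \<open>s(1)\<close>.

  The Mellin transform of \<open>(- z \<partial>)\<^sup>b \<omega>\<close> at \<open>m\<close> is \<open>m\<^sup>b\<close> times that of \<open>\<omega>\<close>.  Therefore the moment of a
  Polya ensemble is \<open>s(1)\<close> times a product of values of the Mellin transform of \<open>\<omega>\<close>, one for each row
  of the determinant, and multiplication by \<open>U\<^sub>1\<close> multiplies the Mellin transforms of all weights by
  that of \<open>\<omega>\<close>: the weights are convolved with \<open>\<omega>\<close>.
\<close>

subsection \<open>Vandermonde determinants and Schur polynomials\<close>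

text \<open>Different Schur functions may share a Casimir eigenvalue, so the operator does not
  identify \<open>s\<close> among all exponents. It does so inside the product of elementary
  symmetric functions over the columns of the diagram of \<open>s\<close>: all terms there have
  equal degree, the wanted one alone has the largest sum of squared exponents, and the eigenvalue
  depends on these two numbers only. A polynomial in the operator then isolates the wanted term,
  before averaging as well as after it. To be differentiated, Schur functions of matrices must be
  polynomials in the entries; the unitary group is large enough for polynomial identities on it to
  survive complex differentiation. Conjugated entries are excluded, so the conjugate determinant is
  carried along separately: its powers supply the negative exponents of Laurent polynomials. Two
  obstacles shape the analysis. The list of eigenvalues is a mere choice, so measurability is
  obtained for symmetrized functions only. The highest derivative exists only almost everywhere, so
  the weights are replaced by explicit combinations of derivatives with known Mellin
  transforms.\<close>

lemma pos_less_iff [simp]: "pos a < pos b \<longleftrightarrow> a < (b::'n::{finite,linorder})"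
proof -
  have *: "pos a < pos b" if "a < b" for a b :: 'n
    unfolding pos_def by (rule psubset_card_mono) (use that in auto)
  show ?thesis using * by (metis linorder_cases order_less_asym)
qed

lemma pos_le_iff [simp]: "pos a \<le> pos b \<longleftrightarrow> a \<le> (b::'n::{finite,linorder})"
  by (simp flip: not_less)

lemma inj_pos: "inj (pos :: 'n::{finite,linorder} \<Rightarrow> nat)"
  by (rule injI) (metis linorder_cases pos_less_iff order_less_irrefl)

lemma pos_less_card: "pos (a :: 'n::{finite,linorder}) < CARD('n)"
  unfolding pos_def by (rule psubset_card_mono) auto

lemma bij_betw_pos: "bij_betw (pos :: 'n::{finite,linorder} \<Rightarrow> nat) UNIV {..<CARD('n)}"
proof -
  have "range (pos :: 'n \<Rightarrow> nat) = {..<CARD('n)}"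
    by (rule card_subset_eq) (auto simp: pos_less_card card_image inj_pos)
  with inj_pos show ?thesis by (simp add: bij_betw_def)
qed

lemma sum_over_pos: "(\<Sum>a\<in>UNIV. f (pos (a::'n::{finite,linorder}))) = (\<Sum>k<CARD('n). f k)"
  by (rule sum.reindex_bij_betw[OF bij_betw_pos])

lemma prod_over_pos: "(\<Prod>a\<in>UNIV. f (pos (a::'n::{finite,linorder}))) = (\<Prod>k<CARD('n). f k)"
  by (rule prod.reindex_bij_betw[OF bij_betw_pos])

text \<open>A permutation leaves the sum of all positions unchanged, so if no index moves down, none
  can move up.\<close>

lemma permutes_le_imp_id:
  fixes p :: "'n::{finite,linorder} \<Rightarrow> 'n"
  assumes "p permutes UNIV" "\<And>i. i \<le> p i"
  shows "p = id"
proof (rule ccontr)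
  assume "p \<noteq> id"
  then obtain i where "p i \<noteq> i" by (auto simp: fun_eq_iff)
  then have i: "i < p i" using assms(2)[of i] by simp
  have "(\<Sum>i\<in>UNIV. pos (i::'n)) < (\<Sum>i\<in>UNIV. pos (p i))"
  proof (rule sum_strict_mono_ex1)
    show "\<exists>a\<in>UNIV. pos a < pos (p a)" using i by auto
  qed (use assms(2) in auto)
  also have "\<dots> = (\<Sum>i\<in>UNIV. pos (i::'n))"
    by (rule sum.permute[OF assms(1), symmetric, unfolded o_def])
  finally show False by simp
qed

lemma det_lower_triangular_linorder:
  fixes A :: "'n::{finite,linorder} cmat"
  assumes "\<And>i j. i < j \<Longrightarrow> A $ i $ j = 0"
  shows "det A = (\<Prod>i\<in>UNIV. A $ i $ i)"
proof -
  have "of_int (sign p) * (\<Prod>i\<in>UNIV. A $ i $ p i) = 0" if p: "p permutes UNIV" "p \<noteq> id" for p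
  proof -
    \<comment> \<open>Otherwise \<open>inv p\<close>, and with it \<open>p\<close>, would be the
      identity. Row \<open>inv p i\<close> then contributes an entry strictly above the
      diagonal.\<close>
    obtain i where "\<not> i \<le> inv p i"
      using permutes_le_imp_id[OF permutes_inv[OF p(1)]] p by (metis inv_id permutes_inv_inv)
    then have "A $ inv p i $ p (inv p i) = 0"
      using assms[of "inv p i" i] permutes_inverses(1)[OF p(1)] by simp
    then show ?thesis by (auto intro!: prod_zero)
  qed
  then have "det A = (\<Sum>p\<in>{id}. of_int (sign p) * (\<Prod>i\<in>UNIV. A $ i $ p i))"
    unfolding det_def
    by (intro sum.mono_neutral_right) (auto simp: permutes_id finite_permutations)
  then show ?thesis by (simp add: sign_id)
qed

lemma det_upper_triangular_linorder:
  fixes A :: "'n::{finite,linorder} cmat"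
  assumes "\<And>i j. j < i \<Longrightarrow> A $ i $ j = 0"
  shows "det A = (\<Prod>i\<in>UNIV. A $ i $ i)"
proof -
  have "det (transpose A) = (\<Prod>i\<in>UNIV. transpose A $ i $ i)"
    by (rule det_lower_triangular_linorder) (simp add: transpose_def assms)
  moreover have "transpose A $ i $ i = A $ i $ i" for i by (simp add: transpose_def)
  ultimately show ?thesis by simp
qed

lemma vandermonde_nested_prod:
  fixes z :: "'n::{finite,linorder} \<Rightarrow> complex"
  shows "vandermonde z = (\<Prod>a\<in>UNIV. \<Prod>c\<in>{c. c < a}. z a - z c)"
proof -
  have "vandermonde z = (\<Prod>(a, c)\<in>Sigma UNIV (\<lambda>a. {c. c < a}). z a - z c)"
    unfolding vandermonde_def
    by (rule prod.reindex_bij_witness[of _ "\<lambda>(a,b). (b,a)" "\<lambda>(a,b). (b,a)"]) auto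
  also have "\<dots> = (\<Prod>a\<in>UNIV. \<Prod>c\<in>{c. c < a}. z a - z c)"
    by (rule prod.Sigma[symmetric]) auto
  finally show ?thesis .
qed

text \<open>The Newton polynomials are monic of degree \<open>pos a\<close>, so replacing the
  monomials by them multiplies with a unitriangular matrix and keeps the determinant; the vanishing
  assumption makes the new matrix triangular. Point evaluations give the Vandermonde product,
  derivatives at repeated nodes its confluent form.\<close>

lemma det_newton_functionals:
  fixes l :: "'n::{finite,linorder} \<Rightarrow> complex poly \<Rightarrow> complex"
  assumes add: "\<And>b p q. l b (p + q) = l b p + l b q"
    and smult: "\<And>b c p. l b (smult c p) = c * l b p"
    and van: "\<And>a b. b < a \<Longrightarrow> l b (\<Prod>c\<in>{c. c < a}. [:- z c, 1:]) = 0"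
  shows "det (\<chi> a b. l b (monom 1 (pos a))) = (\<Prod>a\<in>UNIV. l a (\<Prod>c\<in>{c. c < a}. [:- z c, 1:]))"
proof -
  define q where "q a = (\<Prod>c\<in>{c. c < a}. [:- z c, 1:])" for a
  have deg: "degree (q a) = pos a" for a
    unfolding q_def pos_def by (subst degree_prod_sum_eq) auto
  have lead: "coeff (q a) (pos a) = 1" for a
    using lead_coeff_prod[of "\<lambda>c. [:- z c, 1:]" "{c. c < a}"] deg[of a] by (simp add: q_def)
  have l0: "l b 0 = 0" for b using smult[of b 0 0] by simp
  have sm: "l b (sum f A) = (\<Sum>x\<in>A. l b (f x))" for b A and f :: "nat \<Rightarrow> complex poly"
    by (induction A rule: infinite_finite_induct) (auto simp: l0 add)
  have ev: "l b (q a) = (\<Sum>c\<in>UNIV. coeff (q a) (pos (c::'n)) * l b (monom 1 (pos c)))" for a b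
  proof -
    have "(\<Sum>c\<in>UNIV. coeff (q a) (pos (c::'n)) * l b (monom 1 (pos c))) = (\<Sum>k<CARD('n). coeff (q a) k * l b (monom 1 k))"
      by (rule sum_over_pos)
    also have "\<dots> = (\<Sum>k\<le>pos a. coeff (q a) k * l b (monom 1 k))"
      by (rule sum.mono_neutral_right)
        (use pos_less_card[of a] deg in \<open>auto simp: coeff_eq_0\<close>)
    also have "\<dots> = l b (\<Sum>k\<le>pos a. smult (coeff (q a) k) (monom 1 k))"
      by (simp only: sm smult)
    also have "(\<Sum>k\<le>pos a. smult (coeff (q a) k) (monom 1 k)) = q a"
      using poly_as_sum_of_monoms[of "q a"] by (simp add: deg smult_monom)
    finally show ?thesis ..
  qed
  have "(\<chi> a b. l b (q a)) = (\<chi> a (c::'n). coeff (q a) (pos c)) ** (\<chi> (a::'n) b. l b (monom 1 (pos a)))"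
    by (simp add: vec_eq_iff matrix_matrix_mult_def ev)
  then have "det (\<chi> a b. l b (q a))
      = det ((\<chi> a (c::'n). coeff (q a) (pos c)) ** (\<chi> (a::'n) b. l b (monom 1 (pos a))) :: 'n cmat)" by simp
  also have "\<dots> = det (\<chi> a (c::'n). coeff (q a) (pos c)) * det (\<chi> a b. l b (monom 1 (pos a)))"
    by (rule det_mul)
  also have "det (\<chi> a (c::'n). coeff (q a) (pos c)) = (\<Prod>a\<in>UNIV. coeff (q a) (pos a))"
    by (subst det_lower_triangular_linorder) (auto simp: deg intro!: coeff_eq_0)
  also have "\<dots> = 1" by (simp add: lead)
  finally have "det (\<chi> a b. l b (monom 1 (pos a))) = det (\<chi> a b. l b (q a))" by simp
  also have "\<dots> = (\<Prod>a\<in>UNIV. l a (q a))"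
    by (subst det_upper_triangular_linorder) (auto simp: q_def van)
  finally show ?thesis by (simp add: q_def)
qed

lemma vandermonde_det:
  fixes z :: "'n::{finite,linorder} \<Rightarrow> complex"
  shows "det (\<chi> a b. z b ^ pos a) = vandermonde z"
proof -
  have "det (\<chi> a b. z b ^ pos a) = det (\<chi> a b. poly (monom 1 (pos a)) (z b))"
    by (simp add: poly_monom)
  also have "\<dots> = (\<Prod>a\<in>UNIV. poly (\<Prod>c\<in>{c. c < a}. [:- z c, 1:]) (z a))"
  proof (rule det_newton_functionals)
    show "poly (\<Prod>c\<in>{c. c < a}. [:- z c, 1:]) (z b) = 0" if "b < a" for a b :: 'n
      using that by (auto simp: poly_prod intro!: prod_zero)
  qed auto
  also have "\<dots> = (\<Prod>a\<in>UNIV. \<Prod>c\<in>{c. c < a}. z a - z c)"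
    by (simp add: poly_prod)
  also have "\<dots> = vandermonde z" by (rule vandermonde_nested_prod[symmetric])
  finally show ?thesis .
qed

lemma vandermonde_eq_0_iff: "vandermonde z = 0 \<longleftrightarrow> \<not> inj (z :: 'n::{finite,linorder} \<Rightarrow> complex)"
proof
  assume "vandermonde z = 0"
  then obtain a b where "a < b" "z b - z a = 0"
    unfolding vandermonde_def by (subst (asm) prod_zero_iff) auto
  then show "\<not> inj z" by (auto simp: inj_def)
next
  assume "\<not> inj z"
  then obtain a b where "a < b" "z b - z a = 0" unfolding inj_def
    by (metis linorder_less_linear right_minus_eq)
  then show "vandermonde z = 0" unfolding vandermonde_def
    by (intro prod_zero) auto
qed

section \<open>Alternants and Schur polynomials\<close>

definition alternant :: "('n::finite \<Rightarrow> nat) \<Rightarrow> ('n \<Rightarrow> complex) \<Rightarrow> complex" where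
  "alternant s z = det (\<chi> a b. z b ^ s a)"

lemma alternant_expand:
  "alternant s z = (\<Sum>p | p permutes UNIV. of_int (sign p) * (\<Prod>i\<in>UNIV. z (p i) ^ s i))"
  by (simp add: alternant_def det_def)

lemma alternant_permute:
  assumes "p permutes UNIV"
  shows "alternant s (z \<circ> p) = of_int (sign p) * alternant s z"
  using det_permute_columns[OF assms, of "\<chi> a b. z b ^ s a"] by (simp add: alternant_def)

lemma alternant_pos: "alternant pos z = vandermonde z"
  by (simp add: alternant_def vandermonde_det)

lemma vandermonde_permute:
  "p permutes UNIV \<Longrightarrow> vandermonde (z \<circ> p) = of_int (sign p) * vandermonde z"
  using alternant_permute[of p pos z] by (simp add: alternant_pos)

text \<open>\<open>(\<Sum>k<n. reduction n c m k * y ^ k)\<close> is the remainder of \<open>y ^ m\<close> modulo the monic polynomial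
  with lower coefficients \<open>c 0, \<dots>, c (n - 1)\<close>.  Determinants of these rows give the Schur
  polynomials as polynomials in the coefficients of the characteristic polynomial, so that no
  division by a Vandermonde determinant is needed at coinciding arguments.\<close>

fun reduction :: "nat \<Rightarrow> (nat \<Rightarrow> 'a::comm_ring_1) \<Rightarrow> nat \<Rightarrow> nat \<Rightarrow> 'a" where
  "reduction n c 0 k = (if k = 0 then 1 else 0)"
| "reduction n c (Suc m) k =
     (if k = 0 then 0 else reduction n c m (k - 1)) - reduction n c m (n - 1) * c k"

lemma smult_sum_right: "smult c (\<Sum>i\<in>A. f i) = (\<Sum>i\<in>A. smult c (f i))"
  by (induction A rule: infinite_finite_induct) (auto simp: smult_add_right)

lemma reduction_dvd:
  assumes "n > 0"
  shows "(\<Sum>k<n. monom (c k) k) + monom 1 n dvd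
    monom (1::'a::comm_ring_1) m - (\<Sum>k<n. monom (reduction n c m k) k)"
proof (induction m)
  case 0
  have "(\<Sum>k<n. monom (reduction n c 0 k) k) = (\<Sum>k<n. if k = 0 then monom 1 k else (0::'a poly))"
    by (rule sum.cong) auto
  also have "\<dots> = monom 1 0" using assms by (simp add: sum.delta')
  finally show ?case by (simp only: diff_self) simp
next
  case (Suc m)
  let ?X = "(\<Sum>k<n. monom (c k) k) + monom 1 n"
  let ?r = "reduction n c m"
  obtain l where l: "n = Suc l" using assms not0_implies_Suc by blast
  have "(\<Sum>k<n. monom (reduction n c (Suc m) k) k)
     = (\<Sum>k<n. monom (if k = 0 then 0 else ?r (k - 1)) k) - (\<Sum>k<n. monom (?r (n - 1) * c k) k)"
    by (simp add: diff_monom[symmetric] sum_subtractf del: reduction.simps(1))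
  also have "(\<Sum>k<n. monom (if k = 0 then 0 else ?r (k - 1)) k) = (\<Sum>k<l. monom (?r k) (Suc k))"
    unfolding l by (subst sum.lessThan_Suc_shift) simp
  also have "\<dots> = monom 1 1 * (\<Sum>k<n. monom (?r k) k) - monom (?r (n - 1)) n"
    by (simp add: l sum_distrib_left mult_monom distrib_left)
  also have "(\<Sum>k<n. monom (?r (n - 1) * c k) k) = smult (?r (n - 1)) (\<Sum>k<n. monom (c k) k)"
    by (simp flip: smult_monom add: smult_sum_right)
  finally have "monom 1 (Suc m) - (\<Sum>k<n. monom (reduction n c (Suc m) k) k)
     = monom 1 1 * (monom 1 m - (\<Sum>k<n. monom (?r k) k)) + smult (?r (n - 1)) ?X"
    by (simp add: smult_add_right smult_monom algebra_simps mult_monom)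
  then show ?case by (simp only:) (rule dvd_add[OF dvd_mult[OF Suc] dvd_smult[OF dvd_refl]])
qed

text \<open>The sequence \<open>c\<close> holds the lower coefficients of a monic polynomial, so
  that one formula serves both a list of roots and the characteristic polynomial of a
  matrix.\<close>

definition schur_coeff :: "(nat \<Rightarrow> complex) \<Rightarrow> ('n::{finite,linorder} \<Rightarrow> nat) \<Rightarrow> complex" where
  "schur_coeff c s = det (\<chi> a b. reduction CARD('n) c (s a) (pos (b::'n)))"

definition root_coeff :: "('n::finite \<Rightarrow> complex) \<Rightarrow> nat \<Rightarrow> complex" where
  "root_coeff z k = coeff (\<Prod>a\<in>UNIV. [:- z a, 1:]) k"

text \<open>The index is not the partition but the exponents of the numerator alternant: for
  increasing \<open>s\<close> the parts are \<open>s b - pos b\<close>. Arbitrary \<open>s\<close>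
  is allowed; permuting it changes at most the sign, and a repeated exponent gives zero.\<close>

definition schur :: "('n::{finite,linorder} \<Rightarrow> nat) \<Rightarrow> ('n \<Rightarrow> complex) \<Rightarrow> complex" where
  "schur s z = schur_coeff (root_coeff z) s"

lemma root_poly_degree: "degree (\<Prod>a\<in>UNIV. [:- z (a::'n::finite), 1::complex:]) = CARD('n)"
  by (subst degree_prod_sum_eq) auto

lemma root_poly_eq:
  "(\<Prod>a\<in>UNIV. [:- z (a::'n::finite), 1:]) = (\<Sum>k<CARD('n). monom (root_coeff z k) k) + monom 1 CARD('n)"
proof -
  let ?p = "\<Prod>a\<in>UNIV. [:- z a, 1:]"
  have l: "coeff ?p CARD('n) = 1"
    using lead_coeff_prod[of "\<lambda>a. [:- z a, 1:]" UNIV] by (simp add: root_poly_degree)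
  have "?p = (\<Sum>k\<le>CARD('n). monom (coeff ?p k) k)"
    using poly_as_sum_of_monoms[of ?p] by (simp add: root_poly_degree)
  then show ?thesis by (simp add: root_coeff_def l flip: lessThan_Suc_atMost)
qed

text \<open>With derivatives at coinciding nodes among the functionals \<open>l b\<close>, this is the quotient of
  alternants in the form that l'Hopital's rule gives it.\<close>

lemma det_functionals_eq_schur:
  fixes l :: "'n::{finite,linorder} \<Rightarrow> complex poly \<Rightarrow> complex"
  assumes add: "\<And>b p q. l b (p + q) = l b p + l b q"
    and smult: "\<And>b c p. l b (smult c p) = c * l b p"
    and van: "\<And>b p. (\<Prod>a\<in>UNIV. [:- z a, 1:]) dvd p \<Longrightarrow> l b p = 0"
  shows "det (\<chi> a b. l b (monom 1 (s a))) = schur s z * det (\<chi> a b. l b (monom 1 (pos a)))"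
proof -
  let ?n = "CARD('n)"
  let ?r = "\<lambda>m. reduction ?n (root_coeff z) m"
  have l0: "l b 0 = 0" for b using smult[of b 0 0] by simp
  have sm: "l b (sum f A) = (\<Sum>x\<in>A. l b (f x))" for b A and f :: "nat \<Rightarrow> complex poly"
    by (induction A rule: infinite_finite_induct) (auto simp: l0 add)
  have *: "l b (monom 1 m) = (\<Sum>c\<in>UNIV. ?r m (pos (c::'n)) * l b (monom 1 (pos c)))" for b m
  proof -
    let ?R = "\<Sum>k<?n. monom (?r m k) k"
    have z: "l b (monom 1 m - ?R) = 0"
      using reduction_dvd[of ?n "root_coeff z" m] by (intro van) (simp add: root_poly_eq)
    have "l b (monom 1 m) = l b ((monom 1 m - ?R) + ?R)" by (simp only: diff_add_cancel)
    also have "\<dots> = l b ?R" by (simp only: add z add_0_left)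
    also have "\<dots> = (\<Sum>k<?n. ?r m k * l b (monom 1 k))"
      unfolding sm by (rule sum.cong[OF refl]) (simp flip: smult add: smult_monom)
    finally show ?thesis
      using sum_over_pos[of "\<lambda>k. ?r m k * l b (monom 1 k)", where ?'n = 'n] by simp
  qed
  have "(\<chi> a b. l b (monom 1 (s a)))
      = (\<chi> a b. ?r (s a) (pos (b::'n))) ** (\<chi> a b. l b (monom 1 (pos a)))"
    unfolding vec_eq_iff matrix_matrix_mult_def vec_lambda_beta by (intro allI *)
  then show ?thesis by (simp add: det_mul schur_def schur_coeff_def)
qed

lemma alternant_eq_schur: "alternant s z = schur s z * vandermonde z"
proof -
  have "det (\<chi> a b. poly (monom 1 (s a)) (z b)) = schur s z * det (\<chi> a b. poly (monom 1 (pos a)) (z b))"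
  proof (rule det_functionals_eq_schur[where l = "\<lambda>b p. poly p (z b)"])
    fix b and p :: "complex poly"
    assume "(\<Prod>a\<in>UNIV. [:- z a, 1:]) dvd p"
    moreover have "poly (\<Prod>a\<in>UNIV. [:- z a, 1:]) (z b) = 0"
      by (auto simp: poly_prod intro!: prod_zero)
    ultimately show "poly p (z b) = 0" by (auto elim!: dvdE)
  qed auto
  then show ?thesis by (simp add: poly_monom alternant_def vandermonde_det)
qed

lemma schur_coeff_permute_exponents:
  fixes s :: "'n::{finite,linorder} \<Rightarrow> nat"
  assumes "p permutes UNIV"
  shows "schur_coeff c (s \<circ> p) = of_int (sign p) * schur_coeff c s"
  using det_permute_rows[OF assms, of "\<chi> a b. reduction CARD('n) c (s a) (pos (b::'n))"]
  by (simp add: schur_coeff_def)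

lemma schur_coeff_not_inj: "\<not> inj s \<Longrightarrow> schur_coeff c s = 0"
proof -
  assume "\<not> inj s"
  then obtain i j where "i \<noteq> j" "s i = s j" by (auto simp: inj_def)
  then show ?thesis unfolding schur_coeff_def
    by (intro det_identical_rows[of i j]) (auto simp: row_def)
qed

lemma continuous_on_root_coeff: "continuous_on UNIV (\<lambda>z :: 'n::finite \<Rightarrow> complex. root_coeff z k)"
proof -
  have "continuous_on UNIV (\<lambda>z. coeff (\<Prod>a\<in>A. [:- z (a::'n), 1::complex:]) k)" if "finite A" for A k
    using that
  proof (induction A arbitrary: k rule: finite_induct)
    case (insert x F)
    have eq: "coeff (\<Prod>a\<in>insert x F. [:- z a, 1:]) k
        = - z x * coeff (\<Prod>a\<in>F. [:- z a, 1:]) k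
          + (if k = 0 then 0 else coeff (\<Prod>a\<in>F. [:- z a, 1:]) (k - 1))" for z :: "'n \<Rightarrow> complex"
      using insert(1,2) by (cases k) (simp_all add: mult_pCons_left coeff_pCons)
    have c: "continuous_on UNIV (\<lambda>z :: 'n \<Rightarrow> complex. if k = 0 then 0 else coeff (\<Prod>a\<in>F. [:- z a, 1:]) (k - 1))"
      using insert.IH[of "k - 1"] by (cases "k = 0") simp_all
    show ?case unfolding eq
      by (rule continuous_on_add[OF continuous_on_mult[OF continuous_on_minus[OF
        continuous_on_product_coordinates] insert.IH] c])
  qed simp
  then show ?thesis unfolding root_coeff_def by auto
qed

lemma continuous_on_det:
  assumes "\<And>i j. continuous_on S (\<lambda>x. f x i j)"
  shows "continuous_on S (\<lambda>x. det (\<chi> i j. f x i j) :: complex)"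
  unfolding det_def using assms by (auto intro!: continuous_intros)

lemma continuous_on_schur: "continuous_on UNIV (\<lambda>z. schur s z)"
proof -
  have "continuous_on UNIV (\<lambda>z. reduction n (root_coeff z) m k)" for n m k
  proof (induction m arbitrary: k)
    case (Suc m)
    show ?case
    proof (cases "k = 0")
      case True
      then show ?thesis
        by (simp, intro continuous_on_minus continuous_on_mult Suc continuous_on_root_coeff)
    next
      case False
      then show ?thesis
        by (simp, intro continuous_on_diff continuous_on_mult Suc continuous_on_root_coeff)
    qed
  qed auto
  then show ?thesis unfolding schur_def schur_coeff_def by (intro continuous_on_det)
qed

subsection \<open>Polynomial functions on matrices and the Casimir operator\<close>

text \<open>Polynomials in the entries without their conjugates, hence holomorphic. The inductive
  form lets derivatives, bounds and the effect of a matrix product be obtained by structural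
  induction.\<close>

inductive matpoly :: "('n::finite cmat \<Rightarrow> complex) \<Rightarrow> bool" where
  matpoly_const: "matpoly (\<lambda>A. c)"
| matpoly_entry: "matpoly (\<lambda>A. A $ i $ j)"
| matpoly_add: "matpoly f \<Longrightarrow> matpoly g \<Longrightarrow> matpoly (\<lambda>A. f A + g A)"
| matpoly_mult: "matpoly f \<Longrightarrow> matpoly g \<Longrightarrow> matpoly (\<lambda>A. f A * g A)"

lemma matpoly_uminus: "matpoly f \<Longrightarrow> matpoly (\<lambda>A. - f A)"
  using matpoly_mult[OF matpoly_const[of "-1"]] by simp

lemma matpoly_diff: "matpoly f \<Longrightarrow> matpoly g \<Longrightarrow> matpoly (\<lambda>A. f A - g A)"
  using matpoly_add[OF _ matpoly_uminus, of f g] by simp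

lemma matpoly_sum: "(\<And>i. i \<in> I \<Longrightarrow> matpoly (f i)) \<Longrightarrow> matpoly (\<lambda>A. \<Sum>i\<in>I. f i A)"
  by (induction I rule: infinite_finite_induct) (auto intro: matpoly_const matpoly_add)

lemma matpoly_prod: "(\<And>i. i \<in> I \<Longrightarrow> matpoly (f i)) \<Longrightarrow> matpoly (\<lambda>A. \<Prod>i\<in>I. f i A)"
  by (induction I rule: infinite_finite_induct) (auto intro: matpoly_const matpoly_mult)

lemmas matpoly_intros = matpoly_const matpoly_entry matpoly_add matpoly_mult matpoly_uminus
  matpoly_diff matpoly_sum matpoly_prod

lemma matpoly_det: "(\<And>i j. matpoly (\<lambda>A. f A i j)) \<Longrightarrow> matpoly (\<lambda>A. det (\<chi> i j. f A i j))"
  unfolding det_def by (simp, intro matpoly_intros)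

lemma continuous_on_matpoly: "matpoly f \<Longrightarrow> continuous_on S f"
  by (induction rule: matpoly.induct) (auto intro!: continuous_intros)

lemma matpoly_compose_mult_right: "matpoly f \<Longrightarrow> matpoly (\<lambda>A. f (A ** B))"
  by (induction rule: matpoly.induct) (auto simp: matrix_matrix_mult_def intro!: matpoly_intros)

lemma matpoly_compose_mult_left: "matpoly f \<Longrightarrow> matpoly (\<lambda>A. f (B ** A))"
  by (induction rule: matpoly.induct) (auto simp: matrix_matrix_mult_def intro!: matpoly_intros)

lemma sum_delta_mult [simp]:
  fixes c :: "'n::finite \<Rightarrow> complex"
  shows "(\<Sum>k\<in>UNIV. (if k = j then t else 0) * c k) = t * c j"
    and "(\<Sum>k\<in>UNIV. c k * (if k = j then t else 0)) = c j * t"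
  by (simp_all add: if_distrib[of "\<lambda>x. x * _"] if_distrib[of "\<lambda>x. _ * x"] cong: if_cong)

lemma matrix_add_rdistrib: "(A + B) ** C = A ** C + (B ** C :: 'n::finite cmat)"
  by (simp add: matrix_matrix_mult_def vec_eq_iff distrib_right sum.distrib)

definition unit_entry :: "'n::finite \<Rightarrow> 'n \<Rightarrow> complex \<Rightarrow> 'n cmat" where
  "unit_entry i j t = (\<chi> k l. if k = i \<and> l = j then t else 0)"

definition pd :: "'n::finite \<Rightarrow> 'n \<Rightarrow> ('n cmat \<Rightarrow> complex) \<Rightarrow> 'n cmat \<Rightarrow> complex" where
  "pd i j f A = deriv (\<lambda>t. f (A + unit_entry i j t)) 0"

lemma matpoly_deriv_exists:
  assumes "matpoly f"
  shows "\<exists>D. matpoly D \<and> (\<forall>A. ((\<lambda>t. f (A + unit_entry i j t)) has_field_derivative D A) (at 0))"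
  using assms
proof induction
  case (matpoly_const c)
  then show ?case by (intro exI[of _ "\<lambda>_. 0"]) (auto intro: matpoly_intros)
next
  case (matpoly_entry k l)
  show ?case
    by (intro exI[of _ "\<lambda>_. if k = i \<and> l = j then 1 else 0"])
      (auto simp: unit_entry_def intro!: matpoly_intros derivative_eq_intros)
next
  case (matpoly_add f g)
  then obtain D E where
    "matpoly D" "\<And>A. ((\<lambda>t. f (A + unit_entry i j t)) has_field_derivative D A) (at 0)"
    "matpoly E" "\<And>A. ((\<lambda>t. g (A + unit_entry i j t)) has_field_derivative E A) (at 0)" by blast
  then show ?case
    by (intro exI[of _ "\<lambda>A. D A + E A"] conjI allI matpoly_intros derivative_intros) auto
next
  case (matpoly_mult f g)
  then obtain D E where
    "matpoly D" "\<And>A. ((\<lambda>t. f (A + unit_entry i j t)) has_field_derivative D A) (at 0)"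
    "matpoly E" "\<And>A. ((\<lambda>t. g (A + unit_entry i j t)) has_field_derivative E A) (at 0)" by blast
  moreover have "unit_entry i j 0 = 0" by (simp add: unit_entry_def vec_eq_iff)
  ultimately show ?case using matpoly_mult(1,2)
    by (intro exI[of _ "\<lambda>A. D A * g A + E A * f A"] conjI allI matpoly_intros)
      (auto intro!: derivative_eq_intros)
qed

lemma
  assumes "matpoly f"
  shows matpoly_pd: "matpoly (pd i j f)"
    and has_field_derivative_pd:
      "((\<lambda>t. f (A + unit_entry i j t)) has_field_derivative pd i j f A) (at 0)"
proof -
  obtain D where D: "matpoly D"
    "\<And>A. ((\<lambda>t. f (A + unit_entry i j t)) has_field_derivative D A) (at 0)"
    using matpoly_deriv_exists[OF assms] by blast
  have "pd i j f = D" unfolding pd_def by (intro ext DERIV_imp_deriv D)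
  with D show "matpoly (pd i j f)"
    "((\<lambda>t. f (A + unit_entry i j t)) has_field_derivative pd i j f A) (at 0)" by auto
qed

lemma pd_eqI:
  "((\<lambda>t. f (A + unit_entry i j t)) has_field_derivative D) (at 0) \<Longrightarrow> pd i j f A = D"
  unfolding pd_def by (rule DERIV_imp_deriv)

lemma unit_entry_0 [simp]: "unit_entry i j 0 = 0"
  by (simp add: unit_entry_def vec_eq_iff)

lemma pd_const: "pd i j (\<lambda>A. c) A = 0"
  by (rule pd_eqI) simp

lemma pd_entry: "pd i j (\<lambda>A. A $ k $ l) A = (if k = i \<and> l = j then 1 else 0)"
  by (rule pd_eqI) (auto simp: unit_entry_def intro!: derivative_eq_intros)

lemma pd_add:
  "matpoly f \<Longrightarrow> matpoly g \<Longrightarrow> pd i j (\<lambda>A. f A + g A) A = pd i j f A + pd i j g A"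
  by (intro pd_eqI DERIV_add has_field_derivative_pd)

lemma pd_mult:
  "matpoly f \<Longrightarrow> matpoly g \<Longrightarrow> pd i j (\<lambda>A. f A * g A) A = pd i j f A * g A + f A * pd i j g A"
  using DERIV_mult[OF has_field_derivative_pd[of f A i j] has_field_derivative_pd[of g A i j]]
  by (intro pd_eqI) (simp add: algebra_simps)

lemma pd_cmult: "matpoly f \<Longrightarrow> pd i j (\<lambda>A. c * f A) A = c * pd i j f A"
  by (simp add: pd_mult matpoly_const pd_const)

lemma pd_sum:
  "(\<And>i. i \<in> I \<Longrightarrow> matpoly (f i)) \<Longrightarrow> pd k l (\<lambda>A. \<Sum>i\<in>I. f i A) A = (\<Sum>i\<in>I. pd k l (f i) A)"
  by (induction I rule: infinite_finite_induct) (auto simp: pd_const pd_add matpoly_sum)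

text \<open>This chain rule is phrased with \<open>has_derivative\<close> because it is applied both
  along complex lines and along the real curves t -> cis t that stay in the unitary group.\<close>

lemma has_derivative_matpoly:
  assumes "matpoly f" and "\<And>k l. ((\<lambda>t. \<gamma> t $ k $ l) has_derivative G k l) (at t0)"
  shows "((\<lambda>t. f (\<gamma> t)) has_derivative (\<lambda>h. \<Sum>k\<in>UNIV. \<Sum>l\<in>UNIV. G k l h * pd k l f (\<gamma> t0))) (at t0)"
  using assms(1)
proof induction
  case (matpoly_const c)
  then show ?case by (simp add: pd_const)
next
  case (matpoly_entry i j)
  have "(\<Sum>k\<in>UNIV. \<Sum>l\<in>UNIV. G k l h * (if i = k \<and> j = l then 1 else 0)) = G i j h" for h
  proof -
    have "(\<Sum>k\<in>UNIV. \<Sum>l\<in>UNIV. G k l h * (if i = k \<and> j = l then 1 else 0))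
       = (\<Sum>k\<in>UNIV. if i = k then G k j h else 0)"
      by (rule sum.cong[OF refl]) (auto simp: if_distrib[of "\<lambda>x. _ * x"] cong: if_cong)
    then show ?thesis by simp
  qed
  then show ?case using assms(2)[of i j] by (simp add: pd_entry has_derivative_def)
next
  case (matpoly_add f g)
  from has_derivative_add[OF this(3,4)] show ?case
    by (rule has_derivative_eq_rhs)
      (simp add: fun_eq_iff pd_add matpoly_add distrib_left sum.distrib)
next
  case (matpoly_mult f g)
  from has_derivative_mult[OF this(3,4)] show ?case
    by (rule has_derivative_eq_rhs)
      (simp add: fun_eq_iff pd_mult matpoly_mult distrib_left sum.distrib sum_distrib_left
        sum_distrib_right mult.assoc mult.commute mult.left_commute)
qed

lemma has_field_derivative_matpoly:
  assumes "matpoly f" and "\<And>k l. ((\<lambda>t. \<gamma> t $ k $ l) has_field_derivative G k l) (at t0)"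
  shows "((\<lambda>t. f (\<gamma> t)) has_field_derivative (\<Sum>k\<in>UNIV. \<Sum>l\<in>UNIV. G k l * pd k l f (\<gamma> t0))) (at t0)"
proof -
  have "((\<lambda>t. \<gamma> t $ k $ l) has_derivative (*) (G k l)) (at t0)" for k l
    using assms(2)[of k l] by (simp add: has_field_derivative_def)
  from has_derivative_matpoly[OF assms(1) this] show ?thesis
    unfolding has_field_derivative_def
    by (rule has_derivative_eq_rhs)
      (simp add: fun_eq_iff sum_distrib_left sum_distrib_right mult.assoc mult.commute mult.left_commute)
qed

lemma pd_compose_mult_right:
  assumes "matpoly f"
  shows "pd k j (\<lambda>A. f (A ** Q)) A = (\<Sum>m\<in>UNIV. Q $ j $ m * pd k m f (A ** Q))"
proof -
  have e: "((A + unit_entry k j t) ** Q) $ r $ m = (A ** Q) $ r $ m + (if r = k then Q $ j $ m else 0) * t"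
    for t r m
  proof -
    have "(unit_entry k j t ** Q) $ r $ m = (if r = k then t * Q $ j $ m else 0)"
      by (auto simp: matrix_matrix_mult_def unit_entry_def)
    then show ?thesis by (simp add: matrix_add_rdistrib)
  qed
  have "((\<lambda>t. ((A + unit_entry k j t) ** Q) $ r $ m) has_field_derivative (if r = k then Q $ j $ m else 0)) (at 0)"
    for r m unfolding e by (auto intro!: derivative_eq_intros)
  from has_field_derivative_matpoly[OF assms this]
  have "pd k j (\<lambda>A. f (A ** Q)) A
      = (\<Sum>r\<in>UNIV. \<Sum>m\<in>UNIV. (if r = k then Q $ j $ m else 0) * pd r m f (A ** Q))"
    by (intro pd_eqI) simp
  also have "\<dots> = (\<Sum>r\<in>UNIV. if r = k then \<Sum>m\<in>UNIV. Q $ j $ m * pd r m f (A ** Q) else 0)"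
    by (rule sum.cong) auto
  finally show ?thesis by simp
qed

text \<open>With E_ij = sum_k A_ki d_kj, the invariant fields generating right multiplications, this
  is sum_ij E_ij E_ji minus N times the Euler operator sum_ki A_ki d_ki: the second order part of
  the Casimir element of gl(N), with all derivatives moved to the right.\<close>

definition casimir :: "('n::finite cmat \<Rightarrow> complex) \<Rightarrow> 'n cmat \<Rightarrow> complex" where
  "casimir f A = (\<Sum>k\<in>UNIV. \<Sum>i\<in>UNIV. \<Sum>l\<in>UNIV. \<Sum>j\<in>UNIV. A $ k $ i * A $ l $ j * pd k j (pd l i f) A)"

lemma matpoly_casimir: "matpoly f \<Longrightarrow> matpoly (casimir f)"
  unfolding casimir_def[abs_def] by (intro matpoly_intros matpoly_pd)

text \<open>Differentiating \<open>f (A ** Q)\<close> in the entry (l, j) produces factors Q_jm, and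
  each column index of a derivative is contracted with an entry of A. Since sum_j A_lj Q_jm is an
  entry of \<open>A ** Q\<close>, the matrix Q disappears.\<close>

lemma casimir_compose_mult_right:
  assumes f: "matpoly f"
  shows "casimir (\<lambda>A. f (A ** Q)) A = casimir f (A ** Q)"
proof -
  let ?B = "A ** Q"
  have 1: "pd l i (\<lambda>A. f (A ** Q)) = (\<lambda>A. \<Sum>n\<in>UNIV. Q $ i $ n * pd l n f (A ** Q))" for l i
    using pd_compose_mult_right[OF f] by blast
  have 2: "pd k j (pd l i (\<lambda>A. f (A ** Q))) A
    = (\<Sum>n\<in>UNIV. Q $ i $ n * (\<Sum>m\<in>UNIV. Q $ j $ m * pd k m (pd l n f) ?B))" for k j l i
    unfolding 1
    by (simp add: pd_sum pd_cmult matpoly_compose_mult_right matpoly_pd f matpoly_intros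
        pd_compose_mult_right)
  have mm: "(\<Sum>j\<in>UNIV. A $ l $ j * (\<Sum>m\<in>UNIV. Q $ j $ m * x m)) = (\<Sum>m\<in>UNIV. ?B $ l $ m * x m)" for l x
    unfolding sum_distrib_left
    by (subst sum.swap) (simp add: matrix_matrix_mult_def sum_distrib_right mult.assoc)
  have "casimir (\<lambda>A. f (A ** Q)) A = (\<Sum>k\<in>UNIV. \<Sum>i\<in>UNIV. A $ k $ i * (\<Sum>l\<in>UNIV. \<Sum>j\<in>UNIV. \<Sum>n\<in>UNIV.
      Q $ i $ n * (A $ l $ j * (\<Sum>m\<in>UNIV. Q $ j $ m * pd k m (pd l n f) ?B))))"
    unfolding casimir_def 2 by (simp add: sum_distrib_left mult.assoc mult.left_commute)
  also have "\<dots> = (\<Sum>k\<in>UNIV. \<Sum>i\<in>UNIV. A $ k $ i * (\<Sum>n\<in>UNIV. Q $ i $ n * (\<Sum>l\<in>UNIV. \<Sum>j\<in>UNIV.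
      A $ l $ j * (\<Sum>m\<in>UNIV. Q $ j $ m * pd k m (pd l n f) ?B))))"
  proof -
    have "(\<Sum>l\<in>UNIV. \<Sum>j\<in>UNIV. \<Sum>n\<in>UNIV. q n * y l j n) = (\<Sum>n\<in>UNIV. q n * (\<Sum>l\<in>UNIV. \<Sum>j\<in>UNIV. y l j n))"
      for q :: "'a \<Rightarrow> complex" and y :: "'a \<Rightarrow> 'a \<Rightarrow> 'a \<Rightarrow> complex"
    proof -
      have "(\<Sum>l\<in>UNIV. \<Sum>j\<in>UNIV. \<Sum>n\<in>UNIV. q n * y l j n) = (\<Sum>l\<in>UNIV. \<Sum>n\<in>UNIV. \<Sum>j\<in>UNIV. q n * y l j n)"
        by (rule sum.cong[OF refl], rule sum.swap)
      also have "\<dots> = (\<Sum>n\<in>UNIV. \<Sum>l\<in>UNIV. \<Sum>j\<in>UNIV. q n * y l j n)" by (rule sum.swap)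
      finally show ?thesis by (simp add: sum_distrib_left)
    qed
    then show ?thesis by simp
  qed
  also have "\<dots> = casimir f ?B"
    unfolding mm casimir_def by (simp add: sum_distrib_left mult.assoc)
  finally show ?thesis .
qed

lemma casimir_add: "matpoly f \<Longrightarrow> matpoly g \<Longrightarrow> casimir (\<lambda>A. f A + g A) A = casimir f A + casimir g A"
proof -
  assume fg: "matpoly f" "matpoly g"
  have "pd l i (\<lambda>A. f A + g A) = (\<lambda>A. pd l i f A + pd l i g A)" for l i
    using pd_add[OF fg] by blast
  then show ?thesis unfolding casimir_def
    by (simp add: fg pd_add matpoly_pd distrib_left sum.distrib)
qed

lemma casimir_cmult: "matpoly f \<Longrightarrow> casimir (\<lambda>A. c * f A) A = c * casimir f A"
proof -
  assume f: "matpoly f"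
  have "pd l i (\<lambda>A. c * f A) = (\<lambda>A. c * pd l i f A)" for l i
    using pd_cmult[OF f] by blast
  then show ?thesis unfolding casimir_def
    by (simp add: f pd_cmult matpoly_pd sum_distrib_left mult.left_commute)
qed

lemma casimir_sum:
  assumes "\<And>i. i \<in> I \<Longrightarrow> matpoly (f i)"
  shows "casimir (\<lambda>A. \<Sum>i\<in>I. f i A) A = (\<Sum>i\<in>I. casimir (f i) A)"
  using assms
proof (induction I rule: infinite_finite_induct)
  case (insert x F)
  then show ?case by (simp add: casimir_add matpoly_sum)
qed (use casimir_cmult[OF matpoly_const, of 0 0 A] in simp_all)

subsection \<open>The radial part of the Casimir operator\<close>

text \<open>Invariance under all invertible matrices, not only unitary ones, so that one may
  differentiate along conjugations by \<open>mat 1 + unit_entry i j t\<close>.\<close>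

definition class_function :: "('n::finite cmat \<Rightarrow> complex) \<Rightarrow> bool" where
  "class_function f \<longleftrightarrow> (\<forall>A Q R. Q ** R = mat 1 \<longrightarrow> f (Q ** A ** R) = f A)"

definition diag_mat :: "('n::finite \<Rightarrow> complex) \<Rightarrow> 'n cmat" where
  "diag_mat a = (\<chi> i j. if i = j then a i else 0)"

lemma unit_entry_mult_left: "(unit_entry i j t ** A) $ r $ m = (if r = i then t * A $ j $ m else 0)"
  by (auto simp: matrix_matrix_mult_def unit_entry_def)

lemma unit_entry_mult_right: "(A ** unit_entry i j t) $ r $ m = (if m = j then A $ r $ i * t else 0)"
  by (auto simp: matrix_matrix_mult_def unit_entry_def)

text \<open>Conjugation invariance turns into f((1 + t E_ij) A) = f(A (1 + t E_ij)), and the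
  identity is the derivative of this at t = 0. For i and j different, E_ij has square zero, so 1 - t
  E_ij is an exact inverse.\<close>

lemma class_function_pd:
  assumes f: "matpoly f" "class_function f" and ij: "i \<noteq> j"
  shows "(\<Sum>k\<in>UNIV. A $ k $ i * pd k j f A) = (\<Sum>l\<in>UNIV. A $ j $ l * pd i l f A)"
proof -
  have inv: "(mat 1 + unit_entry i j t) ** (mat 1 + unit_entry i j (- t)) = mat 1" for t
    using ij by (auto simp: matrix_add_rdistrib matrix_add_ldistrib vec_eq_iff unit_entry_mult_left)
      (auto simp: unit_entry_def)
  have eq: "f ((mat 1 + unit_entry i j t) ** A) = f (A ** (mat 1 + unit_entry i j t))" for t
  proof -
    let ?Q = "mat 1 + unit_entry i j t" and ?R = "mat 1 + unit_entry i j (- t)"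
    have "f (?Q ** (A ** ?Q) ** ?R) = f (A ** ?Q)"
      using f(2) inv unfolding class_function_def by blast
    then show ?thesis by (simp add: matrix_mul_assoc[symmetric] inv)
  qed
  have L: "((\<lambda>t. ((mat 1 + unit_entry i j t) ** A) $ r $ m) has_field_derivative (if r = i then A $ j $ m else 0)) (at 0)"
    for r m
    by (auto simp: matrix_add_rdistrib unit_entry_mult_left intro!: derivative_eq_intros)
  have R: "((\<lambda>t. (A ** (mat 1 + unit_entry i j t)) $ r $ m) has_field_derivative (if m = j then A $ r $ i else 0)) (at 0)"
    for r m
    by (auto simp: matrix_add_ldistrib unit_entry_mult_right intro!: derivative_eq_intros)
  have "(\<Sum>r\<in>UNIV. \<Sum>m\<in>UNIV. (if r = i then A $ j $ m else 0) * pd r m f A)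
      = (\<Sum>r\<in>UNIV. \<Sum>m\<in>UNIV. (if m = j then A $ r $ i else 0) * pd r m f A)"
    using has_field_derivative_matpoly[OF f(1) L] has_field_derivative_matpoly[OF f(1) R]
    unfolding eq by simp (rule DERIV_unique)
  also have "(\<Sum>r\<in>UNIV. \<Sum>m\<in>UNIV. (if r = i then A $ j $ m else 0) * pd r m f A)
      = (\<Sum>r\<in>UNIV. if r = i then \<Sum>m\<in>UNIV. A $ j $ m * pd r m f A else 0)"
    by (rule sum.cong) auto
  also have "\<dots> = (\<Sum>l\<in>UNIV. A $ j $ l * pd i l f A)" by simp
  also have "(\<Sum>r\<in>UNIV. \<Sum>m\<in>UNIV. (if m = j then A $ r $ i else 0) * pd r m f A)
      = (\<Sum>r\<in>UNIV. \<Sum>m\<in>UNIV. if m = j then A $ r $ i * pd r m f A else 0)"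
    by (intro sum.cong) auto
  finally show ?thesis by simp
qed

lemma diag_mat_sum:
  "(\<Sum>k\<in>UNIV. diag_mat a $ k $ i * c k) = a i * c i" "(\<Sum>k\<in>UNIV. diag_mat a $ i $ k * c k) = a i * c i"
proof -
  have "diag_mat a $ k $ i = (if k = i then a i else 0)" "diag_mat a $ i $ k = (if k = i then a i else 0)" for k
    by (auto simp: diag_mat_def)
  then show "(\<Sum>k\<in>UNIV. diag_mat a $ k $ i * c k) = a i * c i" "(\<Sum>k\<in>UNIV. diag_mat a $ i $ k * c k) = a i * c i"
    by simp_all
qed

text \<open>Differentiating the first order identity once more, in the entry (i, j), and evaluating
  at a diagonal matrix: mixed second derivatives off the diagonal are thereby expressed through
  first derivatives on the diagonal.\<close>

lemma class_function_pd_pd_diag: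
  assumes f: "matpoly f" "class_function f" and ij: "i \<noteq> j"
  shows "(a j - a i) * pd i j (pd j i f) (diag_mat a) = pd j j f (diag_mat a) - pd i i f (diag_mat a)"
proof -
  let ?D = "diag_mat a"
  have "(\<lambda>A. \<Sum>k\<in>UNIV. A $ k $ j * pd k i f A) = (\<lambda>A. \<Sum>l\<in>UNIV. A $ i $ l * pd j l f A)"
    using class_function_pd[OF f, of j i] ij by blast
  then have "pd i j (\<lambda>A. \<Sum>k\<in>UNIV. A $ k $ j * pd k i f A) ?D = pd i j (\<lambda>A. \<Sum>l\<in>UNIV. A $ i $ l * pd j l f A) ?D"
    by simp
  then have "(\<Sum>k\<in>UNIV. (if k = i then 1 else 0) * pd k i f ?D + ?D $ k $ j * pd i j (pd k i f) ?D)
      = (\<Sum>l\<in>UNIV. (if l = j then 1 else 0) * pd j l f ?D + ?D $ i $ l * pd i j (pd j l f) ?D)"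
    by (simp add: pd_sum pd_mult matpoly_pd f(1) matpoly_intros pd_entry)
  moreover have "(\<Sum>k\<in>UNIV. (if k = i then 1 else 0) * c k) = c i" for i and c :: "'a \<Rightarrow> complex"
    using sum.delta'[of UNIV i c] by (simp add: if_distrib[of "\<lambda>x. x * _"] cong: if_cong)
  ultimately have "pd i i f ?D + a j * pd i j (pd j i f) ?D = pd j j f ?D + a i * pd i j (pd j i f) ?D"
    by (simp only: sum.distrib diag_mat_sum)
  then show ?thesis by (simp add: algebra_simps)
qed

lemma casimir_diag:
  "casimir f (diag_mat a) = (\<Sum>i\<in>UNIV. \<Sum>j\<in>UNIV. a i * a j * pd i j (pd j i f) (diag_mat a))"
proof -
  have "casimir f (diag_mat a) = (\<Sum>k\<in>UNIV. \<Sum>i\<in>UNIV. diag_mat a $ k $ i *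
      (\<Sum>l\<in>UNIV. \<Sum>j\<in>UNIV. diag_mat a $ l $ j * pd k j (pd l i f) (diag_mat a)))"
    unfolding casimir_def by (simp add: sum_distrib_left mult.assoc)
  also have "\<dots> = (\<Sum>k\<in>UNIV. a k * (\<Sum>l\<in>UNIV. a l * pd k l (pd l k f) (diag_mat a)))"
    by (simp add: diag_mat_sum)
  finally show ?thesis by (simp add: sum_distrib_left mult.assoc)
qed

subsection \<open>Polynomials vanishing on the unitary group\<close>

text \<open>The curves that rotate one unit vector by a phase remain in the unitary group. Their
  derivatives show that a sesquilinear form built from the gradient vanishes on unit vectors, hence,
  by polarization over the complex numbers, identically. So real tangent directions already control
  all complex ones.\<close>

lemma matpoly_zero_on_unitary_pd:
  assumes f: "matpoly f" and z: "\<And>A. A \<in> unitary_group \<Longrightarrow> f A = 0" and A: "A \<in> unitary_group"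
  shows "pd k l f A = 0"
proof -
  define W where "W m l = (\<Sum>k\<in>UNIV. A $ k $ m * pd k l f A)" for m l
  have v: "(\<Sum>m\<in>UNIV. \<Sum>l\<in>UNIV. v m * cnj (v l) * W m l) = 0"
    if v: "(\<Sum>m\<in>UNIV. v m * cnj (v m)) = 1" for v
  proof -
    define P :: "complex \<Rightarrow> 'a cmat" where "P c = (\<chi> k l. c * (v k * cnj (v l)))" for c
    have PP: "P c ** P d = P (c * d)" for c d
    proof -
      have "(\<Sum>m\<in>UNIV. c * (v k * cnj (v m)) * (d * (v m * cnj (v l))))
          = c * d * (v k * cnj (v l)) * (\<Sum>m\<in>UNIV. v m * cnj (v m))" for k l
        by (simp add: sum_distrib_left mult.assoc mult.left_commute mult.commute)
      then show ?thesis using v by (simp add: P_def matrix_matrix_mult_def vec_eq_iff)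
    qed
    have Padd: "P c + P d = P (c + d)" for c d by (simp add: P_def vec_eq_iff distrib_right)
    have Pd: "dagger (P c) = P (cnj c)" for c by (simp add: P_def dagger_def vec_eq_iff)
    have dagger_add: "dagger (X + Y) = dagger X + dagger Y" for X Y :: "'a cmat"
      by (simp add: dagger_def vec_eq_iff)
    have dagger_1: "dagger (mat 1 :: 'a cmat) = mat 1" by (simp add: dagger_def vec_eq_iff mat_def)
    have dagger_mult: "dagger (X ** Y) = dagger Y ** dagger X" for X Y :: "'a cmat"
      by (simp add: dagger_def vec_eq_iff matrix_matrix_mult_def mult.commute)
    \<comment> \<open>\<open>P 1\<close> projects onto \<open>v\<close>, so \<open>Q t\<close>
      multiplies \<open>v\<close> by the phase \<open>cis t\<close> and fixes its orthogonal
      complement.\<close>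
    define Q where "Q t = mat 1 + P (cis t - 1)" for t
    have P0: "P 0 = 0" by (simp add: P_def vec_eq_iff)
    have cc: "(cis t - 1) + (cnj (cis t) - 1) + (cis t - 1) * (cnj (cis t) - 1) = 0" for t
      by (simp add: algebra_simps cis_cnj cis_mult)
    have Q1: "Q t ** dagger (Q t) = mat 1" "dagger (Q t) ** Q t = mat 1" for t
    proof -
      have "Q t ** dagger (Q t) = mat 1 + P ((cis t - 1) + (cnj (cis t) - 1) + (cis t - 1) * (cnj (cis t) - 1))"
        by (simp add: Q_def dagger_add dagger_1 Pd matrix_add_ldistrib matrix_add_rdistrib PP
            add.assoc Padd) (simp add: algebra_simps)
      then show "Q t ** dagger (Q t) = mat 1" unfolding cc by (simp add: P0)
      have "dagger (Q t) ** Q t = mat 1 + P ((cis t - 1) + (cnj (cis t) - 1) + (cis t - 1) * (cnj (cis t) - 1))"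
        by (simp add: Q_def dagger_add dagger_1 Pd matrix_add_ldistrib matrix_add_rdistrib PP
            add.assoc Padd) (simp add: algebra_simps)
      then show "dagger (Q t) ** Q t = mat 1" unfolding cc by (simp add: P0)
    qed
    have AQ: "A ** Q t \<in> unitary_group" for t
    proof -
      have "A ** Q t ** (dagger (Q t) ** dagger A) = A ** (Q t ** dagger (Q t)) ** dagger A"
        "dagger (Q t) ** dagger A ** (A ** Q t) = dagger (Q t) ** (dagger A ** A) ** Q t"
        by (simp_all add: matrix_mul_assoc)
      then show ?thesis using A Q1 by (simp add: unitary_group_def dagger_mult)
    qed
    have ent: "(A ** Q t) $ k $ l = A $ k $ l + (\<Sum>m\<in>UNIV. A $ k $ m * (v m * cnj (v l))) * (cis t - 1)" for k l t
    proof -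
      have "(A ** P c) $ k $ l = (\<Sum>m\<in>UNIV. A $ k $ m * (v m * cnj (v l))) * c" for c
        unfolding sum_distrib_right by (simp add: P_def matrix_matrix_mult_def mult.assoc mult.commute mult.left_commute)
      then show ?thesis by (simp add: Q_def matrix_add_ldistrib)
    qed
    have "((\<lambda>t. (A ** Q t) $ k $ l) has_derivative (\<lambda>h. h *\<^sub>R ((\<Sum>m\<in>UNIV. A $ k $ m * (v m * cnj (v l))) * \<i>))) (at 0)" for k l
    proof -
      have "((\<lambda>t. cis t) has_derivative (\<lambda>h. h *\<^sub>R (\<i> * cis 0))) (at 0)"
        by (auto intro!: derivative_eq_intros)
      then have "((\<lambda>t. cis t) has_derivative (\<lambda>h. h *\<^sub>R \<i>)) (at 0)" by simp
      then show ?thesis unfolding ent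
        by (auto intro!: derivative_eq_intros simp: scaleR_conv_of_real mult_ac)
    qed
    from has_derivative_matpoly[OF f this]
    have "((\<lambda>t. f (A ** Q t)) has_derivative (\<lambda>h. \<Sum>k\<in>UNIV. \<Sum>l\<in>UNIV.
        h *\<^sub>R ((\<Sum>m\<in>UNIV. A $ k $ m * (v m * cnj (v l))) * \<i>) * pd k l f (A ** Q 0))) (at 0)" .
    moreover have "((\<lambda>t. f (A ** Q t)) has_derivative (\<lambda>h. 0)) (at 0)"
      using z[OF AQ] by simp
    ultimately have "(\<lambda>h. \<Sum>k\<in>UNIV. \<Sum>l\<in>UNIV.
        h *\<^sub>R ((\<Sum>m\<in>UNIV. A $ k $ m * (v m * cnj (v l))) * \<i>) * pd k l f (A ** Q 0)) = (\<lambda>h. 0)"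
      by (rule has_derivative_unique)
    from fun_cong[OF this, of 1]
    have "(\<Sum>k\<in>UNIV. \<Sum>l\<in>UNIV. ((\<Sum>m\<in>UNIV. A $ k $ m * (v m * cnj (v l))) * \<i>) * pd k l f A) = 0"
      by (simp add: Q_def P0)
    then have "\<i> * (\<Sum>k\<in>UNIV. \<Sum>l\<in>UNIV. \<Sum>m\<in>UNIV. v m * cnj (v l) * (A $ k $ m * pd k l f A)) = 0"
      by (simp add: sum_distrib_left sum_distrib_right mult_ac)
    then have "0 = (\<Sum>k\<in>UNIV. \<Sum>l\<in>UNIV. \<Sum>m\<in>UNIV. v m * cnj (v l) * (A $ k $ m * pd k l f A))"
      by simp
    also have "\<dots> = (\<Sum>l\<in>UNIV. \<Sum>k\<in>UNIV. \<Sum>m\<in>UNIV. v m * cnj (v l) * (A $ k $ m * pd k l f A))"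
      by (rule sum.swap)
    also have "\<dots> = (\<Sum>l\<in>UNIV. \<Sum>m\<in>UNIV. \<Sum>k\<in>UNIV. v m * cnj (v l) * (A $ k $ m * pd k l f A))"
      by (rule sum.cong[OF refl], rule sum.swap)
    also have "\<dots> = (\<Sum>m\<in>UNIV. \<Sum>l\<in>UNIV. v m * cnj (v l) * W m l)"
      unfolding W_def sum_distrib_left by (rule sum.swap)
    finally show ?thesis by simp
  qed
  have delta: "(\<Sum>m\<in>UNIV. (if m = p then c else 0) * g m) = c * g p" for p c and g :: "'a \<Rightarrow> complex"
    by (simp add: if_distrib[of "\<lambda>x. x * _"] cong: if_cong)
  have Wd: "W p p = 0" for p
  proof -
    let ?v = "\<lambda>m. if m = p then 1 else (0::complex)"
    have "(\<Sum>m\<in>UNIV. \<Sum>l\<in>UNIV. ?v m * cnj (?v l) * W m l) = (\<Sum>m\<in>UNIV. ?v m * (\<Sum>l\<in>UNIV. ?v l * W m l))"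
      unfolding sum_distrib_left by (intro sum.cong refl) auto
    also have "\<dots> = W p p" by (simp only: delta mult_1)
    finally show ?thesis using v[of ?v] by (simp add: if_distrib[of cnj] cong: if_cong)
  qed
  \<comment> \<open>Polarization with the unit vectors (e_p + c e_q) / sqrt 2: the choices c = 1 and
    c = i separate \<open>W p q\<close> from \<open>W q p\<close>.\<close>
  have Wo: "W p q = 0" if "p \<noteq> q" for p q
  proof -
    have eq: "cnj c * W p q + c * W q p = 0" if c: "c * cnj c = 1" for c
    proof -
      let ?w = "\<lambda>m. (if m = p then 1 else 0) + (if m = q then c else (0::complex))"
      let ?r = "complex_of_real (1 / sqrt 2)"
      have rr: "?r * ?r = 1/2" by (simp flip: of_real_mult)
      have s2: "(\<Sum>m\<in>UNIV. ?w m * g m) = g p + c * g q" for g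
        by (simp only: distrib_right sum.distrib delta mult_1)
      have s3: "(\<Sum>m\<in>UNIV. cnj (?w m) * g m) = g p + cnj c * g q" for g
      proof -
        have "cnj (?w m) = (if m = p then 1 else 0) + (if m = q then cnj c else 0)" for m by simp
        then show ?thesis by (simp only: distrib_right sum.distrib delta mult_1)
      qed
      have "(\<Sum>m\<in>UNIV. (?r * ?w m) * cnj (?r * ?w m)) = (?r * ?r) * (\<Sum>m\<in>UNIV. ?w m * cnj (?w m))"
        unfolding sum_distrib_left by (intro sum.cong refl) (simp only: complex_cnj_mult complex_cnj_complex_of_real mult_ac)
      also have "\<dots> = 1" unfolding s2 rr using that \<open>p \<noteq> q\<close> c by simp
      finally have 0: "(\<Sum>m\<in>UNIV. \<Sum>l\<in>UNIV. (?r * ?w m) * cnj (?r * ?w l) * W m l) = 0"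
        by (rule v)
      have "(\<Sum>m\<in>UNIV. \<Sum>l\<in>UNIV. (?r * ?w m) * cnj (?r * ?w l) * W m l)
          = (?r * ?r) * (\<Sum>m\<in>UNIV. ?w m * (\<Sum>l\<in>UNIV. cnj (?w l) * W m l))"
        unfolding sum_distrib_left by (intro sum.cong refl) (simp only: complex_cnj_mult complex_cnj_complex_of_real mult_ac)
      also have "\<dots> = (1/2) * (W p p + cnj c * W p q + c * (W q p + cnj c * W q q))"
        unfolding s2 s3 rr ..
      finally have "W p p + cnj c * W p q + c * (W q p + cnj c * W q q) = 0"
        unfolding 0 by (metis mult_eq_0_iff zero_neq_one divide_eq_0_iff zero_neq_numeral)
      then show ?thesis using Wd by simp
    qed
    from eq[of 1] eq[of \<i>] have "W p q + W q p = 0" "- \<i> * W p q + \<i> * W q p = 0" by simp_all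
    then have "W q p = - W p q" "\<i> * (W q p - W p q) = 0" by (simp_all add: algebra_simps eq_neg_iff_add_eq_0)
    then show ?thesis by simp
  qed
  have W0: "W m l = 0" for m l using Wd Wo by (cases "m = l") auto
  \<comment> \<open>\<open>W\<close> is the transpose of A times the matrix of partial derivatives;
    the conjugate of A undoes this factor by unitarity.\<close>
  have "(\<Sum>m\<in>UNIV. cnj (A $ k $ m) * W m l) = (\<Sum>r\<in>UNIV. (\<Sum>m\<in>UNIV. A $ r $ m * cnj (A $ k $ m)) * pd r l f A)"
    unfolding W_def sum_distrib_left sum_distrib_right
    by (subst sum.swap) (simp add: mult_ac)
  also have "\<dots> = (\<Sum>r\<in>UNIV. (mat 1 :: 'a cmat) $ r $ k * pd r l f A)"
  proof -
    have "A ** dagger A = mat 1" using A by (simp add: unitary_group_def)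
    then have "(A ** dagger A) $ r $ k = (mat 1 :: 'a cmat) $ r $ k" for r by simp
    then show ?thesis by (simp add: matrix_matrix_mult_def dagger_def)
  qed
  also have "\<dots> = (\<Sum>r\<in>UNIV. (if r = k then 1 else 0) * pd r l f A)"
    by (simp add: mat_def)
  also have "\<dots> = pd k l f A" by (simp only: delta mult_1)
  finally show ?thesis using W0 by simp
qed

text \<open>The operator uses derivatives in all complex directions, yet on the unitary group it
  depends only on the restriction of the function there: first derivatives of the difference are
  again polynomials vanishing on the group, so the preceding lemma applies twice.\<close>

lemma casimir_cong_unitary:
  assumes "matpoly f" "matpoly g" "\<And>A. A \<in> unitary_group \<Longrightarrow> f A = g A" "A \<in> unitary_group"
  shows "casimir f A = casimir g A"
proof -
  let ?h = "\<lambda>A. f A + - 1 * g A"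
  have h: "matpoly ?h" by (intro matpoly_intros assms)
  have "pd k l ?h B = 0" if "B \<in> unitary_group" for k l B
    using matpoly_zero_on_unitary_pd[OF h _ that] assms(3) by simp
  then have "pd i j (pd k l ?h) A = 0" for i j k l
    using matpoly_zero_on_unitary_pd[OF matpoly_pd[OF h] _ assms(4)] by blast
  then have "casimir ?h A = 0" by (simp add: casimir_def)
  moreover have "casimir ?h A = casimir f A + - 1 * casimir g A"
    unfolding casimir_cmult[OF assms(2), symmetric]
    by (rule casimir_add[OF assms(1) matpoly_mult[OF matpoly_const assms(2)]])
  ultimately show ?thesis by simp
qed

subsection \<open>Unitary matrices\<close>

lemma dagger_mult: "dagger (A ** B) = dagger B ** dagger A"
  by (simp add: dagger_def vec_eq_iff matrix_matrix_mult_def mult.commute)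

lemma dagger_dagger [simp]: "dagger (dagger A) = A"
  by (simp add: dagger_def vec_eq_iff)

lemma dagger_mat_1 [simp]: "dagger (mat 1) = mat 1"
  by (simp add: dagger_def vec_eq_iff mat_def)

lemma unitary_mat_1: "mat 1 \<in> unitary_group"
  by (simp add: unitary_group_def)

lemma unitary_mult:
  assumes "A \<in> unitary_group" "B \<in> unitary_group"
  shows "A ** B \<in> unitary_group"
proof -
  have "A ** B ** (dagger B ** dagger A) = A ** (B ** dagger B) ** dagger A"
    "dagger B ** dagger A ** (A ** B) = dagger B ** (dagger A ** A) ** B"
    by (simp_all add: matrix_mul_assoc)
  then show ?thesis using assms by (simp add: unitary_group_def dagger_mult)
qed

lemma unitary_dagger: "A \<in> unitary_group \<Longrightarrow> dagger A \<in> unitary_group"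
  by (simp add: unitary_group_def)

definition hermite :: "complex ^ 'n \<Rightarrow> complex ^ 'n::finite \<Rightarrow> complex" where
  "hermite u v = (\<Sum>i\<in>UNIV. cnj (u $ i) * v $ i)"

lemma hermite_add: "hermite u (v + w) = hermite u v + hermite u w"
  by (simp add: hermite_def distrib_left sum.distrib)

lemma hermite_diff: "hermite u (v - w) = hermite u v - hermite u w"
  by (simp add: hermite_def right_diff_distrib sum_subtractf)

lemma hermite_scale: "hermite u (c *s v) = c * hermite u v"
  by (simp add: hermite_def sum_distrib_left mult.left_commute)

lemma hermite_cnj: "cnj (hermite u v) = hermite v u"
  by (simp add: hermite_def mult.commute)

lemma hermite_sum: "hermite u (\<Sum>i\<in>I. f i) = (\<Sum>i\<in>I. hermite u (f i))"
  by (induction I rule: infinite_finite_induct) (auto simp: hermite_add, simp_all add: hermite_def)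

lemma hermite_self: "hermite u u = of_real ((norm u)\<^sup>2)"
proof -
  have "hermite u u = of_real (\<Sum>i\<in>UNIV. (cmod (u $ i))\<^sup>2)"
    unfolding hermite_def of_real_sum
    by (intro sum.cong refl) (simp add: complex_norm_square mult.commute del: of_real_power)
  also have "(\<Sum>i\<in>UNIV. (cmod (u $ i))\<^sup>2) = (norm u)\<^sup>2"
    by (simp add: norm_vec_def L2_set_def sum_nonneg)
  finally show ?thesis .
qed

lemma hermite_mult: "hermite u (A *v v) = hermite (dagger A *v u) v"
proof -
  have "hermite u (A *v v) = (\<Sum>i\<in>UNIV. \<Sum>j\<in>UNIV. cnj (u $ i) * A $ i $ j * v $ j)"
    by (simp add: hermite_def matrix_vector_mult_def sum_distrib_left mult.assoc)
  also have "\<dots> = (\<Sum>j\<in>UNIV. \<Sum>i\<in>UNIV. cnj (u $ i) * A $ i $ j * v $ j)"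
    by (rule sum.swap)
  also have "\<dots> = hermite (dagger A *v u) v"
    by (simp add: hermite_def dagger_def matrix_vector_mult_def sum_distrib_right sum_distrib_left mult.commute mult.left_commute)
  finally show ?thesis .
qed

text \<open>A polynomial in \<open>A\<close> annihilates \<open>w\<close> because the vectors \<open>A ^ k *v w\<close> are linearly dependent;
  its last linear factor that does not annihilate \<open>w\<close> produces an eigenvector.\<close>

lemma exists_eigenvector:
  fixes A :: "'n::finite cmat"
  assumes W: "vec.subspace W" "\<And>v. v \<in> W \<Longrightarrow> A *v v \<in> W" and w: "w \<in> W" "w \<noteq> 0"
  shows "\<exists>v\<in>W. \<exists>c. v \<noteq> 0 \<and> A *v v = c *s v"
proof -
  define pw where "pw k = ((\<lambda>v. A *v v) ^^ k) w" for k
  \<comment> \<open>\<open>ev p\<close> is the vector p(A) w.\<close>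
  define ev where "ev p = (\<Sum>k\<le>degree p. coeff p k *s pw k)" for p
  have ev_le: "ev p = (\<Sum>k\<le>m. coeff p k *s pw k)" if "degree p \<le> m" for p m
    unfolding ev_def using that
    by (intro sum.mono_neutral_left) (auto simp: coeff_eq_0)
  have pw0: "pw 0 = w" and pwS: "A *v pw k = pw (Suc k)" for k
    by (simp_all add: pw_def)
  have pwW: "pw k \<in> W" for k
    by (induction k) (auto simp: pw0 w W(2) simp flip: pwS)
  have evW: "ev p \<in> W" for p
    unfolding ev_def by (intro vec.subspace_sum W vec.subspace_scale pwW)
  have evmul: "ev ([:- c, 1:] * q) = A *v ev q - c *s ev q" for c q
  proof -
    let ?m = "degree q"
    have "degree ([:- c, 1:] * q) \<le> Suc ?m"
      using degree_mult_le[of "[:- c, 1:]" q] by simp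
    then have "ev ([:- c, 1:] * q) = (\<Sum>k\<le>Suc ?m. coeff ([:- c, 1:] * q) k *s pw k)"
      by (rule ev_le)
    also have "\<dots> = (\<Sum>k\<le>Suc ?m. (case k of 0 \<Rightarrow> 0 | Suc k \<Rightarrow> coeff q k) *s pw k) - (\<Sum>k\<le>Suc ?m. (c * coeff q k) *s pw k)"
      unfolding sum_subtractf[symmetric]
      by (intro sum.cong refl)
        (simp add: coeff_pCons vec_eq_iff algebra_simps split: nat.split)
    also have "(\<Sum>k\<le>Suc ?m. (case k of 0 \<Rightarrow> 0 | Suc k \<Rightarrow> coeff q k) *s pw k) = (\<Sum>k\<le>?m. coeff q k *s pw (Suc k))"
      unfolding sum.atMost_Suc_shift by simp
    also have "\<dots> = A *v ev q"
      unfolding ev_def by (simp add: pwS[symmetric] vec.linear_sum[OF matrix_vector_mul_linear_gen] vector_scalar_commute)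
    also have "(\<Sum>k\<le>Suc ?m. (c * coeff q k) *s pw k) = c *s ev q"
      by (simp add: ev_def coeff_eq_0 vec.scale_sum_right)
    finally show ?thesis .
  qed
  have "\<exists>p. p \<noteq> 0 \<and> ev p = 0"
  proof -
    \<comment> \<open>Linear dependence is a property of sets, so a coincidence among the vectors
      \<open>pw k\<close> is treated apart; there the difference of two monomials annihilates
      \<open>w\<close>.\<close>
    show ?thesis
    proof (cases "inj_on pw {..CARD('n)}")
      case True
      have dep: "vec.dependent (pw ` {..CARD('n)})"
      proof (rule ccontr)
        assume "\<not> ?thesis"
        moreover have "card (pw ` {..CARD('n)}) = Suc CARD('n)"
          using True by (simp add: card_image)
        ultimately show False
          using vec.independent_card_le_dim[of "pw ` {..CARD('n)}" UNIV] by (simp add: card_cart_basis)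
      qed
        from dep obtain u where u: "\<exists>v\<in>pw ` {..CARD('n)}. u v \<noteq> 0" "(\<Sum>v\<in>pw ` {..CARD('n)}. u v *s v) = 0"
          by (subst (asm) vec.dependent_finite) auto
        define p where "p = (\<Sum>k\<le>CARD('n). monom (u (pw k)) k)"
        have co: "coeff p k = (if k \<le> CARD('n) then u (pw k) else 0)" for k
          by (simp add: p_def coeff_sum)
        have dp: "degree p \<le> CARD('n)" by (intro degree_le) (simp add: co)
        have "ev p = (\<Sum>k\<le>CARD('n). u (pw k) *s pw k)"
          unfolding ev_le[OF dp] by (intro sum.cong) (auto simp: co)
        also have "\<dots> = 0" using u(2) by (simp add: sum.reindex[OF True])
        finally have "ev p = 0" .
        moreover have "p \<noteq> 0" using u(1) co by (metis (no_types, lifting) atMost_iff coeff_0 imageE)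
        ultimately show ?thesis by blast
    next
      case False
        then obtain i j where ij: "i \<noteq> j" "pw i = pw j" by (auto simp: inj_on_def)
        have "degree (monom 1 i - monom 1 j :: complex poly) \<le> max i j"
          by (intro degree_diff_le) (auto simp: degree_monom_eq)
        then have "ev (monom 1 i - monom 1 j) = (\<Sum>k\<le>max i j. coeff (monom 1 i - monom 1 j) k *s pw k)"
          by (rule ev_le)
        also have "\<dots> = (\<Sum>k\<le>max i j. (if k = i then pw k else 0)) - (\<Sum>k\<le>max i j. (if k = j then pw k else 0))"
          unfolding sum_subtractf[symmetric] by (intro sum.cong refl) (auto simp: vec_eq_iff)
        also have "\<dots> = 0" using ij by (simp add: sum.delta' max_def)
        finally have "ev (monom 1 i - monom 1 j) = 0" .
        moreover have "monom 1 i - monom 1 j \<noteq> (0 :: complex poly)"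
          using ij by (simp add: monom_eq_iff')
        ultimately show ?thesis by blast
    qed
  qed
  moreover have "\<exists>v\<in>W. \<exists>c. v \<noteq> 0 \<and> A *v v = c *s v" if "p \<noteq> 0" "ev p = 0" "degree p = n" for p n
    using that
  proof (induction n arbitrary: p)
    case 0
    then have "coeff p 0 \<noteq> 0" using leading_coeff_neq_0[of p] by simp
    with 0 w(2) show ?case by (simp add: ev_def pw0)
  next
    case (Suc n)
    then obtain c where "poly p c = 0"
      using fundamental_theorem_of_algebra[of p] by (auto simp: constant_degree)
    then obtain q where q: "p = [:- c, 1:] * q" by (auto simp: poly_eq_0_iff_dvd elim: dvdE)
    with Suc.prems have q0: "q \<noteq> 0" by auto
    have dq: "degree q = n" using Suc.prems(3) q0 unfolding q by (subst (asm) degree_mult_eq) auto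
    show ?case
    proof (cases "ev q = 0")
      case True
      then show ?thesis using Suc.IH[of q] q0 dq by blast
    next
      case False
      then show ?thesis using evW[of q] evmul[of c q] Suc.prems(2) q by auto
    qed
  qed
  ultimately show ?thesis by blast
qed

lemma unitary_eigenvalue_norm:
  assumes "A \<in> unitary_group" "A *v v = c *s v" "v \<noteq> 0"
  shows "cmod c = 1"
proof -
  have "hermite (A *v v) (A *v v) = hermite v v"
    using assms(1) by (simp add: hermite_mult matrix_vector_mul_assoc unitary_group_def)
  then have "cnj c * c * hermite v v = hermite v v"
    unfolding assms(2) by (simp add: hermite_def sum_distrib_left mult_ac)
  moreover have "hermite v v \<noteq> 0" using assms(3) by (simp add: hermite_self)
  ultimately have "cnj c * c = 1" by simp
  then have "of_real ((cmod c)\<^sup>2) = (1::complex)"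
    by (simp add: complex_norm_square mult.commute del: of_real_power)
  then have "(cmod c)\<^sup>2 = 1" using of_real_eq_1_iff by blast
  then show ?thesis using norm_ge_zero[of c] by (simp add: power2_eq_1_iff)
qed

text \<open>Orthonormal sets are independent, so one consisting of eigenvectors can be taken of
  maximal cardinality. Its orthogonal complement is invariant and, if nonzero, would contain a
  further eigenvector, contradicting maximality.\<close>

theorem unitary_spectral_theorem:
  assumes A: "A \<in> unitary_group"
  shows "\<exists>Q a. Q \<in> unitary_group \<and> (\<forall>i. a i \<in> circle) \<and> A = Q ** diag_mat a ** dagger Q"
proof -
  define P where "P B \<longleftrightarrow> finite B \<and> (\<forall>u\<in>B. \<forall>v\<in>B. hermite u v = (if u = v then 1 else 0)) \<and>
    (\<forall>v\<in>B. \<exists>c. A *v v = c *s v)" for B :: "(complex ^ 'a) set"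
  have ind: "vec.independent B" if "P B" for B
  proof (rule ccontr)
    have fin: "finite B" using that by (simp add: P_def)
    assume "\<not> vec.independent B"
    then have "vec.dependent B" by simp
    then obtain u where u: "\<exists>v\<in>B. u v \<noteq> 0" "(\<Sum>v\<in>B. u v *s v) = 0"
      unfolding vec.dependent_finite[OF fin] by auto
    then obtain w where w: "w \<in> B" "u w \<noteq> 0" by blast
    have "0 = hermite w (\<Sum>v\<in>B. u v *s v)" by (simp add: u hermite_def)
    also have "\<dots> = (\<Sum>v\<in>B. u v * hermite w v)" by (simp add: hermite_sum hermite_scale)
    also have "\<dots> = (\<Sum>v\<in>B. if w = v then u v else 0)"
      using that w(1) by (intro sum.cong) (auto simp: P_def)
    also have "\<dots> = u w" using that w(1) by (simp add: P_def)
    finally show False using w by simp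
  qed
  have bd: "card B \<le> CARD('a)" if "P B" for B
    using vec.independent_card_le_dim[of B UNIV] ind[OF that] by (simp add: card_cart_basis)
  have "P {}" by (simp add: P_def)
  then obtain B where B: "P B" "\<And>B'. P B' \<Longrightarrow> card B' \<le> card B"
    using ex_has_greatest_nat[of P "{}" card "Suc CARD('a)"] bd by (auto simp: less_Suc_eq_le)
  define W where "W = {w. \<forall>b\<in>B. hermite b w = 0}"
  have sub: "vec.subspace W"
    by (auto simp: W_def vec.subspace_def hermite_add hermite_scale) (simp add: hermite_def)
  have inv: "A *v w \<in> W" if "w \<in> W" for w
  proof -
    have "hermite b (A *v w) = 0" if b: "b \<in> B" for b
    proof -
      obtain c where c: "A *v b = c *s b" using B(1) b unfolding P_def by blast
      have "hermite b b = 1" using B(1) that by (simp add: P_def)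
      then have "b \<noteq> 0" by (auto simp: hermite_def)
      then have "cmod c = 1" by (rule unitary_eigenvalue_norm[OF A c])
      then have c0: "c \<noteq> 0" by auto
      \<comment> \<open>An eigenvector of A is one of \<open>dagger A\<close> too, its eigenvalue
        being nonzero; this makes the orthogonal complement invariant.\<close>
      have "b = dagger A *v (A *v b)"
        using A by (simp add: matrix_vector_mul_assoc unitary_group_def)
      also have "\<dots> = c *s (dagger A *v b)" by (simp add: c vector_scalar_commute)
      finally have "hermite b w = hermite (c *s (dagger A *v b)) w" by simp
      also have "\<dots> = cnj c * hermite b (A *v w)"
        unfolding hermite_mult by (simp add: hermite_def sum_distrib_left mult_ac)
      finally show ?thesis using \<open>w \<in> W\<close> that c0 by (simp add: W_def)
    qed
    then show ?thesis by (simp add: W_def)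
  qed
  have W0: "w = 0" if "w \<in> W" for w
  proof (rule ccontr)
    assume "w \<noteq> 0"
    from exists_eigenvector[OF sub inv that this]
    obtain v c where v: "v \<in> W" "v \<noteq> 0" "A *v v = c *s v" by auto
    define n where "n = complex_of_real (1 / norm v)"
    define e where "e = n *s v"
    have "hermite e e = cnj n * n * hermite v v"
      by (simp add: e_def hermite_def sum_distrib_left mult_ac)
    also have "\<dots> = 1" using v(2) by (simp add: n_def hermite_self power2_eq_square)
    finally have ee: "hermite e e = 1" .
    have be: "hermite b e = 0" if "b \<in> B" for b
      using v(1) that by (simp add: e_def W_def hermite_scale)
    then have eb: "hermite e b = 0" if "b \<in> B" for b
      using hermite_cnj[of b e] that by simp
    have "e \<notin> B" using ee be by force
    have "A *v e = c *s e" by (simp add: e_def v(3) vector_scalar_commute vector_smult_assoc mult.commute)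
    then have "P (insert e B)" using B(1) ee be eb \<open>e \<notin> B\<close>
      unfolding P_def by auto
    from B(2)[OF this] show False using \<open>e \<notin> B\<close> B(1) by (simp add: P_def)
  qed
  have "x \<in> vec.span B" for x
  proof -
    have "x - (\<Sum>b\<in>B. hermite b x *s b) \<in> W"
    proof -
      have "hermite c (\<Sum>b\<in>B. hermite b x *s b) = hermite c x" if "c \<in> B" for c
      proof -
        have "hermite c (\<Sum>b\<in>B. hermite b x *s b) = (\<Sum>b\<in>B. if c = b then hermite b x else 0)"
          unfolding hermite_sum hermite_scale using B(1) that by (intro sum.cong) (auto simp: P_def)
        then show ?thesis using B(1) that by (simp add: P_def)
      qed
      then show ?thesis by (simp add: W_def hermite_diff)
    qed
    then have "x = (\<Sum>b\<in>B. hermite b x *s b)" using W0 by fastforce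
    then show ?thesis by (metis (no_types, lifting) vec.span_base vec.span_scale vec.span_sum)
  qed
  then have "UNIV \<subseteq> vec.span B" by auto
  then have "CARD('a) \<le> card B"
    using vec.dim_le_card[of UNIV B] B(1) by (simp add: P_def card_cart_basis)
  with bd[OF B(1)] have cB: "card B = CARD('a)" by simp
  obtain f where f: "bij_betw f (UNIV :: 'a set) B"
    using finite_same_card_bij[of "UNIV :: 'a set" B] B(1) cB by (auto simp: P_def)
  then have fB: "f i \<in> B" and finj: "f i = f j \<longleftrightarrow> i = j" for i j
    by (auto simp: bij_betw_def inj_def)
  define a where "a i = (SOME c. A *v f i = c *s f i)" for i
  have a: "A *v f i = a i *s f i" for i
    unfolding a_def by (rule someI_ex) (use B(1) fB in \<open>auto simp: P_def\<close>)
  define Q :: "'a cmat" where "Q = (\<chi> i j. f j $ i)"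
  have QQ: "dagger Q ** Q = mat 1"
  proof -
    have "(dagger Q ** Q) $ i $ j = hermite (f i) (f j)" for i j
      by (simp add: Q_def dagger_def matrix_matrix_mult_def hermite_def)
    then show ?thesis using B(1) fB finj by (simp add: vec_eq_iff mat_def P_def)
  qed
  then have Q: "Q \<in> unitary_group"
    by (simp add: unitary_group_def matrix_left_right_inverse)
  have "A ** Q = Q ** diag_mat a"
  proof -
    have "(A ** Q) $ i $ j = (A *v f j) $ i" for i j
      by (simp add: Q_def matrix_matrix_mult_def matrix_vector_mult_def)
    moreover have "(Q ** diag_mat a) $ i $ j = f j $ i * a j" for i j
      using diag_mat_sum(1)[of a j "\<lambda>k. f k $ i"]
      by (simp add: Q_def matrix_matrix_mult_def mult.commute)
    ultimately show ?thesis by (simp add: vec_eq_iff a)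
  qed
  then have "A ** Q ** dagger Q = Q ** diag_mat a ** dagger Q" by simp
  then have "A = Q ** diag_mat a ** dagger Q"
    using Q by (simp add: matrix_mul_assoc[symmetric] unitary_group_def)
  moreover have "a i \<in> circle" for i
  proof -
    have "hermite (f i) (f i) = 1" using B(1) fB by (simp add: P_def)
    then have "f i \<noteq> 0" by (auto simp: hermite_def)
    then show ?thesis using unitary_eigenvalue_norm[OF A a] by simp
  qed
  ultimately show ?thesis using Q by blast
qed

subsection \<open>Principal minors and the characteristic polynomial\<close>

text \<open>The principal minor with rows and columns in \<open>I\<close>, written as a determinant
  of full size by replacing the other rows by rows of the identity.\<close>

definition pminor :: "'n::finite set \<Rightarrow> 'n cmat \<Rightarrow> complex" where
  "pminor I A = det (\<chi> i j. if i \<in> I then A $ i $ j else if i = j then 1 else 0)"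

definition esym :: "nat \<Rightarrow> 'n::finite cmat \<Rightarrow> complex" where
  "esym k A = (\<Sum>I | card I = k. pminor I A)"

lemma det_add_expand:
  fixes f g :: "'n::finite \<Rightarrow> 'n \<Rightarrow> complex"
  shows
  "det (\<chi> i j. (f i j + g i j)) = (\<Sum>I\<in>UNIV. det (\<chi> i j. if i \<in> I then f i j else g i j))"
proof -
  have "(\<Prod>i\<in>UNIV. f i (p i) + g i (p i)) = (\<Sum>I\<in>UNIV. \<Prod>i\<in>UNIV. if i \<in> I then f i (p i) else g i (p i))" for p
  proof -
    have "(\<Prod>i\<in>UNIV. f i (p i) + g i (p i))
        = (\<Sum>I\<in>Pow UNIV. (\<Prod>i\<in>I. f i (p i)) * (\<Prod>i\<in>UNIV - I. g i (p i)))"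
      by (rule prod_add) simp
    also have "\<dots> = (\<Sum>I\<in>UNIV. \<Prod>i\<in>UNIV. if i \<in> I then f i (p i) else g i (p i))"
      by (intro sum.cong) (auto simp: prod.If_cases Compl_eq_Diff_UNIV)
    finally show ?thesis .
  qed
  then have "det (\<chi> i j. (f i j + g i j))
      = (\<Sum>p | p permutes UNIV. \<Sum>I\<in>UNIV. of_int (sign p) * (\<Prod>i\<in>UNIV. if i \<in> I then f i (p i) else g i (p i)))"
    by (simp add: det_def sum_distrib_left)
  also have "\<dots> = (\<Sum>I\<in>UNIV. det (\<chi> i j. if i \<in> I then f i j else g i j))"
    by (subst sum.swap) (simp add: det_def if_distrib[of "\<lambda>x. x $ _"] cong: if_cong)
  finally show ?thesis .
qed

lemma pminor_diag_mult: "pminor I (diag_mat a ** U) = (\<Prod>i\<in>I. a i) * pminor I U"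
proof -
  have "(diag_mat a ** U) $ i $ j = a i * U $ i $ j" for i j
    by (simp add: matrix_matrix_mult_def diag_mat_sum)
  then have "pminor I (diag_mat a ** U)
      = det (\<chi> i. (if i \<in> I then a i else 1) *s (\<chi> i j. if i \<in> I then U $ i $ j else if i = j then 1 else 0) $ i)"
    unfolding pminor_def by (intro arg_cong[where f = det]) (simp add: vec_eq_iff)
  also have "\<dots> = (\<Prod>i\<in>UNIV. if i \<in> I then a i else 1) * pminor I U"
    unfolding det_rows_mul by (simp add: pminor_def)
  also have "(\<Prod>i\<in>UNIV. if i \<in> I then a i else 1) = (\<Prod>i\<in>I. a i)"
    by (simp add: prod.If_cases)
  finally show ?thesis .
qed

lemma pminor_mat_1: "pminor I (mat 1) = 1"
proof -
  have "(\<chi> i j. if i \<in> I then (mat 1 :: 'a cmat) $ i $ j else if i = j then 1 else 0) = mat 1"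
    by (simp add: vec_eq_iff mat_def)
  then show ?thesis by (simp add: pminor_def)
qed

lemma matpoly_pminor: "matpoly (pminor I)"
proof -
  have "matpoly (\<lambda>A. if i \<in> I then A $ i $ j else if i = j then 1 else 0)" for i j :: 'a
    by (cases "i \<in> I"; cases "i = j") (auto intro: matpoly_intros)
  then show ?thesis unfolding pminor_def by (rule matpoly_det)
qed

lemma matpoly_esym: "matpoly (esym k)"
  unfolding esym_def[abs_def] by (intro matpoly_intros matpoly_pminor)

lemma det_char_expand:
  "det (mat x - A) = (\<Sum>k\<le>CARD('n). (- 1) ^ k * esym k A * x ^ (CARD('n) - k))" for A :: "'n::finite cmat"
proof -
  have "mat x - A = (\<chi> i j. - A $ i $ j + (if i = j then x else 0))"
    by (simp add: vec_eq_iff mat_def)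
  then have "det (mat x - A) = (\<Sum>I\<in>UNIV. det (\<chi> i j. if i \<in> I then - A $ i $ j else if i = j then x else 0))"
    by (simp only: det_add_expand)
  also have "\<dots> = (\<Sum>I\<in>UNIV. (- 1) ^ card I * x ^ (CARD('n) - card I) * pminor I A)"
  proof (rule sum.cong[OF refl])
    fix I :: "'n set"
    have "det (\<chi> i j. if i \<in> I then - A $ i $ j else if i = j then x else 0)
      = det (\<chi> i. (if i \<in> I then - 1 else x) *s (\<chi> i j. if i \<in> I then A $ i $ j else if i = j then 1 else 0) $ i)"
      by (intro arg_cong[where f = det]) (simp add: vec_eq_iff)
    also have "\<dots> = (\<Prod>i\<in>UNIV. if i \<in> I then - 1 else x) * pminor I A"
      unfolding det_rows_mul by (simp add: pminor_def)
    also have "(\<Prod>i\<in>UNIV. if i \<in> I then - 1 else x) = (- 1) ^ card I * x ^ (CARD('n) - card I)"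
      by (simp add: prod.If_cases card_Diff_subset Compl_eq_Diff_UNIV)
    finally show "det (\<chi> i j. if i \<in> I then - A $ i $ j else if i = j then x else 0)
      = (- 1) ^ card I * x ^ (CARD('n) - card I) * pminor I A" .
  qed
  also have "\<dots> = (\<Sum>k\<le>CARD('n). \<Sum>I | I \<in> UNIV \<and> card I = k. (- 1) ^ card I * x ^ (CARD('n) - card I) * pminor I A)"
    by (rule sum.group[symmetric]) (auto intro: card_mono)
  also have "\<dots> = (\<Sum>k\<le>CARD('n). (- 1) ^ k * esym k A * x ^ (CARD('n) - k))"
    unfolding esym_def sum_distrib_left sum_distrib_right by (intro sum.cong refl) (auto simp: mult_ac)
  finally show ?thesis .
qed

text \<open>Defined through minors, so that the coefficients are visibly polynomials in the
  entries.\<close>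

definition char_coeff :: "'n::finite cmat \<Rightarrow> nat \<Rightarrow> complex" where
  "char_coeff A k = (- 1) ^ (CARD('n) - k) * esym (CARD('n) - k) A"

lemma esym_0: "esym 0 A = 1"
  by (simp add: esym_def pminor_def) (metis mat_def det_I)

lemma det_char_poly:
  "det (mat x - A) = poly ((\<Sum>k<CARD('n). monom (char_coeff A k) k) + monom 1 CARD('n)) x"
  for A :: "'n::finite cmat"
proof -
  let ?n = "CARD('n)"
  have "det (mat x - A) = (\<Sum>k\<le>?n. (- 1) ^ (?n - k) * esym (?n - k) A * x ^ k)"
    unfolding det_char_expand by (rule sum.reindex_bij_witness[of _ "\<lambda>k. ?n - k" "\<lambda>k. ?n - k"]) auto
  also have "\<dots> = (\<Sum>k<?n. char_coeff A k * x ^ k) + x ^ ?n"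
    unfolding lessThan_Suc_atMost[symmetric] by (simp add: char_coeff_def esym_0)
  finally show ?thesis by (simp add: poly_sum poly_monom)
qed

lemma char_coeff_eqI:
  fixes A B :: "'n::finite cmat"
  assumes "\<And>x. det (mat x - A) = poly ((\<Sum>k<CARD('n). monom (c k) k) + monom 1 CARD('n)) x" "k < CARD('n)"
  shows "char_coeff A k = c k"
proof -
  have "(\<Sum>k<CARD('n). monom (char_coeff A k) k) + monom 1 CARD('n) = (\<Sum>k<CARD('n). monom (c k) k) + monom 1 CARD('n)"
    by (intro poly_eq_poly_eq_iff[THEN iffD1] ext) (simp only: det_char_poly[symmetric] assms(1))
  then have "coeff (\<Sum>k<CARD('n). monom (char_coeff A k) k) k = coeff (\<Sum>k<CARD('n). monom (c k) k) k" by simp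
  then show ?thesis using assms(2) by (simp add: coeff_sum)
qed

lemma char_coeff_conj:
  fixes Q R A :: "'n::finite cmat"
  assumes "Q ** R = mat 1" "k < CARD('n)"
  shows "char_coeff (Q ** A ** R) k = char_coeff A k"
proof (rule char_coeff_eqI[OF _ assms(2)])
  fix x
  have "mat x - Q ** A ** R = Q ** (mat x - A) ** R"
  proof -
    have "Q ** mat x ** R = mat x"
    proof -
      have "(Q ** mat x) $ i $ j = x * Q $ i $ j" for i j
        by (simp add: matrix_matrix_mult_def mat_def)
      then have "(Q ** mat x ** R) $ i $ j = x * (Q ** R) $ i $ j" for i j
        by (simp add: matrix_matrix_mult_def sum_distrib_left mult.assoc)
      then show ?thesis by (simp add: assms(1) vec_eq_iff mat_def)
    qed
    moreover have "Q ** (mat x - A) ** R = Q ** mat x ** R - Q ** A ** R"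
      by (simp add: matrix_matrix_mult_def vec_eq_iff sum_subtractf algebra_simps sum_distrib_left)
    ultimately show ?thesis by simp
  qed
  then have "det (mat x - Q ** A ** R) = det (Q ** R) * det (mat x - A)"
    by (simp add: det_mul)
  then show "det (mat x - Q ** A ** R) = poly ((\<Sum>k<CARD('n). monom (char_coeff A k) k) + monom 1 CARD('n)) x"
    by (simp add: assms(1) det_char_poly)
qed

lemma char_coeff_spectrum:
  assumes "is_spectrum A z" "k < CARD('n)"
  shows "char_coeff (A :: 'n::finite cmat) k = root_coeff z k"
proof (rule char_coeff_eqI[OF _ assms(2)])
  fix x
  show "det (mat x - A) = poly ((\<Sum>k<CARD('n). monom (root_coeff z k) k) + monom 1 CARD('n)) x"
    using assms(1) unfolding root_poly_eq[symmetric] by (simp add: is_spectrum_def poly_prod)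
qed

lemma esym_eq_char_coeff: "k \<le> CARD('n) \<Longrightarrow> k > 0 \<Longrightarrow>
   esym k A = (- 1) ^ k * char_coeff (A :: 'n::finite cmat) (CARD('n) - k)"
  by (simp add: char_coeff_def flip: mult.assoc power_mult_distrib)

lemma esym_conj:
  fixes Q R A :: "'n::finite cmat"
  assumes "Q ** R = mat 1" "k \<le> CARD('n)"
  shows "esym k (Q ** A ** R) = esym k A"
  using assms char_coeff_conj[OF assms(1), of "CARD('n) - k" A]
  by (cases "k = 0") (simp_all add: esym_0 esym_eq_char_coeff)

lemma is_spectrum_diag: "is_spectrum (diag_mat a) a"
proof -
  have "det (mat x - diag_mat a) = (\<Prod>i\<in>UNIV. x - a i)" for x
    by (subst det_diagonal) (auto simp: mat_def diag_mat_def)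
  then show ?thesis by (simp add: is_spectrum_def)
qed

lemma is_spectrum_conj:
  fixes Q R A :: "'n::finite cmat"
  shows "is_spectrum A z \<Longrightarrow> Q ** R = mat 1 \<Longrightarrow> is_spectrum (Q ** A ** R) z"
  unfolding is_spectrum_def det_char_poly using char_coeff_conj[of Q R _ A] by simp

definition schur_mat :: "('n::{finite,linorder} \<Rightarrow> nat) \<Rightarrow> 'n cmat \<Rightarrow> complex" where
  "schur_mat s A = schur_coeff (char_coeff A) s"

lemma schur_coeff_cong:
  assumes "\<And>k. k < CARD('n) \<Longrightarrow> c k = d k"
  shows "schur_coeff c s = schur_coeff d (s :: 'n::{finite,linorder} \<Rightarrow> nat)"
proof -
  have "k < CARD('n) \<Longrightarrow> reduction CARD('n) c m k = reduction CARD('n) d m k" for m k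
    by (induction m arbitrary: k) (auto simp: assms)
  then show ?thesis by (simp add: schur_coeff_def pos_less_card)
qed

lemma schur_mat_spectrum: "is_spectrum A z \<Longrightarrow> schur_mat s A = schur s z"
  unfolding schur_mat_def schur_def by (rule schur_coeff_cong) (rule char_coeff_spectrum)

lemma matpoly_schur_mat: "matpoly (schur_mat s)"
proof -
  have c: "matpoly (\<lambda>A. char_coeff A k)" for k
    unfolding char_coeff_def by (intro matpoly_intros matpoly_esym)
  have "matpoly (\<lambda>A. reduction n (char_coeff A) m k)" for n m k
  proof (induction m arbitrary: k)
    case (Suc m)
    then show ?case by (cases "k = 0") (auto intro!: matpoly_intros c)
  qed (auto intro: matpoly_intros)
  then show ?thesis unfolding schur_mat_def[abs_def] schur_coeff_def by (rule matpoly_det)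
qed

lemma class_function_schur_mat: "class_function (schur_mat s)"
  unfolding class_function_def schur_mat_def by (auto intro!: schur_coeff_cong char_coeff_conj)

subsection \<open>Haar measure on the circle and the torus\<close>

lemma sets_circle_haar [measurable_cong]: "sets circle_haar = sets (restrict_space borel circle)"
  by (simp add: circle_haar_def)

lemma space_circle_haar [simp]: "space circle_haar = circle"
  by (simp add: circle_haar_def space_restrict_space)

lemma measurable_cis_circle: "cis \<in> measurable borel (restrict_space borel circle)"
  by (intro measurable_restrict_space2) (auto intro!: borel_measurable_continuous_onI continuous_intros)

interpretation uniform_circle: prob_space "uniform_measure lborel {0..2 * pi}"
  by (rule prob_space_uniform_measure) auto

interpretation circle_haar: prob_space circle_haar
  unfolding circle_haar_def
  by (rule uniform_circle.prob_space_distr) (use measurable_cis_circle in simp)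

interpretation torus_haar: prob_space "torus_haar :: ('n::finite \<Rightarrow> complex) measure"
  unfolding torus_haar_def by (rule prob_space_PiM) (rule circle_haar.prob_space_axioms)

lemma space_torus_haar: "space (torus_haar :: ('n::finite \<Rightarrow> complex) measure) = UNIV \<rightarrow> circle"
  by (simp add: torus_haar_def space_PiM PiE_UNIV_domain)

lemma mem_torusI: "(\<And>i. z i \<in> circle) \<Longrightarrow> z \<in> space torus_haar"
  by (auto simp: space_torus_haar)

lemma mem_torusD: "z \<in> space torus_haar \<Longrightarrow> cmod (z i) = 1"
  by (auto simp: space_torus_haar Pi_iff)

lemma torus_permute: "z \<in> space torus_haar \<Longrightarrow> z \<circ> p \<in> space torus_haar"
  by (auto simp: space_torus_haar Pi_iff)

lemma measurable_circle_borel [measurable]: "(\<lambda>z. z) \<in> borel_measurable circle_haar"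
  by (subst measurable_cong_sets[OF sets_circle_haar refl]) (rule measurable_restrict_space1, simp)

lemma measurable_torus_coordinate [measurable]: "(\<lambda>z. z i) \<in> borel_measurable torus_haar"
  unfolding torus_haar_def by measurable

lemma measurable_torus_permute [measurable]:
  "(\<lambda>z. z \<circ> p) \<in> measurable torus_haar torus_haar"
  unfolding torus_haar_def comp_def by (rule measurable_PiM_single') (auto simp: PiE_UNIV_domain space_PiM)

lemma restrict_UNIV [simp]: "restrict f UNIV = f"
  by (simp add: restrict_def)

lemma torus_haar_permute:
  assumes "p permutes UNIV"
  shows "distr torus_haar torus_haar (\<lambda>z. z \<circ> p) = torus_haar"
proof -
  have "distr (PiM UNIV (\<lambda>_. circle_haar)) (PiM UNIV (\<lambda>_. circle_haar)) (\<lambda>\<omega>. \<lambda>n\<in>UNIV. \<omega> (p n)) = PiM UNIV (\<lambda>_. circle_haar)"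
    using assms by (intro distr_PiM_reindex) (auto simp: permutes_inj circle_haar.prob_space_axioms)
  then show ?thesis by (simp add: torus_haar_def comp_def restrict_UNIV)
qed

text \<open>Multiplying the i-th coordinate by cis (t pos i) separates coinciding coordinates for
  every small t > 0, while distinct ones stay distinct by continuity. Hence points with distinct
  coordinates approach every point of the torus.\<close>

lemma torus_dense:
  fixes f g :: "('n::{finite,linorder} \<Rightarrow> complex) \<Rightarrow> complex"
  assumes "continuous_on UNIV f" "continuous_on UNIV g"
    and eq: "\<And>z. z \<in> space torus_haar \<Longrightarrow> inj z \<Longrightarrow> f z = g z"
    and a: "a \<in> space torus_haar"
  shows "f a = g a"
proof -
  define \<gamma> where "\<gamma> t i = a i * cis (t * real (pos i))" for t i
  have \<gamma>0: "\<gamma> 0 = a" by (simp add: \<gamma>_def fun_eq_iff)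
  have c: "continuous_on UNIV \<gamma>"
    by (rule continuous_on_coordinatewise_then_product) (auto simp: \<gamma>_def intro!: continuous_intros)
  have lim: "((\<lambda>t. h (\<gamma> t)) \<longlongrightarrow> h a) (at_right 0)" if "continuous_on UNIV h" for h :: "('n \<Rightarrow> complex) \<Rightarrow> complex"
  proof -
    have "continuous_on UNIV (\<lambda>t. h (\<gamma> t))"
      by (rule continuous_on_compose2[OF that c]) auto
    then have "isCont (\<lambda>t. h (\<gamma> t)) 0" by (simp add: continuous_on_eq_continuous_at)
    then show ?thesis by (simp add: isCont_def \<gamma>0 filterlim_at_split)
  qed
  have "eventually (\<lambda>t. \<gamma> t i \<noteq> \<gamma> t j) (at_right 0)" if "i \<noteq> j" for i j
  proof (cases "a i = a j")
    case False
    have "((\<lambda>t. a i * cis (t * real (pos i)) - a j * cis (t * real (pos j))) \<longlongrightarrow> a i - a j) (at_right 0)"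
      by (auto intro!: tendsto_eq_intros)
    then have "eventually (\<lambda>t. a i * cis (t * real (pos i)) - a j * cis (t * real (pos j)) \<noteq> 0) (at_right 0)"
      by (rule tendsto_imp_eventually_ne) (use False in auto)
    then show ?thesis by eventually_elim (simp add: \<gamma>_def)
  next
    case True
    \<comment> \<open>For such t all angles t pos i lie in [0, 1), so two of them cannot differ by a
      nonzero multiple of 2 pi.\<close>
    have "eventually (\<lambda>t::real. t \<in> {0<..<1 / real CARD('n)}) (at_right 0)"
      by (rule eventually_at_right_real) simp
    then show ?thesis
    proof eventually_elim
      case (elim t)
      show ?case
      proof
        assume "\<gamma> t i = \<gamma> t j"
        moreover have "a i \<noteq> 0" using mem_torusD[OF a, of i] by auto
        ultimately have "cis (t * real (pos i)) = cis (t * real (pos j))" by (simp add: \<gamma>_def True)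
        then have "cis (t * real (pos i) - t * real (pos j)) = 1"
          by (simp flip: cis_divide)
        then have "cos (t * real (pos i) - t * real (pos j)) = 1" by (metis cis.sel(1) one_complex.sel(1))
        then obtain n :: int where n: "t * real (pos i) - t * real (pos j) = real_of_int n * 2 * pi"
          using cos_one_2pi_int by blast
        have b: "t * real (pos i) < 1" "t * real (pos j) < 1" "0 \<le> t * real (pos i)" "0 \<le> t * real (pos j)"
        proof -
          have "t * real (pos k) < 1" for k :: 'n
          proof -
            have "t * real (pos k) \<le> t * real CARD('n)"
              using elim pos_less_card[of k] by (intro mult_left_mono) auto
            also have "\<dots> < 1" using elim by (simp add: field_simps)
            finally show ?thesis .
          qed
          then show "t * real (pos i) < 1" "t * real (pos j) < 1" by auto
        qed (use elim in auto)
        have "\<bar>real_of_int n * 2 * pi\<bar> < 1" using b unfolding n[symmetric] by linarith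
        moreover have "\<bar>real_of_int n * 2 * pi\<bar> \<ge> 1" if "n \<noteq> 0"
        proof -
          have "1 \<le> \<bar>real_of_int n\<bar>" using that by linarith
          moreover have "1 \<le> 2 * pi" using pi_ge_two by linarith
          ultimately have "1 * 1 \<le> \<bar>real_of_int n\<bar> * (2 * pi)" by (intro mult_mono) auto
          then show ?thesis by (simp add: abs_mult mult.assoc)
        qed
        ultimately have "n = 0" by fastforce
        with n elim have "pos i = pos j" by simp
        with that show False using inj_pos by (auto simp: inj_def)
      qed
    qed
  qed
  then have "eventually (\<lambda>t. \<forall>(i, j)\<in>{(i, j). i \<noteq> j}. \<gamma> t i \<noteq> \<gamma> t j) (at_right 0)"
    by (intro eventually_ball_finite) auto
  then have "eventually (\<lambda>t. f (\<gamma> t) = g (\<gamma> t)) (at_right 0)"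
  proof eventually_elim
    case (elim t)
    have "\<gamma> t \<in> space torus_haar"
      by (rule mem_torusI) (use mem_torusD[OF a] in \<open>simp add: \<gamma>_def norm_mult\<close>)
    then show ?case using elim by (intro eq) (auto simp: inj_def)
  qed
  then have "((\<lambda>t. f (\<gamma> t)) \<longlongrightarrow> g a) (at_right 0)"
    using lim[OF assms(2)] by (simp add: filterlim_cong)
  with lim[OF assms(1)] show ?thesis
    by (intro tendsto_unique[of "at_right (0::real)"]) auto
qed

subsection \<open>The spectrum of a unitary matrix\<close>

text \<open>Both lists enumerate the multiset of roots of one monic polynomial.\<close>

lemma is_spectrum_unique:
  assumes "is_spectrum A z" "is_spectrum A a"
  shows "\<exists>p. p permutes UNIV \<and> z = a \<circ> p"
proof -
  have "poly (\<Prod>i\<in>UNIV. [:- z i, 1:]) = poly (\<Prod>i\<in>UNIV. [:- a i, 1:])"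
    using assms by (simp add: is_spectrum_def poly_prod fun_eq_iff)
  then have "(\<Prod>i\<in>UNIV. [:- z i, 1:]) = (\<Prod>i\<in>UNIV. [:- a i, 1:])"
    by (simp add: poly_eq_poly_eq_iff)
  then have "proots (\<Prod>i\<in>UNIV. [:- z i, 1:]) = proots (\<Prod>i\<in>UNIV. [:- a i, 1:])" by simp
  then have "image_mset z (mset_set UNIV) = image_mset a (mset_set UNIV)"
    by (simp add: proots_prod sum_unfold_sum_mset)
  then obtain p where "p permutes UNIV" "\<forall>x\<in>UNIV. z x = a (p x)"
    using image_mset_eq_implies_permutes[of UNIV z a] by auto
  then show ?thesis by (intro exI[of _ p]) (auto simp: fun_eq_iff)
qed

lemma some_spectrum_diagonalized:
  assumes "Q \<in> unitary_group" "A = Q ** diag_mat a ** dagger Q"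
  shows "\<exists>p. p permutes UNIV \<and> some_spectrum A = a \<circ> p" "is_spectrum A a"
proof -
  show *: "is_spectrum A a"
    unfolding assms(2) by (rule is_spectrum_conj[OF is_spectrum_diag]) (use assms(1) in \<open>simp add: unitary_group_def\<close>)
  then have "is_spectrum A (some_spectrum A)" unfolding some_spectrum_def by (rule someI[of "is_spectrum A"])
  then show "\<exists>p. p permutes UNIV \<and> some_spectrum A = a \<circ> p" using * by (rule is_spectrum_unique)
qed

lemma
  assumes "A \<in> unitary_group"
  shows is_spectrum_some_spectrum: "is_spectrum A (some_spectrum A)"
    and some_spectrum_torus: "some_spectrum A \<in> space torus_haar"
proof -
  obtain Q a where Q: "Q \<in> unitary_group" "\<forall>i. a i \<in> circle" "A = Q ** diag_mat a ** dagger Q"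
    using unitary_spectral_theorem[OF assms] by blast
  have *: "is_spectrum A a" by (rule some_spectrum_diagonalized(2)[OF Q(1,3)])
  then show "is_spectrum A (some_spectrum A)" unfolding some_spectrum_def by (rule someI[of "is_spectrum A"])
  have "a \<in> space torus_haar" using Q(2) by (intro mem_torusI) auto
  then show "some_spectrum A \<in> space torus_haar"
    using some_spectrum_diagonalized(1)[OF Q(1,3)] torus_permute by auto
qed

lemma is_spectrum_torus:
  assumes "A \<in> unitary_group" "is_spectrum A z"
  shows "z \<in> space torus_haar"
  using is_spectrum_unique[OF assms(2) is_spectrum_some_spectrum[OF assms(1)]]
    torus_permute[OF some_spectrum_torus[OF assms(1)]] by auto

lemma det_spectrum:
  assumes "is_spectrum A z"
  shows "det A = (\<Prod>i\<in>UNIV. z i)"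
proof -
  have "det (mat 0 - A) = det (\<chi> i. (- 1) *s A $ i)"
    by (intro arg_cong[where f = det]) (simp add: vec_eq_iff mat_def)
  also have "\<dots> = (- 1) ^ CARD('a) * det A" unfolding det_rows_mul by simp
  finally have "(- 1) ^ CARD('a) * det A = (\<Prod>a\<in>UNIV. - 1 * z a)"
    using assms[unfolded is_spectrum_def, rule_format, of 0] by simp
  also have "\<dots> = (- 1) ^ CARD('a) * (\<Prod>i\<in>UNIV. z i)" by (simp only: prod.distrib) simp
  finally show ?thesis by simp
qed

section \<open>Expansion of symmetric polynomials in Schur polynomials\<close>

lemma symmetric_times_vandermonde:
  fixes a :: "'n::{finite,linorder} \<Rightarrow> complex"
  assumes "finite X"
    and "\<And>q. q permutes UNIV \<Longrightarrow> F = (\<Sum>I\<in>X. u I * (\<Prod>i\<in>UNIV. a (q i) ^ \<nu> I i))"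
  shows "F * vandermonde a = (\<Sum>I\<in>X. u I * schur (\<lambda>i. \<nu> I i + pos i) a) * vandermonde a"
proof -
  \<comment> \<open>The Vandermonde determinant is expanded over permutations q, and for each q the
    expression of F in the variables permuted by q is inserted. Exponents then simply add, and
    summing over q restores alternants.\<close>
  have "F * vandermonde a = (\<Sum>q | q permutes UNIV. of_int (sign q) * (\<Sum>I\<in>X. u I * (\<Prod>i\<in>UNIV. a (q i) ^ (\<nu> I i + pos i))))"
    unfolding alternant_pos[symmetric] alternant_expand sum_distrib_left
  proof (rule sum.cong[OF refl])
    fix q assume "q \<in> {q. q permutes (UNIV :: 'n set)}"
    then have "F = (\<Sum>I\<in>X. u I * (\<Prod>i\<in>UNIV. a (q i) ^ \<nu> I i))" using assms(2) by blast
    then show "F * (of_int (sign q) * (\<Prod>i\<in>UNIV. a (q i) ^ pos i))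
        = (\<Sum>I\<in>X. of_int (sign q) * (u I * (\<Prod>i\<in>UNIV. a (q i) ^ (\<nu> I i + pos i))))"
      by (simp add: sum_distrib_right sum_distrib_left power_add prod.distrib mult_ac)
  qed
  also have "\<dots> = (\<Sum>I\<in>X. u I * alternant (\<lambda>i. \<nu> I i + pos i) a)"
    unfolding alternant_expand sum_distrib_left by (subst sum.swap) (simp add: mult_ac)
  finally show ?thesis by (simp add: alternant_eq_schur sum_distrib_right mult.assoc)
qed

text \<open>Coefficients of monomials become coefficients of Schur polynomials without any
  straightening. The Vandermonde factor is cancelled at distinct arguments, and density covers the
  others.\<close>

lemma symmetric_eq_schur_sum:
  fixes F :: "('n::{finite,linorder} \<Rightarrow> complex) \<Rightarrow> complex"
  assumes "finite X" and F: "\<And>a. a \<in> space torus_haar \<Longrightarrow> F a = (\<Sum>I\<in>X. u I * (\<Prod>i\<in>UNIV. a i ^ \<nu> I i))"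
    and sym: "\<And>a q. a \<in> space torus_haar \<Longrightarrow> q permutes UNIV \<Longrightarrow> F (a \<circ> q) = F a"
    and a: "a \<in> space torus_haar"
  shows "F a = (\<Sum>I\<in>X. u I * schur (\<lambda>i. \<nu> I i + pos i) a)"
  unfolding F[OF a]
proof (rule torus_dense[OF _ _ _ a])
  show "continuous_on UNIV (\<lambda>a::'n \<Rightarrow> complex. \<Sum>I\<in>X. u I * (\<Prod>i\<in>UNIV. a i ^ \<nu> I i))"
    by (intro continuous_intros continuous_on_product_coordinates)
  show "continuous_on UNIV (\<lambda>a::'n \<Rightarrow> complex. \<Sum>I\<in>X. u I * schur (\<lambda>i. \<nu> I i + pos i) a)"
    by (intro continuous_intros continuous_on_schur)
next
  fix z :: "'n \<Rightarrow> complex" assume z: "z \<in> space torus_haar" "inj z"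
  have "F z * vandermonde z = (\<Sum>I\<in>X. u I * schur (\<lambda>i. \<nu> I i + pos i) z) * vandermonde z"
  proof (rule symmetric_times_vandermonde[OF assms(1)])
    fix q assume "q permutes (UNIV :: 'n set)"
    from sym[OF z(1) this] F[OF torus_permute[OF z(1)], of q]
    show "F z = (\<Sum>I\<in>X. u I * (\<Prod>i\<in>UNIV. z (q i) ^ \<nu> I i))" by (simp add: comp_def)
  qed
  then show "(\<Sum>I\<in>X. u I * (\<Prod>i\<in>UNIV. z i ^ \<nu> I i)) = (\<Sum>I\<in>X. u I * schur (\<lambda>i. \<nu> I i + pos i) z)"
    using z(2) vandermonde_eq_0_iff[of z] by (simp add: F[OF z(1)])
qed

section \<open>Derivatives of alternants and the Casimir eigenvalue\<close>

definition exponent_sum :: "('n::finite \<Rightarrow> nat) \<Rightarrow> complex" where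
  "exponent_sum s = (\<Sum>i\<in>UNIV. of_nat (s i))"

definition exponent_sum2 :: "('n::finite \<Rightarrow> nat) \<Rightarrow> complex" where
  "exponent_sum2 s = (\<Sum>i\<in>UNIV. of_nat (s i) * (of_nat (s i) - 1))"

text \<open>The second order terms come from sum_i a_i^2 d_i^2 on the alternants of \<open>s\<close>
  and \<open>pos\<close>; the factor N - 1 comes from rewriting a_i a_j as a_i^2 - a_i (a_i - a_j)
  for the N - 1 indices j different from i. For a fixed sum of exponents the value grows with the
  sum of their squares.\<close>

definition casimir_eigenvalue :: "('n::{finite,linorder} \<Rightarrow> nat) \<Rightarrow> complex" where
  "casimir_eigenvalue s = exponent_sum2 s - exponent_sum2 (pos :: 'n \<Rightarrow> nat)
     - 2 * (of_nat CARD('n) - 1) * (exponent_sum s - exponent_sum (pos :: 'n \<Rightarrow> nat))"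

text \<open>In the term of the permutation \<open>p\<close>, the coordinate \<open>a i\<close>
  occurs in the row \<open>inv p i\<close> only; this is the remaining factor. It exhibits the
  alternant as a polynomial in \<open>a i\<close> alone.\<close>

definition alt_cofactor :: "('n::finite \<Rightarrow> nat) \<Rightarrow> ('n \<Rightarrow> complex) \<Rightarrow> 'n \<Rightarrow> ('n \<Rightarrow> 'n) \<Rightarrow> complex" where
  "alt_cofactor s a i p = of_int (sign p) * (\<Prod>j\<in>UNIV - {inv p i}. a (p j) ^ s j)"

definition alt_deriv :: "('n::finite \<Rightarrow> nat) \<Rightarrow> ('n \<Rightarrow> complex) \<Rightarrow> 'n \<Rightarrow> complex \<Rightarrow> complex" where
  "alt_deriv s a i t = (\<Sum>p | p permutes UNIV. alt_cofactor s a i p *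
     (of_nat (s (inv p i)) * (a i + t) ^ (s (inv p i) - 1)))"

definition alt_deriv2 :: "('n::finite \<Rightarrow> nat) \<Rightarrow> ('n \<Rightarrow> complex) \<Rightarrow> 'n \<Rightarrow> complex \<Rightarrow> complex" where
  "alt_deriv2 s a i t = (\<Sum>p | p permutes UNIV. alt_cofactor s a i p *
     (of_nat (s (inv p i)) * (of_nat (s (inv p i) - 1) * (a i + t) ^ (s (inv p i) - 2))))"

lemma alternant_line:
  "alternant s (a(i := a i + t)) = (\<Sum>p | p permutes UNIV. alt_cofactor s a i p * (a i + t) ^ s (inv p i))"
  unfolding alternant_expand
proof (rule sum.cong[OF refl])
  fix p assume "p \<in> {p. p permutes (UNIV :: 'a set)}"
  then have p: "p (inv p i) = i" "\<And>j. p j = i \<longleftrightarrow> j = inv p i"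
    by (auto simp: permutes_inverses permutes_inv_eq)
  have "(\<Prod>j\<in>UNIV. (a(i := a i + t)) (p j) ^ s j)
      = (a(i := a i + t)) (p (inv p i)) ^ s (inv p i) * (\<Prod>j\<in>UNIV - {inv p i}. (a(i := a i + t)) (p j) ^ s j)"
    by (rule prod.remove) auto
  also have "(\<Prod>j\<in>UNIV - {inv p i}. (a(i := a i + t)) (p j) ^ s j) = (\<Prod>j\<in>UNIV - {inv p i}. a (p j) ^ s j)"
    by (intro prod.cong refl) (use p in auto)
  finally show "of_int (sign p) * (\<Prod>j\<in>UNIV. (a(i := a i + t)) (p j) ^ s j) = alt_cofactor s a i p * (a i + t) ^ s (inv p i)"
    by (simp add: alt_cofactor_def p mult_ac)
qed

lemma alternant_line_deriv:
  "((\<lambda>t. alternant s (a(i := a i + t))) has_field_derivative alt_deriv s a i t) (at t)"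
  unfolding alternant_line alt_deriv_def
  by (intro DERIV_sum) (auto intro!: derivative_eq_intros)

lemma alt_deriv_deriv: "(alt_deriv s a i has_field_derivative alt_deriv2 s a i t) (at t)"
  unfolding alt_deriv_def[abs_def] alt_deriv2_def
  by (intro DERIV_sum) (auto intro!: derivative_eq_intros simp: numeral_2_eq_2)

text \<open>An operator that weights each power of \<open>a i\<close> by \<open>w\<close> of its
  exponent, summed over i, multiplies every monomial of the alternant by the sum of \<open>w\<close>
  over all exponents, which is the same for all permutations.\<close>

lemma alt_euler:
  fixes w :: "nat \<Rightarrow> complex"
  assumes X: "\<And>i. X i = (\<Sum>p | p permutes UNIV. alt_cofactor s a i p * (w (s (inv p i)) * a i ^ s (inv p i)))"
  shows "(\<Sum>i\<in>UNIV. X i) = (\<Sum>i\<in>UNIV. w (s i)) * alternant s a"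
proof -
  have *: "alt_cofactor s a i p * (w (s (inv p i)) * a i ^ s (inv p i))
      = w (s (inv p i)) * (of_int (sign p) * (\<Prod>j\<in>UNIV. a (p j) ^ s j))" if "p permutes UNIV" for i p
  proof -
    have "p (inv p i) = i" using that by (simp add: permutes_inverses)
    then show ?thesis
      using prod.remove[of UNIV "inv p i" "\<lambda>j. a (p j) ^ s j"] by (simp add: alt_cofactor_def mult_ac)
  qed
  have "(\<Sum>i\<in>UNIV. X i) = (\<Sum>i\<in>UNIV. \<Sum>p | p permutes UNIV. w (s (inv p i)) * (of_int (sign p) * (\<Prod>j\<in>UNIV. a (p j) ^ s j)))"
    unfolding X by (intro sum.cong refl *) simp
  also have "\<dots> = (\<Sum>p | p permutes UNIV. (\<Sum>i\<in>UNIV. w (s (inv p i))) * (of_int (sign p) * (\<Prod>j\<in>UNIV. a (p j) ^ s j)))"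
    by (subst sum.swap) (simp add: sum_distrib_right)
  also have "\<dots> = (\<Sum>p | p permutes UNIV. (\<Sum>i\<in>UNIV. w (s i)) * (of_int (sign p) * (\<Prod>j\<in>UNIV. a (p j) ^ s j)))"
  proof (rule sum.cong[OF refl])
    fix p assume "p \<in> {p. p permutes (UNIV :: 'a set)}"
    then have "inv p permutes UNIV" by (simp add: permutes_inv)
    from sum.permute[OF this, of "\<lambda>i. w (s i)"]
    show "(\<Sum>i\<in>UNIV. w (s (inv p i))) * (of_int (sign p) * (\<Prod>j\<in>UNIV. a (p j) ^ s j))
        = (\<Sum>i\<in>UNIV. w (s i)) * (of_int (sign p) * (\<Prod>j\<in>UNIV. a (p j) ^ s j))" by (simp add: comp_def)
  qed
  finally show ?thesis by (simp add: alternant_expand sum_distrib_left)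
qed

lemma alt_deriv_euler: "(\<Sum>i\<in>UNIV. a i * alt_deriv s a i 0) = exponent_sum s * alternant s a"
  unfolding exponent_sum_def
proof (rule alt_euler)
  fix i
  have *: "x * (of_nat m * x ^ (m - 1)) = of_nat m * x ^ m" for x :: complex and m by (cases m) auto
  show "a i * alt_deriv s a i 0 = (\<Sum>p | p permutes UNIV. alt_cofactor s a i p * (of_nat (s (inv p i)) * a i ^ s (inv p i)))"
    unfolding alt_deriv_def sum_distrib_left
    by (intro sum.cong refl) (simp only: add_0_right mult.left_commute[of "a i" "alt_cofactor _ _ _ _"] *)
qed

lemma alt_deriv2_euler: "(\<Sum>i\<in>UNIV. (a i)\<^sup>2 * alt_deriv2 s a i 0) = exponent_sum2 s * alternant s a"
  unfolding exponent_sum2_def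
proof (rule alt_euler[where w = "\<lambda>m. of_nat m * (of_nat m - 1)"])
  fix i
  have *: "x\<^sup>2 * (of_nat m * (of_nat (m - 1) * x ^ (m - 2))) = of_nat m * (of_nat m - 1) * x ^ m" for x :: complex and m
  proof (cases m)
    case (Suc k)
    then show ?thesis by (cases k) (auto simp: power2_eq_square)
  qed auto
  show "(a i)\<^sup>2 * alt_deriv2 s a i 0
      = (\<Sum>p | p permutes UNIV. alt_cofactor s a i p * (of_nat (s (inv p i)) * (of_nat (s (inv p i)) - 1) * a i ^ s (inv p i)))"
    unfolding alt_deriv2_def sum_distrib_left
    by (intro sum.cong refl) (simp only: add_0_right mult.left_commute[of "(a i)\<^sup>2" "alt_cofactor _ _ _ _"] *)
qed

text \<open>Only the factors containing \<open>a i\<close> vary along the line, and each contributes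
  1 / (a_i - a_j), whichever of the two indices is larger.\<close>

lemma vandermonde_log_deriv:
  fixes a :: "'n::{finite,linorder} \<Rightarrow> complex"
  assumes "inj a"
  shows "alt_deriv pos a i 0 = vandermonde a * (\<Sum>j\<in>UNIV. if j = i then 0 else 1 / (a i - a j))"
proof -
  let ?f = "\<lambda>(x, y) t. (a(i := a i + t)) y - (a(i := a i + t)) x"
  let ?d = "\<lambda>(x, y). (if y = i then 1 else 0) - (if x = i then 1 else 0) :: complex"
  have "((\<lambda>t. \<Prod>xy\<in>{(x, y). x < y}. ?f xy t) has_field_derivative
      (\<Prod>xy\<in>{(x, y). x < y}. ?f xy 0) * (\<Sum>xy\<in>{(x, y). x < y}. ?d xy / ?f xy 0)) (at 0)"
  proof (rule has_field_derivative_prod')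
    fix xy :: "'n \<times> 'n" assume "xy \<in> {(x, y). x < y}"
    then show "?f xy 0 \<noteq> 0" by (auto simp: inj_eq[OF assms] split: if_splits)
    show "(?f xy has_field_derivative ?d xy) (at 0)"
      by (cases xy) (auto intro!: derivative_eq_intros)
  qed
  moreover have "(\<lambda>t. \<Prod>xy\<in>{(x, y). x < y}. ?f xy t) = (\<lambda>t. alternant pos (a(i := a i + t)))"
    unfolding alternant_pos vandermonde_def by (intro ext prod.cong) auto
  ultimately have *: "alt_deriv pos a i 0 = (\<Prod>xy\<in>{(x, y). x < y}. ?f xy 0) * (\<Sum>xy\<in>{(x, y). x < y}. ?d xy / ?f xy 0)"
    using alternant_line_deriv[of pos a i 0] by (auto intro: DERIV_unique)
  have m: "- (1 / (a y - a i)) = 1 / (a i - a y)" for y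
    by (metis minus_diff_eq minus_divide_right)
  note *
  also have "(\<Prod>xy\<in>{(x, y). x < y}. ?f xy 0) = vandermonde a"
    unfolding vandermonde_def by (intro prod.cong) auto
  also have "(\<Sum>xy\<in>{(x, y). x < y}. ?d xy / ?f xy 0)
      = (\<Sum>(x, y)\<in>UNIV \<times> UNIV. if x < y then ((if y = i then 1 else 0) - (if x = i then 1 else 0)) / (a y - a x) else 0)"
    by (rule sum.mono_neutral_cong_left) (auto split: prod.splits)
  also have "\<dots> = (\<Sum>x\<in>UNIV. \<Sum>y\<in>UNIV. (if y = i then (if x < i then 1 / (a i - a x) else 0) else 0)
      + (if x = i then (if i < y then 1 / (a i - a y) else 0) else 0))"
    unfolding sum.cartesian_product[symmetric]
    by (intro sum.cong refl) (auto simp: m)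
  also have "\<dots> = (\<Sum>x\<in>UNIV. if x < i then 1 / (a i - a x) else 0) + (\<Sum>y\<in>UNIV. if i < y then 1 / (a i - a y) else 0)"
  proof -
    have "(\<Sum>x\<in>UNIV. \<Sum>y\<in>UNIV. if x = i then (if i < y then 1 / (a i - a y) else 0) else 0)
       = (\<Sum>y\<in>UNIV. if i < y then 1 / (a i - a y) else 0)"
      by (subst sum.swap) simp
    then show ?thesis by (simp add: sum.distrib)
  qed
  also have "\<dots> = (\<Sum>j\<in>UNIV. if j = i then 0 else 1 / (a i - a j))"
    unfolding sum.distrib[symmetric] by (intro sum.cong refl) auto
  finally show ?thesis .
qed

lemma diag_mat_line: "diag_mat (a(i := a i + t)) = diag_mat a + unit_entry i i t"
  by (auto simp: diag_mat_def unit_entry_def vec_eq_iff)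

lemma has_field_derivative_pd_at:
  assumes "matpoly f"
  shows "((\<lambda>t. f (A + unit_entry i j t)) has_field_derivative pd i j f (A + unit_entry i j t0)) (at t0)"
proof -
  have *: "A + unit_entry i j t0 + unit_entry i j h = A + unit_entry i j (h + t0)" for h
    by (simp add: unit_entry_def vec_eq_iff)
  have "((\<lambda>h. f (A + unit_entry i j (h + t0))) has_field_derivative pd i j f (A + unit_entry i j t0)) (at 0)"
    using has_field_derivative_pd[OF assms, of "A + unit_entry i j t0" i j] by (simp only: *)
  then show ?thesis using DERIV_shift[of "\<lambda>t. f (A + unit_entry i j t)" _ 0 t0] by simp
qed

text \<open>Along the diagonal, alternant = Schur function times Vandermonde determinant.
  Differentiating this product once and twice and summing with the weights a_i and a_i^2 gives two
  relations for the derivatives of the Schur function. The cross term of the second relation is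
  exactly what the off-diagonal second derivatives contribute, so the individual derivatives never
  have to be computed.\<close>

lemma casimir_schur_mat_diag:
  fixes a :: "'n::{finite,linorder} \<Rightarrow> complex"
  assumes inj: "inj a"
  shows "casimir (schur_mat s) (diag_mat a) = casimir_eigenvalue s * schur_mat s (diag_mat a)"
proof -
  let ?f = "schur_mat s" and ?D = "diag_mat a"
  define V where "V = vandermonde a"
  define G where "G = ?f ?D"
  define p where "p i = pd i i ?f ?D" for i
  define q where "q i = pd i i (pd i i ?f) ?D" for i
  define w where "w i = (\<Sum>j\<in>UNIV. if j = i then 0 else 1 / (a i - a j))" for i
  have V0: "V \<noteq> 0" using inj by (simp add: V_def vandermonde_eq_0_iff)
  note mp = matpoly_schur_mat[of s]
  have prod: "alternant s b = ?f (diag_mat b) * alternant pos b" for b :: "'n \<Rightarrow> complex"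
    by (simp add: alternant_pos alternant_eq_schur[of s] schur_mat_spectrum[OF is_spectrum_diag])
  have d1: "alt_deriv s a i t = pd i i ?f (?D + unit_entry i i t) * alternant pos (a(i := a i + t))
      + ?f (?D + unit_entry i i t) * alt_deriv pos a i t" for i t
  proof (rule DERIV_unique[OF alternant_line_deriv])
    show "((\<lambda>t. alternant s (a(i := a i + t))) has_field_derivative
        pd i i ?f (?D + unit_entry i i t) * alternant pos (a(i := a i + t))
      + ?f (?D + unit_entry i i t) * alt_deriv pos a i t) (at t)"
      unfolding prod[of "a(i := a i + _)"] diag_mat_line
      using DERIV_mult[OF has_field_derivative_pd_at[OF mp, of ?D i i t] alternant_line_deriv[of pos a i t]]
      by (simp add: algebra_simps)
  qed
  have d2: "alt_deriv2 s a i 0 = q i * V + 2 * (p i * alt_deriv pos a i 0) + G * alt_deriv2 pos a i 0" for i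
  proof (rule DERIV_unique[OF alt_deriv_deriv])
    have "alt_deriv s a i = (\<lambda>t. pd i i ?f (?D + unit_entry i i t) * alternant pos (a(i := a i + t))
      + ?f (?D + unit_entry i i t) * alt_deriv pos a i t)" using d1 by blast
    moreover have "((\<lambda>t. pd i i ?f (?D + unit_entry i i t) * alternant pos (a(i := a i + t))
      + ?f (?D + unit_entry i i t) * alt_deriv pos a i t) has_field_derivative
       q i * V + 2 * (p i * alt_deriv pos a i 0) + G * alt_deriv2 pos a i 0) (at 0)"
      using DERIV_add[OF DERIV_mult[OF has_field_derivative_pd[OF matpoly_pd[OF mp, of i i], of ?D i i] alternant_line_deriv[of pos a i 0]]
        DERIV_mult[OF has_field_derivative_pd[OF mp, of ?D i i] alt_deriv_deriv[of pos a i 0]]]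
      by (simp add: q_def p_def V_def G_def alternant_pos algebra_simps)
    ultimately show "(alt_deriv s a i has_field_derivative
       q i * V + 2 * (p i * alt_deriv pos a i 0) + G * alt_deriv2 pos a i 0) (at 0)" by simp
  qed
  have V1: "alt_deriv pos a i 0 = V * w i" for i
    unfolding V_def w_def by (rule vandermonde_log_deriv[OF inj])
  have alts: "alternant s a = G * V" "alternant pos a = V"
    by (simp_all add: prod[of a] G_def V_def alternant_pos)
  have e1: "exponent_sum s * (G * V) = V * (\<Sum>i\<in>UNIV. a i * p i) + G * (exponent_sum (pos :: 'n \<Rightarrow> nat) * V)"
  proof -
    have "exponent_sum s * (G * V) = (\<Sum>i\<in>UNIV. a i * alt_deriv s a i 0)"
      by (simp add: alt_deriv_euler alts)
    also have "\<dots> = (\<Sum>i\<in>UNIV. V * (a i * p i) + G * (a i * alt_deriv pos a i 0))"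
      by (intro sum.cong refl) (simp add: d1 p_def G_def V_def alternant_pos algebra_simps)
    finally show ?thesis
      by (simp add: sum.distrib sum_distrib_left[symmetric] alt_deriv_euler alts)
  qed
  have e2: "exponent_sum2 s * (G * V) = V * (\<Sum>i\<in>UNIV. (a i)\<^sup>2 * q i) + V * (2 * (\<Sum>i\<in>UNIV. (a i)\<^sup>2 * p i * w i))
      + G * (exponent_sum2 (pos :: 'n \<Rightarrow> nat) * V)"
  proof -
    have "exponent_sum2 s * (G * V) = (\<Sum>i\<in>UNIV. (a i)\<^sup>2 * alt_deriv2 s a i 0)"
      by (simp add: alt_deriv2_euler alts)
    also have "\<dots> = (\<Sum>i\<in>UNIV. V * ((a i)\<^sup>2 * q i) + V * (2 * ((a i)\<^sup>2 * p i * w i)) + G * ((a i)\<^sup>2 * alt_deriv2 pos a i 0))"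
      by (intro sum.cong refl) (simp add: d2 V1 algebra_simps)
    finally show ?thesis
      by (simp only: sum.distrib sum_distrib_left[symmetric] alt_deriv2_euler alts)
  qed
  define S1 where "S1 = (\<Sum>i\<in>UNIV. a i * p i)"
  define S2 where "S2 = (\<Sum>i\<in>UNIV. (a i)\<^sup>2 * q i)"
  define Sw where "Sw = (\<Sum>i\<in>UNIV. (a i)\<^sup>2 * p i * w i)"
  have "V * S1 = V * ((exponent_sum s - exponent_sum (pos :: 'n \<Rightarrow> nat)) * G)"
    using e1 by (simp add: S1_def algebra_simps)
  then have S1: "S1 = (exponent_sum s - exponent_sum (pos :: 'n \<Rightarrow> nat)) * G" using V0 by simp
  have "V * (S2 + 2 * Sw) = V * ((exponent_sum2 s - exponent_sum2 (pos :: 'n \<Rightarrow> nat)) * G)"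
    using e2 by (simp add: S2_def Sw_def algebra_simps)
  then have S2: "S2 + 2 * Sw = (exponent_sum2 s - exponent_sum2 (pos :: 'n \<Rightarrow> nat)) * G" using V0 by simp
  \<comment> \<open>The off-diagonal term a_i a_j (p_j - p_i) / (a_j - a_i) splits into
    \<open>U i j + U j i\<close>, whose double sums agree.\<close>
  define U where "U i j = (if j = i then 0 else a i * a j * p i / (a i - a j))" for i j
  have cas: "casimir ?f ?D = S2 + 2 * (\<Sum>i\<in>UNIV. \<Sum>j\<in>UNIV. U i j)"
  proof -
    have "a i * a j * pd i j (pd j i ?f) ?D = (if j = i then (a i)\<^sup>2 * q i else 0) + (U i j + U j i)" for i j
    proof (cases "i = j")
      case True
      then show ?thesis by (simp add: U_def q_def power2_eq_square)
    next
      case False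
      then have ne: "a j - a i \<noteq> 0" "a i - a j \<noteq> 0" using inj by (auto simp: inj_def)
      have "(a j - a i) * pd i j (pd j i ?f) ?D = p j - p i"
        unfolding p_def by (rule class_function_pd_pd_diag[OF mp class_function_schur_mat False])
      then have "pd i j (pd j i ?f) ?D = (p j - p i) / (a j - a i)" using ne by (simp add: field_simps)
      moreover have "a i * a j * p i / (a i - a j) = - (a i * a j * p i / (a j - a i))"
        using ne by (simp add: field_simps)
      ultimately show ?thesis using False by (simp add: U_def right_diff_distrib diff_divide_distrib mult_ac)
    qed
    then have "casimir ?f ?D = S2 + ((\<Sum>i\<in>UNIV. \<Sum>j\<in>UNIV. U i j) + (\<Sum>i\<in>UNIV. \<Sum>j\<in>UNIV. U j i))"
      by (simp add: casimir_diag S2_def sum.distrib)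
    moreover have "(\<Sum>i\<in>UNIV. \<Sum>j\<in>UNIV. U j i) = (\<Sum>i\<in>UNIV. \<Sum>j\<in>UNIV. U i j)" by (rule sum.swap)
    ultimately show ?thesis by simp
  qed
  have "(\<Sum>j\<in>UNIV. U i j) = (a i)\<^sup>2 * p i * w i - (of_nat CARD('n) - 1) * (a i * p i)" for i
  proof -
    \<comment> \<open>This is a_i a_j / (a_i - a_j) = a_i^2 / (a_i - a_j) - a_i.\<close>
    have "U i j = (a i)\<^sup>2 * p i * (if j = i then 0 else 1 / (a i - a j)) - (if j = i then 0 else a i * p i)" for j
    proof (cases "j = i")
      case False
      then have "a i - a j \<noteq> 0" using inj by (auto simp: inj_def)
      then show ?thesis using False by (simp add: U_def field_simps power2_eq_square)
    qed (simp add: U_def)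
    moreover have "(\<Sum>j\<in>UNIV. if j = i then 0 else a i * p i) = (of_nat CARD('n) - 1) * (a i * p i)"
      using sum.remove[of UNIV i "\<lambda>j. if j = i then 0 else a i * p i"]
      by (simp add: card_Diff_subset of_nat_diff Suc_leI)
    ultimately show ?thesis by (simp add: sum_subtractf sum_distrib_left[symmetric] w_def)
  qed
  then have "(\<Sum>i\<in>UNIV. \<Sum>j\<in>UNIV. U i j) = Sw - (of_nat CARD('n) - 1) * S1"
    by (simp add: sum_subtractf Sw_def S1_def sum_distrib_left)
  with cas have "casimir ?f ?D = (S2 + 2 * Sw) - 2 * (of_nat CARD('n) - 1) * S1"
    by (simp add: algebra_simps)
  also have "\<dots> = casimir_eigenvalue s * G"
    unfolding S2 S1 casimir_eigenvalue_def by (simp add: algebra_simps)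
  finally show ?thesis by (simp add: G_def)
qed

subsection \<open>Multiplicativity of averaged Schur functions\<close>

lemma pd_transpose: "pd i j (\<lambda>A. f (transpose A)) A = pd j i f (transpose A)"
proof -
  have "transpose (A + unit_entry i j t) = transpose A + unit_entry j i t" for t
    by (auto simp: transpose_def unit_entry_def vec_eq_iff)
  then show ?thesis by (simp add: pd_def)
qed

text \<open>Transposition permutes the four summation indices of the operator among themselves; this
  carries invariance under right multiplications over to left multiplications.\<close>

lemma casimir_transpose: "casimir (\<lambda>A. f (transpose A)) A = casimir f (transpose A)"
proof -
  have eq: "pd l i (\<lambda>A. f (transpose A)) = (\<lambda>A. pd i l f (transpose A))" for l i
    by (rule ext) (rule pd_transpose)
  let ?t = "\<lambda>k i l j. A $ k $ i * A $ l $ j * pd j k (pd i l f) (transpose A)"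
  have "casimir (\<lambda>A. f (transpose A)) A = (\<Sum>k\<in>UNIV. \<Sum>i\<in>UNIV. \<Sum>l\<in>UNIV. \<Sum>j\<in>UNIV. ?t k i l j)"
    unfolding casimir_def eq pd_transpose ..
  also have "\<dots> = (\<Sum>k\<in>UNIV. \<Sum>l\<in>UNIV. \<Sum>i\<in>UNIV. \<Sum>j\<in>UNIV. ?t k i l j)"
    by (rule sum.cong[OF refl], rule sum.swap)
  also have "\<dots> = (\<Sum>k\<in>UNIV. \<Sum>l\<in>UNIV. \<Sum>j\<in>UNIV. \<Sum>i\<in>UNIV. ?t k i l j)"
    by (rule sum.cong[OF refl], rule sum.cong[OF refl], rule sum.swap)
  also have "\<dots> = (\<Sum>k\<in>UNIV. \<Sum>j\<in>UNIV. \<Sum>l\<in>UNIV. \<Sum>i\<in>UNIV. ?t k i l j)"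
    by (rule sum.cong[OF refl], rule sum.swap)
  also have "\<dots> = (\<Sum>j\<in>UNIV. \<Sum>k\<in>UNIV. \<Sum>l\<in>UNIV. \<Sum>i\<in>UNIV. ?t k i l j)"
    by (rule sum.swap)
  also have "\<dots> = (\<Sum>j\<in>UNIV. \<Sum>l\<in>UNIV. \<Sum>k\<in>UNIV. \<Sum>i\<in>UNIV. ?t k i l j)"
    by (rule sum.cong[OF refl], rule sum.swap)
  also have "\<dots> = (\<Sum>j\<in>UNIV. \<Sum>l\<in>UNIV. \<Sum>i\<in>UNIV. \<Sum>k\<in>UNIV. ?t k i l j)"
    by (rule sum.cong[OF refl], rule sum.cong[OF refl], rule sum.swap)
  also have "\<dots> = casimir f (transpose A)"
    unfolding casimir_def by (simp add: transpose_def mult_ac)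
  finally show ?thesis .
qed

lemma casimir_compose_mult_left:
  assumes "matpoly f"
  shows "casimir (\<lambda>A. f (Q ** A)) A = casimir f (Q ** A)"
proof -
  define h where "h B = f (transpose B)" for B
  have "matpoly h" unfolding h_def using assms
    by (induction rule: matpoly.induct) (auto simp: transpose_def intro: matpoly_intros)
  have "(\<lambda>A. f (Q ** A)) = (\<lambda>A. h (transpose A ** transpose Q))"
    by (simp add: h_def fun_eq_iff matrix_transpose_mul)
  then have "casimir (\<lambda>A. f (Q ** A)) A = casimir (\<lambda>B. h (B ** transpose Q)) (transpose A)"
    using casimir_transpose[of "\<lambda>B. h (B ** transpose Q)" A] by simp
  also have "\<dots> = casimir h (transpose A ** transpose Q)"
    by (rule casimir_compose_mult_right[OF \<open>matpoly h\<close>])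
  also have "\<dots> = casimir h (transpose (Q ** A))" by (simp add: matrix_transpose_mul)
  also have "\<dots> = casimir f (Q ** A)"
    using casimir_transpose[of f "transpose (Q ** A)"] by (simp add: h_def[abs_def])
  finally show ?thesis .
qed

lemma continuous_on_diag_mat: "continuous_on UNIV (diag_mat :: ('n::finite \<Rightarrow> complex) \<Rightarrow> _)"
proof -
  have "continuous_on UNIV (\<lambda>a. if i = j then a i else (0::complex))" for i j :: 'n
    by (cases "i = j") (auto intro: continuous_on_product_coordinates)
  then show ?thesis unfolding diag_mat_def by (intro continuous_on_vec_lambda)
qed

text \<open>A is diagonalised by the spectral theorem, and invariance under both multiplications
  moves the operator to the diagonal matrix. Coinciding eigenvalues are reached by density.\<close>

lemma casimir_schur_mat:
  assumes A: "A \<in> unitary_group"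
  shows "casimir (schur_mat s) A = casimir_eigenvalue s * schur_mat s A"
proof -
  obtain Q a where Q: "Q \<in> unitary_group" "\<forall>i. a i \<in> circle" "A = Q ** diag_mat a ** dagger Q"
    using unitary_spectral_theorem[OF A] by blast
  have inv: "dagger Q ** Q = mat 1" "Q ** dagger Q = mat 1" using Q(1) by (auto simp: unitary_group_def)
  note mp = matpoly_schur_mat[of s]
  have cl: "schur_mat s (Q ** B ** dagger Q) = schur_mat s B" for B
    using class_function_schur_mat inv(2) unfolding class_function_def by blast
  have "casimir (schur_mat s) (diag_mat a) = casimir_eigenvalue s * schur_mat s (diag_mat a)"
  proof (rule torus_dense[of "\<lambda>a. casimir (schur_mat s) (diag_mat a)" "\<lambda>a. casimir_eigenvalue s * schur_mat s (diag_mat a)"])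
    show "continuous_on UNIV (\<lambda>a. casimir (schur_mat s) (diag_mat a))"
      by (rule continuous_on_compose2[OF continuous_on_matpoly[OF matpoly_casimir[OF mp]] continuous_on_diag_mat]) auto
    show "continuous_on UNIV (\<lambda>a. casimir_eigenvalue s * schur_mat s (diag_mat a))"
      by (intro continuous_intros continuous_on_compose2[OF continuous_on_matpoly[OF mp] continuous_on_diag_mat]) auto
    show "a \<in> space torus_haar" using Q(2) by (intro mem_torusI) auto
  qed (rule casimir_schur_mat_diag)
  moreover have "casimir (schur_mat s) A = casimir (schur_mat s) (diag_mat a)"
  proof -
    have "casimir (schur_mat s) A = casimir (\<lambda>B. schur_mat s (B ** dagger Q)) (Q ** diag_mat a)"
      unfolding Q(3) by (rule casimir_compose_mult_right[OF mp, symmetric])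
    also have "\<dots> = casimir (\<lambda>B. schur_mat s (Q ** B ** dagger Q)) (diag_mat a)"
      using casimir_compose_mult_left[OF matpoly_compose_mult_right[OF mp, of "dagger Q"], of Q "diag_mat a"] by simp
    finally show ?thesis by (simp add: cl)
  qed
  ultimately show ?thesis by (simp add: Q(3) cl)
qed

text \<open>Separating A from Q in finitely many products allows a linear functional to be applied
  in Q term by term. The result is again a polynomial in A and can be differentiated without
  interchanging limits.\<close>

lemma matpoly_mult_decompose:
  assumes "matpoly f"
  shows "\<exists>ps. (\<forall>(p, q)\<in>set ps. matpoly p \<and> matpoly q) \<and> (\<forall>A Q. f (A ** Q) = (\<Sum>(p, q)\<leftarrow>ps. p A * q Q))"
  using assms
proof induction
  case (matpoly_const c)
  show ?case by (intro exI[of _ "[(\<lambda>_. c, \<lambda>_. 1)]"]) (auto intro: matpoly_intros)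
next
  case (matpoly_entry i j)
  obtain ms where ms: "set ms = (UNIV :: 'a set)" "distinct ms"
    using finite_distinct_list[of "UNIV :: 'a set"] by auto
  show ?case
  proof (intro exI[of _ "map (\<lambda>m. (\<lambda>A. A $ i $ m, \<lambda>Q. Q $ m $ j)) ms"] conjI allI)
    fix A Q :: "'a cmat"
    have "(A ** Q) $ i $ j = (\<Sum>m\<leftarrow>ms. A $ i $ m * Q $ m $ j)"
      by (simp add: matrix_matrix_mult_def sum_list_distinct_conv_sum_set ms)
    then show "(A ** Q) $ i $ j = (\<Sum>(p, q)\<leftarrow>map (\<lambda>m. (\<lambda>A. A $ i $ m, \<lambda>Q. Q $ m $ j)) ms. p A * q Q)"
      by (simp add: comp_def)
  qed (auto intro: matpoly_intros)
next
  case (matpoly_add f g)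
  then obtain ps qs where
    "\<forall>(p, q)\<in>set ps. matpoly p \<and> matpoly q" "\<forall>A Q. f (A ** Q) = (\<Sum>(p, q)\<leftarrow>ps. p A * q Q)"
    "\<forall>(p, q)\<in>set qs. matpoly p \<and> matpoly q" "\<forall>A Q. g (A ** Q) = (\<Sum>(p, q)\<leftarrow>qs. p A * q Q)" by blast
  then show ?case by (intro exI[of _ "ps @ qs"]) auto
next
  case (matpoly_mult f g)
  then obtain ps qs where
    P: "\<forall>(p, q)\<in>set ps. matpoly p \<and> matpoly q" "\<forall>A Q. f (A ** Q) = (\<Sum>(p, q)\<leftarrow>ps. p A * q Q)" and
    Q: "\<forall>(p, q)\<in>set qs. matpoly p \<and> matpoly q" "\<forall>A Q. g (A ** Q) = (\<Sum>(p, q)\<leftarrow>qs. p A * q Q)" by blast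
  let ?m = "\<lambda>(p, q) (p', q'). (\<lambda>A. p A * p' A, \<lambda>Q. q Q * q' Q)"
  let ?rs = "concat (map (\<lambda>x. map (?m x) qs) ps)"
  have "(\<Sum>(p, q)\<leftarrow>map (?m x) qs. p A * q Q) = (case x of (p, q) \<Rightarrow> p A * q Q) * (\<Sum>(p, q)\<leftarrow>qs. p A * q Q)" for x A Q
    by (induction qs) (auto simp: algebra_simps split: prod.splits)
  then have "(\<Sum>(p, q)\<leftarrow>?rs. p A * q Q) = (\<Sum>(p, q)\<leftarrow>ps. p A * q Q) * (\<Sum>(p, q)\<leftarrow>qs. p A * q Q)" for A Q
    by (induction ps) (auto simp: algebra_simps)
  moreover have "\<forall>(p, q)\<in>set ?rs. matpoly p \<and> matpoly q"
    using P(1) Q(1) by (fastforce intro: matpoly_intros)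
  ultimately show ?case using P(2) Q(2) by (intro exI[of _ ?rs]) simp
qed

text \<open>The properties of f -> E [cnj (det U)^k f(U)] on which the functional equation rests.
  Evaluation at the identity matrix is another instance, so both are treated at once.\<close>

definition conj_invariant_functional :: "(('n::finite cmat \<Rightarrow> complex) \<Rightarrow> complex) \<Rightarrow> bool" where
  "conj_invariant_functional L \<longleftrightarrow>
     (\<forall>f g. matpoly f \<longrightarrow> matpoly g \<longrightarrow> L (\<lambda>A. f A + g A) = L f + L g) \<and>
     (\<forall>c f. matpoly f \<longrightarrow> L (\<lambda>A. c * f A) = c * L f) \<and>
     (\<forall>f g. matpoly f \<longrightarrow> matpoly g \<longrightarrow> (\<forall>A\<in>unitary_group. f A = g A) \<longrightarrow> L f = L g) \<and>
     (\<forall>V\<in>unitary_group. \<forall>f. matpoly f \<longrightarrow> L (\<lambda>A. f (V ** A ** dagger V)) = L f)"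

context
  fixes L :: "('n::finite cmat \<Rightarrow> complex) \<Rightarrow> complex"
  assumes L: "conj_invariant_functional L"
begin

lemma functional_add: "matpoly f \<Longrightarrow> matpoly g \<Longrightarrow> L (\<lambda>A. f A + g A) = L f + L g"
  and functional_cmult: "matpoly f \<Longrightarrow> L (\<lambda>A. c * f A) = c * L f"
  and functional_cong: "matpoly f \<Longrightarrow> matpoly g \<Longrightarrow> (\<And>A. A \<in> unitary_group \<Longrightarrow> f A = g A) \<Longrightarrow> L f = L g"
  and functional_conj: "V \<in> unitary_group \<Longrightarrow> matpoly f \<Longrightarrow> L (\<lambda>A. f (V ** A ** dagger V)) = L f"
  using L unfolding conj_invariant_functional_def by blast+

lemma functional_0: "L (\<lambda>_. 0) = 0"
  using functional_cmult[OF matpoly_const, of 0 0] by simp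

lemma functional_sum:
  "(\<And>i. i \<in> I \<Longrightarrow> matpoly (f i)) \<Longrightarrow> L (\<lambda>A. \<Sum>i\<in>I. f i A) = (\<Sum>i\<in>I. L (f i))"
  by (induction I rule: infinite_finite_induct) (auto simp: functional_0 functional_add matpoly_sum)

lemma functional_sum_list:
  assumes "\<forall>(p, q)\<in>set ps. matpoly p \<and> matpoly q"
  shows "L (\<lambda>Q. \<Sum>(p, q)\<leftarrow>ps. c p * q Q) = (\<Sum>(p, q)\<leftarrow>ps. c p * L q)"
    and "matpoly (\<lambda>Q. \<Sum>(p, q)\<leftarrow>ps. c p * q Q)"
proof -
  have "L (\<lambda>Q. \<Sum>(p, q)\<leftarrow>ps. c p * q Q) = (\<Sum>(p, q)\<leftarrow>ps. c p * L q) \<and> matpoly (\<lambda>Q. \<Sum>(p, q)\<leftarrow>ps. c p * q Q)"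
    using assms
    by (induction ps)
      (auto simp: functional_0 functional_add functional_cmult matpoly_mult matpoly_const
        split: prod.splits intro!: matpoly_intros)
  then show "L (\<lambda>Q. \<Sum>(p, q)\<leftarrow>ps. c p * q Q) = (\<Sum>(p, q)\<leftarrow>ps. c p * L q)"
    "matpoly (\<lambda>Q. \<Sum>(p, q)\<leftarrow>ps. c p * q Q)" by auto
qed

lemma casimir_sum_list:
  assumes "\<forall>(p, q)\<in>set ps. matpoly p \<and> matpoly (q :: 'n cmat \<Rightarrow> complex)"
  shows "casimir (\<lambda>A. \<Sum>(p, q)\<leftarrow>ps. p A * c q) A = (\<Sum>(p, q)\<leftarrow>ps. casimir p A * c q)"
    and "matpoly (\<lambda>A. \<Sum>(p, q)\<leftarrow>ps. p A * c q)"
proof -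
  have "casimir (\<lambda>A. \<Sum>(p, q)\<leftarrow>ps. p A * c q) A = (\<Sum>(p, q)\<leftarrow>ps. casimir p A * c q) \<and> matpoly (\<lambda>A. \<Sum>(p, q)\<leftarrow>ps. p A * c q)"
    using assms
  proof (induction ps)
    case Nil
    then show ?case using casimir_cmult[OF matpoly_const, of 0 0 A] by (auto intro: matpoly_intros)
  next
    case (Cons x ps)
    obtain p q where x: "x = (p, q)" by (cases x)
    with Cons show ?case
      by (auto simp: casimir_add casimir_cmult matpoly_intros mult.commute[of _ "c q"])
  qed
  then show "casimir (\<lambda>A. \<Sum>(p, q)\<leftarrow>ps. p A * c q) A = (\<Sum>(p, q)\<leftarrow>ps. casimir p A * c q)"
    "matpoly (\<lambda>A. \<Sum>(p, q)\<leftarrow>ps. p A * c q)" by auto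
qed

definition average :: "('n cmat \<Rightarrow> complex) \<Rightarrow> 'n cmat \<Rightarrow> complex" where
  "average f A = L (\<lambda>Q. f (A ** Q))"

lemma
  assumes "matpoly f"
  shows matpoly_average: "matpoly (average f)"
    and casimir_average: "casimir (average f) A = average (casimir f) A"
proof -
  obtain ps where ps: "\<forall>(p, q)\<in>set ps. matpoly p \<and> matpoly q" "\<forall>A Q. f (A ** Q) = (\<Sum>(p, q)\<leftarrow>ps. p A * q Q)"
    using matpoly_mult_decompose[OF assms] by blast
  have av: "average f = (\<lambda>A. \<Sum>(p, q)\<leftarrow>ps. p A * L q)"
  proof
    fix A
    show "average f A = (\<Sum>(p, q)\<leftarrow>ps. p A * L q)"
      unfolding average_def ps(2)[rule_format]
      by (rule functional_sum_list(1)[OF ps(1), where c = "\<lambda>p. p A"])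
  qed
  then show "matpoly (average f)" using casimir_sum_list(2)[OF ps(1)] by simp
  have "casimir (average f) A = (\<Sum>(p, q)\<leftarrow>ps. casimir p A * L q)"
    unfolding av by (rule casimir_sum_list(1)[OF ps(1)])
  also have "\<dots> = L (\<lambda>Q. \<Sum>(p, q)\<leftarrow>ps. casimir p A * q Q)"
    by (rule functional_sum_list(1)[OF ps(1), where c = "\<lambda>p. casimir p A", symmetric])
  also have "(\<lambda>Q. \<Sum>(p, q)\<leftarrow>ps. casimir p A * q Q) = (\<lambda>Q. casimir (\<lambda>B. f (B ** Q)) A)"
    unfolding ps(2)[rule_format] using casimir_sum_list(1)[OF ps(1)] by (auto simp: fun_eq_iff)
  also have "\<dots> = (\<lambda>Q. casimir f (A ** Q))" by (rule ext) (rule casimir_compose_mult_right[OF assms])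
  finally show "casimir (average f) A = average (casimir f) A"
    unfolding average_def[of "casimir f" A] .
qed

text \<open>A class function lets the conjugation pass from A to the averaged matrix, where the
  functional absorbs it.\<close>

lemma average_conj:
  assumes f: "matpoly f" "class_function f" and V: "V \<in> unitary_group"
  shows "average f (V ** A ** dagger V) = average f A"
proof -
  have inv: "dagger V ** V = mat 1" "V ** dagger V = mat 1" using V by (auto simp: unitary_group_def)
  have "f (V ** A ** dagger V ** Q) = f (A ** (dagger V ** Q ** V))" for Q
  proof -
    have "V ** A ** dagger V ** Q = V ** (A ** (dagger V ** Q ** V)) ** dagger V"
      by (simp add: matrix_mul_assoc[symmetric] inv)
    then show ?thesis using f(2) inv(2) unfolding class_function_def by metis
  qed
  then have "average f (V ** A ** dagger V) = L (\<lambda>Q. f (A ** (dagger V ** Q ** dagger (dagger V))))"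
    by (simp add: average_def)
  also have "\<dots> = average f A"
    unfolding average_def
    by (rule functional_conj[OF unitary_dagger[OF V] matpoly_compose_mult_left[OF f(1)]])
  finally show ?thesis .
qed

end

lemma permutation_matrix:
  assumes "q permutes UNIV"
  shows "\<exists>V\<in>unitary_group. \<forall>a. diag_mat (a \<circ> q) = V ** diag_mat a ** dagger V"
proof -
  define V :: "'a cmat" where "V = (\<chi> i k. if k = q i then 1 else 0)"
  have V: "V $ i $ k = (if k = q i then 1 else 0)" "dagger V $ k $ i = (if k = q i then 1 else 0)" for i k
    by (auto simp: V_def dagger_def)
  have qi: "q i = q j \<longleftrightarrow> i = j" for i j using assms by (metis permutes_def)
  have "V ** dagger V = mat 1"
    by (simp add: matrix_matrix_mult_def V vec_eq_iff mat_def qi)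
  then have "V \<in> unitary_group" by (simp add: unitary_group_def matrix_left_right_inverse)
  moreover have "diag_mat (a \<circ> q) = V ** diag_mat a ** dagger V" for a
  proof -
    have "(V ** diag_mat a) $ i $ j = (if j = q i then a j else 0)" for i j
      by (simp add: matrix_matrix_mult_def V diag_mat_def)
    then show ?thesis by (auto simp: matrix_matrix_mult_def V vec_eq_iff diag_mat_def qi)
  qed
  ultimately show ?thesis by blast
qed

text \<open>The product of the operators \<open>casimir\<close> - c over the list; it annihilates
  every eigenfunction whose eigenvalue is listed.\<close>

fun casimir_poly :: "complex list \<Rightarrow> ('n::finite cmat \<Rightarrow> complex) \<Rightarrow> 'n cmat \<Rightarrow> complex" where
  "casimir_poly [] f = f"
| "casimir_poly (c # cs) f = casimir_poly cs (\<lambda>A. casimir f A + - c * f A)"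

lemma matpoly_casimir_poly: "matpoly f \<Longrightarrow> matpoly (casimir_poly cs f)"
proof (induction cs arbitrary: f)
  case (Cons c cs)
  have "matpoly (\<lambda>A. casimir f A + - c * f A)"
    by (rule matpoly_add[OF matpoly_casimir[OF Cons.prems] matpoly_mult[OF matpoly_const Cons.prems]])
  from Cons.IH[OF this] show ?case by simp
qed simp

lemma casimir_poly_schur_sum:
  assumes "finite X" "matpoly f"
    and "\<And>A. A \<in> unitary_group \<Longrightarrow> f A = (\<Sum>I\<in>X. u I * schur_mat (\<sigma> I) A)" and "A \<in> unitary_group"
  shows "casimir_poly cs f A = (\<Sum>I\<in>X. u I * (\<Prod>c\<leftarrow>cs. casimir_eigenvalue (\<sigma> I) - c) * schur_mat (\<sigma> I) A)"
  using assms
proof (induction cs arbitrary: f u)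
  case (Cons c cs)
  let ?g = "\<lambda>A. casimir f A + - c * f A"
  have g: "?g B = (\<Sum>I\<in>X. u I * (casimir_eigenvalue (\<sigma> I) - c) * schur_mat (\<sigma> I) B)" if B: "B \<in> unitary_group" for B
  proof -
    have "casimir f B = casimir (\<lambda>A. \<Sum>I\<in>X. u I * schur_mat (\<sigma> I) A) B"
      by (rule casimir_cong_unitary) (use Cons.prems B in \<open>auto intro!: matpoly_intros matpoly_schur_mat\<close>)
    also have "\<dots> = (\<Sum>I\<in>X. u I * (casimir_eigenvalue (\<sigma> I) * schur_mat (\<sigma> I) B))"
      by (simp add: casimir_sum casimir_cmult matpoly_intros matpoly_schur_mat casimir_schur_mat[OF B])
    finally show ?thesis
      by (simp add: Cons.prems(3)[OF B] sum_distrib_left sum.distrib[symmetric] sum_subtractf[symmetric] algebra_simps)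
  qed
  have "casimir_poly cs ?g A = (\<Sum>I\<in>X. u I * (casimir_eigenvalue (\<sigma> I) - c) *
      (\<Prod>c\<leftarrow>cs. casimir_eigenvalue (\<sigma> I) - c) * schur_mat (\<sigma> I) A)"
    by (rule Cons.IH[OF Cons.prems(1) _ g Cons.prems(4)])
      (auto intro!: matpoly_intros matpoly_casimir Cons.prems)
  then show ?case by (simp add: mult.assoc)
qed auto

lemma average_casimir_poly:
  assumes "conj_invariant_functional L" "matpoly f"
  shows "average L (casimir_poly cs f) A = casimir_poly cs (average L f) A"
  using assms(2)
proof (induction cs arbitrary: f)
  case (Cons c cs)
  have "average L (\<lambda>A. casimir f A + - c * f A) = (\<lambda>A. casimir (average L f) A + - c * average L f A)"
  proof
    fix A
    have "average L (\<lambda>A. casimir f A + - c * f A) A = average L (casimir f) A + - c * average L f A"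
      unfolding average_def[OF assms(1)]
      using functional_add[OF assms(1) matpoly_compose_mult_left[OF matpoly_casimir[OF Cons.prems], of A]
          matpoly_compose_mult_left[OF matpoly_mult[OF matpoly_const[of "- c"] Cons.prems], of A]]
        functional_cmult[OF assms(1) matpoly_compose_mult_left[OF Cons.prems, of A], of "- c"] by simp
    then show "average L (\<lambda>A. casimir f A + - c * f A) A = casimir (average L f) A + - c * average L f A"
      by (simp add: casimir_average[OF assms(1) Cons.prems])
  qed
  then show ?case using Cons.IH[of "\<lambda>A. casimir f A + - c * f A"] Cons.prems
    by (simp add: matpoly_intros matpoly_casimir)
qed simp

section \<open>Exponents in products of elementary symmetric functions\<close>

lemma prod_prod_pow:
  fixes a :: "'n::finite \<Rightarrow> complex"
  shows "(\<Prod>j<(m::nat). \<Prod>i\<in>I j. a i) = (\<Prod>i\<in>UNIV. a i ^ card {j. j < m \<and> i \<in> I j})"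
proof -
  have "(\<Prod>j<m. \<Prod>i\<in>I j. a i) = (\<Prod>j<m. \<Prod>i\<in>UNIV. if i \<in> I j then a i else 1)"
    by (simp add: prod.If_cases)
  also have "\<dots> = (\<Prod>i\<in>UNIV. \<Prod>j<m. if i \<in> I j then a i else 1)" by (rule prod.swap)
  finally have *: "(\<Prod>j<m. \<Prod>i\<in>I j. a i) = (\<Prod>i\<in>UNIV. \<Prod>j<m. if i \<in> I j then a i else 1)" .
  have "(\<Prod>j<m. if i \<in> I j then a i else 1) = a i ^ card {j. j < m \<and> i \<in> I j}" for i
  proof -
    have "(\<Prod>j<m. if i \<in> I j then a i else 1) = (\<Prod>j\<in>{j \<in> {..<m}. i \<in> I j}. a i)"
      by (rule prod.inter_filter[symmetric]) simp
    then show ?thesis by simp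
  qed
  then show ?thesis unfolding * by simp
qed

text \<open>Since T is upward closed, every element of I - T lies below the least element of T - I;
  exchanging the two differences, which have equal size, increases the sum of positions.\<close>

lemma sum_pos_upward_closed:
  fixes I T :: "'n::{finite,linorder} set"
  assumes up: "\<And>b c. b \<in> T \<Longrightarrow> b \<le> c \<Longrightarrow> c \<in> T" and card: "card I = card T"
  shows "(\<Sum>b\<in>I. pos b) \<le> (\<Sum>b\<in>T. pos b)" "I \<noteq> T \<Longrightarrow> (\<Sum>b\<in>I. pos b) < (\<Sum>b\<in>T. pos b)"
proof -
  show *: "(\<Sum>b\<in>I. pos b) < (\<Sum>b\<in>T. pos b)" if ne: "I \<noteq> T"
  proof -
    have "card I = card (I \<inter> T) + card (I - T)" "card T = card (I \<inter> T) + card (T - I)"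
      by (metis card_Int_Diff finite_code Int_commute)+
    then have c: "card (I - T) = card (T - I)" using card by linarith
    have "I - T \<noteq> {}"
    proof
      assume "I - T = {}"
      then have "I \<subseteq> T" by auto
      then show False using ne card by (metis card_subset_eq finite_code)
    qed
    then have "T - I \<noteq> {}" using c by (metis card_eq_0_iff finite_code)
    define y where "y = Min (T - I)"
    have y: "y \<in> T - I" "\<And>b. b \<in> T - I \<Longrightarrow> y \<le> b"
      using \<open>T - I \<noteq> {}\<close> unfolding y_def by (auto intro: Min_in Min_le simp del: Diff_iff)
    have "(\<Sum>b\<in>I - T. pos b) < (\<Sum>b\<in>I - T. pos y)"
      by (rule sum_strict_mono) (use \<open>I - T \<noteq> {}\<close> up y in \<open>auto simp: not_le[symmetric]\<close>)
    also have "\<dots> = (\<Sum>b\<in>T - I. pos y)" by (simp add: c)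
    also have "\<dots> \<le> (\<Sum>b\<in>T - I. pos b)" by (rule sum_mono) (use y in auto)
    finally have "(\<Sum>b\<in>I - T. pos b) < (\<Sum>b\<in>T - I. pos b)" .
    moreover have "(\<Sum>b\<in>I. pos b) = (\<Sum>b\<in>I \<inter> T. pos b) + (\<Sum>b\<in>I - T. pos b)"
      "(\<Sum>b\<in>T. pos b) = (\<Sum>b\<in>I \<inter> T. pos b) + (\<Sum>b\<in>T - I. pos b)"
      by (metis sum.Int_Diff finite_code Int_commute)+
    ultimately show ?thesis by linarith
  qed
  show "(\<Sum>b\<in>I. pos b) \<le> (\<Sum>b\<in>T. pos b)"
    using * by (cases "I = T") auto
qed

text \<open>A strictly increasing \<open>s\<close> maps an interval of indices injectively into an
  interval of values, so it grows at least as fast as \<open>pos\<close>. Hence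
  \<open>s b - pos b\<close> are the parts of a partition.\<close>

lemma strict_mono_pos_diff:
  fixes s :: "'n::{finite,linorder} \<Rightarrow> nat"
  assumes s: "strict_mono s"
  shows "pos b \<le> s b" "b \<le> c \<Longrightarrow> s b - pos b \<le> s c - pos c"
proof -
  have card_le: "card A \<le> v - u" if "s ` A \<subseteq> {u..<v}" for A u v
    using card_mono[OF _ that] inj_on_subset[OF strict_mono_imp_inj_on[OF s] subset_UNIV, of A]
    by (simp add: card_image)
  show *: "pos b \<le> s b" for b
  proof -
    have "s ` {a. a < b} \<subseteq> {0..<s b}" by (auto simp: strict_mono_less[OF s])
    from card_le[OF this] show ?thesis by (simp add: pos_def)
  qed
  assume bc: "b \<le> c"
  have "{a. a < c} = {a. a < b} \<union> {a. b \<le> a \<and> a < c}" using bc by auto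
  then have "pos c = pos b + card {a. b \<le> a \<and> a < c}"
    unfolding pos_def by (simp add: card_Un_disjoint disjoint_iff not_le[symmetric])
  moreover have "card {a. b \<le> a \<and> a < c} \<le> s c - s b"
    by (intro card_le) (auto simp: strict_mono_less[OF s] strict_mono_less_eq[OF s])
  moreover have "s b \<le> s c" using bc by (simp add: strict_mono_less_eq[OF s])
  ultimately show "s b - pos b \<le> s c - pos c" using *[of b] *[of c] by linarith
qed

text \<open>The functional equation is first proved for products of elementary symmetric functions, whose
  Schur expansion contains the Schur function of \<open>s\<close> exactly once, all other exponents having
  strictly smaller Casimir eigenvalue.\<close>

context
  fixes s :: "'n::{finite,linorder} \<Rightarrow> nat"
  assumes s: "strict_mono s"
begin

definition part :: "'n \<Rightarrow> nat" where "part b = s b - pos b"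

text \<open>The size of the partition, taken as a convenient bound for its number of columns:
  columns beyond the largest part are empty and contribute the factor \<open>esym 0 A\<close>, which
  is 1.\<close>

definition nparts :: nat where "nparts = (\<Sum>b\<in>UNIV. part b)"

definition topset :: "nat \<Rightarrow> 'n set" where "topset j = {b. j < part b}"

text \<open>Expanding the product of elementary symmetric functions selects, for each column of the
  diagram, a set of indices of the size of that column. \<open>PiE\<close> fixes the values outside
  the range, so that distinct families are distinct selections.\<close>

definition families :: "(nat \<Rightarrow> 'n set) set" where
  "families = PiE {..<nparts} (\<lambda>j. {I. card I = card (topset j)})"

definition top_family :: "nat \<Rightarrow> 'n set" where
  "top_family = (\<lambda>j\<in>{..<nparts}. topset j)"

definition multiplicity_in :: "(nat \<Rightarrow> 'n set) \<Rightarrow> 'n \<Rightarrow> nat" where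
  "multiplicity_in I b = card {j. j < nparts \<and> b \<in> I j}"

definition esym_prod :: "'n cmat \<Rightarrow> complex" where
  "esym_prod A = (\<Prod>j<nparts. esym (card (topset j)) A)"

lemma finite_families: "finite families"
  unfolding families_def by (rule finite_PiE) auto

lemma top_family_in: "top_family \<in> families"
  unfolding top_family_def families_def by (rule restrict_PiE[THEN iffD2]) simp

lemma topset_up: "b \<in> topset j \<Longrightarrow> b \<le> c \<Longrightarrow> c \<in> topset j"
  using strict_mono_pos_diff(2)[OF s, of b c] by (simp add: topset_def part_def)

lemma multiplicity_top: "multiplicity_in top_family b = part b"
proof -
  have "part b \<le> nparts" unfolding nparts_def by (rule member_le_sum) auto
  then have "{j. j < nparts \<and> b \<in> top_family j} = {..<part b}"
    by (auto simp: top_family_def topset_def)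
  then show ?thesis by (simp add: multiplicity_in_def)
qed

lemma sum_multiplicity:
  "(\<Sum>b\<in>UNIV. multiplicity_in I b * g b) = (\<Sum>j<nparts. \<Sum>b\<in>I j. g b)" for g :: "'n \<Rightarrow> nat"
proof -
  have "multiplicity_in I b = (\<Sum>j<nparts. if b \<in> I j then 1 else 0)" for b
    by (simp add: multiplicity_in_def sum.If_cases Int_def)
  then have "(\<Sum>b\<in>UNIV. multiplicity_in I b * g b) = (\<Sum>b\<in>UNIV. \<Sum>j<nparts. if b \<in> I j then g b else 0)"
    by (simp only: sum_distrib_right) (simp add: if_distrib[of "\<lambda>x. x * _"] cong: if_cong)
  also have "\<dots> = (\<Sum>j<nparts. \<Sum>b\<in>UNIV. if b \<in> I j then g b else 0)" by (rule sum.swap)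
  also have "\<dots> = (\<Sum>j<nparts. \<Sum>b\<in>I j. g b)" by (simp add: sum.If_cases)
  finally show ?thesis .
qed

lemma sum_multiplicity_sq:
  "(\<Sum>b\<in>UNIV. multiplicity_in I b * multiplicity_in I b) = (\<Sum>j<nparts. \<Sum>k<nparts. card (I k \<inter> I j))"
proof -
  have "(\<Sum>b\<in>S. multiplicity_in I b) = (\<Sum>k<nparts. card (I k \<inter> S))" for S
  proof -
    have "(\<Sum>b\<in>S. multiplicity_in I b) = (\<Sum>b\<in>UNIV. multiplicity_in I b * (if b \<in> S then 1 else 0))"
      by (simp add: if_distrib[of "\<lambda>x. _ * x"] sum.If_cases cong: if_cong)
    also have "\<dots> = (\<Sum>k<nparts. card (I k \<inter> S))"
      unfolding sum_multiplicity by (simp add: sum.If_cases Int_def)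
    finally show ?thesis .
  qed
  then show ?thesis by (simp add: sum_multiplicity)
qed

text \<open>With m the multiplicities, the sum of squares splits into sums of m^2, 2 m pos and
  pos^2. The first counts the intersections of all pairs of chosen sets and is largest for the
  nested top sets; the second adds up positions and is strictly smaller as soon as one set is not
  the top one.\<close>

lemma
  assumes "I \<in> families"
  shows family_exponent_sum: "(\<Sum>b\<in>UNIV. multiplicity_in I b + pos b) = (\<Sum>b\<in>UNIV. s b)"
    and family_exponent_sq:
      "I \<noteq> top_family \<Longrightarrow> (\<Sum>b\<in>UNIV. (multiplicity_in I b + pos b)\<^sup>2) < (\<Sum>b\<in>UNIV. (s b)\<^sup>2)"
proof -
  have card: "card (I j) = card (topset j)" if "j < nparts" for j
    using assms that by (auto simp: families_def)
  have top: "top_family j = topset j" if "j < nparts" for j using that by (simp add: top_family_def)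
  have sb: "s b = multiplicity_in top_family b + pos b" for b
    using strict_mono_pos_diff(1)[OF s, of b] by (simp add: multiplicity_top part_def)
  have "(\<Sum>b\<in>UNIV. multiplicity_in I b) = (\<Sum>b\<in>UNIV. multiplicity_in top_family b)"
    using sum_multiplicity[of I "\<lambda>_. 1"] sum_multiplicity[of top_family "\<lambda>_. 1"] by (simp add: card top)
  then show "(\<Sum>b\<in>UNIV. multiplicity_in I b + pos b) = (\<Sum>b\<in>UNIV. s b)"
    by (simp add: sb sum.distrib)
  have sq: "(\<Sum>b\<in>UNIV. (multiplicity_in J b + pos b)\<^sup>2)
      = (\<Sum>b\<in>UNIV. multiplicity_in J b * multiplicity_in J b) + 2 * (\<Sum>b\<in>UNIV. multiplicity_in J b * pos b)
        + (\<Sum>b\<in>UNIV. (pos (b::'n))\<^sup>2)" for J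
  proof -
    have "(m + p)\<^sup>2 = m * m + 2 * (m * p) + p\<^sup>2" for m p :: nat
      by (simp add: power2_eq_square algebra_simps)
    then show ?thesis by (simp only: sum.distrib sum_distrib_left[symmetric])
  qed
  assume ne: "I \<noteq> top_family"
  have "(\<Sum>b\<in>UNIV. multiplicity_in I b * multiplicity_in I b)
      \<le> (\<Sum>b\<in>UNIV. multiplicity_in top_family b * multiplicity_in top_family b)"
    unfolding sum_multiplicity_sq
  proof (intro sum_mono)
    fix j k assume "j \<in> {..<nparts}" "k \<in> {..<nparts}"
    then have jk: "j < nparts" "k < nparts" by auto
    have "card (I k \<inter> I j) \<le> card (I k)" "card (I k \<inter> I j) \<le> card (I j)"
      by (auto intro: card_mono)
    moreover have "topset k \<subseteq> topset j \<or> topset j \<subseteq> topset k"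
      by (cases "j \<le> k") (auto simp: topset_def)
    ultimately show "card (I k \<inter> I j) \<le> card (top_family k \<inter> top_family j)"
      using card[OF jk(1)] card[OF jk(2)] by (auto simp: top jk Int_absorb1 Int_absorb2)
  qed
  moreover have "(\<Sum>b\<in>UNIV. multiplicity_in I b * pos b) < (\<Sum>b\<in>UNIV. multiplicity_in top_family b * pos b)"
    unfolding sum_multiplicity
  proof (rule sum_strict_mono_ex1)
    show "\<forall>j\<in>{..<nparts}. sum pos (I j) \<le> sum pos (top_family j)"
      using sum_pos_upward_closed(1)[OF topset_up card] by (auto simp: top)
    have "\<exists>j<nparts. I j \<noteq> top_family j"
    proof (rule ccontr)
      assume "\<not> ?thesis"
      then have "I = top_family"
        using assms top_family_in unfolding families_def by (intro PiE_ext[of I _ _ top_family]) auto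
      with ne show False by simp
    qed
    then obtain j where "j < nparts" "I j \<noteq> top_family j" by blast
    then have "j < nparts" "I j \<noteq> topset j" using top by simp_all
    then have "sum pos (I j) < sum pos (topset j)"
      using sum_pos_upward_closed(2)[of "topset j" "I j"] card topset_up by blast
    then show "\<exists>j\<in>{..<nparts}. sum pos (I j) < sum pos (top_family j)"
      using \<open>j < nparts\<close> by (auto simp: top intro!: bexI[of _ j])
  qed simp
  ultimately have "(\<Sum>b\<in>UNIV. (multiplicity_in I b + pos b)\<^sup>2)
      < (\<Sum>b\<in>UNIV. (multiplicity_in top_family b + pos b)\<^sup>2)"
    unfolding sq by (intro add_strict_right_mono add_le_less_mono mult_strict_left_mono) simp_all
  then show "(\<Sum>b\<in>UNIV. (multiplicity_in I b + pos b)\<^sup>2) < (\<Sum>b\<in>UNIV. (s b)\<^sup>2)"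
    by (simp only: sb[symmetric])
qed

lemma top_exponent: "(\<lambda>b. multiplicity_in top_family b + pos b) = s"
proof
  fix b
  show "multiplicity_in top_family b + pos b = s b"
    using strict_mono_pos_diff(1)[OF s, of b] by (simp add: multiplicity_top part_def)
qed

text \<open>All families share the sum of exponents, so equal eigenvalues would force equal sums of
  squares.\<close>

lemma family_eigenvalue:
  assumes "I \<in> families" "I \<noteq> top_family"
  shows "casimir_eigenvalue (\<lambda>b. multiplicity_in I b + pos b) \<noteq> casimir_eigenvalue s"
proof
  let ?\<sigma> = "\<lambda>b. multiplicity_in I b + pos b"
  have e1: "exponent_sum t = of_nat (\<Sum>b\<in>UNIV. t b)" for t :: "'n \<Rightarrow> nat" by (simp add: exponent_sum_def)
  have e2: "exponent_sum2 t = of_nat (\<Sum>b\<in>UNIV. (t b)\<^sup>2) - exponent_sum t" for t :: "'n \<Rightarrow> nat"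
    by (simp add: exponent_sum_def exponent_sum2_def power2_eq_square algebra_simps sum_subtractf)
  assume "casimir_eigenvalue ?\<sigma> = casimir_eigenvalue s"
  moreover have "exponent_sum ?\<sigma> = exponent_sum s"
    unfolding e1 family_exponent_sum[OF assms(1)] ..
  ultimately have "of_nat (\<Sum>b\<in>UNIV. (?\<sigma> b)\<^sup>2) = (of_nat (\<Sum>b\<in>UNIV. (s b)\<^sup>2) :: complex)"
    by (simp only: casimir_eigenvalue_def e2) (simp del: of_nat_sum of_nat_power)
  then have "(\<Sum>b\<in>UNIV. (?\<sigma> b)\<^sup>2) = (\<Sum>b\<in>UNIV. (s b)\<^sup>2)" by (simp only: of_nat_eq_iff)
  with family_exponent_sq[OF assms] show False by simp
qed

lemma matpoly_esym_prod: "matpoly esym_prod"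
  unfolding esym_prod_def[abs_def] by (intro matpoly_prod matpoly_esym)

lemma class_function_esym_prod: "class_function esym_prod"
  unfolding class_function_def esym_prod_def
proof (intro allI impI prod.cong refl)
  fix A Q R :: "'n cmat" and j
  assume "Q ** R = mat 1"
  then show "esym (card (topset j)) (Q ** A ** R) = esym (card (topset j)) A"
    by (rule esym_conj) (rule card_mono, auto)
qed

lemma esym_prod_diag_mult:
  "esym_prod (diag_mat a ** Q)
    = (\<Sum>I\<in>families. (\<Prod>j<nparts. pminor (I j) Q) * (\<Prod>i\<in>UNIV. a i ^ multiplicity_in I i))"
proof -
  have "esym_prod (diag_mat a ** Q) = (\<Prod>j<nparts. \<Sum>J | card J = card (topset j). (\<Prod>i\<in>J. a i) * pminor J Q)"
    by (simp add: esym_prod_def esym_def pminor_diag_mult)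
  also have "\<dots> = (\<Sum>I\<in>families. \<Prod>j<nparts. (\<Prod>i\<in>I j. a i) * pminor (I j) Q)"
    unfolding families_def by (rule prod_sum_PiE) auto
  finally show ?thesis
    by (simp add: prod.distrib prod_prod_pow multiplicity_in_def mult.commute)
qed

text \<open>At a diagonal matrix the average is a polynomial whose coefficients are averages of
  products of minors. Conjugation by permutation matrices makes it symmetric, so each monomial may
  be replaced by the Schur function with exponents raised by \<open>pos\<close>.\<close>

lemma average_esym_prod:
  assumes L: "conj_invariant_functional L" and A: "A \<in> unitary_group"
  shows "average L esym_prod A = (\<Sum>I\<in>families. L (\<lambda>Q. \<Prod>j<nparts. pminor (I j) Q) *
    schur_mat (\<lambda>i. multiplicity_in I i + pos i) A)"
proof -
  obtain Q a where Q: "Q \<in> unitary_group" "\<forall>i. a i \<in> circle" "A = Q ** diag_mat a ** dagger Q"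
    using unitary_spectral_theorem[OF A] by blast
  define F where "F a = average L esym_prod (diag_mat a)" for a
  have "F a = (\<Sum>I\<in>families. L (\<lambda>Q. \<Prod>j<nparts. pminor (I j) Q) * schur (\<lambda>i. multiplicity_in I i + pos i) a)"
  proof (rule symmetric_eq_schur_sum[OF finite_families])
    fix a :: "'n \<Rightarrow> complex"
    have lc: "L (\<lambda>Q. (\<Prod>j<nparts. pminor (I j) Q) * c) = L (\<lambda>Q. \<Prod>j<nparts. pminor (I j) Q) * c" for c I
      unfolding mult.commute[of _ c]
      by (rule functional_cmult[OF L]) (intro matpoly_intros matpoly_pminor)
    show "F a = (\<Sum>I\<in>families. L (\<lambda>Q. \<Prod>j<nparts. pminor (I j) Q) * (\<Prod>i\<in>UNIV. a i ^ multiplicity_in I i))"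
      unfolding F_def average_def[OF L] esym_prod_diag_mult
      by (subst functional_sum[OF L]) (auto intro!: matpoly_intros matpoly_pminor simp: lc)
    fix q :: "'n \<Rightarrow> 'n" assume "q permutes UNIV"
    from permutation_matrix[OF this] obtain V where
      "V \<in> unitary_group" "diag_mat (a \<circ> q) = V ** diag_mat a ** dagger V" by blast
    then show "F (a \<circ> q) = F a"
      unfolding F_def using average_conj[OF L matpoly_esym_prod class_function_esym_prod] by simp
  next
    show "a \<in> space torus_haar" using Q(2) by (intro mem_torusI) auto
  qed
  moreover have "average L esym_prod A = F a"
    unfolding F_def Q(3) by (rule average_conj[OF L matpoly_esym_prod class_function_esym_prod Q(1)])
  moreover have "schur_mat t A = schur t a" for t
    by (rule schur_mat_spectrum) (rule some_spectrum_diagonalized(2)[OF Q(1,3)])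
  ultimately show ?thesis by simp
qed

text \<open>For this functional the average of \<open>esym_prod\<close> is \<open>esym_prod\<close>
  itself, which yields its own Schur expansion.\<close>

lemma conj_invariant_functional_eval_1: "conj_invariant_functional (\<lambda>f :: 'n cmat \<Rightarrow> complex. f (mat 1))"
  unfolding conj_invariant_functional_def
proof (intro conjI allI impI ballI)
  fix V :: "'n cmat" and f :: "'n cmat \<Rightarrow> complex"
  assume "V \<in> unitary_group"
  then have "V ** mat 1 ** dagger V = mat 1" by (simp add: unitary_group_def)
  then show "f (V ** mat 1 ** dagger V) = f (mat 1)" by simp
qed (use unitary_mat_1 in blast)+

text \<open>A polynomial in the Casimir operator that annihilates the eigenvalues of all other
  families turns \<open>esym_prod\<close> into a nonzero multiple of the Schur function of
  \<open>s\<close>, and its average into a multiple too. As it commutes with averaging, the averaged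
  Schur function is a multiple of the Schur function; A = 1 identifies the factor.\<close>

lemma average_schur_mat_strict_mono:
  assumes L: "conj_invariant_functional L" and A: "A \<in> unitary_group"
  shows "L (\<lambda>Q. schur_mat s (A ** Q)) * schur_mat s (mat 1) = schur_mat s A * L (schur_mat s)"
proof -
  let ?\<sigma> = "\<lambda>I b. multiplicity_in I b + pos b"
  define K where "K = (\<lambda>I. casimir_eigenvalue (?\<sigma> I)) ` (families - {top_family})"
  have "finite K" unfolding K_def using finite_families by auto
  then obtain cs where cs: "set cs = K" using finite_list by blast
  define \<kappa> where "\<kappa> = (\<Prod>c\<leftarrow>cs. casimir_eigenvalue s - c)"
  have \<kappa>: "\<kappa> \<noteq> 0" unfolding \<kappa>_def prod_list_zero_iff
  proof
    assume "0 \<in> set (map ((-) (casimir_eigenvalue s)) cs)"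
    then have "casimir_eigenvalue s \<in> K" by (auto simp: cs)
    then obtain I where I: "casimir_eigenvalue s = casimir_eigenvalue (?\<sigma> I)" "I \<in> families - {top_family}"
      unfolding K_def by (rule imageE)
    then show False using family_eigenvalue[of I] by simp
  qed
  have proj: "casimir_poly cs f B = \<kappa> * u top_family * schur_mat s B"
    if f: "matpoly f" "\<And>A. A \<in> unitary_group \<Longrightarrow> f A = (\<Sum>I\<in>families. u I * schur_mat (?\<sigma> I) A)"
      and B: "B \<in> unitary_group" for f u B
  proof -
    have "casimir_poly cs f B = (\<Sum>I\<in>families. u I * (\<Prod>c\<leftarrow>cs. casimir_eigenvalue (?\<sigma> I) - c) * schur_mat (?\<sigma> I) B)"
      by (rule casimir_poly_schur_sum[OF finite_families f B])
    also have "\<dots> = (\<Sum>I\<in>families. if I = top_family then \<kappa> * u top_family * schur_mat s B else 0)"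
    proof (rule sum.cong[OF refl])
      fix I assume I: "I \<in> families"
      show "u I * (\<Prod>c\<leftarrow>cs. casimir_eigenvalue (?\<sigma> I) - c) * schur_mat (?\<sigma> I) B
        = (if I = top_family then \<kappa> * u top_family * schur_mat s B else 0)"
      proof (cases "I = top_family")
        case True
        then show ?thesis by (simp add: \<kappa>_def top_exponent)
      next
        case False
        then have "casimir_eigenvalue (?\<sigma> I) \<in> set cs" using I by (auto simp: cs K_def)
        then have "(\<Prod>c\<leftarrow>cs. casimir_eigenvalue (?\<sigma> I) - c) = 0"
          unfolding prod_list_zero_iff by (auto simp: image_iff)
        then show ?thesis using False by simp
      qed
    qed
    also have "\<dots> = \<kappa> * u top_family * schur_mat s B"
      using finite_families top_family_in by simp
    finally show ?thesis .
  qed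
  have e: "casimir_poly cs esym_prod B = \<kappa> * schur_mat s B" if B: "B \<in> unitary_group" for B
  proof -
    have "esym_prod B = (\<Sum>I\<in>families. 1 * schur_mat (?\<sigma> I) B)" if "B \<in> unitary_group" for B
      using average_esym_prod[OF conj_invariant_functional_eval_1 that]
      by (simp add: average_def[OF conj_invariant_functional_eval_1] pminor_mat_1)
    from proj[OF matpoly_esym_prod this B] show ?thesis by simp
  qed
  define u where "u = L (\<lambda>Q. \<Prod>j<nparts. pminor (top_family j) Q)"
  have H: "L (\<lambda>Q. schur_mat s (B ** Q)) = u * schur_mat s B" if B: "B \<in> unitary_group" for B
  proof -
    have "\<kappa> * L (\<lambda>Q. schur_mat s (B ** Q)) = L (\<lambda>Q. \<kappa> * schur_mat s (B ** Q))"
      by (rule functional_cmult[OF L matpoly_compose_mult_left[OF matpoly_schur_mat], symmetric])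
    also have "\<dots> = L (\<lambda>Q. casimir_poly cs esym_prod (B ** Q))"
      by (rule functional_cong[OF L])
        (auto simp: e unitary_mult B intro!: matpoly_intros matpoly_compose_mult_left
          matpoly_schur_mat matpoly_casimir_poly matpoly_esym_prod)
    also have "\<dots> = average L (casimir_poly cs esym_prod) B" by (simp add: average_def[OF L])
    also have "\<dots> = casimir_poly cs (average L esym_prod) B"
      by (rule average_casimir_poly[OF L matpoly_esym_prod])
    also have "\<dots> = \<kappa> * u * schur_mat s B"
      unfolding u_def
      by (rule proj[OF matpoly_average[OF L matpoly_esym_prod] average_esym_prod[OF L] B])
    finally show ?thesis using \<kappa> by simp
  qed
  have "L (schur_mat s) = u * schur_mat s (mat 1)" using H[OF unitary_mat_1] by simp
  then show ?thesis by (simp add: H[OF A])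
qed

end

lemma exists_sorting:
  fixes s :: "'n::{finite,linorder} \<Rightarrow> nat"
  assumes "inj s"
  shows "\<exists>q. q permutes UNIV \<and> strict_mono (s \<circ> q)"
proof -
  define r where "r i = card {j. s j < s i}" for i
  have r_less: "r i < r j" if "s i < s j" for i j
    unfolding r_def by (rule psubset_card_mono) (use that in auto)
  have r_iff: "r i < r j \<longleftrightarrow> s i < s j" for i j
    using r_less[of i j] r_less[of j i] assms by (metis injD less_asym' linorder_neqE_nat less_irrefl)
  have "r i < CARD('n)" for i unfolding r_def by (rule psubset_card_mono) auto
  then have "r i \<in> range (pos :: 'n \<Rightarrow> nat)" for i
    using bij_betw_pos[where ?'n = 'n] by (auto simp: bij_betw_def)
  then have pr: "pos (inv_into UNIV (pos :: 'n \<Rightarrow> nat) (r i)) = r i" for i by (simp add: f_inv_into_f)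
  define p where "p i = inv_into UNIV (pos :: 'n \<Rightarrow> nat) (r i)" for i
  have pl: "p i < p j \<longleftrightarrow> s i < s j" for i j
    using r_iff[of i j] unfolding pos_less_iff[symmetric] p_def pr .
  have "inj p"
  proof (rule injI)
    fix i j assume "p i = p j"
    then have "\<not> s i < s j" "\<not> s j < s i" using pl[of i j] pl[of j i] by auto
    then show "i = j" using assms by (metis injD linorder_neqE_nat)
  qed
  then have p: "p permutes UNIV" by (simp add: permutes_def bij_iff[symmetric] bij_def finite_UNIV_inj_surj)
  have "strict_mono (s \<circ> inv p)"
  proof (rule strict_monoI)
    fix i j :: 'n assume "i < j"
    then have "p (inv p i) < p (inv p j)" by (simp add: permutes_inverses[OF p])
    then show "(s \<circ> inv p) i < (s \<circ> inv p) j" by (simp add: pl)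
  qed
  then show ?thesis using permutes_inv[OF p] by blast
qed

text \<open>Sorting injective exponents changes both sides by the square of a sign; for repeated
  exponents both sides vanish.\<close>

theorem average_schur_mat:
  assumes L: "conj_invariant_functional L" and A: "A \<in> unitary_group"
  shows "L (\<lambda>Q. schur_mat s (A ** Q)) * schur_mat s (mat 1) = schur_mat s A * L (schur_mat s)"
proof (cases "inj s")
  case True
  then obtain q where q: "q permutes UNIV" "strict_mono (s \<circ> q)" using exists_sorting by blast
  define c where "c = complex_of_int (sign q)"
  have c: "schur_mat (s \<circ> q) B = c * schur_mat s B" for B
    unfolding c_def schur_mat_def by (rule schur_coeff_permute_exponents[OF q(1)])
  have c0: "c \<noteq> 0" by (simp add: c_def sign_def)
  have "L (schur_mat (s \<circ> q)) = c * L (schur_mat s)"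
    unfolding c[abs_def] by (rule functional_cmult[OF L matpoly_schur_mat])
  moreover have "L (\<lambda>Q. schur_mat (s \<circ> q) (A ** Q)) = c * L (\<lambda>Q. schur_mat s (A ** Q))"
    unfolding c by (rule functional_cmult[OF L matpoly_compose_mult_left[OF matpoly_schur_mat]])
  ultimately have "c * c * (L (\<lambda>Q. schur_mat s (A ** Q)) * schur_mat s (mat 1)) = c * c * (schur_mat s A * L (schur_mat s))"
    using average_schur_mat_strict_mono[OF q(2) L A] by (simp add: c mult_ac)
  then show ?thesis using c0 by simp
next
  case False
  then show ?thesis using functional_0[OF L] by (simp add: schur_mat_def schur_coeff_not_inj)
qed

subsection \<open>Eigenvalue densities from moments of Schur functions\<close>

lemma sum_permutes_compose_left:
  assumes "q permutes (UNIV :: 'n::finite set)"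
  shows "(\<Sum>p | p permutes (UNIV :: 'n set). f (q \<circ> p)) = (\<Sum>p | p permutes (UNIV :: 'n set). f p)"
  by (rule sum.reindex_bij_witness[of _ "\<lambda>p. inv q \<circ> p" "\<lambda>p. q \<circ> p"])
    (use assms in \<open>auto simp: permutes_compose permutes_inv permutes_inv_o o_assoc[symmetric]
      simp flip: comp_assoc\<close>)

section \<open>Measurability and bounds on the unitary group and the torus\<close>

lemma space_unitary_space [simp]: "space unitary_space = unitary_group"
  by (simp add: unitary_space_def space_restrict_space)

lemma measurable_unitary_continuous:
  fixes f :: "'n::finite cmat \<Rightarrow> 'b::topological_space"
  assumes "continuous_on UNIV f"
  shows "f \<in> borel_measurable unitary_space"
  unfolding unitary_space_def
  by (rule measurable_restrict_space1) (rule borel_measurable_continuous_onI[OF assms])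

lemma continuous_on_det_mat: "continuous_on UNIV (det :: 'n::finite cmat \<Rightarrow> complex)"
proof -
  have "continuous_on UNIV (\<lambda>A :: 'n cmat. det (\<chi> i j. A $ i $ j))"
    by (intro continuous_on_det continuous_intros)
  then show ?thesis by simp
qed

lemma unitary_entry_bound:
  assumes "A \<in> unitary_group"
  shows "cmod (A $ i $ j) \<le> 1"
proof -
  have "(A ** dagger A) $ i $ i = 1" using assms by (simp add: unitary_group_def mat_def)
  then have "of_real (\<Sum>k\<in>UNIV. (cmod (A $ i $ k))\<^sup>2) = (1 :: complex)"
    by (simp add: matrix_matrix_mult_def dagger_def complex_norm_square del: of_real_power)
  then have 1: "(\<Sum>k\<in>UNIV. (cmod (A $ i $ k))\<^sup>2) = 1" using of_real_eq_1_iff by blast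
  have "(cmod (A $ i $ j))\<^sup>2 \<le> (\<Sum>k\<in>UNIV. (cmod (A $ i $ k))\<^sup>2)"
    by (rule member_le_sum) auto
  then show ?thesis unfolding 1 using power2_le_imp_le[of "cmod (A $ i $ j)" 1] by simp
qed

lemma matpoly_bounded:
  assumes "matpoly f"
  shows "\<exists>B. \<forall>A\<in>unitary_group. cmod (f A) \<le> B"
  using assms
proof induction
  case (matpoly_add f g)
  then obtain B C where "\<forall>A\<in>unitary_group. cmod (f A) \<le> B" "\<forall>A\<in>unitary_group. cmod (g A) \<le> C" by blast
  then show ?case by (intro exI[of _ "B + C"]) (auto intro: norm_triangle_le add_mono)
next
  case (matpoly_mult f g)
  then obtain B C where "\<forall>A\<in>unitary_group. cmod (f A) \<le> B" "\<forall>A\<in>unitary_group. cmod (g A) \<le> C" by blast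
  then show ?case by (intro exI[of _ "B * C"]) (auto simp: norm_mult intro!: mult_mono intro: order_trans[OF norm_ge_zero])
qed (auto intro: unitary_entry_bound)

lemma unitary_det_norm:
  assumes "A \<in> unitary_group"
  shows "cmod (det A) = 1"
  using mem_torusD[OF some_spectrum_torus[OF assms]]
  by (simp add: det_spectrum[OF is_spectrum_some_spectrum[OF assms]] flip: prod_norm)

lemma unitary_diag_mat:
  assumes "z \<in> space torus_haar"
  shows "diag_mat z \<in> unitary_group"
proof -
  have "z i * cnj (z i) = 1" for i
    using mem_torusD[OF assms, of i] by (metis complex_norm_square mult_1 norm_one of_real_1 power_one)
  then have "diag_mat z ** dagger (diag_mat z) = mat 1"
    by (auto simp: vec_eq_iff matrix_matrix_mult_def diag_mat_sum mat_def dagger_def) (auto simp: diag_mat_def)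
  then show ?thesis by (simp add: unitary_group_def matrix_left_right_inverse)
qed

lemma schur_bounded: "\<exists>B. \<forall>z\<in>space torus_haar. cmod (schur s z) \<le> B"
  using matpoly_bounded[OF matpoly_schur_mat[of s]] unitary_diag_mat
  by (metis schur_mat_spectrum is_spectrum_diag)

lemma borel_measurable_torus_continuous:
  fixes f :: "('n::finite \<Rightarrow> complex) \<Rightarrow> complex"
  assumes "continuous_on UNIV f"
  shows "f \<in> borel_measurable torus_haar"
proof -
  have "(\<lambda>z. z) \<in> measurable (torus_haar :: ('n \<Rightarrow> complex) measure) (PiM UNIV (\<lambda>_. borel))"
    by (rule measurable_PiM_single') (auto simp: space_PiM PiE_UNIV_domain)
  then have "(\<lambda>z. z) \<in> measurable (torus_haar :: ('n \<Rightarrow> complex) measure) borel"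
    by (simp add: measurable_cong_sets[OF refl sets_PiM_equal_borel])
  from measurable_compose[OF this borel_measurable_continuous_onI[OF assms]] show ?thesis by simp
qed

text \<open>On the torus the conjugate of the product of all coordinates is its inverse, so these
  are the Laurent monomials with exponents \<open>s i - k\<close>.\<close>

definition laurent :: "nat \<Rightarrow> ('n::finite \<Rightarrow> nat) \<Rightarrow> ('n \<Rightarrow> complex) \<Rightarrow> complex" where
  "laurent k s z = cnj (\<Prod>i\<in>UNIV. z i) ^ k * (\<Prod>i\<in>UNIV. z i ^ s i)"

text \<open>Summing over all orders removes the dependence on the order chosen by
  \<open>some_spectrum\<close>. The sum is not normalised, whence the factors
  \<open>fact CARD('n)\<close>.\<close>

definition symmetrize :: "(('n::finite \<Rightarrow> complex) \<Rightarrow> 'b::comm_monoid_add) \<Rightarrow> ('n \<Rightarrow> complex) \<Rightarrow> 'b" where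
  "symmetrize h z = (\<Sum>p | p permutes UNIV. h (z \<circ> p))"

lemma symmetrize_laurent:
  fixes z :: "'n::{finite,linorder} \<Rightarrow> complex"
  assumes z: "z \<in> space torus_haar"
  shows "symmetrize (laurent k s) z
    = cnj (\<Prod>i\<in>UNIV. z i) ^ k * (\<Sum>p | p permutes UNIV. schur (\<lambda>i. s (inv p i) + pos i) z)"
proof -
  define F where "F a = (\<Sum>p | p permutes (UNIV :: 'n set). \<Prod>i\<in>UNIV. a (p i) ^ s i)" for a :: "'n \<Rightarrow> complex"
  have "F z = (\<Sum>p | p permutes UNIV. 1 * schur (\<lambda>i. s (inv p i) + pos i) z)"
  proof (rule symmetric_eq_schur_sum[OF _ _ _ z])
    show "finite {p. p permutes (UNIV :: 'n set)}" by (rule finite_permutations) simp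
    fix a :: "'n \<Rightarrow> complex"
    have "(\<Prod>i\<in>UNIV. a (p i) ^ s i) = (\<Prod>i\<in>UNIV. a i ^ s (inv p i))" if "p permutes UNIV" for p
      using prod.permute[OF that, of "\<lambda>i. a i ^ s (inv p i)"] by (simp add: comp_def permutes_inverses[OF that])
    then show "F a = (\<Sum>p | p permutes UNIV. 1 * (\<Prod>i\<in>UNIV. a i ^ s (inv p i)))"
      by (simp add: F_def)
    fix q :: "'n \<Rightarrow> 'n" assume q: "q permutes UNIV"
    show "F (a \<circ> q) = F a"
      using sum_permutes_compose_left[OF q, of "\<lambda>p. \<Prod>i\<in>UNIV. a (p i) ^ s i"] by (simp add: F_def)
  qed
  moreover have "(\<Prod>i\<in>UNIV. z (p i)) = (\<Prod>i\<in>UNIV. z i)" if "p permutes UNIV" for p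
    using prod.permute[OF that, of z] by (simp add: comp_def)
  ultimately show ?thesis by (simp add: symmetrize_def laurent_def F_def flip: sum_distrib_left)
qed

lemma integral_torus_permute:
  fixes f :: "('n::finite \<Rightarrow> complex) \<Rightarrow> complex"
  assumes "f \<in> borel_measurable torus_haar" "p permutes UNIV"
  shows "(\<integral>z. f (z \<circ> p) \<partial>torus_haar) = (\<integral>z. f z \<partial>torus_haar)"
    and "integrable torus_haar f \<Longrightarrow> integrable torus_haar (\<lambda>z. f (z \<circ> p))"
proof -
  show "(\<integral>z. f (z \<circ> p) \<partial>torus_haar) = (\<integral>z. f z \<partial>torus_haar)"
    using integral_distr[OF measurable_torus_permute[of p] assms(1)] torus_haar_permute[OF assms(2)] by simp
  assume "integrable torus_haar f"
  then show "integrable torus_haar (\<lambda>z. f (z \<circ> p))"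
    using integrable_distr_eq[OF measurable_torus_permute[of p] assms(1)] torus_haar_permute[OF assms(2)] by simp
qed

lemma AE_nonneg_of_set_integrals:
  fixes f :: "'a \<Rightarrow> real"
  assumes f: "integrable M f" and pos: "\<And>X. X \<in> sets M \<Longrightarrow> 0 \<le> (\<integral>x. indicator X x * f x \<partial>M)"
  shows "AE x in M. 0 \<le> f x"
proof -
  have [measurable]: "f \<in> borel_measurable M" using f by auto
  let ?X = "{x \<in> space M. f x < 0}"
  have X: "?X \<in> sets M" by measurable
  have i: "integrable M (\<lambda>x. indicator ?X x * f x)"
    using integrable_mult_indicator[OF X f] by simp
  let ?g = "\<lambda>x. - (indicator ?X x * f x)"
  have "0 \<le> (\<integral>x. ?g x \<partial>M)"
    by (rule Bochner_Integration.integral_nonneg) (auto simp: indicator_def)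
  with pos[OF X] have "(\<integral>x. ?g x \<partial>M) = 0" by simp
  moreover have "integrable M ?g" using i by simp
  ultimately have "AE x in M. ?g x = 0"
    by (subst (asm) integral_nonneg_eq_0_iff_AE) (auto simp: indicator_def)
  then show ?thesis
    by (rule AE_mp) (auto simp: indicator_def intro!: AE_I2 split: if_splits)
qed

context
  fixes M :: "'a measure" and U :: "'a \<Rightarrow> 'n::{finite,linorder} cmat"
    and p :: "('n \<Rightarrow> complex) \<Rightarrow> complex"
  assumes M: "prob_space M" and U: "U \<in> measurable M unitary_space"
    and p: "integrable torus_haar p" "symmetric_on_torus p"
    and moments: "\<And>k s. (\<integral>\<xi>. cnj (det (U \<xi>)) ^ k * schur_mat s (U \<xi>) \<partial>M)
      = (\<integral>z. cnj (\<Prod>i\<in>UNIV. z i) ^ k * schur s z * p z \<partial>torus_haar)"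
begin

interpretation M: prob_space M by (rule M)

text \<open>Measurability of the symmetrized function on the unitary group belongs to the property:
  \<open>some_spectrum\<close> is a choice, so measurability cannot be had by composition. It is
  inherited from Laurent monomials through every limit taken below.\<close>

definition spectrally_matched :: "(('n \<Rightarrow> complex) \<Rightarrow> complex) \<Rightarrow> bool" where
  "spectrally_matched h \<longleftrightarrow> h \<in> borel_measurable torus_haar \<and>
     (\<lambda>A. symmetrize h (some_spectrum A)) \<in> borel_measurable unitary_space \<and>
     (\<exists>B. \<forall>z\<in>space torus_haar. cmod (h z) \<le> B) \<and>
     (\<integral>\<xi>. symmetrize h (some_spectrum (U \<xi>)) \<partial>M) = fact CARD('n) * (\<integral>z. h z * p z \<partial>torus_haar)"

lemma U_unitary: "\<xi> \<in> space M \<Longrightarrow> U \<xi> \<in> unitary_group"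
  using measurable_space[OF U] by simp

lemma spectrally_matched_symmetrize_bound:
  fixes A :: "'n cmat"
  assumes "\<forall>z\<in>space torus_haar. cmod (h z) \<le> B" "A \<in> unitary_group"
  shows "cmod (symmetrize h (some_spectrum A)) \<le> fact CARD('n) * B"
proof -
  have "cmod (symmetrize h (some_spectrum A)) \<le> (\<Sum>q | q permutes (UNIV :: 'n set). B)"
    unfolding symmetrize_def
    by (rule sum_norm_le) (use assms in \<open>auto intro: torus_permute some_spectrum_torus\<close>)
  also have "\<dots> = fact CARD('n) * B" by (simp add: card_permutations)
  finally show ?thesis .
qed

lemma integrable_symmetrize:
  assumes "(\<lambda>A. symmetrize h (some_spectrum A)) \<in> borel_measurable unitary_space"
    "\<forall>z\<in>space torus_haar. cmod (h z) \<le> B"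
  shows "integrable M (\<lambda>\<xi>. symmetrize h (some_spectrum (U \<xi>)))"
  by (rule M.integrable_const_bound[where B = "fact CARD('n) * B"])
    (auto intro!: AE_I2 spectrally_matched_symmetrize_bound[OF assms(2)] U_unitary measurable_compose[OF U assms(1)])

lemma integrable_bounded_times_density:
  assumes "h \<in> borel_measurable torus_haar" "\<forall>z\<in>space torus_haar. cmod (h z) \<le> B"
  shows "integrable torus_haar (\<lambda>z. h z * p z)"
proof (rule Bochner_Integration.integrable_bound)
  show "integrable torus_haar (\<lambda>z. of_real B * p z)" using p(1) by simp
  show "(\<lambda>z. h z * p z) \<in> borel_measurable torus_haar" using assms(1) p(1) by (auto intro: borel_measurable_times)
  show "AE z in torus_haar. norm (h z * p z) \<le> norm (of_real B * p z)"
    using assms(2) by (auto simp: norm_mult intro!: AE_I2 mult_right_mono intro: order_trans[OF _ abs_ge_self])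
qed

lemma spectrally_matched_cong:
  assumes "spectrally_matched h" "\<And>z. z \<in> space torus_haar \<Longrightarrow> h z = g z"
  shows "spectrally_matched g"
proof -
  have s: "symmetrize g (some_spectrum A) = symmetrize h (some_spectrum A)" if "A \<in> unitary_group" for A
    unfolding symmetrize_def by (simp add: assms(2) torus_permute some_spectrum_torus that)
  have "g \<in> borel_measurable torus_haar"
    using assms measurable_cong[of torus_haar h g] by (auto simp: spectrally_matched_def)
  moreover have "(\<lambda>A. symmetrize g (some_spectrum A)) \<in> borel_measurable unitary_space"
    using assms(1) by (subst measurable_cong[where g = "\<lambda>A. symmetrize h (some_spectrum A)"]) (auto simp: s spectrally_matched_def)
  moreover have "(\<integral>\<xi>. symmetrize g (some_spectrum (U \<xi>)) \<partial>M) = (\<integral>\<xi>. symmetrize h (some_spectrum (U \<xi>)) \<partial>M)"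
    by (rule Bochner_Integration.integral_cong) (auto simp: s U_unitary)
  moreover have "(\<integral>z. g z * p z \<partial>torus_haar) = (\<integral>z. h z * p z \<partial>torus_haar)"
    by (rule Bochner_Integration.integral_cong) (auto simp: assms(2))
  ultimately show ?thesis using assms by (auto simp: spectrally_matched_def)
qed

lemma spectrally_matched_add:
  assumes "spectrally_matched h" "spectrally_matched g"
  shows "spectrally_matched (\<lambda>z. h z + g z)"
proof -
  obtain B C where B: "\<forall>z\<in>space torus_haar. cmod (h z) \<le> B" and C: "\<forall>z\<in>space torus_haar. cmod (g z) \<le> C"
    using assms by (auto simp: spectrally_matched_def)
  have m: "h \<in> borel_measurable torus_haar" "g \<in> borel_measurable torus_haar"
    "(\<lambda>A. symmetrize h (some_spectrum A)) \<in> borel_measurable unitary_space"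
    "(\<lambda>A. symmetrize g (some_spectrum A)) \<in> borel_measurable unitary_space"
    using assms by (auto simp: spectrally_matched_def)
  have s: "symmetrize (\<lambda>z. h z + g z) z = symmetrize h z + symmetrize g z" for z
    by (simp add: symmetrize_def sum.distrib)
  show ?thesis unfolding spectrally_matched_def s
  proof (intro conjI)
    show "\<exists>B. \<forall>z\<in>space torus_haar. cmod (h z + g z) \<le> B"
      using B C by (intro exI[of _ "B + C"]) (auto intro: norm_triangle_le add_mono)
    show "(\<integral>\<xi>. symmetrize h (some_spectrum (U \<xi>)) + symmetrize g (some_spectrum (U \<xi>)) \<partial>M)
      = fact CARD('n) * (\<integral>z. (h z + g z) * p z \<partial>torus_haar)"
      using assms integrable_symmetrize[OF m(3) B] integrable_symmetrize[OF m(4) C]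
        integrable_bounded_times_density[OF m(1) B] integrable_bounded_times_density[OF m(2) C]
      by (simp add: spectrally_matched_def distrib_left distrib_right)
  qed (use m in auto)
qed

lemma spectrally_matched_cmult:
  assumes "spectrally_matched h"
  shows "spectrally_matched (\<lambda>z. c * h z)"
proof -
  obtain B where B: "\<forall>z\<in>space torus_haar. cmod (h z) \<le> B"
    using assms by (auto simp: spectrally_matched_def)
  have s: "symmetrize (\<lambda>z. c * h z) z = c * symmetrize h z" for z
    by (simp add: symmetrize_def sum_distrib_left)
  show ?thesis unfolding spectrally_matched_def s
  proof (intro conjI)
    show "\<exists>B. \<forall>z\<in>space torus_haar. cmod (c * h z) \<le> B"
      using B by (intro exI[of _ "cmod c * B"]) (auto simp: norm_mult intro: mult_left_mono)
  qed (use assms in \<open>auto simp: spectrally_matched_def mult.assoc\<close>)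
qed

text \<open>Dominated convergence applies on both sides, with a constant bound under M and a
  multiple of |p| on the torus.\<close>

lemma spectrally_matched_limit:
  assumes h: "\<And>n. spectrally_matched (h n)"
    and B: "\<And>n z. z \<in> space torus_haar \<Longrightarrow> cmod (h n z) \<le> B"
    and lim: "\<And>z. z \<in> space torus_haar \<Longrightarrow> (\<lambda>n. h n z) \<longlonglongrightarrow> g z"
  shows "spectrally_matched g"
proof -
  have m [measurable]: "h n \<in> borel_measurable torus_haar"
    "(\<lambda>A. symmetrize (h n) (some_spectrum A)) \<in> borel_measurable unitary_space" for n
    using h[of n] by (auto simp: spectrally_matched_def)
  have g [measurable]: "g \<in> borel_measurable torus_haar"
    by (rule borel_measurable_LIMSEQ_metric[OF m(1) lim])
  have ls: "(\<lambda>n. symmetrize (h n) (some_spectrum A)) \<longlonglongrightarrow> symmetrize g (some_spectrum A)"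
    if "A \<in> unitary_group" for A
    unfolding symmetrize_def
    by (intro tendsto_sum lim torus_permute some_spectrum_torus that)
  have sg: "(\<lambda>A. symmetrize g (some_spectrum A)) \<in> borel_measurable unitary_space"
    by (rule borel_measurable_LIMSEQ_metric[where f = "\<lambda>n A. symmetrize (h n) (some_spectrum A)"])
      (use m(2) ls in auto)
  have gB: "cmod (g z) \<le> B" if "z \<in> space torus_haar" for z
    using tendsto_norm[OF lim[OF that]] by (rule LIMSEQ_le_const2) (use B[OF that] in auto)
  have B0: "0 \<le> B"
    using B[OF mem_torusI[of "\<lambda>_. 1"], of 0] by (simp add: order_trans[OF norm_ge_zero])
  have [measurable]: "p \<in> borel_measurable torus_haar" using p(1) by auto
  have "(\<lambda>n. \<integral>\<xi>. symmetrize (h n) (some_spectrum (U \<xi>)) \<partial>M) \<longlonglongrightarrow> (\<integral>\<xi>. symmetrize g (some_spectrum (U \<xi>)) \<partial>M)"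
  proof (rule integral_dominated_convergence[where w = "\<lambda>_. fact CARD('n) * B"])
    show "AE \<xi> in M. cmod (symmetrize (h n) (some_spectrum (U \<xi>))) \<le> fact CARD('n) * B" for n
      using B by (intro AE_I2 spectrally_matched_symmetrize_bound U_unitary) auto
  qed (auto intro!: measurable_compose[OF U] sg m AE_I2 ls U_unitary)
  moreover have "(\<lambda>n. fact CARD('n) * (\<integral>z. h n z * p z \<partial>torus_haar)) \<longlonglongrightarrow> fact CARD('n) * (\<integral>z. g z * p z \<partial>torus_haar)"
  proof (intro tendsto_mult tendsto_const integral_dominated_convergence[where w = "\<lambda>z. B * cmod (p z)"])
    show "integrable torus_haar (\<lambda>z. B * cmod (p z))" using p(1) by auto
    show "AE z in torus_haar. cmod (h n z * p z) \<le> B * cmod (p z)" for n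
      using B by (intro AE_I2) (auto simp: norm_mult intro!: mult_right_mono)
  qed (auto intro!: AE_I2 tendsto_mult lim)
  ultimately have "(\<integral>\<xi>. symmetrize g (some_spectrum (U \<xi>)) \<partial>M) = fact CARD('n) * (\<integral>z. g z * p z \<partial>torus_haar)"
    using h by (intro LIMSEQ_unique) (auto simp: spectrally_matched_def)
  then show ?thesis using g sg gB by (auto simp: spectrally_matched_def)
qed

text \<open>The place where the assumed moments enter. The symmetrized monomial is a power of the
  conjugate determinant times a sum of Schur functions, and symmetry of p makes all permuted copies
  of the monomial have the same integral.\<close>

lemma spectrally_matched_laurent: "spectrally_matched (laurent k s)"
proof -
  let ?\<sigma> = "\<lambda>q i. s (inv q i) + pos i"
  let ?P = "{q. q permutes (UNIV :: 'n set)}"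
  have s: "symmetrize (laurent k s) (some_spectrum A) = (\<Sum>q\<in>?P. cnj (det A) ^ k * schur_mat (?\<sigma> q) A)"
    if "A \<in> unitary_group" for A
    using is_spectrum_some_spectrum[OF that]
    by (simp add: symmetrize_laurent[OF some_spectrum_torus[OF that]] sum_distrib_left det_spectrum schur_mat_spectrum)
  have m: "(\<lambda>A. cnj (det A) ^ k * schur_mat t A) \<in> borel_measurable unitary_space" for t :: "'n \<Rightarrow> nat"
    by (intro measurable_unitary_continuous continuous_intros continuous_on_det_mat continuous_on_matpoly matpoly_schur_mat)
  have c: "continuous_on UNIV (laurent k s)"
    unfolding laurent_def by (intro continuous_intros continuous_on_product_coordinates)
  have B: "\<forall>z\<in>space torus_haar. cmod (laurent k s z) \<le> 1"
  proof
    fix z :: "'n \<Rightarrow> complex" assume z: "z \<in> space torus_haar"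
    show "cmod (laurent k s z) \<le> 1"
      by (simp add: laurent_def norm_mult norm_power mem_torusD[OF z] flip: prod_norm)
  qed
  have iM: "integrable M (\<lambda>\<xi>. cnj (det (U \<xi>)) ^ k * schur_mat t (U \<xi>))" for t :: "'n \<Rightarrow> nat"
  proof -
    obtain B where "\<forall>A\<in>unitary_group. cmod (schur_mat t A) \<le> B"
      using matpoly_bounded[OF matpoly_schur_mat] by blast
    then show ?thesis
      by (intro M.integrable_const_bound[where B = B] AE_I2 measurable_compose[OF U m])
        (auto simp: norm_mult norm_power unitary_det_norm U_unitary)
  qed
  have it: "integrable torus_haar (\<lambda>z. cnj (\<Prod>i\<in>UNIV. z i) ^ k * schur t z * p z)" for t :: "'n \<Rightarrow> nat"
  proof -
    obtain B where "\<forall>z\<in>space torus_haar. cmod (schur t z) \<le> B" using schur_bounded by blast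
    then show ?thesis
      by (intro integrable_bounded_times_density[where B = B] borel_measurable_torus_continuous
          continuous_intros continuous_on_product_coordinates continuous_on_schur)
        (auto simp: norm_mult norm_power mem_torusD simp flip: prod_norm)
  qed
  have "(\<integral>\<xi>. symmetrize (laurent k s) (some_spectrum (U \<xi>)) \<partial>M)
      = (\<integral>\<xi>. (\<Sum>q\<in>?P. cnj (det (U \<xi>)) ^ k * schur_mat (?\<sigma> q) (U \<xi>)) \<partial>M)"
    by (rule Bochner_Integration.integral_cong) (auto simp: s U_unitary)
  also have "\<dots> = (\<Sum>q\<in>?P. \<integral>z. cnj (\<Prod>i\<in>UNIV. z i) ^ k * schur (?\<sigma> q) z * p z \<partial>torus_haar)"
    by (simp add: iM moments)
  also have "\<dots> = (\<integral>z. (\<Sum>q\<in>?P. cnj (\<Prod>i\<in>UNIV. z i) ^ k * schur (?\<sigma> q) z * p z) \<partial>torus_haar)"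
    by (rule Bochner_Integration.integral_sum[symmetric]) (rule it)
  also have "\<dots> = (\<integral>z. (\<Sum>q\<in>?P. laurent k s (z \<circ> q) * p (z \<circ> q)) \<partial>torus_haar)"
  proof (rule Bochner_Integration.integral_cong[OF refl])
    fix z :: "'n \<Rightarrow> complex" assume z: "z \<in> space torus_haar"
    have "(\<Sum>q\<in>?P. cnj (\<Prod>i\<in>UNIV. z i) ^ k * schur (?\<sigma> q) z * p z) = symmetrize (laurent k s) z * p z"
      by (simp add: symmetrize_laurent[OF z] sum_distrib_left sum_distrib_right)
    also have "\<dots> = (\<Sum>q\<in>?P. laurent k s (z \<circ> q) * p (z \<circ> q))"
      unfolding symmetrize_def sum_distrib_right
      using p(2) z by (intro sum.cong refl) (auto simp: symmetric_on_torus_def permutes_bij)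
    finally show "(\<Sum>q\<in>?P. cnj (\<Prod>i\<in>UNIV. z i) ^ k * schur (?\<sigma> q) z * p z) = (\<Sum>q\<in>?P. laurent k s (z \<circ> q) * p (z \<circ> q))" .
  qed
  also have "\<dots> = (\<Sum>q\<in>?P. \<integral>z. laurent k s z * p z \<partial>torus_haar)"
  proof -
    note i = integrable_bounded_times_density[OF borel_measurable_torus_continuous[OF c] B]
    show ?thesis
      using integral_torus_permute(1)[OF borel_measurable_integrable[OF i]] integral_torus_permute(2)[OF borel_measurable_integrable[OF i] _ i]
      by (subst Bochner_Integration.integral_sum) auto
  qed
  also have "\<dots> = fact CARD('n) * (\<integral>z. laurent k s z * p z \<partial>torus_haar)"
    by (simp add: card_permutations)
  finally have e: "(\<integral>\<xi>. symmetrize (laurent k s) (some_spectrum (U \<xi>)) \<partial>M) = fact CARD('n) * (\<integral>z. laurent k s z * p z \<partial>torus_haar)" .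
  have "(\<lambda>A. symmetrize (laurent k s) (some_spectrum A)) \<in> borel_measurable unitary_space"
    by (subst measurable_cong[where g = "\<lambda>A. \<Sum>q\<in>?P. cnj (det A) ^ k * schur_mat (?\<sigma> q) A"])
      (use m in \<open>auto simp: s intro!: borel_measurable_sum\<close>)
  then show ?thesis using e B borel_measurable_torus_continuous[OF c] by (auto simp: spectrally_matched_def)
qed

section \<open>From Laurent polynomials to Borel sets\<close>

definition laurent_span :: "(('n \<Rightarrow> complex) \<Rightarrow> complex) \<Rightarrow> bool" where
  "laurent_span h \<longleftrightarrow> (\<exists>xs. \<forall>z\<in>space torus_haar. h z = (\<Sum>(c, k, s)\<leftarrow>xs. c * laurent k s z))"

lemma laurent_span_matched:
  assumes "laurent_span h"
  shows "spectrally_matched h"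
proof -
  obtain xs where xs: "\<And>z. z \<in> space torus_haar \<Longrightarrow> h z = (\<Sum>(c, k, s)\<leftarrow>xs. c * laurent k s z)"
    using assms by (auto simp: laurent_span_def)
  have "spectrally_matched (\<lambda>z. 0 * laurent 0 (\<lambda>_. 0) z)"
    by (rule spectrally_matched_cmult[OF spectrally_matched_laurent])
  then have 0: "spectrally_matched (\<lambda>z. 0)" by simp
  have "spectrally_matched (\<lambda>z. \<Sum>(c, k, s)\<leftarrow>xs. c * laurent k s z)"
  proof (induction xs)
    case (Cons x xs)
    obtain c k s where x: "x = (c, k, s)" by (cases x)
    show ?case using spectrally_matched_add[OF spectrally_matched_cmult[OF spectrally_matched_laurent] Cons.IH]
      by (simp add: x)
  qed (use 0 in simp)
  then show ?thesis by (rule spectrally_matched_cong) (simp add: xs)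
qed

lemma laurent_span_add:
  assumes "laurent_span f" "laurent_span g"
  shows "laurent_span (\<lambda>z. f z + g z)"
proof -
  obtain xs ys where "\<forall>z\<in>space torus_haar. f z = (\<Sum>(c, k, s)\<leftarrow>xs. c * laurent k s z)"
    "\<forall>z\<in>space torus_haar. g z = (\<Sum>(c, k, s)\<leftarrow>ys. c * laurent k s z)"
    using assms by (auto simp: laurent_span_def)
  then show ?thesis unfolding laurent_span_def by (intro exI[of _ "xs @ ys"]) simp
qed

lemma laurent_mult: "laurent k s z * laurent l t z = laurent (k + l) (\<lambda>i. s i + t i) z"
  by (simp add: laurent_def power_add prod.distrib mult_ac)

lemma laurent_span_mult:
  assumes "laurent_span f" "laurent_span g"
  shows "laurent_span (\<lambda>z. f z * g z)"
proof -
  obtain xs ys where f: "\<forall>z\<in>space torus_haar. f z = (\<Sum>(c, k, s)\<leftarrow>xs. c * laurent k s z)"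
    and g: "\<forall>z\<in>space torus_haar. g z = (\<Sum>(c, k, s)\<leftarrow>ys. c * laurent k s z)"
    using assms by (auto simp: laurent_span_def)
  let ?m = "\<lambda>(c, k, s) (d, l, t). (c * d, k + l, \<lambda>i. s i + t i)"
  have 1: "(\<Sum>(c, k, s)\<leftarrow>map (?m x) ys. c * laurent k s z)
      = (case x of (c, k, s) \<Rightarrow> c * laurent k s z) * (\<Sum>(c, k, s)\<leftarrow>ys. c * laurent k s z)"
    for x and z :: "'n \<Rightarrow> complex"
    by (induction ys) (auto simp: algebra_simps laurent_mult[symmetric] split: prod.splits)
  have "(\<Sum>(c, k, s)\<leftarrow>concat (map (\<lambda>x. map (?m x) ys) xs). c * laurent k s z)
      = (\<Sum>(c, k, s)\<leftarrow>xs. c * laurent k s z) * (\<Sum>(c, k, s)\<leftarrow>ys. c * laurent k s z)"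
    for z :: "'n \<Rightarrow> complex"
  proof (induction xs)
    case (Cons x xs)
    then show ?case using 1[of z x] by (simp add: distrib_right)
  qed simp
  then show ?thesis using f g unfolding laurent_span_def
    by (intro exI[of _ "concat (map (\<lambda>x. map (?m x) ys) xs)"]) simp
qed

lemma laurent_span_const: "laurent_span (\<lambda>z. c)"
  unfolding laurent_span_def by (intro exI[of _ "[(c, 0, \<lambda>_. 0)]"]) (simp add: laurent_def)

lemma laurent_span_sum: "(\<And>i. i \<in> I \<Longrightarrow> laurent_span (f i)) \<Longrightarrow> laurent_span (\<lambda>z. \<Sum>i\<in>I. f i z)"
  by (induction I rule: infinite_finite_induct) (auto intro: laurent_span_const laurent_span_add)

lemma laurent_span_coordinate: "laurent_span (\<lambda>z. z i)" "laurent_span (\<lambda>z. cnj (z i))"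
proof -
  have pow: "z j ^ (if j = i then 1 else 0) = (if j = i then z j else 1)"
    "z j ^ (if j = i then 0 else 1) = (if j = i then 1 else z j)" for z :: "'n \<Rightarrow> complex" and j
    by auto
  have "laurent 0 (\<lambda>j. if j = i then 1 else 0) z = z i" for z :: "'n \<Rightarrow> complex"
    by (simp add: laurent_def pow)
  then show "laurent_span (\<lambda>z. z i)"
    unfolding laurent_span_def by (intro exI[of _ "[(1, 0, \<lambda>j. if j = i then 1 else 0)]"]) simp
  have "laurent 1 (\<lambda>j. if j = i then 0 else 1) z = cnj (z i)" if z: "z \<in> space torus_haar" for z
  proof -
    have 1: "cnj (z j) * z j = 1" for j
      using mem_torusD[OF z, of j] by (metis complex_norm_square mult.commute mult_1 norm_one of_real_1 power_one)
    have "laurent 1 (\<lambda>j. if j = i then 0 else 1) z = (\<Prod>j\<in>UNIV. cnj (z j) * (if j = i then 1 else z j))"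
      unfolding laurent_def pow prod.distrib by simp
    also have "\<dots> = (\<Prod>j\<in>UNIV. if j = i then cnj (z j) else 1)"
      by (intro prod.cong refl) (simp add: 1)
    finally show ?thesis by simp
  qed
  then show "laurent_span (\<lambda>z. cnj (z i))"
    unfolding laurent_span_def by (intro exI[of _ "[(1, 1, \<lambda>j. if j = i then 0 else 1)]"]) simp
qed

lemma laurent_span_real_polynomial:
  assumes "real_polynomial_function (g :: (complex, 'n) vec \<Rightarrow> real)"
  shows "laurent_span (\<lambda>z. of_real (g (\<chi> i. z i)))"
  using assms
proof induction
  case (linear f)
  interpret f: bounded_linear f by (rule linear)
  have "f (\<chi> i. z i) = (\<Sum>i\<in>UNIV. Re (z i) * f (axis i 1) + Im (z i) * f (axis i \<i>))" for z
  proof -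
    have "(\<chi> i. z i) = (\<Sum>i\<in>UNIV. Re (z i) *\<^sub>R axis i 1 + Im (z i) *\<^sub>R axis i \<i>)"
    proof (subst vec_eq_iff, intro allI)
      fix j
      have "(\<Sum>i\<in>UNIV. Re (z i) *\<^sub>R axis i 1 + Im (z i) *\<^sub>R axis i \<i>) $ j
          = (\<Sum>i\<in>UNIV. if i = j then z j else 0)"
        unfolding sum_component
        by (intro sum.cong refl) (auto simp: axis_def complex_eq_iff)
      then show "(\<chi> i. z i) $ j = (\<Sum>i\<in>UNIV. Re (z i) *\<^sub>R axis i 1 + Im (z i) *\<^sub>R axis i \<i>) $ j"
        by simp
    qed
    then show ?thesis by (simp add: f.sum f.add f.scale)
  qed
  then have eq: "complex_of_real (f (\<chi> i. z i)) = (\<Sum>i\<in>UNIV. (z i + cnj (z i)) * of_real (f (axis i 1) / 2)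
      + (z i + (- 1) * cnj (z i)) * (of_real (f (axis i \<i>)) / (2 * \<i>)))" for z
  proof -
    have "z i + cnj (z i) = of_real (2 * Re (z i))" "z i + (- 1) * cnj (z i) = of_real (2 * Im (z i)) * \<i>" for i
      by (simp_all add: complex_eq_iff)
    then show ?thesis using \<open>f (\<chi> i. z i) = _\<close> by simp
  qed
  show ?case unfolding eq
    by (intro laurent_span_sum laurent_span_add laurent_span_mult laurent_span_const laurent_span_coordinate)
next
  case (const c)
  show ?case by (rule laurent_span_const)
next
  case (add f g)
  then show ?case using laurent_span_add by simp
next
  case (mult f g)
  then show ?case using laurent_span_mult by simp
qed

text \<open>Reading coordinates as a vector places the torus as a compact set in a Euclidean space,
  where real polynomial functions approximate uniformly. These are Laurent polynomials on the torus,
  as real and imaginary parts are combinations of a coordinate and its conjugate.\<close>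

lemma spectrally_matched_continuous:
  fixes g :: "(complex, 'n) vec \<Rightarrow> real"
  assumes g: "continuous_on UNIV g"
  shows "spectrally_matched (\<lambda>z. of_real (g (\<chi> i. z i)))"
proof -
  define T :: "((complex, 'n) vec) set" where "T = {x. \<forall>i. x $ i \<in> circle}"
  have "closed T"
    unfolding T_def by (auto intro!: closed_Collect_all closed_Collect_eq continuous_intros simp: dist_norm)
  moreover have "bounded T"
  proof -
    have "norm x \<le> real CARD('n)" if "x \<in> T" for x
    proof -
      have "norm x \<le> (\<Sum>i\<in>UNIV. norm (x $ i))" by (simp add: norm_vec_def L2_set_le_sum)
      also have "\<dots> = real CARD('n)" using that by (simp add: T_def)
      finally show ?thesis .
    qed
    then show ?thesis by (auto simp: bounded_iff)
  qed
  ultimately have T: "compact T" by (simp add: compact_eq_bounded_closed)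
  have vT: "(\<chi> i. z i) \<in> T" if "z \<in> space torus_haar" for z
    using mem_torusD[OF that] by (simp add: T_def)
  have gT: "continuous_on T g" using g by (rule continuous_on_subset) simp
  have "\<exists>q. real_polynomial_function q \<and> (\<forall>x\<in>T. \<bar>g x - q x\<bar> < inverse (real (Suc n)))" for n
    using Stone_Weierstrass_real_polynomial_function[OF T gT, of "inverse (real (Suc n))"] by (metis inverse_positive_iff_positive of_nat_0_less_iff zero_less_Suc)
  then obtain q where q: "\<And>n. real_polynomial_function (q n)"
    "\<And>n x. x \<in> T \<Longrightarrow> \<bar>g x - q n x\<bar> < inverse (real (Suc n))" by metis
  have "bounded (g ` T)" by (intro compact_imp_bounded compact_continuous_image gT T)
  then obtain B where B: "\<And>x. x \<in> T \<Longrightarrow> \<bar>g x\<bar> \<le> B" by (auto simp: bounded_iff)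
  show ?thesis
  proof (rule spectrally_matched_limit[where h = "\<lambda>n z. of_real (q n (\<chi> i. z i))" and B = "B + 1"])
    fix n show "spectrally_matched (\<lambda>z. of_real (q n (\<chi> i. z i)))"
      by (intro laurent_span_matched laurent_span_real_polynomial q)
  next
    fix n and z :: "'n \<Rightarrow> complex" assume z: "z \<in> space torus_haar"
    have "inverse (real (Suc n)) \<le> 1" by (simp add: inverse_le_1_iff)
    then have "\<bar>q n (\<chi> i. z i)\<bar> \<le> B + 1"
      using q(2)[OF vT[OF z], of n] B[OF vT[OF z]] by linarith
    then show "cmod (of_real (q n (\<chi> i. z i))) \<le> B + 1" by simp
  next
    fix z :: "'n \<Rightarrow> complex" assume z: "z \<in> space torus_haar"
    have "(\<lambda>n. q n (\<chi> i. z i)) \<longlonglongrightarrow> g (\<chi> i. z i)"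
    proof (rule LIMSEQ_I)
      fix e :: real assume "0 < e"
      from LIMSEQ_D[OF LIMSEQ_inverse_real_of_nat this] obtain m
        where m: "\<And>n. n \<ge> m \<Longrightarrow> inverse (real (Suc n)) < e" by auto
      show "\<exists>m. \<forall>n\<ge>m. norm (q n (\<chi> i. z i) - g (\<chi> i. z i)) < e"
      proof (intro exI[of _ m] allI impI)
        fix n assume "n \<ge> m"
        then show "norm (q n (\<chi> i. z i) - g (\<chi> i. z i)) < e"
          using q(2)[OF vT[OF z], of n] m[of n] by (simp add: abs_minus_commute)
      qed
    qed
    then show "(\<lambda>n. complex_of_real (q n (\<chi> i. z i))) \<longlonglongrightarrow> of_real (g (\<chi> i. z i))"
      by (rule tendsto_of_real)
  qed
qed

text \<open>The continuous functions max 0 (1 - n dist) decrease to the indicator of the closed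
  set.\<close>

lemma spectrally_matched_closed:
  fixes C :: "((complex, 'n) vec) set"
  assumes C: "closed C"
  shows "spectrally_matched (\<lambda>z. indicator C (\<chi> i. z i))"
proof (cases "C = {}")
  case True
  then show ?thesis using laurent_span_matched[OF laurent_span_const[of 0]] by simp
next
  case False
  let ?g = "\<lambda>n x. max 0 (1 - real n * infdist x C)"
  show ?thesis
  proof (rule spectrally_matched_limit[where h = "\<lambda>n z. of_real (?g n (\<chi> i. z i))" and B = 1])
    fix n show "spectrally_matched (\<lambda>z. of_real (?g n (\<chi> i. z i)))"
      by (intro spectrally_matched_continuous[of "?g n"] continuous_intros)
    fix z :: "'n \<Rightarrow> complex"
    show "cmod (of_real (?g n (\<chi> i. z i))) \<le> 1" by (simp add: infdist_nonneg)
  next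
    fix z :: "'n \<Rightarrow> complex"
    let ?x = "\<chi> i. z i"
    have "(\<lambda>n. ?g n ?x) \<longlonglongrightarrow> indicator C ?x"
    proof (cases "?x \<in> C")
      case True
      then show ?thesis by simp
    next
      case False
      then have pos: "infdist ?x C > 0"
        using in_closed_iff_infdist_zero[OF C \<open>C \<noteq> {}\<close>] infdist_nonneg[of ?x C] by force
      obtain m where m: "1 / infdist ?x C < real m" using reals_Archimedean2 by blast
      have "?g n ?x = 0" if "n \<ge> m" for n
      proof -
        have "1 / infdist ?x C \<le> real n" using m that by linarith
        then show ?thesis using pos by (simp add: field_simps)
      qed
      then have "eventually (\<lambda>n. ?g n ?x = 0) sequentially"
        by (auto simp: eventually_sequentially)
      then show ?thesis using False by (simp add: tendsto_eventually)
    qed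
    then have "(\<lambda>n. complex_of_real (?g n ?x)) \<longlonglongrightarrow> of_real (indicator C ?x)"
      by (rule tendsto_of_real)
    moreover have "complex_of_real (indicator C ?x) = indicator C ?x" by (simp add: indicator_def)
    ultimately show "(\<lambda>n. complex_of_real (?g n ?x)) \<longlonglongrightarrow> indicator C ?x" by (simp only:)
  qed
qed

text \<open>A Dynkin class argument starting from the closed sets. Disjointness keeps the partial
  sums of indicators bounded by 1, as needed for the limit.\<close>

lemma spectrally_matched_borel:
  fixes B :: "((complex, 'n) vec) set"
  assumes "B \<in> sets borel"
  shows "spectrally_matched (\<lambda>z. indicator B (\<chi> i. z i))"
proof -
  have "Int_stable (Collect closed :: (complex, 'n) vec set set)" by (auto simp: Int_stable_def)
  moreover have "Collect closed \<subseteq> Pow (UNIV :: (complex, 'n) vec set)" by simp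
  moreover have "B \<in> sigma_sets UNIV (Collect closed)"
    using assms by (simp add: borel_eq_closed)
  ultimately show ?thesis
  proof (induction rule: sigma_sets_induct_disjoint)
    case (basic A)
    then show ?case by (simp add: spectrally_matched_closed)
  next
    case empty
    show ?case using laurent_span_matched[OF laurent_span_const[of 0]] by simp
  next
    case (compl A)
    have "spectrally_matched (\<lambda>z. 1 + (- 1) * indicator A (\<chi> i. z i))"
      by (intro spectrally_matched_add spectrally_matched_cmult compl laurent_span_matched laurent_span_const)
    then show ?case by (rule spectrally_matched_cong) (simp add: indicator_def)
  next
    case (union A)
    let ?h = "\<lambda>n z. \<Sum>i<n. indicator (A i) (\<chi> i. z i)"
    have ind: "?h n z = indicator (\<Union>i<n. A i) (\<chi> i. z i)" for n and z :: "'n \<Rightarrow> complex"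
      using union(1) by (subst indicator_UN_disjoint) (auto simp: disjoint_family_on_def)
    show ?case
    proof (rule spectrally_matched_limit[where h = ?h and B = 1])
      fix n
      show "spectrally_matched (?h n)"
      proof (induction n)
        case 0
        show ?case using laurent_span_matched[OF laurent_span_const[of 0]] by simp
      next
        case (Suc n)
        then show ?case using spectrally_matched_add[OF Suc.IH union(3)[of n]] by simp
      qed
      fix z :: "'n \<Rightarrow> complex"
      show "cmod (?h n z) \<le> 1" unfolding ind by (simp add: indicator_def)
    next
      fix z :: "'n \<Rightarrow> complex"
      let ?x = "\<chi> i. z i"
      show "(\<lambda>n. ?h n z) \<longlonglongrightarrow> indicator (\<Union>i. A i) ?x"
      proof (cases "?x \<in> (\<Union>i. A i)")
        case True
        then obtain m where "?x \<in> A m" by blast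
        then have "eventually (\<lambda>n. ?h n z = indicator (\<Union>i. A i) ?x) sequentially"
          unfolding ind by (intro eventually_sequentiallyI[of "Suc m"]) (auto simp: indicator_def)
        then show ?thesis by (rule tendsto_eventually)
      next
        case False
        then show ?thesis unfolding ind by (simp add: indicator_def)
      qed
    qed
  qed
qed

lemma sets_torus_haar_vec:
  assumes "X \<in> sets (torus_haar :: ('n \<Rightarrow> complex) measure)"
  shows "\<exists>B\<in>sets borel. X = (\<lambda>z. \<chi> i. z i) -` B \<inter> space torus_haar"
proof -
  let ?T = "space (torus_haar :: ('n \<Rightarrow> complex) measure)"
  let ?V = "vimage_algebra ?T (\<lambda>z. (\<chi> i. z i) :: (complex, 'n) vec) borel"
  have v: "(\<lambda>z. (\<chi> i. z i) :: (complex, 'n) vec) \<in> measurable ?V borel"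
    by (rule measurable_vimage_algebra1) auto
  have *: "(\<lambda>z. z) \<in> measurable ?V (PiM UNIV (\<lambda>_. circle_haar))"
  proof (rule measurable_PiM_single')
    fix i :: 'n
    have "(\<lambda>z. (\<chi> i. z i) $ i) \<in> measurable ?V borel"
      by (rule measurable_compose[OF v]) (intro borel_measurable_continuous_onI continuous_intros)
    then have "(\<lambda>z. z i) \<in> measurable ?V (restrict_space borel circle)"
      by (intro measurable_restrict_space2) (auto simp: space_torus_haar)
    then show "(\<lambda>z. z i) \<in> measurable ?V circle_haar"
      by (simp add: measurable_cong_sets[OF refl sets_circle_haar])
  qed (auto simp: space_torus_haar PiE_UNIV_domain)
  have "(\<lambda>z. z) \<in> measurable ?V torus_haar"
    using * by (simp only: torus_haar_def)
  from measurable_sets[OF this assms] have "X \<inter> ?T \<in> sets ?V" by simp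
  moreover have "X \<subseteq> ?T" using sets.sets_into_space[OF assms] .
  ultimately show ?thesis
    by (auto simp: sets_vimage_algebra2 Int_absorb2)
qed

lemma spectrally_matched_indicator:
  assumes "X \<in> sets torus_haar"
  shows "spectrally_matched (indicator X)"
proof -
  obtain B where B: "B \<in> sets borel" "X = (\<lambda>z. \<chi> i. z i) -` B \<inter> space torus_haar"
    using sets_torus_haar_vec[OF assms] by blast
  from spectrally_matched_borel[OF B(1)] show ?thesis
    by (rule spectrally_matched_cong) (simp add: B(2) indicator_def)
qed

lemma symmetrize_indicator_of_real:
  "symmetrize (indicator X) z = complex_of_real (symmetrize (indicator X) z)"
  by (simp add: symmetrize_def indicator_def)

lemma symmetrize_indicator_nonneg: "0 \<le> (symmetrize (indicator X) z :: real)"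
  by (simp add: symmetrize_def sum_nonneg)

lemma density_set_integral:
  assumes "X \<in> sets torus_haar"
  shows "fact CARD('n) * (\<integral>z. indicator X z * p z \<partial>torus_haar)
    = of_real (\<integral>\<xi>. symmetrize (indicator X) (some_spectrum (U \<xi>)) \<partial>M)"
proof -
  have "fact CARD('n) * (\<integral>z. indicator X z * p z \<partial>torus_haar) = (\<integral>\<xi>. symmetrize (indicator X) (some_spectrum (U \<xi>)) \<partial>M)"
    using spectrally_matched_indicator[OF assms] by (simp add: spectrally_matched_def)
  also have "\<dots> = of_real (\<integral>\<xi>. symmetrize (indicator X) (some_spectrum (U \<xi>)) \<partial>M)"
    unfolding symmetrize_indicator_of_real by (rule integral_complex_of_real)
  finally show ?thesis .
qed

text \<open>Nonnegativity of p is a conclusion: its integral over every measurable set is, up to a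
  factorial, the expectation of a nonnegative function. The imaginary part is shown to be
  nonnegative together with its negative.\<close>

lemma density_nonneg: "AE z in torus_haar. 0 \<le> p z"
proof -
  have i: "integrable torus_haar (\<lambda>z. indicator X z * p z)" if "X \<in> sets torus_haar" for X
    by (rule integrable_bounded_times_density[where B = 1]) (use that in \<open>auto simp: indicator_def\<close>)
  have re: "(\<integral>z. indicator X z * Re (p z) \<partial>torus_haar) = Re (\<integral>z. indicator X z * p z \<partial>torus_haar)"
    and im: "(\<integral>z. indicator X z * Im (p z) \<partial>torus_haar) = Im (\<integral>z. indicator X z * p z \<partial>torus_haar)"
    if "X \<in> sets torus_haar" for X
    unfolding integral_Re[OF i[OF that], symmetric] integral_Im[OF i[OF that], symmetric]
    by (rule Bochner_Integration.integral_cong; simp add: indicator_def)+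
  have f0: "complex_of_real (fact n) \<noteq> 0" for n by simp
  have val: "(\<integral>z. indicator X z * p z \<partial>torus_haar)
      = of_real ((\<integral>\<xi>. symmetrize (indicator X) (some_spectrum (U \<xi>)) \<partial>M) / fact CARD('n))"
    if "X \<in> sets torus_haar" for X
    using density_set_integral[OF that] by (simp add: field_simps)
  have pos: "(0::real) \<le> (\<integral>\<xi>. symmetrize (indicator X) (some_spectrum (U \<xi>)) \<partial>M)" for X :: "('n \<Rightarrow> complex) set"
    by (intro Bochner_Integration.integral_nonneg symmetrize_indicator_nonneg)
  have "AE z in torus_haar. 0 \<le> Re (p z)"
    by (rule AE_nonneg_of_set_integrals) (use p(1) pos in \<open>auto simp only: re val Re_complex_of_real
      integrable_Re intro!: divide_nonneg_pos fact_gt_zero\<close>)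
  moreover have "AE z in torus_haar. 0 \<le> Im (p z)"
    by (rule AE_nonneg_of_set_integrals) (use p(1) in \<open>auto simp: im val simp del: of_real_divide\<close>)
  moreover have "AE z in torus_haar. 0 \<le> - Im (p z)"
    by (rule AE_nonneg_of_set_integrals) (use p(1) in \<open>auto simp: im val simp del: of_real_divide\<close>)
  ultimately show ?thesis
    by eventually_elim (auto simp: less_eq_complex_def)
qed

text \<open>Measurability of the symmetrized function is proved along with the integral identity,
  because each stage of the induction over nonnegative measurable functions relies on it for the
  stage before.\<close>

lemma density_nn_integral:
  fixes h :: "('n \<Rightarrow> complex) \<Rightarrow> ennreal"
  assumes "h \<in> borel_measurable torus_haar"
  shows "(\<lambda>A. symmetrize h (some_spectrum A)) \<in> borel_measurable unitary_space \<and>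
    (\<integral>\<^sup>+\<xi>. symmetrize h (some_spectrum (U \<xi>)) \<partial>M) = fact CARD('n) * (\<integral>\<^sup>+z. h z * ennreal (Re (p z)) \<partial>torus_haar)"
  using assms
proof (induction rule: borel_measurable_induct)
  case (cong f g)
  have s: "symmetrize f (some_spectrum A) = symmetrize g (some_spectrum A)" if "A \<in> unitary_group" for A
    unfolding symmetrize_def by (simp add: cong(3) torus_permute some_spectrum_torus that)
  have "(\<lambda>A. symmetrize f (some_spectrum A)) \<in> borel_measurable unitary_space"
    using cong(4) by (subst measurable_cong[where g = "\<lambda>A. symmetrize g (some_spectrum A)"]) (auto simp: s)
  moreover have "(\<integral>\<^sup>+\<xi>. symmetrize f (some_spectrum (U \<xi>)) \<partial>M) = (\<integral>\<^sup>+\<xi>. symmetrize g (some_spectrum (U \<xi>)) \<partial>M)"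
    by (rule nn_integral_cong) (simp add: s U_unitary)
  moreover have "(\<integral>\<^sup>+z. f z * ennreal (Re (p z)) \<partial>torus_haar) = (\<integral>\<^sup>+z. g z * ennreal (Re (p z)) \<partial>torus_haar)"
    by (rule nn_integral_cong) (simp add: cong(3))
  ultimately show ?case using cong(4) by simp
next
  case (set X)
  let ?S = "\<lambda>A. symmetrize (indicator X) (some_spectrum A) :: real"
  have e: "symmetrize (indicator X) z = ennreal (symmetrize (indicator X) z)" for z :: "'n \<Rightarrow> complex"
    by (simp add: symmetrize_def sum_ennreal[symmetric] ennreal_indicator)
  have mc: "(\<lambda>A. complex_of_real (?S A)) \<in> borel_measurable unitary_space"
    using spectrally_matched_indicator[OF set] unfolding spectrally_matched_def symmetrize_indicator_of_real by blast
  then have m: "?S \<in> borel_measurable unitary_space"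
    using measurable_compose[OF mc borel_measurable_Re] by simp
  have B: "\<forall>z\<in>space torus_haar. cmod (indicator X z) \<le> 1" by (simp add: indicator_def)
  have iM: "integrable M (\<lambda>\<xi>. ?S (U \<xi>))"
  proof -
    have "integrable M (\<lambda>\<xi>. symmetrize (indicator X) (some_spectrum (U \<xi>)) :: complex)"
      using spectrally_matched_indicator[OF set] by (intro integrable_symmetrize[OF _ B]) (simp add: spectrally_matched_def)
    from integrable_Re[OF this] show ?thesis unfolding symmetrize_indicator_of_real by simp
  qed
  have i: "integrable torus_haar (\<lambda>z. indicator X z * p z)"
    by (rule integrable_bounded_times_density[where B = 1]) (use set in \<open>auto simp: indicator_def\<close>)
  have iR: "integrable torus_haar (\<lambda>z. indicator X z * Re (p z))"
    using integrable_Re[OF i] by (rule Bochner_Integration.integrable_cong[THEN iffD1, rotated -1]) (auto simp: indicator_def)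
  have "(\<integral>\<^sup>+z. indicator X z * ennreal (Re (p z)) \<partial>torus_haar) = (\<integral>\<^sup>+z. ennreal (indicator X z * Re (p z)) \<partial>torus_haar)"
    by (rule nn_integral_cong) (simp add: indicator_def)
  also have "\<dots> = ennreal (\<integral>z. indicator X z * Re (p z) \<partial>torus_haar)"
    using density_nonneg by (intro nn_integral_eq_integral iR) (auto simp: less_eq_complex_def elim: eventually_mono)
  finally have r: "(\<integral>\<^sup>+z. indicator X z * ennreal (Re (p z)) \<partial>torus_haar) = ennreal (\<integral>z. indicator X z * Re (p z) \<partial>torus_haar)" .
  have "(\<integral>z. indicator X z * Re (p z) \<partial>torus_haar) = Re (\<integral>z. indicator X z * p z \<partial>torus_haar)"
    unfolding integral_Re[OF i, symmetric] by (rule Bochner_Integration.integral_cong) (auto simp: indicator_def)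
  then have v: "fact CARD('n) * (\<integral>z. indicator X z * Re (p z) \<partial>torus_haar) = (\<integral>\<xi>. ?S (U \<xi>) \<partial>M)"
    using arg_cong[OF density_set_integral[OF set], of Re] by simp
  have "(\<integral>\<^sup>+\<xi>. ennreal (?S (U \<xi>)) \<partial>M) = ennreal (\<integral>\<xi>. ?S (U \<xi>) \<partial>M)"
    by (intro nn_integral_eq_integral iM) (simp add: symmetrize_indicator_nonneg)
  also have "\<dots> = fact CARD('n) * (\<integral>\<^sup>+z. indicator X z * ennreal (Re (p z)) \<partial>torus_haar)"
    unfolding r v[symmetric] by (simp add: ennreal_mult' ennreal_fact)
  finally show ?case using m by (simp add: e)
next
  case (mult u c)
  have s: "symmetrize (\<lambda>z. c * u z) z = c * symmetrize u z" for z :: "'n \<Rightarrow> complex"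
    by (simp add: symmetrize_def sum_distrib_left)
  have [measurable]: "p \<in> borel_measurable torus_haar" using p(1) by auto
  note [measurable] = mult(2)
  have "(\<lambda>\<xi>. symmetrize u (some_spectrum (U \<xi>))) \<in> borel_measurable M"
    using mult(4) by (intro measurable_compose[OF U]) auto
  then show ?case using mult(4)
    by (auto simp: s nn_integral_cmult mult.assoc mult.left_commute)
next
  case (add u v)
  have s: "symmetrize (\<lambda>z. v z + u z) z = symmetrize v z + symmetrize u z" for z :: "'n \<Rightarrow> complex"
    by (simp add: symmetrize_def sum.distrib)
  have [measurable]: "p \<in> borel_measurable torus_haar" using p(1) by auto
  note [measurable] = add.hyps(1,3)
  have "(\<lambda>\<xi>. symmetrize u (some_spectrum (U \<xi>))) \<in> borel_measurable M"
    "(\<lambda>\<xi>. symmetrize v (some_spectrum (U \<xi>))) \<in> borel_measurable M"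
    using add.IH by (auto intro: measurable_compose[OF U])
  then show ?case using add.IH
    by (auto simp: s nn_integral_add distrib_left distrib_right)
next
  case (seq V)
  have inc: "incseq (\<lambda>i. V i z)" for z using seq.hyps by (auto simp: incseq_def le_fun_def)
  have s: "symmetrize (SUP i. V i) z = (SUP i. symmetrize (V i) z)" for z :: "'n \<Rightarrow> complex"
    unfolding symmetrize_def by (subst ennreal_SUP_sum) (auto simp: inc image_comp)
  have incs: "incseq (\<lambda>i. symmetrize (V i) z)" for z :: "'n \<Rightarrow> complex"
    unfolding symmetrize_def using inc by (auto simp: incseq_def intro!: sum_mono)
  have [measurable]: "p \<in> borel_measurable torus_haar" using p(1) by auto
  note [measurable] = seq.hyps(1)
  have m: "(\<lambda>A. symmetrize (V i) (some_spectrum A)) \<in> borel_measurable unitary_space" for i using seq.IH by simp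
  have "(\<integral>\<^sup>+\<xi>. (SUP i. symmetrize (V i) (some_spectrum (U \<xi>))) \<partial>M) = (SUP i. \<integral>\<^sup>+\<xi>. symmetrize (V i) (some_spectrum (U \<xi>)) \<partial>M)"
    using incs by (intro nn_integral_monotone_convergence_SUP measurable_compose[OF U m]) (auto simp: incseq_def le_fun_def)
  also have "\<dots> = fact CARD('n) * (SUP i. \<integral>\<^sup>+z. V i z * ennreal (Re (p z)) \<partial>torus_haar)"
    using seq.IH by (simp add: SUP_mult_left_ennreal)
  also have "(SUP i. \<integral>\<^sup>+z. V i z * ennreal (Re (p z)) \<partial>torus_haar) = (\<integral>\<^sup>+z. (SUP i. V i z * ennreal (Re (p z))) \<partial>torus_haar)"
    using inc by (intro nn_integral_monotone_convergence_SUP[symmetric])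
      (auto simp: incseq_def le_fun_def intro!: mult_right_mono)
  also have "\<dots> = (\<integral>\<^sup>+z. (SUP i. V i) z * ennreal (Re (p z)) \<partial>torus_haar)"
    by (intro nn_integral_cong) (simp add: SUP_mult_right_ennreal image_comp)
  finally have "(\<integral>\<^sup>+\<xi>. symmetrize (SUP i. V i) (some_spectrum (U \<xi>)) \<partial>M) = fact CARD('n) * (\<integral>\<^sup>+z. (SUP i. V i) z * ennreal (Re (p z)) \<partial>torus_haar)"
    by (simp only: s)
  moreover have "(\<lambda>A. symmetrize (SUP i. V i) (some_spectrum A)) \<in> borel_measurable unitary_space"
    unfolding s using m by (intro borel_measurable_SUP) auto
  ultimately show ?case by (rule conjI[rotated])
qed

text \<open>For a symmetric test function symmetrization is multiplication by a factorial, which is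
  finite and nonzero and cancels.\<close>

theorem eigenvalue_densityI: "eigenvalue_density M U p"
  unfolding eigenvalue_density_def
proof (intro conjI allI impI)
  show "p \<in> borel_measurable torus_haar" using p(1) by auto
  fix f :: "('n \<Rightarrow> complex) \<Rightarrow> ennreal"
  assume f: "f \<in> borel_measurable torus_haar" "symmetric_on_torus f"
  have F: "(fact CARD('n) :: ennreal) \<noteq> 0" "(fact CARD('n) :: ennreal) \<noteq> top"
    by (simp_all flip: ennreal_fact)
  have s: "symmetrize f (some_spectrum A) = fact CARD('n) * f (some_spectrum A)" if "A \<in> unitary_group" for A
    using f(2) some_spectrum_torus[OF that]
    by (simp add: symmetrize_def symmetric_on_torus_def permutes_bij card_permutations)
  note d = density_nn_integral[OF f(1)]
  have "f (some_spectrum (U \<xi>)) = symmetrize f (some_spectrum (U \<xi>)) / fact CARD('n)" if "\<xi> \<in> space M" for \<xi>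
    using F by (simp add: s U_unitary that ennreal_mult_divide_eq mult.commute[of "fact _"])
  then have "(\<integral>\<^sup>+\<xi>. f (some_spectrum (U \<xi>)) \<partial>M) = (\<integral>\<^sup>+\<xi>. symmetrize f (some_spectrum (U \<xi>)) / fact CARD('n) \<partial>M)"
    by (rule nn_integral_cong)
  also have "\<dots> = (\<integral>\<^sup>+\<xi>. symmetrize f (some_spectrum (U \<xi>)) \<partial>M) / fact CARD('n)"
    using d by (intro nn_integral_divide measurable_compose[OF U]) auto
  also have "\<dots> = (\<integral>\<^sup>+z. f z * ennreal (Re (p z)) \<partial>torus_haar)"
    using d F by (simp add: ennreal_mult_divide_eq mult.commute[of "fact _"])
  finally show "(\<integral>\<^sup>+\<xi>. f (some_spectrum (U \<xi>)) \<partial>M) = (\<integral>\<^sup>+z. f z * ennreal (Re (p z)) \<partial>torus_haar)" .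
qed (use p density_nonneg in auto)

end

subsection \<open>Moments of a density\<close>

lemma eigenvalue_density_integrable:
  fixes p :: "('n::finite \<Rightarrow> complex) \<Rightarrow> complex"
  assumes "prob_space M" "eigenvalue_density M U p"
  shows "integrable torus_haar p" "(\<integral>z. Re (p z) \<partial>torus_haar) = 1" "integrable torus_haar (\<lambda>z. Re (p z))"
proof -
  interpret M: prob_space M by fact
  have [measurable]: "p \<in> borel_measurable torus_haar" and nn: "AE z in torus_haar. 0 \<le> p z"
    using assms(2) by (auto simp: eigenvalue_density_def)
  have "(\<integral>\<^sup>+\<xi>. (\<lambda>_. 1) (some_spectrum (U \<xi>)) \<partial>M) = (\<integral>\<^sup>+z. (\<lambda>_. 1) z * ennreal (Re (p z)) \<partial>torus_haar)"
    using assms(2) unfolding eigenvalue_density_def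
    by (elim conjE allE[of _ "\<lambda>_. 1"]) (simp add: symmetric_on_torus_def)
  then have 1: "(\<integral>\<^sup>+z. ennreal (Re (p z)) \<partial>torus_haar) = 1"
    by (simp add: M.emeasure_space_1)
  have nR: "AE z in torus_haar. 0 \<le> Re (p z)" using nn by (rule AE_mp) (auto simp: less_eq_complex_def)
  show R: "integrable torus_haar (\<lambda>z. Re (p z))"
    by (rule integrableI_nonneg) (use 1 nR in auto)
  show "(\<integral>z. Re (p z) \<partial>torus_haar) = 1"
    using nn_integral_eq_integral[OF R nR] 1 by simp
  have "AE z in torus_haar. of_real (Re (p z)) = p z"
    using nn by (rule AE_mp) (auto simp: less_eq_complex_def complex_eq_iff)
  then show "integrable torus_haar p"
    using R by (subst integrable_cong_AE[where g = "\<lambda>z. of_real (Re (p z))"]) (auto elim: eventually_mono)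
qed

text \<open>A density is tested against nonnegative functions only; real and imaginary parts of a
  bounded function become nonnegative after adding the bound, and both sides change by the same
  constant since the total mass is 1. Measurability of the composition with the chosen spectrum is
  assumed, as it does not follow from that of \<open>g\<close>.\<close>

lemma eigenvalue_density_expectation:
  fixes g :: "('n::finite \<Rightarrow> complex) \<Rightarrow> complex"
  assumes M: "prob_space M" and U: "U \<in> measurable M unitary_space" and d: "eigenvalue_density M U p"
    and g: "g \<in> borel_measurable torus_haar" "symmetric_on_torus g" "\<And>z. z \<in> space torus_haar \<Longrightarrow> cmod (g z) \<le> B"
      "(\<lambda>\<xi>. g (some_spectrum (U \<xi>))) \<in> borel_measurable M"
  shows "(\<integral>\<xi>. g (some_spectrum (U \<xi>)) \<partial>M) = (\<integral>z. g z * p z \<partial>torus_haar)"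
proof -
  interpret M: prob_space M by fact
  note ip = eigenvalue_density_integrable[OF M d]
  have [measurable]: "p \<in> borel_measurable torus_haar" and nn: "AE z in torus_haar. 0 \<le> p z"
    using d by (auto simp: eigenvalue_density_def)
  note [measurable] = g(1)
  have nR: "AE z in torus_haar. 0 \<le> Re (p z)" using nn by (rule AE_mp) (auto simp: less_eq_complex_def)
  have spec: "some_spectrum (U \<xi>) \<in> space torus_haar" if "\<xi> \<in> space M" for \<xi>
    using measurable_space[OF U that] by (simp add: some_spectrum_torus)
  have real: "(\<integral>\<xi>. r (some_spectrum (U \<xi>)) \<partial>M) = (\<integral>z. r z * Re (p z) \<partial>torus_haar)"
    if [measurable]: "r \<in> borel_measurable torus_haar" and sym: "symmetric_on_torus r"
      and b: "\<And>z. z \<in> space torus_haar \<Longrightarrow> \<bar>r z\<bar> \<le> B"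
      and m: "(\<lambda>\<xi>. r (some_spectrum (U \<xi>))) \<in> borel_measurable M" for r
  proof -
    have iM: "integrable M (\<lambda>\<xi>. r (some_spectrum (U \<xi>)))"
      by (rule M.integrable_const_bound[where B = B]) (use m b spec in \<open>auto intro!: AE_I2\<close>)
    have it: "integrable torus_haar (\<lambda>z. r z * Re (p z))"
    proof (rule Bochner_Integration.integrable_bound)
      show "integrable torus_haar (\<lambda>z. B * Re (p z))" using ip(3) by simp
      show "AE z in torus_haar. norm (r z * Re (p z)) \<le> norm (B * Re (p z))"
        using b by (auto simp: abs_mult intro!: AE_I2 mult_right_mono intro: order_trans[OF _ abs_ge_self])
    qed simp
    have pos: "0 \<le> r z + B" if "z \<in> space torus_haar" for z using b[OF that] by linarith
    have "(\<integral>\<^sup>+\<xi>. (\<lambda>z. ennreal (r z + B)) (some_spectrum (U \<xi>)) \<partial>M)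
        = (\<integral>\<^sup>+z. (\<lambda>z. ennreal (r z + B)) z * ennreal (Re (p z)) \<partial>torus_haar)"
    proof -
      have "symmetric_on_torus (\<lambda>z. ennreal (r z + B))" using sym by (simp add: symmetric_on_torus_def)
      then show ?thesis using d unfolding eigenvalue_density_def
        by (elim conjE allE[of _ "\<lambda>z. ennreal (r z + B)"]) simp
    qed
    also have "(\<integral>\<^sup>+z. (\<lambda>z. ennreal (r z + B)) z * ennreal (Re (p z)) \<partial>torus_haar)
        = (\<integral>\<^sup>+z. ennreal (r z * Re (p z) + B * Re (p z)) \<partial>torus_haar)"
      by (rule nn_integral_cong_AE, rule AE_mp[OF nR], rule AE_I2)
        (auto simp: ennreal_mult[symmetric] pos distrib_right)
    also have "\<dots> = ennreal (\<integral>z. r z * Re (p z) + B * Re (p z) \<partial>torus_haar)"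
    proof (rule nn_integral_eq_integral)
      show "integrable torus_haar (\<lambda>z. r z * Re (p z) + B * Re (p z))" using it ip(3) by simp
      show "AE z in torus_haar. 0 \<le> r z * Re (p z) + B * Re (p z)"
        by (rule AE_mp[OF nR], rule AE_I2) (auto simp: distrib_right[symmetric] pos)
    qed
    also have "(\<integral>z. r z * Re (p z) + B * Re (p z) \<partial>torus_haar) = (\<integral>z. r z * Re (p z) \<partial>torus_haar) + B"
      using it ip(2,3) by simp
    also have "(\<integral>\<^sup>+\<xi>. (\<lambda>z. ennreal (r z + B)) (some_spectrum (U \<xi>)) \<partial>M)
        = ennreal (\<integral>\<xi>. r (some_spectrum (U \<xi>)) + B \<partial>M)"
      using iM pos spec by (intro nn_integral_eq_integral) auto
    also have "(\<integral>\<xi>. r (some_spectrum (U \<xi>)) + B \<partial>M) = (\<integral>\<xi>. r (some_spectrum (U \<xi>)) \<partial>M) + B"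
      using iM by (simp add: M.prob_space)
    finally have e: "ennreal ((\<integral>\<xi>. r (some_spectrum (U \<xi>)) \<partial>M) + B) = ennreal ((\<integral>z. r z * Re (p z) \<partial>torus_haar) + B)" .
    have "0 \<le> (\<integral>\<xi>. r (some_spectrum (U \<xi>)) + B \<partial>M)"
      by (rule Bochner_Integration.integral_nonneg_AE) (use pos spec in \<open>auto intro!: AE_I2\<close>)
    then have 1: "0 \<le> (\<integral>\<xi>. r (some_spectrum (U \<xi>)) \<partial>M) + B" using iM by (simp add: M.prob_space)
    have "0 \<le> (\<integral>z. r z * Re (p z) + B * Re (p z) \<partial>torus_haar)"
      by (rule Bochner_Integration.integral_nonneg_AE, rule AE_mp[OF nR], rule AE_I2)
        (auto simp: distrib_right[symmetric] pos)
    then have 2: "0 \<le> (\<integral>z. r z * Re (p z) \<partial>torus_haar) + B" using it ip(2,3) by simp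
    show ?thesis using e 1 2 by (simp add: ennreal_inj)
  qed
  have AEp: "AE z in torus_haar. g z * p z = of_real (Re (g z) * Re (p z)) + \<i> * of_real (Im (g z) * Re (p z))"
    using nn by (rule AE_mp) (auto simp: less_eq_complex_def complex_eq_iff intro!: AE_I2)
  have sym: "symmetric_on_torus (\<lambda>z. Re (g z))" "symmetric_on_torus (\<lambda>z. Im (g z))"
    using g(2) by (auto simp: symmetric_on_torus_def)
  have b: "\<bar>Re (g z)\<bar> \<le> B" "\<bar>Im (g z)\<bar> \<le> B" if "z \<in> space torus_haar" for z
    using g(3)[OF that] abs_Re_le_cmod[of "g z"] abs_Im_le_cmod[of "g z"] by linarith+
  have mm: "(\<lambda>\<xi>. Re (g (some_spectrum (U \<xi>)))) \<in> borel_measurable M" "(\<lambda>\<xi>. Im (g (some_spectrum (U \<xi>)))) \<in> borel_measurable M"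
    using g(4) by auto
  have R: "(\<integral>\<xi>. Re (g (some_spectrum (U \<xi>))) \<partial>M) = (\<integral>z. Re (g z) * Re (p z) \<partial>torus_haar)"
    by (rule real[OF _ sym(1) b(1) mm(1)]) auto
  have I: "(\<integral>\<xi>. Im (g (some_spectrum (U \<xi>))) \<partial>M) = (\<integral>z. Im (g z) * Re (p z) \<partial>torus_haar)"
    by (rule real[OF _ sym(2) b(2) mm(2)]) auto
  have ig: "integrable M (\<lambda>\<xi>. g (some_spectrum (U \<xi>)))"
    by (rule M.integrable_const_bound[where B = B]) (use g spec in \<open>auto intro!: AE_I2\<close>)
  have it: "integrable torus_haar (\<lambda>z. r z * Re (p z))" if [measurable]: "r \<in> borel_measurable torus_haar"
    and b: "\<And>z. z \<in> space torus_haar \<Longrightarrow> \<bar>r z\<bar> \<le> B" for r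
  proof (rule Bochner_Integration.integrable_bound)
    show "integrable torus_haar (\<lambda>z. B * Re (p z))" using ip(3) by simp
    show "AE z in torus_haar. norm (r z * Re (p z)) \<le> norm (B * Re (p z))"
      using b by (auto simp: abs_mult intro!: AE_I2 mult_right_mono intro: order_trans[OF _ abs_ge_self])
  qed simp
  have "(\<integral>z. g z * p z \<partial>torus_haar) = (\<integral>z. of_real (Re (g z) * Re (p z)) + \<i> * of_real (Im (g z) * Re (p z)) \<partial>torus_haar)"
    by (rule integral_cong_AE) (use AEp in auto)
  also have "\<dots> = of_real (\<integral>z. Re (g z) * Re (p z) \<partial>torus_haar) + \<i> * of_real (\<integral>z. Im (g z) * Re (p z) \<partial>torus_haar)"
    using it[OF _ b(1)] it[OF _ b(2)]
    by (subst Bochner_Integration.integral_add)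
      (auto simp: integral_complex_of_real simp del: of_real_mult intro!: integrable_of_real integrable_mult_right)
  also have "\<dots> = of_real (\<integral>\<xi>. Re (g (some_spectrum (U \<xi>))) \<partial>M) + \<i> * of_real (\<integral>\<xi>. Im (g (some_spectrum (U \<xi>))) \<partial>M)"
    unfolding R I ..
  also have "\<dots> = (\<integral>\<xi>. g (some_spectrum (U \<xi>)) \<partial>M)"
    by (simp add: integral_Re[OF ig] integral_Im[OF ig] complex_eq_iff)
  finally show ?thesis ..
qed

section \<open>Andreief's identity and moments of determinantal densities\<close>

lemma integral_torus_prod:
  fixes f :: "'n::finite \<Rightarrow> complex \<Rightarrow> complex"
  assumes "\<And>i. integrable circle_haar (f i)"
  shows "integrable torus_haar (\<lambda>z. \<Prod>i\<in>UNIV. f i (z i))"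
    and "(\<integral>z. (\<Prod>i\<in>UNIV. f i (z i)) \<partial>torus_haar) = (\<Prod>i\<in>UNIV. \<integral>x. f i x \<partial>circle_haar)"
proof -
  interpret product_sigma_finite "\<lambda>_ :: 'n. circle_haar"
    by unfold_locales
  show "integrable torus_haar (\<lambda>z. \<Prod>i\<in>UNIV. f i (z i))"
    unfolding torus_haar_def by (rule product_integrable_prod) (use assms in auto)
  show "(\<integral>z. (\<Prod>i\<in>UNIV. f i (z i)) \<partial>torus_haar) = (\<Prod>i\<in>UNIV. \<integral>x. f i x \<partial>circle_haar)"
    unfolding torus_haar_def by (rule product_integral_prod) (use assms in auto)
qed

text \<open>Both determinants are expanded and integrated coordinate by coordinate. Since
  \<open>sign p * sign q\<close> is the sign of \<open>q \<circ> p\<close>, the sum over q gives the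
  same determinant for each of the N! permutations p.\<close>

lemma andreief:
  fixes \<phi> \<psi> :: "'n::finite \<Rightarrow> complex \<Rightarrow> complex"
  assumes i: "\<And>a b. integrable circle_haar (\<lambda>z. \<phi> a z * \<psi> b z)"
  shows "integrable torus_haar (\<lambda>z. det (\<chi> a b. \<phi> a (z b)) * det (\<chi> a b. \<psi> b (z a)))"
    and "(\<integral>z. det (\<chi> a b. \<phi> a (z b)) * det (\<chi> a b. \<psi> b (z a)) \<partial>torus_haar)
      = fact CARD('n) * det (\<chi> a b. \<integral>z. \<phi> a z * \<psi> b z \<partial>circle_haar)"
proof -
  let ?P = "{p. p permutes (UNIV :: 'n set)}"
  let ?G = "\<lambda>a b. \<integral>z. \<phi> a z * \<psi> b z \<partial>circle_haar"
  let ?t = "\<lambda>p q z. \<Prod>c\<in>UNIV. \<phi> (inv p c) (z c) * \<psi> (q c) (z c)"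
  have "(\<Prod>a\<in>UNIV. \<phi> a (z (p a))) = (\<Prod>c\<in>UNIV. \<phi> (inv p c) (z c))" if "p \<in> ?P" for p z
  proof -
    from that have p: "p permutes UNIV" by simp
    show ?thesis
      using prod.permute[OF p, of "\<lambda>c. \<phi> (inv p c) (z c)"] by (simp add: comp_def permutes_inverses[OF p])
  qed
  then have 1: "det (\<chi> a b. \<phi> a (z b)) = (\<Sum>p\<in>?P. of_int (sign p) * (\<Prod>c\<in>UNIV. \<phi> (inv p c) (z c)))" for z
    by (simp add: det_def)
  have exp: "det (\<chi> a b. \<phi> a (z b)) * det (\<chi> a b. \<psi> b (z a))
      = (\<Sum>p\<in>?P. \<Sum>q\<in>?P. of_int (sign p) * of_int (sign q) * ?t p q z)" for z
    unfolding 1 det_def[of "\<chi> a b. \<psi> b (z a)"] sum_product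
    by (intro sum.cong refl) (simp add: prod.distrib mult_ac)
  have it: "integrable torus_haar (?t p q)" and vt: "(\<integral>z. ?t p q z \<partial>torus_haar) = (\<Prod>c\<in>UNIV. ?G (inv p c) (q c))" for p q
    using integral_torus_prod[of "\<lambda>c x. \<phi> (inv p c) x * \<psi> (q c) x"] i by auto
  show "integrable torus_haar (\<lambda>z. det (\<chi> a b. \<phi> a (z b)) * det (\<chi> a b. \<psi> b (z a)))"
    unfolding exp by (intro Bochner_Integration.integrable_sum integrable_mult_right it)
  have "(\<integral>z. det (\<chi> a b. \<phi> a (z b)) * det (\<chi> a b. \<psi> b (z a)) \<partial>torus_haar)
      = (\<Sum>p\<in>?P. \<Sum>q\<in>?P. of_int (sign p) * of_int (sign q) * (\<Prod>c\<in>UNIV. ?G (inv p c) (q c)))"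
    unfolding exp
    by (subst Bochner_Integration.integral_sum, intro Bochner_Integration.integrable_sum integrable_mult_right it)
      (intro sum.cong refl, subst Bochner_Integration.integral_sum, auto intro!: integrable_mult_right it simp: vt)
  also have "\<dots> = (\<Sum>p\<in>?P. det (\<chi> a b. ?G a b))"
  proof (rule sum.cong[OF refl])
    fix p assume "p \<in> ?P"
    then have p: "p permutes UNIV" by simp
    have "of_int (sign p) * of_int (sign q) * (\<Prod>c\<in>UNIV. ?G (inv p c) (q c))
        = of_int (sign (q \<circ> p)) * (\<Prod>a\<in>UNIV. ?G a ((q \<circ> p) a))" if "q \<in> ?P" for q
    proof -
      have "(\<Prod>c\<in>UNIV. ?G (inv p c) (q c)) = (\<Prod>a\<in>UNIV. ?G a ((q \<circ> p) a))"
        using prod.permute[OF p, of "\<lambda>c. ?G (inv p c) (q c)"] by (simp add: comp_def permutes_inverses[OF p])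
      moreover have "sign (q \<circ> p) = sign q * sign p"
        using that p by (intro sign_compose) (auto intro: permutation_permutes[THEN iffD2] simp: permutation_permutes)
      ultimately show ?thesis by simp
    qed
    then have "(\<Sum>q\<in>?P. of_int (sign p) * of_int (sign q) * (\<Prod>c\<in>UNIV. ?G (inv p c) (q c)))
        = (\<Sum>q\<in>?P. of_int (sign (q \<circ> p)) * (\<Prod>a\<in>UNIV. ?G a ((q \<circ> p) a)))"
      by (intro sum.cong) auto
    also have "\<dots> = (\<Sum>q\<in>?P. of_int (sign q) * (\<Prod>a\<in>UNIV. ?G a (q a)))"
      by (rule sum_permutations_compose_right[OF p, symmetric])
    finally show "(\<Sum>q\<in>?P. of_int (sign p) * of_int (sign q) * (\<Prod>c\<in>UNIV. ?G (inv p c) (q c))) = det (\<chi> a b. ?G a b)"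
      by (simp add: det_def)
  qed
  also have "\<dots> = fact CARD('n) * det (\<chi> a b. ?G a b)" by (simp add: card_permutations)
  finally show "(\<integral>z. det (\<chi> a b. \<phi> a (z b)) * det (\<chi> a b. \<psi> b (z a)) \<partial>torus_haar) = fact CARD('n) * det (\<chi> a b. ?G a b)" .
qed

lemma borel_measurable_circle_continuous:
  "continuous_on circle f \<Longrightarrow> f \<in> borel_measurable circle_haar"
  by (subst measurable_cong_sets[OF sets_circle_haar refl]) (rule borel_measurable_continuous_on_restrict)

lemma circle_power_int:
  assumes "z \<in> circle"
  shows "cnj z ^ k * z ^ s = z powi (int s - int k)"
proof -
  have "z \<noteq> 0" "cnj z = inverse z"
    using assms by (auto simp: divide_conv_cnj inverse_eq_divide)
  then show ?thesis by (simp add: power_int_diff power_inverse divide_inverse mult.commute)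
qed

lemma det_scale_columns:
  fixes c :: "'n::finite \<Rightarrow> complex"
  shows "det (\<chi> a b. c b * f a b) = (\<Prod>b\<in>UNIV. c b) * det (\<chi> a b. f a b)"
proof -
  have "det (\<chi> a b. c b * f a b) = det (\<chi> b. c b *s (\<chi> a. f a b))"
    using det_transpose[of "\<chi> a b. c b * f a b"] by (simp add: transpose_def vector_scalar_mult_def)
  also have "\<dots> = (\<Prod>b\<in>UNIV. c b) * det (\<chi> b a. f a b)" by (rule det_rows_mul)
  also have "det (\<chi> b a. f a b) = det (\<chi> a b. f a b)"
    using det_transpose[of "\<chi> a b. f a b"] by (simp add: transpose_def)
  finally show ?thesis .
qed

lemma integrable_circle_bounded_mult:
  assumes "integrable circle_haar \<psi>" "\<phi> \<in> borel_measurable circle_haar" "\<And>z. z \<in> circle \<Longrightarrow> cmod (\<phi> z) \<le> B"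
  shows "integrable circle_haar (\<lambda>z. \<phi> z * \<psi> z :: complex)"
proof (rule Bochner_Integration.integrable_bound)
  show "integrable circle_haar (\<lambda>z. of_real B * \<psi> z)" using assms by simp
  show "(\<lambda>z. \<phi> z * \<psi> z) \<in> borel_measurable circle_haar" using assms by auto
  show "AE z in circle_haar. norm (\<phi> z * \<psi> z) \<le> norm (of_real B * \<psi> z)"
    using assms(3) by (auto simp: norm_mult intro!: AE_I2 mult_right_mono intro: order_trans[OF _ abs_ge_self])
qed

text \<open>The Schur polynomial times the Vandermonde factor of the density is an alternant, whose
  columns absorb the conjugate determinant, and Andreief's identity applies. Equality almost
  everywhere suffices for p, so weights may be changed on null sets.\<close>

lemma vandermonde_density_moment:
  fixes \<psi> :: "'n::{finite,linorder} \<Rightarrow> complex \<Rightarrow> complex"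
  assumes \<psi>: "\<And>b. integrable circle_haar (\<psi> b)"
    and p: "p \<in> borel_measurable torus_haar" "AE z in torus_haar. p z = c * vandermonde z * det (\<chi> a b. \<psi> b (z a))"
  shows "integrable torus_haar p"
    and "(\<integral>z. cnj (\<Prod>i\<in>UNIV. z i) ^ k * schur s z * p z \<partial>torus_haar)
      = c * fact CARD('n) * det (\<chi> a b. mellin (\<psi> b) (int (s a) - int k))"
proof -
  define \<phi> where "\<phi> k s (a::'n) x = cnj x ^ k * x ^ s a" for k :: nat and s :: "'n \<Rightarrow> nat" and a and x :: complex
  have \<phi>b: "cmod (\<phi> k s a x) \<le> 1" if "x \<in> circle" for k s a x
    using that by (simp add: \<phi>_def norm_mult norm_power)
  have i: "integrable circle_haar (\<lambda>z. \<phi> k s a z * \<psi> b z)" for k s a b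
    by (rule integrable_circle_bounded_mult[OF \<psi> _ \<phi>b])
      (auto simp: \<phi>_def intro!: borel_measurable_circle_continuous continuous_intros)
  have \<phi>det: "det (\<chi> a b. \<phi> k s a (z b)) = cnj (\<Prod>i\<in>UNIV. z i) ^ k * alternant s z" for k s z
    unfolding \<phi>_def det_scale_columns alternant_def by (simp add: prod_power_distrib)
  have eq: "AE z in torus_haar. cnj (\<Prod>i\<in>UNIV. z i) ^ k * schur s z * p z
      = c * (det (\<chi> a b. \<phi> k s a (z b)) * det (\<chi> a b. \<psi> b (z a)))" for k s
    using p(2) by (rule AE_mp) (auto simp: \<phi>det alternant_eq_schur intro!: AE_I2)
  have m: "(\<lambda>z. cnj (\<Prod>i\<in>UNIV. z i) ^ k * schur s z * p z) \<in> borel_measurable torus_haar" for k s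
    by (intro borel_measurable_times p borel_measurable_torus_continuous continuous_intros
      continuous_on_product_coordinates continuous_on_schur)
  note a = andreief[OF i]
  have "(\<integral>z. cnj (\<Prod>i\<in>UNIV. z i) ^ k * schur s z * p z \<partial>torus_haar)
      = (\<integral>z. c * (det (\<chi> a b. \<phi> k s a (z b)) * det (\<chi> a b. \<psi> b (z a))) \<partial>torus_haar)"
    by (rule integral_cong_AE[OF m _ eq]) (use andreief(1)[of "\<phi> k s" \<psi>, OF i] in auto)
  also have "\<dots> = c * fact CARD('n) * det (\<chi> a b. \<integral>z. \<phi> k s a z * \<psi> b z \<partial>circle_haar)"
    by (simp add: a(2))
  also have "(\<lambda>a b. \<integral>z. \<phi> k s a z * \<psi> b z \<partial>circle_haar) = (\<lambda>a b. mellin (\<psi> b) (int (s a) - int k))"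
    unfolding mellin_def \<phi>_def
    by (intro ext Bochner_Integration.integral_cong refl) (simp add: circle_power_int)
  finally show "(\<integral>z. cnj (\<Prod>i\<in>UNIV. z i) ^ k * schur s z * p z \<partial>torus_haar)
      = c * fact CARD('n) * det (\<chi> a b. mellin (\<psi> b) (int (s a) - int k))" .
  have "AE z in torus_haar. p z = c * (det (\<chi> a b. \<phi> 0 pos a (z b)) * det (\<chi> a b. \<psi> b (z a)))"
    using p(2) by (rule AE_mp) (auto simp: \<phi>det alternant_pos intro!: AE_I2)
  then show "integrable torus_haar p"
    using andreief(1)[of "\<phi> 0 pos" \<psi>, OF i] by (subst integrable_cong_AE[OF p(1), where g = "\<lambda>z. c * (det (\<chi> a b. \<phi> 0 pos a (z b)) * det (\<chi> a b. \<psi> b (z a)))"]) auto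
qed

text \<open>Weyl's dimension formula. At the points cis (t pos i) the alternant is itself a
  Vandermonde determinant in the points cis (t s i); each factor of both products is divided by i t,
  and t tends to 0.\<close>

lemma schur_one:
  fixes s :: "'n::{finite,linorder} \<Rightarrow> nat"
  shows "schur s (\<lambda>_. 1) * vandermonde (\<lambda>i. of_nat (pos (i::'n))) = vandermonde (\<lambda>i. of_nat (s i))"
proof -
  define \<gamma> where "\<gamma> t i = cis (t * real (pos i))" for t and i :: 'n
  have \<gamma>0: "\<gamma> 0 = (\<lambda>_. 1)" by (simp add: \<gamma>_def fun_eq_iff)
  have c: "continuous_on UNIV \<gamma>"
    by (rule continuous_on_coordinatewise_then_product) (auto simp: \<gamma>_def intro!: continuous_intros)
  have "continuous_on UNIV (\<lambda>t. schur s (\<gamma> t))"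
    by (rule continuous_on_compose2[OF continuous_on_schur c]) auto
  then have "isCont (\<lambda>t. schur s (\<gamma> t)) 0" by (simp add: continuous_on_eq_continuous_at)
  then have lim1: "(\<lambda>t. schur s (\<gamma> t)) \<midarrow>0\<rightarrow> schur s (\<lambda>_. 1)" by (simp add: isCont_def \<gamma>0)
  define q where "q m n t = (cis (t * real m) - cis (t * real n)) / (\<i> * of_real t)" for m n t
  have lim2: "(\<lambda>t. q m n t) \<midarrow>0\<rightarrow> of_nat m - of_nat n" for m n
  proof -
    let ?F = "\<lambda>h. exp (\<i> * of_nat m * h) - exp (\<i> * of_nat n * h)"
    have "(?F has_field_derivative \<i> * (of_nat m - of_nat n)) (at 0)"
      by (auto intro!: derivative_eq_intros simp: algebra_simps)
    then have "((\<lambda>h. (?F h - ?F 0) / (h - 0)) \<longlongrightarrow> \<i> * (of_nat m - of_nat n)) (at 0)"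
      unfolding has_field_derivative_iff .
    moreover have "filterlim (\<lambda>t::real. complex_of_real t) (at 0) (at 0)"
      by (rule filterlim_atI) (auto intro!: tendsto_eq_intros simp: eventually_at_filter)
    ultimately have "((\<lambda>t. (?F (of_real t) - ?F 0) / (of_real t - 0)) \<longlongrightarrow> \<i> * (of_nat m - of_nat n)) (at 0)"
      by (rule filterlim_compose)
    then have "((\<lambda>t. ((?F (of_real t) - ?F 0) / (of_real t - 0)) / \<i>) \<longlongrightarrow> (\<i> * (of_nat m - of_nat n)) / \<i>) (at 0)"
      by (rule tendsto_divide) auto
    moreover have "((?F (of_real t) - ?F 0) / (of_real t - 0)) / \<i> = q m n t" for t :: real
      by (simp only: q_def divide_divide_eq_left diff_zero) (simp add: cis_conv_exp mult_ac)
    ultimately show ?thesis by simp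
  qed
  let ?P = "{(a, b). a < (b :: 'n)}"
  have lim3: "(\<lambda>t. schur s (\<gamma> t) * (\<Prod>(a, b)\<in>?P. q (pos b) (pos a) t))
      \<midarrow>0\<rightarrow> schur s (\<lambda>_. 1) * vandermonde (\<lambda>i. of_nat (pos (i::'n)))"
    unfolding vandermonde_def by (intro tendsto_mult lim1 tendsto_prod) (auto intro: lim2)
  have lim4: "(\<lambda>t. \<Prod>(a, b)\<in>?P. q (s b) (s a) t) \<midarrow>0\<rightarrow> vandermonde (\<lambda>i. of_nat (s i))"
    unfolding vandermonde_def by (intro tendsto_prod) (auto intro: lim2)
  have eq: "schur s (\<gamma> t) * (\<Prod>(a, b)\<in>?P. q (pos b) (pos a) t) = (\<Prod>(a, b)\<in>?P. q (s b) (s a) t)" for t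
  proof -
    \<comment> \<open>De Moivre's formula exchanges exponents and nodes.\<close>
    have dm: "cis (t * real m) ^ n = cis (t * real n) ^ m" for m n
      by (simp add: Complex.DeMoivre mult_ac)
    have "alternant s (\<gamma> t) = det (\<chi> a b. cis (t * real (s a)) ^ pos b)"
      unfolding alternant_def \<gamma>_def by (intro arg_cong[where f = det]) (simp add: vec_eq_iff dm)
    also have "\<dots> = det (\<chi> a b. cis (t * real (s b)) ^ pos a)"
      using det_transpose[of "\<chi> a b. cis (t * real (s b)) ^ pos a"] by (simp add: transpose_def)
    also have "\<dots> = vandermonde (\<lambda>i. cis (t * real (s i)))" by (rule vandermonde_det)
    finally have "schur s (\<gamma> t) * vandermonde (\<gamma> t) = vandermonde (\<lambda>i. cis (t * real (s i)))"
      by (simp add: alternant_eq_schur)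
    then have "schur s (\<gamma> t) * (\<Prod>(a, b)\<in>?P. (cis (t * real (pos b)) - cis (t * real (pos a)))) / (\<Prod>(a, b)\<in>?P. \<i> * of_real t)
        = (\<Prod>(a, b)\<in>?P. (cis (t * real (s b)) - cis (t * real (s a)))) / (\<Prod>(a, b)\<in>?P. \<i> * of_real t)"
      by (simp add: vandermonde_def \<gamma>_def)
    then show ?thesis by (simp add: q_def prod_dividef case_prod_unfold)
  qed
  show ?thesis using LIM_unique[OF lim3 lim4[folded eq]] .
qed

subsection \<open>Products of independent unitarily invariant matrices\<close>

lemma continuous_on_matrix_mult:
  "continuous_on S f \<Longrightarrow> continuous_on S g \<Longrightarrow> continuous_on S (\<lambda>x. f x ** (g x :: 'n::finite cmat))"
  unfolding matrix_matrix_mult_def by (intro continuous_on_vec_lambda continuous_intros) auto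

lemma continuous_on_dagger: "continuous_on S f \<Longrightarrow> continuous_on S (\<lambda>x. dagger (f x))"
  unfolding dagger_def by (intro continuous_on_vec_lambda continuous_intros) auto

lemma measurable_unitary_borel: "(\<lambda>A. A) \<in> borel_measurable unitary_space"
  by (rule measurable_unitary_continuous) (rule continuous_on_id)

lemma measurable_unitary_mult:
  assumes "f \<in> measurable M unitary_space" "g \<in> measurable M unitary_space"
  shows "(\<lambda>x. f x ** g x) \<in> measurable M unitary_space"
  unfolding unitary_space_def
proof (rule measurable_restrict_space2)
  show "(\<lambda>x. f x ** g x) \<in> borel_measurable M"
    by (rule borel_measurable_continuous_Pair[OF measurable_compose[OF assms(1) measurable_unitary_borel]
      measurable_compose[OF assms(2) measurable_unitary_borel]])
      (intro continuous_on_matrix_mult continuous_intros)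
  show "(\<lambda>x. f x ** g x) \<in> space M \<rightarrow> unitary_group"
    using measurable_space[OF assms(1)] measurable_space[OF assms(2)] by (auto intro: unitary_mult)
qed

lemma measurable_unitary_const: "A \<in> unitary_group \<Longrightarrow> (\<lambda>x. A) \<in> measurable M unitary_space"
  by (rule measurable_const) simp

lemma measurable_unitary_dagger:
  assumes "f \<in> measurable M unitary_space"
  shows "(\<lambda>x. dagger (f x)) \<in> measurable M unitary_space"
  unfolding unitary_space_def
proof (rule measurable_restrict_space2)
  have "continuous_on UNIV (dagger :: 'b cmat \<Rightarrow> _)" using continuous_on_dagger[OF continuous_on_id] by simp
  then show "(\<lambda>x. dagger (f x)) \<in> borel_measurable M"
    by (rule measurable_compose[OF assms measurable_unitary_continuous])
  show "(\<lambda>x. dagger (f x)) \<in> space M \<rightarrow> unitary_group"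
    using measurable_space[OF assms] by (auto intro: unitary_dagger)
qed

lemmas measurable_unitary_intros = measurable_unitary_mult measurable_unitary_const measurable_unitary_dagger

lemma measurable_unitary_ident: "(\<lambda>A. A) \<in> measurable unitary_space unitary_space" by simp

lemma measurable_unitary_conj:
  "V \<in> unitary_group \<Longrightarrow> (\<lambda>A. V ** A ** dagger V) \<in> measurable unitary_space unitary_space"
  by (intro measurable_unitary_intros measurable_unitary_ident unitary_dagger)

lemma unitarily_invariant_distr:
  assumes "unitarily_invariant M U" "V \<in> unitary_group"
  shows "distr (distr M unitary_space U) unitary_space (\<lambda>A. V ** A ** dagger V) = distr M unitary_space U"
  using assms by (subst distr_distr) (auto simp: unitarily_invariant_def comp_def intro: measurable_unitary_conj)

definition class_moment :: "'a measure \<Rightarrow> ('a \<Rightarrow> 'n::{finite,linorder} cmat) \<Rightarrow> nat \<Rightarrow> ('n \<Rightarrow> nat) \<Rightarrow> complex" where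
  "class_moment M U k s = (\<integral>\<xi>. cnj (det (U \<xi>)) ^ k * schur_mat s (U \<xi>) \<partial>M)"

lemma integrable_det_matpoly:
  assumes "prob_space M" "U \<in> measurable M unitary_space" "matpoly f"
  shows "integrable M (\<lambda>\<xi>. cnj (det (U \<xi>)) ^ k * f (U \<xi>))"
proof -
  interpret M: prob_space M by fact
  obtain B where "\<forall>A\<in>unitary_group. cmod (f A) \<le> B"
    using matpoly_bounded[OF assms(3)] by blast
  moreover have "(\<lambda>A. cnj (det A) ^ k * f A) \<in> borel_measurable unitary_space"
    by (intro measurable_unitary_continuous continuous_intros continuous_on_det_mat continuous_on_matpoly assms)
  ultimately show ?thesis using measurable_space[OF assms(2)]
    by (intro M.integrable_const_bound[where B = B] AE_I2 measurable_compose[OF assms(2)])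
      (auto simp: norm_mult norm_power unitary_det_norm)
qed

text \<open>The conjugate determinant is not a polynomial in the entries, so it is made part of the
  functional; it is invariant under conjugation and does not disturb the symmetry of the
  law.\<close>

lemma unitarily_invariant_functional:
  assumes M: "prob_space M" and U: "unitarily_invariant M U"
  shows "conj_invariant_functional (\<lambda>f. \<integral>\<xi>. cnj (det (U \<xi>)) ^ k * f (U \<xi>) \<partial>M)"
proof -
  have m: "U \<in> measurable M unitary_space" using U by (simp add: unitarily_invariant_def)
  note i = integrable_det_matpoly[OF M m]
  show ?thesis unfolding conj_invariant_functional_def
  proof (intro conjI allI impI ballI)
    fix f g :: "'b cmat \<Rightarrow> complex" assume "matpoly f" "matpoly g"
    then show "(\<integral>\<xi>. cnj (det (U \<xi>)) ^ k * (f (U \<xi>) + g (U \<xi>)) \<partial>M)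
        = (\<integral>\<xi>. cnj (det (U \<xi>)) ^ k * f (U \<xi>) \<partial>M) + (\<integral>\<xi>. cnj (det (U \<xi>)) ^ k * g (U \<xi>) \<partial>M)"
      by (simp add: distrib_left i)
  next
    fix c and f :: "'b cmat \<Rightarrow> complex" assume "matpoly f"
    then show "(\<integral>\<xi>. cnj (det (U \<xi>)) ^ k * (c * f (U \<xi>)) \<partial>M) = c * (\<integral>\<xi>. cnj (det (U \<xi>)) ^ k * f (U \<xi>) \<partial>M)"
      by (simp add: mult.left_commute[of _ c])
  next
    fix f g :: "'b cmat \<Rightarrow> complex" assume "\<forall>A\<in>unitary_group. f A = g A"
    then show "(\<integral>\<xi>. cnj (det (U \<xi>)) ^ k * f (U \<xi>) \<partial>M) = (\<integral>\<xi>. cnj (det (U \<xi>)) ^ k * g (U \<xi>) \<partial>M)"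
      using measurable_space[OF m] by (intro Bochner_Integration.integral_cong) auto
  next
    fix V :: "'b cmat" and f :: "'b cmat \<Rightarrow> complex" assume V: "V \<in> unitary_group" and f: "matpoly f"
    let ?F = "\<lambda>A. cnj (det A) ^ k * f A"
    have F: "?F \<in> borel_measurable unitary_space"
      by (intro measurable_unitary_continuous continuous_intros continuous_on_det_mat continuous_on_matpoly f)
    have "det (V ** A ** dagger V) = det (V ** dagger V) * det A" for A by (simp add: det_mul)
    then have d: "det (V ** A ** dagger V) = det A" for A using V by (simp add: unitary_group_def)
    have "(\<integral>\<xi>. cnj (det (U \<xi>)) ^ k * f (V ** U \<xi> ** dagger V) \<partial>M) = (\<integral>\<xi>. ?F (V ** U \<xi> ** dagger V) \<partial>M)"
      by (simp add: d)
    also have "\<dots> = (\<integral>A. ?F (V ** A ** dagger V) \<partial>distr M unitary_space U)"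
      by (rule integral_distr[symmetric, OF m]) (rule measurable_compose[OF measurable_unitary_conj[OF V] F])
    also have "\<dots> = (\<integral>A. ?F A \<partial>distr (distr M unitary_space U) unitary_space (\<lambda>A. V ** A ** dagger V))"
      by (rule integral_distr[symmetric]) (use measurable_unitary_conj[OF V] F in auto)
    also have "\<dots> = (\<integral>\<xi>. ?F (U \<xi>) \<partial>M)"
      unfolding unitarily_invariant_distr[OF U V] by (rule integral_distr[OF m F])
    finally show "(\<integral>\<xi>. cnj (det (U \<xi>)) ^ k * f (V ** U \<xi> ** dagger V) \<partial>M) = (\<integral>\<xi>. cnj (det (U \<xi>)) ^ k * f (U \<xi>) \<partial>M)" .
  qed
qed

text \<open>Independence makes the joint law a product, which is invariant under simultaneous
  conjugation of both factors, and conjugation is multiplicative. For the moments, Fubini fixes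
  \<open>U1\<close> at a unitary A, and the functional equation for \<open>U2\<close> splits off the
  value at A.\<close>

lemma
  assumes M: "prob_space M" and U1: "unitarily_invariant M U1" and U2: "unitarily_invariant M U2"
    and indep: "prob_space.indep_var M unitary_space U1 unitary_space U2"
  shows unitarily_invariant_mult: "unitarily_invariant M (\<lambda>\<xi>. U1 \<xi> ** U2 \<xi>)"
    and class_moment_mult: "class_moment M (\<lambda>\<xi>. U1 \<xi> ** U2 \<xi>) k s * schur_mat s (mat 1)
      = class_moment M U1 k s * class_moment M U2 k s"
proof -
  interpret M: prob_space M by fact
  let ?S = "unitary_space :: 'b cmat measure"
  let ?D1 = "distr M ?S U1" and ?D2 = "distr M ?S U2"
  have m [measurable]: "U1 \<in> measurable M ?S" "U2 \<in> measurable M ?S"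
    using U1 U2 by (auto simp: unitarily_invariant_def)
  interpret D1: prob_space ?D1 by (rule M.prob_space_distr[OF m(1)])
  interpret D2: prob_space ?D2 by (rule M.prob_space_distr[OF m(2)])
  interpret P: pair_sigma_finite ?D1 ?D2 ..
  have joint: "distr M (?S \<Otimes>\<^sub>M ?S) (\<lambda>\<xi>. (U1 \<xi>, U2 \<xi>)) = ?D1 \<Otimes>\<^sub>M ?D2"
    using indep by (simp add: M.indep_var_distribution_eq)
  have mp: "(\<lambda>\<xi>. (U1 \<xi>, U2 \<xi>)) \<in> measurable M (?S \<Otimes>\<^sub>M ?S)" by measurable
  have mult: "(\<lambda>x. fst x ** snd x) \<in> measurable (?S \<Otimes>\<^sub>M ?S) ?S"
    by (rule measurable_unitary_mult) auto
  show "unitarily_invariant M (\<lambda>\<xi>. U1 \<xi> ** U2 \<xi>)"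
    unfolding unitarily_invariant_def
  proof (intro conjI ballI)
    show "(\<lambda>\<xi>. U1 \<xi> ** U2 \<xi>) \<in> measurable M ?S" by (rule measurable_unitary_mult[OF m])
    fix V :: "'b cmat" assume V: "V \<in> unitary_group"
    let ?c = "\<lambda>A. V ** A ** dagger V"
    have VV: "dagger V ** V = mat 1" using V by (simp add: unitary_group_def)
    have split: "?c (A ** B) = ?c A ** ?c B" for A B
    proof -
      have "?c A ** ?c B = V ** A ** (dagger V ** V) ** B ** dagger V" by (simp add: matrix_mul_assoc)
      then show ?thesis by (simp add: VV matrix_mul_assoc)
    qed
    have mc: "?c \<in> measurable ?S ?S" by (rule measurable_unitary_conj[OF V])
    have mcc: "(\<lambda>(A, B). (?c A, ?c B)) \<in> measurable (?S \<Otimes>\<^sub>M ?S) (?S \<Otimes>\<^sub>M ?S)"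
      using mc by measurable
    have "?D1 \<Otimes>\<^sub>M ?D2 = distr ?D1 ?S ?c \<Otimes>\<^sub>M distr ?D2 ?S ?c"
      by (simp add: unitarily_invariant_distr[OF U1 V] unitarily_invariant_distr[OF U2 V])
    also have "\<dots> = distr (?D1 \<Otimes>\<^sub>M ?D2) (?S \<Otimes>\<^sub>M ?S) (\<lambda>(A, B). (?c A, ?c B))"
    proof (rule pair_measure_distr)
      interpret X: prob_space "distr ?D2 ?S ?c" by (rule D2.prob_space_distr) (use mc in simp)
      show "sigma_finite_measure (distr ?D2 ?S ?c)" by unfold_locales
    qed (use mc in auto)
    finally have inv: "distr (?D1 \<Otimes>\<^sub>M ?D2) (?S \<Otimes>\<^sub>M ?S) (\<lambda>(A, B). (?c A, ?c B)) = ?D1 \<Otimes>\<^sub>M ?D2" ..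
    have "distr M ?S (\<lambda>\<xi>. ?c (U1 \<xi> ** U2 \<xi>))
        = distr (distr (distr M (?S \<Otimes>\<^sub>M ?S) (\<lambda>\<xi>. (U1 \<xi>, U2 \<xi>))) (?S \<Otimes>\<^sub>M ?S) (\<lambda>(A, B). (?c A, ?c B))) ?S (\<lambda>x. fst x ** snd x)"
      using mult mcc mp by (simp add: distr_distr comp_def split)
    also have "\<dots> = distr (distr M (?S \<Otimes>\<^sub>M ?S) (\<lambda>\<xi>. (U1 \<xi>, U2 \<xi>))) ?S (\<lambda>x. fst x ** snd x)"
      by (simp add: joint inv)
    also have "\<dots> = distr M ?S (\<lambda>\<xi>. U1 \<xi> ** U2 \<xi>)"
      using mult mp by (simp add: distr_distr comp_def)
    finally show "distr M ?S (\<lambda>\<xi>. ?c (U1 \<xi> ** U2 \<xi>)) = distr M ?S (\<lambda>\<xi>. U1 \<xi> ** U2 \<xi>)" .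
  qed
  define F where "F A = cnj (det A) ^ k * schur_mat s A" for A
  have F: "F \<in> borel_measurable ?S" unfolding F_def[abs_def]
    by (intro measurable_unitary_continuous continuous_intros continuous_on_det_mat continuous_on_matpoly matpoly_schur_mat)
  have int: "integrable (?D1 \<Otimes>\<^sub>M ?D2) (\<lambda>x. F (fst x ** snd x))"
  proof -
    have "integrable M (\<lambda>\<xi>. F (U1 \<xi> ** U2 \<xi>))"
      unfolding F_def by (rule integrable_det_matpoly[OF M measurable_unitary_mult[OF m] matpoly_schur_mat])
    then show ?thesis unfolding joint[symmetric]
      by (subst integrable_distr_eq[OF mp measurable_compose[OF mult F]]) simp
  qed
  have inner: "(\<integral>B. F (A ** B) \<partial>?D2) * schur_mat s (mat 1) = F A * class_moment M U2 k s" if A: "A \<in> unitary_group" for A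
  proof -
    have "(\<integral>B. F (A ** B) \<partial>?D2) = (\<integral>\<xi>. F (A ** U2 \<xi>) \<partial>M)"
      by (rule integral_distr[OF m(2)])
        (rule measurable_compose[OF measurable_unitary_mult[OF measurable_unitary_const[OF A] measurable_unitary_ident] F])
    also have "\<dots> = cnj (det A) ^ k * (\<integral>\<xi>. cnj (det (U2 \<xi>)) ^ k * schur_mat s (A ** U2 \<xi>) \<partial>M)"
      by (simp add: F_def det_mul power_mult_distrib mult.assoc)
    finally show ?thesis
      using average_schur_mat[OF unitarily_invariant_functional[OF M U2, of k] A, of s]
      by (simp add: F_def class_moment_def mult_ac)
  qed
  have "class_moment M (\<lambda>\<xi>. U1 \<xi> ** U2 \<xi>) k s = (\<integral>x. F (fst x ** snd x) \<partial>distr M (?S \<Otimes>\<^sub>M ?S) (\<lambda>\<xi>. (U1 \<xi>, U2 \<xi>)))"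
    by (subst integral_distr[OF mp measurable_compose[OF mult F]]) (simp add: class_moment_def F_def)
  also have "\<dots> = (\<integral>A. (\<integral>B. F (A ** B) \<partial>?D2) \<partial>?D1)"
    unfolding joint using P.integral_fst'[OF int] by simp
  finally have "class_moment M (\<lambda>\<xi>. U1 \<xi> ** U2 \<xi>) k s * schur_mat s (mat 1)
      = (\<integral>A. (\<integral>B. F (A ** B) \<partial>?D2) * schur_mat s (mat 1) \<partial>?D1)" by simp
  also have "\<dots> = (\<integral>A. F A * class_moment M U2 k s \<partial>?D1)"
    by (rule Bochner_Integration.integral_cong) (auto simp: inner)
  also have "\<dots> = (\<integral>A. F A \<partial>?D1) * class_moment M U2 k s" by simp
  also have "(\<integral>A. F A \<partial>?D1) = class_moment M U1 k s"
    by (subst integral_distr[OF m(1) F]) (simp add: class_moment_def F_def)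
  finally show "class_moment M (\<lambda>\<xi>. U1 \<xi> ** U2 \<xi>) k s * schur_mat s (mat 1)
      = class_moment M U1 k s * class_moment M U2 k s" .
qed

text \<open>Conjugating by W replaces V by \<open>W ** V\<close>, which has the same law by left
  invariance.\<close>

lemma haar_conjugate:
  fixes U2 :: "'n::{finite,linorder} cmat"
  assumes M: "prob_space M" and U2: "U2 \<in> unitary_group" and V: "haar_distributed M V"
    and indep: "prob_space.indep_var M unitary_space U1 unitary_space V"
  shows "unitarily_invariant M (\<lambda>\<xi>. V \<xi> ** U2 ** dagger (V \<xi>))"
    and "prob_space.indep_var M unitary_space U1 unitary_space (\<lambda>\<xi>. V \<xi> ** U2 ** dagger (V \<xi>))"
proof -
  interpret M: prob_space M by fact
  let ?S = "unitary_space :: 'n cmat measure"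
  let ?g = "\<lambda>W. W ** U2 ** dagger W"
  have mV: "V \<in> measurable M ?S" using V by (simp add: haar_distributed_def)
  have g: "?g \<in> measurable ?S ?S"
    by (intro measurable_unitary_intros measurable_unitary_ident U2)
  show "unitarily_invariant M (\<lambda>\<xi>. ?g (V \<xi>))"
    unfolding unitarily_invariant_def
  proof (intro conjI ballI)
    show "(\<lambda>\<xi>. ?g (V \<xi>)) \<in> measurable M ?S" by (rule measurable_compose[OF mV g])
    fix W :: "'n cmat" assume W: "W \<in> unitary_group"
    have mW: "(\<lambda>\<xi>. W ** V \<xi>) \<in> measurable M ?S" by (intro measurable_unitary_intros mV W)
    have "distr M ?S (\<lambda>\<xi>. W ** ?g (V \<xi>) ** dagger W) = distr (distr M ?S (\<lambda>\<xi>. W ** V \<xi>)) ?S ?g"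
      using mW g by (simp add: distr_distr comp_def dagger_mult matrix_mul_assoc)
    also have "\<dots> = distr (distr M ?S V) ?S ?g" using V W by (simp add: haar_distributed_def)
    also have "\<dots> = distr M ?S (\<lambda>\<xi>. ?g (V \<xi>))" using mV g by (simp add: distr_distr comp_def)
    finally show "distr M ?S (\<lambda>\<xi>. W ** ?g (V \<xi>) ** dagger W) = distr M ?S (\<lambda>\<xi>. ?g (V \<xi>))" .
  qed
  show "M.indep_var ?S U1 ?S (\<lambda>\<xi>. ?g (V \<xi>))"
    using M.indep_var_compose[OF indep measurable_unitary_ident g] by (simp add: comp_def)
qed

subsection \<open>Convolution on the circle\<close>

lemma measurable_cis_circle_haar [measurable]: "cis \<in> measurable borel circle_haar"
  using measurable_cis_circle by (simp add: measurable_cong_sets[OF refl sets_circle_haar])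

section \<open>Rotations and reflections of the circle\<close>

lemma nn_integral_circle_haar:
  assumes "f \<in> borel_measurable circle_haar"
  shows "(\<integral>\<^sup>+z. f z \<partial>circle_haar) = (\<integral>\<^sup>+\<theta>. f (cis \<theta>) * indicator {0..2 * pi} \<theta> \<partial>lborel) / ennreal (2 * pi)"
proof -
  have m: "(\<lambda>\<theta>. f (cis \<theta>)) \<in> borel_measurable borel" using assms by measurable
  have "f \<in> borel_measurable (restrict_space borel circle)"
    using assms by (simp add: measurable_cong_sets[OF sets_circle_haar refl])
  then have "(\<integral>\<^sup>+z. f z \<partial>circle_haar) = (\<integral>\<^sup>+\<theta>. f (cis \<theta>) \<partial>uniform_measure lborel {0..2 * pi})"
    unfolding circle_haar_def using measurable_cis_circle by (subst nn_integral_distr) auto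
  also have "\<dots> = (\<integral>\<^sup>+\<theta>. f (cis \<theta>) * indicator {0..2 * pi} \<theta> \<partial>lborel) / ennreal (2 * pi)"
    using m by (subst nn_integral_uniform_measure) auto
  finally show ?thesis .
qed

lemma nn_integral_period:
  assumes [measurable]: "g \<in> borel_measurable borel" and per: "\<And>x. g (x + 2 * pi) = g x" and a: "0 \<le> a" "a < 2 * pi"
  shows "(\<integral>\<^sup>+x. g (a + x) * indicator {0..<2 * pi} x \<partial>lborel) = (\<integral>\<^sup>+x. g x * indicator {0..<2 * pi} x \<partial>lborel)"
proof -
  have "(\<integral>\<^sup>+x. g x * indicator {2 * pi..<2 * pi + a} x \<partial>lborel)
      = (\<integral>\<^sup>+x. g (2 * pi + 1 * x) * indicator {2 * pi..<2 * pi + a} (2 * pi + 1 * x) \<partial>lborel)"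
    using nn_integral_real_affine[of "\<lambda>x. g x * indicator {2 * pi..<2 * pi + a} x" 1 "2 * pi"] by simp
  also have "\<dots> = (\<integral>\<^sup>+x. g x * indicator {0..<a} x \<partial>lborel)"
    by (intro nn_integral_cong) (use per in \<open>auto simp: indicator_def add.commute\<close>)
  finally have 1: "(\<integral>\<^sup>+x. g x * indicator {2 * pi..<2 * pi + a} x \<partial>lborel) = (\<integral>\<^sup>+x. g x * indicator {0..<a} x \<partial>lborel)" .
  have "(\<integral>\<^sup>+x. g x * indicator {a..<2 * pi + a} x \<partial>lborel)
      = (\<integral>\<^sup>+x. g (a + 1 * x) * indicator {a..<2 * pi + a} (a + 1 * x) \<partial>lborel)"
    using nn_integral_real_affine[of "\<lambda>x. g x * indicator {a..<2 * pi + a} x" 1 a] by simp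
  also have "\<dots> = (\<integral>\<^sup>+x. g (a + x) * indicator {0..<2 * pi} x \<partial>lborel)"
    by (intro nn_integral_cong) (auto simp: indicator_def)
  finally have "(\<integral>\<^sup>+x. g (a + x) * indicator {0..<2 * pi} x \<partial>lborel) = (\<integral>\<^sup>+x. g x * indicator {a..<2 * pi + a} x \<partial>lborel)" ..
  also have "\<dots> = (\<integral>\<^sup>+x. g x * indicator {a..<2 * pi} x + g x * indicator {2 * pi..<2 * pi + a} x \<partial>lborel)"
    using a by (intro nn_integral_cong) (auto simp: indicator_def)
  also have "\<dots> = (\<integral>\<^sup>+x. g x * indicator {a..<2 * pi} x \<partial>lborel) + (\<integral>\<^sup>+x. g x * indicator {0..<a} x \<partial>lborel)"
    by (subst nn_integral_add) (simp_all add: 1)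
  also have "\<dots> = (\<integral>\<^sup>+x. g x * indicator {a..<2 * pi} x + g x * indicator {0..<a} x \<partial>lborel)"
    by (subst nn_integral_add) simp_all
  also have "\<dots> = (\<integral>\<^sup>+x. g x * indicator {0..<2 * pi} x \<partial>lborel)"
    using a by (intro nn_integral_cong) (auto simp: indicator_def)
  finally show ?thesis .
qed

lemma nn_integral_half_open:
  "(\<integral>\<^sup>+x. g x * indicator {a..b::real} x \<partial>lborel) = (\<integral>\<^sup>+x. g x * indicator {a..<b} x \<partial>lborel)"
  by (rule nn_integral_cong_AE) (use AE_lborel_singleton[of b] in \<open>auto simp: indicator_def elim!: eventually_mono\<close>)

lemma measurable_circle_haarI:
  "f \<in> borel_measurable M \<Longrightarrow> (\<And>x. x \<in> space M \<Longrightarrow> f x \<in> circle) \<Longrightarrow> f \<in> measurable M circle_haar"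
  by (subst measurable_cong_sets[OF refl sets_circle_haar]) (rule measurable_restrict_space2, auto)

lemma measurable_circle_haar_borel: "f \<in> measurable M circle_haar \<Longrightarrow> f \<in> borel_measurable M"
  by (rule measurable_compose[OF _ measurable_circle_borel])

lemma measurable_circle_mult:
  "f \<in> measurable M circle_haar \<Longrightarrow> g \<in> measurable M circle_haar \<Longrightarrow> (\<lambda>x. f x * g x) \<in> measurable M circle_haar"
  using measurable_space[of f M circle_haar] measurable_space[of g M circle_haar]
  by (intro measurable_circle_haarI[OF borel_measurable_times[OF measurable_circle_haar_borel measurable_circle_haar_borel]])
    (auto simp: norm_mult)

lemma measurable_circle_divide:
  "f \<in> measurable M circle_haar \<Longrightarrow> g \<in> measurable M circle_haar \<Longrightarrow> (\<lambda>x. f x / g x) \<in> measurable M circle_haar"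
  using measurable_space[of f M circle_haar] measurable_space[of g M circle_haar]
  by (intro measurable_circle_haarI[OF borel_measurable_divide[OF measurable_circle_haar_borel measurable_circle_haar_borel]])
    (auto simp: norm_divide)

lemma measurable_circle_const: "u \<in> circle \<Longrightarrow> (\<lambda>x. u) \<in> measurable M circle_haar"
  by (rule measurable_const) simp

lemma measurable_circle_ident: "(\<lambda>z. z) \<in> measurable circle_haar circle_haar" by simp

lemma
  assumes "u \<in> circle"
  shows measurable_circle_rotate: "(\<lambda>z. u * z) \<in> measurable circle_haar circle_haar"
    and measurable_circle_reflect: "(\<lambda>z. u / z) \<in> measurable circle_haar circle_haar"
  by (rule measurable_circle_mult measurable_circle_divide; rule measurable_circle_const[OF assms] measurable_circle_ident)+

lemma circle_cis:
  assumes "u \<in> circle"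
  obtains a where "0 \<le> a" "a < 2 * pi" "u = cis a"
proof (rule that)
  show "0 \<le> Arg2pi u" "Arg2pi u < 2 * pi" using Arg2pi[of u] by auto
  show "u = cis (Arg2pi u)" using Arg2pi_eq[of u] assms by (simp add: cis_conv_exp)
qed

lemma distr_circle_haarI:
  assumes h: "h \<in> measurable circle_haar circle_haar"
    and eq: "\<And>f::complex \<Rightarrow> ennreal. f \<in> borel_measurable circle_haar \<Longrightarrow> (\<integral>\<^sup>+z. f (h z) \<partial>circle_haar) = (\<integral>\<^sup>+z. f z \<partial>circle_haar)"
  shows "distr circle_haar circle_haar h = circle_haar"
proof (rule measure_eqI)
  fix A assume "A \<in> sets (distr circle_haar circle_haar h)"
  then have A: "A \<in> sets circle_haar" by simp
  have "emeasure (distr circle_haar circle_haar h) A = (\<integral>\<^sup>+z. indicator A z \<partial>distr circle_haar circle_haar h)"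
    using A by simp
  also have "\<dots> = (\<integral>\<^sup>+z. indicator A (h z) \<partial>circle_haar)" using A h by (subst nn_integral_distr) auto
  also have "\<dots> = emeasure circle_haar A" using A by (simp add: eq)
  finally show "emeasure (distr circle_haar circle_haar h) A = emeasure circle_haar A" .
qed simp

lemma circle_haar_rotate:
  assumes u: "u \<in> circle"
  shows "distr circle_haar circle_haar (\<lambda>z. u * z) = circle_haar"
proof (rule distr_circle_haarI)
  note [measurable] = measurable_circle_rotate[OF u]
  show "(\<lambda>z. u * z) \<in> measurable circle_haar circle_haar" by measurable
  fix f :: "complex \<Rightarrow> ennreal" assume [measurable]: "f \<in> borel_measurable circle_haar"
  obtain a where a: "0 \<le> a" "a < 2 * pi" "u = cis a" using circle_cis[OF u] .
  have m: "(\<lambda>\<theta>. f (cis \<theta>)) \<in> borel_measurable borel" by measurable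
  have per: "cis (x + 2 * pi) = cis x" for x by (simp add: complex_eq_iff)
  have "(\<integral>\<^sup>+\<theta>. f (u * cis \<theta>) * indicator {0..2 * pi} \<theta> \<partial>lborel) = (\<integral>\<^sup>+\<theta>. f (cis \<theta>) * indicator {0..2 * pi} \<theta> \<partial>lborel)"
    unfolding nn_integral_half_open using nn_integral_period[OF m _ a(1,2)]
    by (simp add: a(3) cis_mult per)
  then show "(\<integral>\<^sup>+z. f (u * z) \<partial>circle_haar) = (\<integral>\<^sup>+z. f z \<partial>circle_haar)"
    by (subst (1 2) nn_integral_circle_haar) (simp_all)
qed

lemma circle_haar_inverse: "distr circle_haar circle_haar (\<lambda>z. 1 / z) = circle_haar"
proof (rule distr_circle_haarI)
  have [measurable]: "(\<lambda>z::complex. 1 / z) \<in> measurable circle_haar circle_haar"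
    by (rule measurable_circle_reflect) simp
  show "(\<lambda>z::complex. 1 / z) \<in> measurable circle_haar circle_haar" by measurable
  fix f :: "complex \<Rightarrow> ennreal" assume [measurable]: "f \<in> borel_measurable circle_haar"
  have m: "(\<lambda>\<theta>. f (cis \<theta>)) \<in> borel_measurable borel" by measurable
  have i: "1 / cis \<theta> = cis (2 * pi + -1 * \<theta>)" for \<theta>
    using cis_divide[of "2 * pi" \<theta>] by simp
  have "(\<integral>\<^sup>+\<theta>. f (cis \<theta>) * indicator {0..2 * pi} \<theta> \<partial>lborel)
      = (\<integral>\<^sup>+\<theta>. f (cis (2 * pi + -1 * \<theta>)) * indicator {0..2 * pi} (2 * pi + -1 * \<theta>) \<partial>lborel)"
    using nn_integral_real_affine[of "\<lambda>\<theta>. f (cis \<theta>) * indicator {0..2 * pi} \<theta>" "-1" "2 * pi"] m by simp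
  also have "\<dots> = (\<integral>\<^sup>+\<theta>. f (1 / cis \<theta>) * indicator {0..2 * pi} \<theta> \<partial>lborel)"
    unfolding i by (intro nn_integral_cong) (auto simp: indicator_def)
  finally have e: "(\<integral>\<^sup>+\<theta>. f (1 / cis \<theta>) * indicator {0..2 * pi} \<theta> \<partial>lborel) = (\<integral>\<^sup>+\<theta>. f (cis \<theta>) * indicator {0..2 * pi} \<theta> \<partial>lborel)" ..
  have "(\<lambda>z. f (1 / z)) \<in> borel_measurable circle_haar" by measurable
  then show "(\<integral>\<^sup>+z. f (1 / z) \<partial>circle_haar) = (\<integral>\<^sup>+z. f z \<partial>circle_haar)"
    by (simp add: nn_integral_circle_haar e)
qed

lemma circle_haar_reflect:
  assumes u: "u \<in> circle"
  shows "distr circle_haar circle_haar (\<lambda>z. u / z) = circle_haar"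
proof -
  note [measurable] = measurable_circle_rotate[OF u]
  have [measurable]: "(\<lambda>z::complex. 1 / z) \<in> measurable circle_haar circle_haar"
    by (rule measurable_circle_reflect) simp
  have "distr circle_haar circle_haar (\<lambda>z. u / z) = distr (distr circle_haar circle_haar (\<lambda>z. 1 / z)) circle_haar (\<lambda>z. u * z)"
    by (subst distr_distr) (auto simp: comp_def)
  then show ?thesis by (simp add: circle_haar_inverse circle_haar_rotate[OF u])
qed

lemma
  fixes f :: "complex \<Rightarrow> complex"
  assumes u: "u \<in> circle" and f: "f \<in> borel_measurable circle_haar"
  shows circle_integral_rotate: "(\<integral>z. f (u * z) \<partial>circle_haar) = (\<integral>z. f z \<partial>circle_haar)"
    and circle_integral_reflect: "(\<integral>z. f (u / z) \<partial>circle_haar) = (\<integral>z. f z \<partial>circle_haar)"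
    and circle_integrable_rotate: "integrable circle_haar (\<lambda>z. f (u * z)) \<longleftrightarrow> integrable circle_haar f"
    and circle_integrable_reflect: "integrable circle_haar (\<lambda>z. f (u / z)) \<longleftrightarrow> integrable circle_haar f"
proof -
  note h = measurable_circle_rotate[OF u] measurable_circle_reflect[OF u]
  show "(\<integral>z. f (u * z) \<partial>circle_haar) = (\<integral>z. f z \<partial>circle_haar)"
    using integral_distr[OF h(1) f] by (simp add: circle_haar_rotate[OF u])
  show "(\<integral>z. f (u / z) \<partial>circle_haar) = (\<integral>z. f z \<partial>circle_haar)"
    using integral_distr[OF h(2) f] by (simp add: circle_haar_reflect[OF u])
  show "integrable circle_haar (\<lambda>z. f (u * z)) \<longleftrightarrow> integrable circle_haar f"
    using integrable_distr_eq[OF h(1) f] by (simp add: circle_haar_rotate[OF u])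
  show "integrable circle_haar (\<lambda>z. f (u / z)) \<longleftrightarrow> integrable circle_haar f"
    using integrable_distr_eq[OF h(2) f] by (simp add: circle_haar_reflect[OF u])
qed

lemma
  assumes u: "u \<in> circle" and P: "AE z in circle_haar. P z"
  shows circle_AE_rotate: "AE z in circle_haar. P (u * z)"
    and circle_AE_reflect: "AE z in circle_haar. P (u / z)"
proof -
  note h = measurable_circle_rotate[OF u] measurable_circle_reflect[OF u]
  show "AE z in circle_haar. P (u * z)"
    by (rule AE_distrD[OF h(1)]) (subst circle_haar_rotate[OF u], rule P)
  show "AE z in circle_haar. P (u / z)"
    by (rule AE_distrD[OF h(2)]) (subst circle_haar_reflect[OF u], rule P)
qed

lemma circle_inverse: "x \<in> circle \<Longrightarrow> 1 / x \<in> circle"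
  by (simp add: norm_divide)

lemma circle_divide: "x \<in> circle \<Longrightarrow> y \<in> circle \<Longrightarrow> x / y \<in> circle"
  by (simp add: norm_divide)

section \<open>Integrability, Mellin transform and continuity of convolutions\<close>

lemma circle_continuous_bounded:
  fixes f :: "complex \<Rightarrow> complex"
  assumes "continuous_on circle f"
  obtains B where "\<And>z. z \<in> circle \<Longrightarrow> cmod (f z) \<le> B"
proof -
  have "compact (f ` circle)" by (rule compact_continuous_image[OF assms compact_sphere])
  then have "bounded (f ` circle)" by (rule compact_imp_bounded)
  then obtain B where "\<forall>x\<in>f ` circle. norm x \<le> B" unfolding bounded_iff by blast
  then show thesis using that by blast
qed

lemma integrable_circle_continuous:
  fixes f :: "complex \<Rightarrow> complex"
  assumes "continuous_on circle f"
  shows "integrable circle_haar f"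
proof -
  obtain B where "\<And>z. z \<in> circle \<Longrightarrow> cmod (f z) \<le> B"
    using circle_continuous_bounded[OF assms] by blast
  then show ?thesis
    by (intro circle_haar.integrable_const_bound[where B = B] borel_measurable_circle_continuous assms AE_I2) auto
qed

lemma integrable_circle_continuous_mult:
  fixes \<phi> \<psi> :: "complex \<Rightarrow> complex"
  assumes "continuous_on circle \<phi>" "integrable circle_haar \<psi>"
  shows "integrable circle_haar (\<lambda>z. \<phi> z * \<psi> z)"
proof -
  obtain B where "\<And>z. z \<in> circle \<Longrightarrow> cmod (\<phi> z) \<le> B"
    using circle_continuous_bounded[OF assms(1)] by blast
  then show ?thesis
    by (intro integrable_circle_bounded_mult borel_measurable_circle_continuous assms) auto
qed

lemma continuous_on_circle_powi: "continuous_on circle (\<lambda>z. z powi s)"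
  by (rule continuous_on_power_int) (auto intro!: continuous_intros)

lemma integrable_circle_powi: "integrable circle_haar f \<Longrightarrow> integrable circle_haar (\<lambda>z. z powi s * f z)"
  by (rule integrable_circle_continuous_mult[OF continuous_on_circle_powi])

lemma
  assumes f: "integrable circle_haar f" and g: "integrable circle_haar g"
  shows integrable_circle_conv: "integrable circle_haar (circle_conv f g)"
    and integral_circle_conv: "(\<integral>z. circle_conv f g z \<partial>circle_haar) = (\<integral>z. f z \<partial>circle_haar) * (\<integral>z. g z \<partial>circle_haar)"
proof -
  interpret P: pair_sigma_finite circle_haar circle_haar by unfold_locales
  have [measurable]: "f \<in> borel_measurable circle_haar" "g \<in> borel_measurable circle_haar" using f g by auto
  let ?F = "\<lambda>(t, z). f (z / t) * g t"
  have [measurable]: "(\<lambda>x. snd x / fst x) \<in> measurable (circle_haar \<Otimes>\<^sub>M circle_haar) circle_haar"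
    by (rule measurable_circle_divide) auto
  have mF: "?F \<in> borel_measurable (circle_haar \<Otimes>\<^sub>M circle_haar)" unfolding case_prod_unfold by measurable
  have in1: "(\<integral>z. f (z / t) \<partial>circle_haar) = (\<integral>z. f z \<partial>circle_haar)" if "t \<in> circle" for t
    using circle_integral_rotate[OF circle_inverse[OF that], of f] by simp
  have in2: "integrable circle_haar (\<lambda>z. f (z / t))" if "t \<in> circle" for t
    using circle_integrable_rotate[OF circle_inverse[OF that], of f] f by simp
  have in3: "(\<integral>z. cmod (f (z / t)) \<partial>circle_haar) = (\<integral>z. cmod (f z) \<partial>circle_haar)" if "t \<in> circle" for t
    using circle_integral_rotate[OF circle_inverse[OF that], of "\<lambda>z. of_real (cmod (f z))"]
    by (simp del: of_real_eq_iff add: integral_complex_of_real) (simp add: integral_complex_of_real)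
  have iF: "integrable (circle_haar \<Otimes>\<^sub>M circle_haar) ?F"
  proof (rule P.Fubini_integrable[OF mF])
    have "integrable circle_haar (\<lambda>t. (\<integral>z. cmod (f z) \<partial>circle_haar) * cmod (g t))" using g by simp
    then show "integrable circle_haar (\<lambda>t. \<integral>z. norm (?F (t, z)) \<partial>circle_haar)"
      by (rule iffD2[OF Bochner_Integration.integrable_cong, OF refl, rotated])
        (simp add: norm_mult in3)
    show "AE t in circle_haar. integrable circle_haar (\<lambda>z. ?F (t, z))"
      using in2 by (intro AE_I2) auto
  qed
  show "integrable circle_haar (circle_conv f g)"
    using P.integrable_snd[OF iF] by (simp add: circle_conv_def[abs_def])
  have "(\<integral>z. circle_conv f g z \<partial>circle_haar) = (\<integral>t. (\<integral>z. f (z / t) * g t \<partial>circle_haar) \<partial>circle_haar)"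
    using P.Fubini_integral[OF iF] by (simp add: circle_conv_def[abs_def])
  also have "\<dots> = (\<integral>t. (\<integral>z. f z \<partial>circle_haar) * g t \<partial>circle_haar)"
    by (rule Bochner_Integration.integral_cong) (auto simp: in1)
  finally show "(\<integral>z. circle_conv f g z \<partial>circle_haar) = (\<integral>z. f z \<partial>circle_haar) * (\<integral>z. g z \<partial>circle_haar)" by simp
qed

lemma mellin_circle_conv:
  assumes "integrable circle_haar f" "integrable circle_haar g"
  shows "mellin (circle_conv f g) s = mellin f s * mellin g s"
proof -
  have "z powi s * circle_conv f g z = circle_conv (\<lambda>z. z powi s * f z) (\<lambda>z. z powi s * g z) z" if "z \<in> circle" for z
  proof -
    have "z powi s * circle_conv f g z = (\<integral>t. z powi s * (f (z / t) * g t) \<partial>circle_haar)"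
      by (simp add: circle_conv_def)
    also have "\<dots> = circle_conv (\<lambda>z. z powi s * f z) (\<lambda>z. z powi s * g z) z"
      unfolding circle_conv_def
      by (rule Bochner_Integration.integral_cong) (auto simp: power_int_divide_distrib)
    finally show ?thesis .
  qed
  then have "mellin (circle_conv f g) s = (\<integral>z. circle_conv (\<lambda>z. z powi s * f z) (\<lambda>z. z powi s * g z) z \<partial>circle_haar)"
    unfolding mellin_def by (intro Bochner_Integration.integral_cong) auto
  then show ?thesis
    by (simp add: integral_circle_conv integrable_circle_powi assms mellin_def)
qed

lemma circle_conv_commute:
  assumes "f \<in> borel_measurable circle_haar" "g \<in> borel_measurable circle_haar" "z \<in> circle"
  shows "circle_conv f g z = circle_conv g f z"
proof -
  note [measurable] = assms(1,2) measurable_circle_reflect[OF assms(3)]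
  have "circle_conv f g z = (\<integral>t. f (z / (z / t)) * g (z / t) \<partial>circle_haar)"
    unfolding circle_conv_def
    by (rule circle_integral_reflect[OF assms(3), of "\<lambda>t. f (z / t) * g t", symmetric]) measurable
  also have "\<dots> = circle_conv g f z"
    unfolding circle_conv_def using assms(3) by (intro Bochner_Integration.integral_cong) auto
  finally show ?thesis .
qed

text \<open>The factor z^(N-1) is a character: (z/t)^(N-1) t^(N-1) = z^(N-1), so the reflection
  symmetries of both factors combine under the integral.\<close>

lemma circle_conv_L1_cyclic:
  assumes "f \<in> L1_cyclic N" "g \<in> L1_cyclic N"
  shows "circle_conv f g \<in> L1_cyclic N"
proof -
  have f: "integrable circle_haar f" "AE z in circle_haar. cnj (f z) = z ^ (N - 1) * f z"
    and g: "integrable circle_haar g" "AE z in circle_haar. cnj (g z) = z ^ (N - 1) * g z"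
    using assms by (auto simp: L1_cyclic_def)
  have [measurable]: "f \<in> borel_measurable circle_haar" "g \<in> borel_measurable circle_haar" using f g by auto
  have "cnj (circle_conv f g z) = z ^ (N - 1) * circle_conv f g z" if z: "z \<in> circle" for z
  proof -
    note [measurable] = measurable_circle_reflect[OF z]
    have "cnj (circle_conv f g z) = (\<integral>t. cnj (f (z / t) * g t) \<partial>circle_haar)"
      unfolding circle_conv_def by (rule Bochner_Integration.integral_cnj[symmetric])
    also have "\<dots> = (\<integral>t. z ^ (N - 1) * (f (z / t) * g t) \<partial>circle_haar)"
    proof (rule integral_cong_AE)
      show "AE t in circle_haar. cnj (f (z / t) * g t) = z ^ (N - 1) * (f (z / t) * g t)"
        using circle_AE_reflect[OF z f(2)] g(2) AE_space
        by eventually_elim (auto simp: power_divide)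
      show m: "(\<lambda>t. z ^ (N - 1) * (f (z / t) * g t)) \<in> borel_measurable circle_haar" by measurable
      have "(\<lambda>t. f (z / t) * g t) \<in> borel_measurable circle_haar" by measurable
      then show "(\<lambda>t. cnj (f (z / t) * g t)) \<in> borel_measurable circle_haar"
        by (rule measurable_compose) (intro borel_measurable_continuous_onI continuous_intros)
    qed
    finally show ?thesis by (simp add: circle_conv_def)
  qed
  then show ?thesis
    unfolding L1_cyclic_def using integrable_circle_conv[OF f(1) g(1)] by (auto intro!: AE_I2)
qed

text \<open>After commuting the factors, the variable z occurs in the continuous one only, and
  dominated convergence applies.\<close>

lemma continuous_on_circle_conv:
  assumes f: "integrable circle_haar f" and g: "continuous_on circle g"
  shows "continuous_on circle (circle_conv f g)"
proof -
  have [measurable]: "f \<in> borel_measurable circle_haar" "g \<in> borel_measurable circle_haar"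
    using f g by (auto intro: borel_measurable_circle_continuous)
  obtain B where B: "\<And>z. z \<in> circle \<Longrightarrow> cmod (g z) \<le> B"
    using circle_continuous_bounded[OF g] by blast
  have "continuous_on circle (circle_conv g f)"
    unfolding continuous_on_sequentially comp_def circle_conv_def
  proof (intro ballI allI impI, elim conjE)
    fix X z assume z: "z \<in> circle" and X: "\<forall>n. X n \<in> circle" and lim: "X \<longlonglongrightarrow> z"
    have Xn: "X n \<in> circle" for n using X by auto
    note [measurable] = measurable_circle_reflect[OF z] measurable_circle_reflect[OF Xn]
    show "(\<lambda>n. \<integral>t. g (X n / t) * f t \<partial>circle_haar) \<longlonglongrightarrow> (\<integral>t. g (z / t) * f t \<partial>circle_haar)"
    proof (rule integral_dominated_convergence[where w = "\<lambda>t. B * cmod (f t)"])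
      show "integrable circle_haar (\<lambda>t. B * cmod (f t))" using f by simp
      show "AE t in circle_haar. (\<lambda>n. g (X n / t) * f t) \<longlonglongrightarrow> g (z / t) * f t"
      proof (rule AE_I2)
        fix t assume "t \<in> space circle_haar"
        then have t: "t \<in> circle" by simp
        have "(\<lambda>n. g (X n / t)) \<longlonglongrightarrow> g (z / t)"
          by (rule continuous_on_tendsto_compose[OF g])
            (use lim Xn z t circle_divide in \<open>auto intro!: tendsto_eq_intros\<close>)
        then show "(\<lambda>n. g (X n / t) * f t) \<longlonglongrightarrow> g (z / t) * f t" by (rule tendsto_mult_right)
      qed
      show "AE t in circle_haar. norm (g (X n / t) * f t) \<le> B * cmod (f t)" for n
        using B Xn by (intro AE_I2) (auto simp: norm_mult norm_divide intro!: mult_right_mono)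
    qed measurable
  qed
  then show ?thesis
    by (rule iffD2[OF continuous_on_cong[OF refl], rotated]) (rule circle_conv_commute; simp)
qed

subsection \<open>Differentiation along the circle\<close>

lemma range_cis: "range cis = circle"
proof -
  have "u \<in> range cis" if "u \<in> circle" for u using circle_cis[OF that] by blast
  then show ?thesis by auto
qed

lemma cis_has_vector_derivative: "(cis has_vector_derivative \<i> * cis \<theta>) (at \<theta> within S)"
  unfolding cis_conv_exp
  by (rule has_vector_derivative_real_field)
    (auto intro!: derivative_eq_intros)

lemma has_circle_deriv_cis:
  assumes "has_circle_deriv f D (cis \<theta>)"
  shows "((\<lambda>\<theta>. f (cis \<theta>)) has_vector_derivative \<i> * cis \<theta> * D) (at \<theta>)"
  using field_vector_diff_chain_within[OF cis_has_vector_derivative, of f D \<theta> UNIV] assms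
  by (simp add: has_circle_deriv_def range_cis comp_def)

lemma cis_eq_on_circle:
  assumes "w \<in> circle"
  shows "cis (\<theta> + Arg (w / cis \<theta>)) = w"
proof -
  have "sgn (w / cis \<theta>) = w / cis \<theta>" using assms by (simp add: sgn_div_norm norm_divide)
  moreover have "w / cis \<theta> \<noteq> 0" using assms by auto
  ultimately have "cis (Arg (w / cis \<theta>)) = w / cis \<theta>" by (simp add: cis_Arg)
  then show ?thesis by (simp add: cis_mult[symmetric])
qed

text \<open>The converse of differentiating in the angle. Near cis \<theta> the angle is recovered
  by \<theta> + Arg (w / cis \<theta>), which is continuous there because Arg is continuous at
  1.\<close>

lemma has_circle_derivI:
  assumes "((\<lambda>\<theta>. f (cis \<theta>)) has_vector_derivative \<i> * cis \<theta> * D) (at \<theta>)"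
  shows "has_circle_deriv f D (cis \<theta>)"
proof -
  define \<phi> where "\<phi> w = \<theta> + Arg (w / cis \<theta>)" for w
  have c: "cis (\<phi> w) = w" if "w \<in> circle" for w using cis_eq_on_circle[OF that] by (simp add: \<phi>_def)
  have "isCont Arg 1" by (rule continuous_at_Arg) (auto simp: complex_nonpos_Reals_iff)
  then have "isCont (\<lambda>w. Arg (w / cis \<theta>)) (cis \<theta>)"
    by (intro continuous_at_compose[unfolded comp_def, of _ "\<lambda>w. w / cis \<theta>" Arg]) (auto intro!: continuous_intros)
  then have "isCont \<phi> (cis \<theta>)" unfolding \<phi>_def by (intro continuous_intros)
  then have "(\<phi> \<longlongrightarrow> \<theta>) (at (cis \<theta>))" by (simp add: isCont_def \<phi>_def)
  then have "(\<phi> \<longlongrightarrow> \<theta>) (at (cis \<theta>) within circle)" by (rule tendsto_within_subset) auto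
  moreover have "eventually (\<lambda>w. \<phi> w \<noteq> \<theta>) (at (cis \<theta>) within circle)"
    unfolding eventually_at_filter by (intro always_eventually) (use c in force)
  ultimately have lim: "filterlim \<phi> (at \<theta>) (at (cis \<theta>) within circle)" by (rule filterlim_atI)
  have q: "((\<lambda>x. (g x - g \<theta>) /\<^sub>R (x - \<theta>)) \<longlongrightarrow> G) (at \<theta>)"
    if "(g has_vector_derivative G) (at \<theta>)" for g and G :: complex
  proof (rule Lim_null[THEN iffD2], rule tendsto_norm_zero_cancel)
    have "((\<lambda>x. norm (g x - g \<theta> - (x - \<theta>) *\<^sub>R G) / norm (x - \<theta>)) \<longlongrightarrow> 0) (at \<theta>)"
      using that by (simp add: has_vector_derivative_def has_derivative_iff_norm)
    moreover have "norm (g x - g \<theta> - (x - \<theta>) *\<^sub>R G) / norm (x - \<theta>) = norm ((g x - g \<theta>) /\<^sub>R (x - \<theta>) - G)"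
      if "x \<noteq> \<theta>" for x
    proof -
      have "(g x - g \<theta>) /\<^sub>R (x - \<theta>) - G = (g x - g \<theta> - (x - \<theta>) *\<^sub>R G) /\<^sub>R (x - \<theta>)"
        using that by (simp add: scaleR_diff_right)
      then show ?thesis by (simp add: divide_inverse_commute)
    qed
    then have "eventually (\<lambda>x. norm (g x - g \<theta> - (x - \<theta>) *\<^sub>R G) / norm (x - \<theta>) = norm ((g x - g \<theta>) /\<^sub>R (x - \<theta>) - G)) (at \<theta>)"
      unfolding eventually_at_filter by (intro always_eventually) auto
    ultimately show "((\<lambda>x. norm ((g x - g \<theta>) /\<^sub>R (x - \<theta>) - G)) \<longlongrightarrow> 0) (at \<theta>)"
      by (rule Lim_transform_eventually)
  qed
  have cancel: "(x /\<^sub>R r) / (y /\<^sub>R r) = x / y" if "r \<noteq> 0" for r and x y :: complex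
    using that by (simp add: scaleR_conv_of_real)
  \<comment> \<open>The quotient in w is a quotient of two difference quotients in the angle, whose
    common denominator cancels.\<close>
  have "((\<lambda>w. ((f (cis (\<phi> w)) - f (cis \<theta>)) /\<^sub>R (\<phi> w - \<theta>)) / ((cis (\<phi> w) - cis \<theta>) /\<^sub>R (\<phi> w - \<theta>))) \<longlongrightarrow> (\<i> * cis \<theta> * D) / (\<i> * cis \<theta>))
      (at (cis \<theta>) within circle)" (is "(?q \<longlongrightarrow> _) _")
    by (intro tendsto_divide filterlim_compose[OF q[OF assms] lim] filterlim_compose[OF q[OF cis_has_vector_derivative] lim]) auto
  moreover have "eventually (\<lambda>w. ((f (cis (\<phi> w)) - f (cis \<theta>)) /\<^sub>R (\<phi> w - \<theta>)) / ((cis (\<phi> w) - cis \<theta>) /\<^sub>R (\<phi> w - \<theta>))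
      = (f w - f (cis \<theta>)) / (w - cis \<theta>)) (at (cis \<theta>) within circle)"
  proof -
    have "eventually (\<lambda>w. w \<in> circle) (at (cis \<theta>) within circle)"
      unfolding eventually_at_filter by simp
    with \<open>eventually (\<lambda>w. \<phi> w \<noteq> \<theta>) _\<close> show ?thesis
      by eventually_elim (simp add: c cancel)
  qed
  ultimately have "((\<lambda>w. (f w - f (cis \<theta>)) / (w - cis \<theta>)) \<longlongrightarrow> (\<i> * cis \<theta> * D) / (\<i> * cis \<theta>)) (at (cis \<theta>) within circle)"
    by (rule Lim_transform_eventually)
  then show ?thesis by (simp add: has_circle_deriv_def has_field_derivative_iff)
qed

lemma has_circle_deriv_unique:
  assumes "has_circle_deriv f D z" "has_circle_deriv f E z" "z \<in> circle"
  shows "D = E"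
proof -
  obtain \<theta> where "z = cis \<theta>" using circle_cis[OF assms(3)] .
  then have "\<i> * cis \<theta> * D = \<i> * cis \<theta> * E"
    using assms(1,2) by (intro vector_derivative_unique_at[OF has_circle_deriv_cis has_circle_deriv_cis]) auto
  then show ?thesis by simp
qed

lemma circle_deriv_eq: "has_circle_deriv f D z \<Longrightarrow> z \<in> circle \<Longrightarrow> circle_deriv f z = D"
  unfolding circle_deriv_def by (auto intro!: the_equality has_circle_deriv_unique)

lemma has_circle_deriv_cong:
  assumes "\<And>y. y \<in> circle \<Longrightarrow> f y = g y" "z \<in> circle"
  shows "has_circle_deriv f D z \<longleftrightarrow> has_circle_deriv g D z"
  unfolding has_circle_deriv_def
  using assms by (intro has_field_derivative_cong_ev) auto

lemma circle_deriv_cong: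
  assumes "\<And>y. y \<in> circle \<Longrightarrow> f y = g y" "z \<in> circle"
  shows "circle_deriv f z = circle_deriv g z"
  unfolding circle_deriv_def using has_circle_deriv_cong[OF assms] by simp

lemma has_circle_deriv_imp_continuous_on:
  "(\<And>z. z \<in> circle \<Longrightarrow> has_circle_deriv f (f' z) z) \<Longrightarrow> continuous_on circle f"
  unfolding has_circle_deriv_def by (blast intro: DERIV_continuous_on)

text \<open>Absolute continuity along the circle with derivative f' in the variable z; the factor i
  cis \<theta> is the derivative of the parametrization. It holds for derivatives that exist only
  almost everywhere.\<close>

definition circle_ac :: "(complex \<Rightarrow> complex) \<Rightarrow> (complex \<Rightarrow> complex) \<Rightarrow> bool" where
  "circle_ac f f' \<longleftrightarrow> continuous_on circle f \<and> integrable circle_haar f' \<and>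
     (\<forall>s t. s \<le> t \<longrightarrow> f (cis t) - f (cis s) = (LBINT \<theta>:{s..t}. \<i> * cis \<theta> * f' (cis \<theta>)))"

lemma continuous_on_cis_compose: "continuous_on circle f \<Longrightarrow> continuous_on S (\<lambda>\<theta>. f (cis \<theta>))"
  by (rule continuous_on_compose2[of circle f S cis]) (auto intro!: continuous_intros)

lemma C1_circle_ac:
  assumes d: "\<And>z. z \<in> circle \<Longrightarrow> has_circle_deriv f (f' z) z" and c: "continuous_on circle f'"
  shows "circle_ac f f'"
  unfolding circle_ac_def
proof (intro conjI allI impI)
  show "continuous_on circle f" using d by (rule has_circle_deriv_imp_continuous_on)
  show "integrable circle_haar f'" by (rule integrable_circle_continuous[OF c])
  fix s t :: real assume st: "s \<le> t"
  show "f (cis t) - f (cis s) = (LBINT \<theta>:{s..t}. \<i> * cis \<theta> * f' (cis \<theta>))"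
    unfolding set_lebesgue_integral_def
  proof (rule integral_FTC_atLeastAtMost[OF st, symmetric])
    show "((\<lambda>\<theta>. f (cis \<theta>)) has_vector_derivative \<i> * cis \<theta> * f' (cis \<theta>)) (at \<theta> within {s..t})" for \<theta>
      by (rule has_vector_derivative_at_within[OF has_circle_deriv_cis[OF d]]) simp
    show "continuous_on {s..t} (\<lambda>\<theta>. \<i> * cis \<theta> * f' (cis \<theta>))"
      by (intro continuous_on_mult continuous_on_const continuous_on_cis_compose[OF c] continuous_on_cis continuous_on_id)
  qed
qed

text \<open>Each translate f(z/t) is the integral of its derivative, whose factor 1/t is moved to g;
  Fubini exchanges the integrations over t and over the arc.\<close>

lemma circle_conv_increment:
  assumes ac: "circle_ac f f'" and g: "continuous_on circle g" and ab: "a \<le> b"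
  shows "circle_conv f g (cis b) - circle_conv f g (cis a)
    = (\<integral>u. indicator {a..b} u *\<^sub>R (\<i> * cis u * circle_conv f' (\<lambda>t. g t / t) (cis u)) \<partial>lborel)"
proof -
  interpret P: pair_sigma_finite lborel circle_haar by unfold_locales
  have fc: "continuous_on circle f" and f': "integrable circle_haar f'" using ac by (auto simp: circle_ac_def)
  have [measurable]: "f' \<in> borel_measurable circle_haar" using f' by simp
  have [measurable]: "g \<in> borel_measurable circle_haar" by (rule borel_measurable_circle_continuous[OF g])
  define F where "F u t = \<i> * cis u * (f' (cis u / t) * (g t / t))" for u t
  have [measurable]: "(\<lambda>x. cis (fst x) / snd x) \<in> measurable (lborel \<Otimes>\<^sub>M circle_haar) circle_haar"
    by (rule measurable_circle_divide) measurable
  have [measurable]: "(\<lambda>x. cis (fst x)) \<in> borel_measurable (lborel \<Otimes>\<^sub>M circle_haar)"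
    by (rule measurable_circle_haar_borel) measurable
  have mF: "(\<lambda>x. indicator {a..b} (fst x) *\<^sub>R F (fst x) (snd x)) \<in> borel_measurable (lborel \<Otimes>\<^sub>M circle_haar)"
    unfolding F_def by measurable
  obtain B where B: "\<And>z. z \<in> circle \<Longrightarrow> cmod (g z) \<le> B" using circle_continuous_bounded[OF g] by blast
  have gt: "continuous_on circle (\<lambda>t. g t / t)"
    by (intro continuous_on_divide g continuous_on_id) auto
  have Fi: "integrable circle_haar (F u)" for u
  proof -
    have "integrable circle_haar (\<lambda>t. f' (cis u / t))" using circle_integrable_reflect[of "cis u" f'] f' by simp
    then have "integrable circle_haar (\<lambda>t. (g t / t) * f' (cis u / t))"
      by (rule integrable_circle_continuous_mult[OF gt])
    then show ?thesis unfolding F_def by (intro integrable_mult_right) (simp add: mult.commute)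
  qed
  have iF: "integrable (lborel \<Otimes>\<^sub>M circle_haar) (\<lambda>(u, t). indicator {a..b} u *\<^sub>R F u t)"
  proof (rule P.Fubini_integrable)
    show "(\<lambda>(u, t). indicator {a..b} u *\<^sub>R F u t) \<in> borel_measurable (lborel \<Otimes>\<^sub>M circle_haar)"
      using mF by (simp add: case_prod_unfold)
    show "AE u in lborel. integrable circle_haar (\<lambda>t. case (u, t) of (u, t) \<Rightarrow> indicator {a..b} u *\<^sub>R F u t)"
      using Fi by (intro AE_I2) simp
    let ?C = "B * (\<integral>t. cmod (f' t) \<partial>circle_haar)"
    have bound: "(\<integral>t. cmod (F u t) \<partial>circle_haar) \<le> ?C" for u
    proof -
      have if': "integrable circle_haar (\<lambda>t. f' (cis u / t))" using circle_integrable_reflect[of "cis u" f'] f' by simp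
      have "(\<integral>t. cmod (F u t) \<partial>circle_haar) \<le> (\<integral>t. B * cmod (f' (cis u / t)) \<partial>circle_haar)"
      proof (rule Bochner_Integration.integral_mono)
        fix t assume "t \<in> space circle_haar"
        then have "cmod (F u t) = cmod (g t) * cmod (f' (cis u / t))" "cmod (g t) \<le> B"
          using B by (auto simp: F_def norm_mult norm_divide)
        then show "cmod (F u t) \<le> B * cmod (f' (cis u / t))" by (simp add: mult_right_mono)
      qed (use Fi if' in auto)
      also have "\<dots> = ?C"
        using circle_integral_reflect[of "cis u" "\<lambda>t. of_real (cmod (f' t))"]
        by (simp del: of_real_eq_iff add: integral_complex_of_real) (simp add: integral_complex_of_real)
      finally show ?thesis .
    qed
    have m: "(\<lambda>u. \<integral>t. norm (indicator {a..b} u *\<^sub>R F u t) \<partial>circle_haar) \<in> borel_measurable lborel"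
      using measurable_compose[OF mF borel_measurable_norm] by (intro circle_haar.borel_measurable_lebesgue_integral) (simp add: case_prod_unfold)
    have "integrable lborel (indicator {a..b} :: real \<Rightarrow> real)" by (rule integrable_real_indicator) (auto simp: emeasure_lborel_Icc_eq)
    then have "integrable lborel (\<lambda>u. indicator {a..b} u *\<^sub>R ?C)" by (rule integrable_scaleR_left)
    then have "integrable lborel (\<lambda>u. \<integral>t. norm (indicator {a..b} u *\<^sub>R F u t) \<partial>circle_haar)"
    proof (rule Bochner_Integration.integrable_bound[OF _ m], intro AE_I2)
      fix u :: real
      have "0 \<le> B" using order_trans[OF norm_ge_zero B[of 1]] by simp
      moreover have "0 \<le> (\<integral>t. cmod (F u t) \<partial>circle_haar)" by simp
      ultimately show "norm (\<integral>t. norm (indicator {a..b} u *\<^sub>R F u t) \<partial>circle_haar) \<le> norm (indicator {a..b} u *\<^sub>R ?C)"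
        using bound[of u] by (auto simp: indicator_def abs_mult)
    qed
    then show "integrable lborel (\<lambda>u. \<integral>t. norm (case (u, t) of (u, t) \<Rightarrow> indicator {a..b} u *\<^sub>R F u t) \<partial>circle_haar)"
      by simp
  qed
  have pointwise: "f (cis b / t) * g t - f (cis a / t) * g t = (\<integral>u. indicator {a..b} u *\<^sub>R F u t \<partial>lborel)" if t: "t \<in> circle" for t
  proof -
    obtain \<tau> where \<tau>: "t = cis \<tau>" using circle_cis[OF t] .
    have "f (cis (b - \<tau>)) - f (cis (a - \<tau>)) = (LBINT \<theta>:{a - \<tau>..b - \<tau>}. \<i> * cis \<theta> * f' (cis \<theta>))"
      using ac ab unfolding circle_ac_def by auto
    also have "\<dots> = (\<integral>u. indicator {a - \<tau>..b - \<tau>} (- \<tau> + 1 * u) *\<^sub>R (\<i> * cis (- \<tau> + 1 * u) * f' (cis (- \<tau> + 1 * u))) \<partial>lborel)"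
      unfolding set_lebesgue_integral_def by (subst lborel_integral_real_affine[where c = 1 and t = "- \<tau>"]) auto
    also have "\<dots> = (\<integral>u. indicator {a..b} u *\<^sub>R (\<i> * (cis u / t) * f' (cis u / t)) \<partial>lborel)"
      by (intro Bochner_Integration.integral_cong) (auto simp: indicator_def \<tau> cis_divide)
    finally have "(f (cis b / t) - f (cis a / t)) * g t = (\<integral>u. indicator {a..b} u *\<^sub>R (\<i> * (cis u / t) * f' (cis u / t)) \<partial>lborel) * g t"
      by (simp add: \<tau> cis_divide)
    also have "\<dots> = (\<integral>u. (indicator {a..b} u *\<^sub>R (\<i> * (cis u / t) * f' (cis u / t))) * g t \<partial>lborel)"
      by (rule integral_mult_left_zero[symmetric])
    also have "\<dots> = (\<integral>u. indicator {a..b} u *\<^sub>R F u t \<partial>lborel)"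
      by (intro Bochner_Integration.integral_cong) (auto simp: F_def)
    finally show ?thesis by (simp add: algebra_simps)
  qed
  have ci: "integrable circle_haar (\<lambda>t. f (cis u / t) * g t)" for u
  proof (rule integrable_circle_continuous)
    show "continuous_on circle (\<lambda>t. f (cis u / t) * g t)"
      by (intro continuous_on_mult g continuous_on_compose2[OF fc] continuous_on_divide continuous_on_const continuous_on_id)
        (auto simp: norm_divide)
  qed
  have "circle_conv f g (cis b) - circle_conv f g (cis a) = (\<integral>t. f (cis b / t) * g t - f (cis a / t) * g t \<partial>circle_haar)"
    unfolding circle_conv_def by (rule Bochner_Integration.integral_diff[symmetric, OF ci ci])
  also have "\<dots> = (\<integral>t. (\<integral>u. indicator {a..b} u *\<^sub>R F u t \<partial>lborel) \<partial>circle_haar)"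
    by (rule Bochner_Integration.integral_cong) (auto simp: pointwise)
  also have "\<dots> = (\<integral>u. (\<integral>t. indicator {a..b} u *\<^sub>R F u t \<partial>circle_haar) \<partial>lborel)"
    by (rule P.Fubini_integral[OF iF])
  also have "\<dots> = (\<integral>u. indicator {a..b} u *\<^sub>R (\<i> * cis u * circle_conv f' (\<lambda>t. g t / t) (cis u)) \<partial>lborel)"
    unfolding F_def circle_conv_def by (simp only: integral_scaleR_right integral_mult_right_zero)
  finally show ?thesis .
qed

text \<open>The integrand of the increment formula is itself a convolution with a continuous
  function, hence continuous. The fundamental theorem then gives a derivative at every point,
  although f may have one only almost everywhere.\<close>

lemma circle_conv_deriv:
  assumes ac: "circle_ac f f'" and g: "continuous_on circle g" and z: "z \<in> circle"
  shows "has_circle_deriv (circle_conv f g) (circle_conv f' (\<lambda>t. g t / t) z) z"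
proof -
  obtain \<theta> where \<theta>: "z = cis \<theta>" using circle_cis[OF z] .
  let ?c = "\<lambda>u. circle_conv f g (cis u)" and ?K = "\<lambda>u. \<i> * cis u * circle_conv f' (\<lambda>t. g t / t) (cis u)"
  let ?a = "\<theta> - 1" and ?b = "\<theta> + 1"
  have "continuous_on circle (circle_conv f' (\<lambda>t. g t / t))"
    using ac by (intro continuous_on_circle_conv continuous_on_divide g continuous_on_id) (auto simp: circle_ac_def)
  then have K: "continuous_on S ?K" for S
    by (intro continuous_on_mult continuous_on_const continuous_on_cis_compose continuous_on_cis continuous_on_id)
  have "((\<lambda>u. integral {?a..u} ?K) has_vector_derivative ?K \<theta>) (at \<theta> within {?a..?b})"
    by (rule integral_has_vector_derivative[OF K]) auto
  then have d: "((\<lambda>u. ?c ?a + integral {?a..u} ?K) has_vector_derivative ?K \<theta>) (at \<theta> within {?a..?b})"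
    using has_vector_derivative_add[OF has_vector_derivative_const[of "?c ?a"]] by fastforce
  have e: "?c u = ?c ?a + integral {?a..u} ?K" if "u \<in> {?a..?b}" for u
  proof -
    have "set_integrable lborel {?a..u} ?K" by (rule borel_integrable_atLeastAtMost'[OF K])
    then have "(LINT u:{?a..u}|lborel. ?K u) = integral {?a..u} ?K" by (rule set_borel_integral_eq_integral(2))
    then show ?thesis using circle_conv_increment[OF ac g, of ?a u] that
      unfolding set_lebesgue_integral_def by (simp add: algebra_simps)
  qed
  have "(?c has_vector_derivative ?K \<theta>) (at \<theta> within {?a..?b})"
    by (rule has_vector_derivative_transform[OF _ e d]) auto
  then have "(?c has_vector_derivative ?K \<theta>) (at \<theta>)"
    using at_within_interior[of \<theta> "{?a..?b}"] by simp
  then show ?thesis unfolding \<theta> by (rule has_circle_derivI)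
qed

lemma has_circle_deriv_powi: "z \<in> circle \<Longrightarrow> has_circle_deriv (\<lambda>z. z powi m) (of_int m * z powi (m - 1)) z"
  unfolding has_circle_deriv_def by (rule derivative_eq_intros refl | force)+

lemma circle_conv_powi:
  assumes "f \<in> borel_measurable circle_haar" "z \<in> circle"
  shows "circle_conv f (\<lambda>t. t powi m) z = z powi m * mellin f (- m)"
proof -
  have "(\<lambda>t. t powi m) \<in> borel_measurable circle_haar"
    by (intro borel_measurable_circle_continuous continuous_on_circle_powi)
  then have "circle_conv f (\<lambda>t. t powi m) z = circle_conv (\<lambda>t. t powi m) f z"
    by (rule circle_conv_commute[OF assms(1) _ assms(2)])
  also have "\<dots> = (\<integral>t. z powi m * (t powi (- m) * f t) \<partial>circle_haar)"
    unfolding circle_conv_def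
    by (intro Bochner_Integration.integral_cong) (auto simp: power_int_divide_distrib power_int_minus field_simps)
  finally show ?thesis by (simp add: mellin_def)
qed

text \<open>Differentiating the convolution of \<open>f\<close> with the character \<open>t\<^sup>-\<^sup>s\<close>, which is a multiple of that
  character, replaces an integration by parts.\<close>

lemma mellin_circle_ac:
  assumes ac: "circle_ac f f'"
  shows "mellin f' (s + 1) = - of_int s * mellin f s"
proof -
  have f: "f \<in> borel_measurable circle_haar" "f' \<in> borel_measurable circle_haar"
    using ac by (auto simp: circle_ac_def intro: borel_measurable_circle_continuous)
  have powi: "t powi (- s - 1) = t powi (- s) / t" if "cmod t = 1" for t :: complex
  proof -
    have "t \<noteq> 0" using that by auto
    then show ?thesis using power_int_diff[of t "- s" 1] by simp
  qed
  have "has_circle_deriv (circle_conv f (\<lambda>t. t powi (- s))) (circle_conv f' (\<lambda>t. t powi (- s) / t) 1) 1"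
    by (rule circle_conv_deriv[OF ac continuous_on_circle_powi]) simp
  moreover have "circle_conv f' (\<lambda>t. t powi (- s) / t) 1 = circle_conv f' (\<lambda>t. t powi (- s - 1)) 1"
    unfolding circle_conv_def
    by (intro Bochner_Integration.integral_cong) (auto simp: powi)
  moreover have "has_circle_deriv (circle_conv f (\<lambda>t. t powi (- s))) (- of_int s * mellin f s) 1"
  proof -
    have "has_circle_deriv (\<lambda>z. z powi (- s) * mellin f s) (of_int (- s) * 1 powi (- s - 1) * mellin f s) 1"
      using has_circle_deriv_powi[of 1 "- s"] unfolding has_circle_deriv_def by (intro DERIV_cmult_right) simp
    then show ?thesis
      by (subst has_circle_deriv_cong[where g = "\<lambda>z. z powi (- s) * mellin f s"]) (simp_all add: circle_conv_powi f)
  qed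
  ultimately show ?thesis using has_circle_deriv_unique[of _ _ 1] by (simp add: circle_conv_powi f algebra_simps)
qed

subsection \<open>Differentiable weights\<close>

lemma
  assumes "\<omega> \<in> L1_cyclic_diff N"
  shows L1_cyclic_diff_integrable: "j < N \<Longrightarrow> integrable circle_haar ((circle_deriv ^^ j) \<omega>)"
    and L1_cyclic_diff_continuous: "j + 2 \<le> N \<Longrightarrow> continuous_on circle ((circle_deriv ^^ j) \<omega>)"
    and L1_cyclic_diff_L1_cyclic: "\<omega> \<in> L1_cyclic N"
  using assms unfolding L1_cyclic_diff_def by blast+

text \<open>Below order N - 2 the next derivative is continuous and the fundamental theorem applies;
  at order N - 2 the integral formula is part of the definition of the space.\<close>

lemma L1_cyclic_diff_ac:
  assumes "\<omega> \<in> L1_cyclic_diff N" "j + 2 \<le> N"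
  shows "circle_ac ((circle_deriv ^^ j) \<omega>) ((circle_deriv ^^ Suc j) \<omega>)"
proof (cases "j + 3 \<le> N")
  case True
  have 1: "has_circle_deriv ((circle_deriv ^^ j) \<omega>) ((circle_deriv ^^ Suc j) \<omega> z) z" if "z \<in> circle" for z
  proof -
    have "\<forall>j. j + 3 \<le> N \<longrightarrow>
        (\<forall>z\<in>circle. has_circle_deriv ((circle_deriv ^^ j) \<omega>) ((circle_deriv ^^ (j + 1)) \<omega> z) z)"
      using assms(1) unfolding L1_cyclic_diff_def by blast
    from this[rule_format, OF True that] show ?thesis by simp
  qed
  have 2: "continuous_on circle ((circle_deriv ^^ Suc j) \<omega>)"
    using True by (intro L1_cyclic_diff_continuous[OF assms(1)]) simp
  from 1 2 show ?thesis by (rule C1_circle_ac)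
next
  case False
  with assms(2) have j: "j = N - 2" and N: "2 \<le> N" and Sj: "Suc j = N - 1" by auto
  have "continuous_on circle ((circle_deriv ^^ j) \<omega>)"
    using assms unfolding L1_cyclic_diff_def by blast
  moreover have "integrable circle_haar ((circle_deriv ^^ Suc j) \<omega>)"
    using assms(2) by (intro L1_cyclic_diff_integrable[OF assms(1)]) simp
  moreover have "\<forall>s t. s \<le> t \<longrightarrow> (circle_deriv ^^ j) \<omega> (cis t) - (circle_deriv ^^ j) \<omega> (cis s)
      = (LBINT \<theta>:{s..t}. \<i> * cis \<theta> * (circle_deriv ^^ Suc j) \<omega> (cis \<theta>))"
    using assms(1) N unfolding L1_cyclic_diff_def j[symmetric] Sj[symmetric] by blast
  ultimately show ?thesis unfolding circle_ac_def by blast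
qed

lemma L1_cyclic_diff_deriv:
  assumes "\<omega> \<in> L1_cyclic_diff N" "j + 3 \<le> N" "z \<in> circle"
  shows "has_circle_deriv ((circle_deriv ^^ j) \<omega>) ((circle_deriv ^^ Suc j) \<omega> z) z"
proof -
  have "\<forall>j. j + 3 \<le> N \<longrightarrow>
      (\<forall>z\<in>circle. has_circle_deriv ((circle_deriv ^^ j) \<omega>) ((circle_deriv ^^ (j + 1)) \<omega> z) z)"
    using assms(1) unfolding L1_cyclic_diff_def by blast
  from this[rule_format, OF assms(2,3)] show ?thesis by simp
qed

lemma L1_cyclic_diff_AE_deriv:
  assumes "\<omega> \<in> L1_cyclic_diff N" "Suc j < N"
  shows "AE z in circle_haar. has_circle_deriv ((circle_deriv ^^ j) \<omega>) ((circle_deriv ^^ Suc j) \<omega> z) z"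
proof (cases "j + 3 \<le> N")
  case True
  then show ?thesis using L1_cyclic_diff_deriv[OF assms(1)] by (intro AE_I2) simp
next
  case False
  with assms(2) have j: "j = N - 2" and N: "2 \<le> N" and Sj: "Suc j = N - 1" by auto
  show ?thesis using assms(1) N unfolding L1_cyclic_diff_def j[symmetric] Sj[symmetric] by blast
qed

lemma mellin_circle_deriv_Suc:
  assumes "\<omega> \<in> L1_cyclic_diff N" "Suc k < N"
  shows "mellin ((circle_deriv ^^ Suc k) \<omega>) (s + int (Suc k)) = - of_int (s + int k) * mellin ((circle_deriv ^^ k) \<omega>) (s + int k)"
  using mellin_circle_ac[OF L1_cyclic_diff_ac[OF assms(1)], of k "s + int k"] assms(2)
  by (simp add: add_ac)

text \<open>The weights in question are combinations of \<open>z\<^sup>k \<partial>\<^sup>k \<omega>\<close>: iterating the Euler operator, and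
  differentiating \<open>\<omega> (z / y)\<close> in \<open>y\<close>, give such combinations with coefficients of the following
  kind, for \<open>e b = 0\<close> and \<open>e b = b\<close> respectively.\<close>

fun diff_coeff :: "(nat \<Rightarrow> complex) \<Rightarrow> nat \<Rightarrow> nat \<Rightarrow> complex" where
  "diff_coeff e 0 k = (if k = 0 then 1 else 0)"
| "diff_coeff e (Suc b) k = - (of_nat k + e b) * diff_coeff e b k - (case k of 0 \<Rightarrow> 0 | Suc l \<Rightarrow> diff_coeff e b l)"

definition diff_comb :: "(nat \<Rightarrow> complex) \<Rightarrow> nat \<Rightarrow> (nat \<Rightarrow> complex) \<Rightarrow> complex" where
  "diff_comb e b X = (\<Sum>k\<le>b. diff_coeff e b k * X k)"

lemma diff_coeff_eq_0: "b < k \<Longrightarrow> diff_coeff e b k = 0"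
  by (induction b arbitrary: k) (auto split: nat.split)

lemma diff_comb_0 [simp]: "diff_comb e 0 X = X 0"
  by (simp add: diff_comb_def)

text \<open>Moves the recursion from the coefficients to the sequence: differentiating the k-th term
  yields a combination of the terms k and k + 1 of exactly this form.\<close>

lemma diff_comb_Suc: "diff_comb e (Suc b) X = diff_comb e b (\<lambda>k. - (of_nat k + e b) * X k - X (Suc k))"
proof -
  have "diff_comb e (Suc b) X = (\<Sum>k\<le>Suc b. - (of_nat k + e b) * diff_coeff e b k * X k)
      - (\<Sum>k\<le>Suc b. (case k of 0 \<Rightarrow> 0 | Suc l \<Rightarrow> diff_coeff e b l) * X k)"
    by (simp only: diff_comb_def diff_coeff.simps left_diff_distrib sum_subtractf)
  also have "(\<Sum>k\<le>Suc b. (case k of 0 \<Rightarrow> 0 | Suc l \<Rightarrow> diff_coeff e b l) * X k) = (\<Sum>k\<le>b. diff_coeff e b k * X (Suc k))"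
    by (subst sum.atMost_Suc_shift) simp
  also have "(\<Sum>k\<le>Suc b. - (of_nat k + e b) * diff_coeff e b k * X k) = (\<Sum>k\<le>b. - (of_nat k + e b) * diff_coeff e b k * X k)"
    by (simp add: diff_coeff_eq_0)
  finally show ?thesis by (simp add: diff_comb_def sum_subtractf[symmetric] algebra_simps)
qed

lemma diff_comb_cmult: "diff_comb e b (\<lambda>k. c * X k) = c * diff_comb e b X"
  by (simp add: diff_comb_def sum_distrib_left mult_ac)

lemma has_circle_deriv_diff_comb:
  assumes "\<And>k. k \<le> b \<Longrightarrow> has_circle_deriv (\<lambda>z. X z k) (X' k) z"
  shows "has_circle_deriv (\<lambda>z. diff_comb e b (X z)) (diff_comb e b X') z"
  using assms unfolding has_circle_deriv_def diff_comb_def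
  by (intro DERIV_sum DERIV_cmult) simp

lemma continuous_on_diff_comb:
  assumes "\<And>k. k \<le> b \<Longrightarrow> continuous_on S (\<lambda>z. X z k)"
  shows "continuous_on S (\<lambda>z. diff_comb e b (X z))"
  using assms unfolding diff_comb_def by (intro continuous_intros) simp

lemma integrable_diff_comb:
  assumes "\<And>k. k \<le> b \<Longrightarrow> integrable circle_haar (\<lambda>z. X z k)"
  shows "integrable circle_haar (\<lambda>z. diff_comb e b (X z))"
  using assms unfolding diff_comb_def by (intro Bochner_Integration.integrable_sum integrable_mult_right) simp

lemma mellin_diff_comb:
  assumes "\<And>k. k \<le> b \<Longrightarrow> integrable circle_haar (\<lambda>z. X z k)"
  shows "mellin (\<lambda>z. diff_comb e b (X z)) s = diff_comb e b (\<lambda>k. mellin (\<lambda>z. X z k) s)"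
proof -
  have "mellin (\<lambda>z. diff_comb e b (X z)) s = (\<integral>z. (\<Sum>k\<le>b. diff_coeff e b k * (z powi s * X z k)) \<partial>circle_haar)"
    by (simp add: mellin_def diff_comb_def sum_distrib_left mult_ac)
  also have "\<dots> = (\<Sum>k\<le>b. \<integral>z. diff_coeff e b k * (z powi s * X z k) \<partial>circle_haar)"
    using assms by (intro Bochner_Integration.integral_sum integrable_mult_right integrable_circle_powi) simp
  finally show ?thesis by (simp add: mellin_def diff_comb_def)
qed

text \<open>The shift by \<open>k\<close> compensates the factor \<open>z\<^sup>k\<close> in front of the \<open>k\<close>-th derivative.\<close>

lemma diff_comb_mellin:
  assumes "\<omega> \<in> L1_cyclic_diff N" "b < N"
  shows "diff_comb e b (\<lambda>k. mellin ((circle_deriv ^^ k) \<omega>) (s + int k)) = (\<Prod>i<b. of_int s - e i) * mellin \<omega> s"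
  using assms(2)
proof (induction b)
  case (Suc b)
  let ?m = "\<lambda>k. mellin ((circle_deriv ^^ k) \<omega>) (s + int k)"
  have "diff_comb e (Suc b) ?m = diff_comb e b (\<lambda>k. (of_int s - e b) * ?m k)"
  proof -
    have "- (of_nat k + e b) * ?m k - ?m (Suc k) = (of_int s - e b) * ?m k" if "k \<le> b" for k
    proof -
      have "Suc k < N" using Suc.prems that by simp
      from mellin_circle_deriv_Suc[OF assms(1) this, of s] show ?thesis
        by (simp only:) (simp add: algebra_simps)
    qed
    then have "(\<Sum>k\<le>b. diff_coeff e b k * (- (of_nat k + e b) * ?m k - ?m (Suc k)))
        = (\<Sum>k\<le>b. diff_coeff e b k * ((of_int s - e b) * ?m k))"
      by (intro sum.cong refl) (simp only: atMost_iff)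
    then show ?thesis by (simp only: diff_comb_Suc) (simp only: diff_comb_def)
  qed
  also have "\<dots> = (of_int s - e b) * diff_comb e b ?m" by (rule diff_comb_cmult)
  finally show ?case using Suc by simp
qed simp

lemma mellin_powi_mult: "mellin (\<lambda>z. z ^ k * f z) s = mellin f (s + int k)"
  unfolding mellin_def
proof (intro Bochner_Integration.integral_cong refl)
  fix z assume "z \<in> space circle_haar"
  then have "z \<noteq> 0" by auto
  then show "z powi s * (z ^ k * f z) = z powi (s + int k) * f z" by (simp add: power_int_add)
qed

text \<open>The b-th power of - z d/dz written out in iterated derivatives. It is integrable as a
  combination of integrable derivatives, whereas the iterate \<open>neg_euler ^^ b\<close> is
  controlled only where these derivatives exist.\<close>

definition euler_weight :: "(complex \<Rightarrow> complex) \<Rightarrow> nat \<Rightarrow> complex \<Rightarrow> complex" where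
  "euler_weight \<omega> b z = diff_comb (\<lambda>_. 0) b (\<lambda>k. z ^ k * (circle_deriv ^^ k) \<omega> z)"

lemma euler_weight_deriv:
  assumes "\<And>k. k \<le> b \<Longrightarrow> has_circle_deriv ((circle_deriv ^^ k) \<omega>) ((circle_deriv ^^ Suc k) \<omega> z) z" "z \<in> circle"
  shows "neg_euler (euler_weight \<omega> b) z = euler_weight \<omega> (Suc b) z"
proof -
  let ?X' = "\<lambda>k. of_nat k * z ^ (k - 1) * (circle_deriv ^^ k) \<omega> z + (circle_deriv ^^ Suc k) \<omega> z * z ^ k"
  have "has_circle_deriv (\<lambda>z. euler_weight \<omega> b z) (diff_comb (\<lambda>_. 0) b ?X') z"
    unfolding euler_weight_def
  proof (rule has_circle_deriv_diff_comb)
    fix k assume "k \<le> b"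
    from assms(1)[OF this] show "has_circle_deriv (\<lambda>z. z ^ k * (circle_deriv ^^ k) \<omega> z) (?X' k) z"
      unfolding has_circle_deriv_def by (intro DERIV_mult' [THEN DERIV_cong]) (auto intro!: derivative_eq_intros simp: algebra_simps)
  qed
  then have "neg_euler (euler_weight \<omega> b) z = - z * diff_comb (\<lambda>_. 0) b ?X'"
    unfolding neg_euler_def using circle_deriv_eq[OF _ assms(2)] by simp
  also have "\<dots> = diff_comb (\<lambda>_. 0) b (\<lambda>k. - z * ?X' k)" by (rule diff_comb_cmult[symmetric])
  also have "\<dots> = euler_weight \<omega> (Suc b) z"
  proof -
    have "- z * ?X' k = - (of_nat k + 0) * (z ^ k * (circle_deriv ^^ k) \<omega> z) - z ^ Suc k * (circle_deriv ^^ Suc k) \<omega> z" for k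
      by (cases k) (simp_all add: algebra_simps)
    then show ?thesis unfolding euler_weight_def diff_comb_Suc by presburger
  qed
  finally show ?thesis .
qed

lemma neg_euler_cong:
  assumes "\<And>y. y \<in> circle \<Longrightarrow> f y = g y" "z \<in> circle"
  shows "neg_euler f z = neg_euler g z"
  unfolding neg_euler_def using circle_deriv_cong[OF assms] by simp

text \<open>A derivative at z looks at all nearby points, so the derivatives of lower order must
  exist on the whole circle; the last one is required at z only.\<close>

lemma neg_euler_iter:
  assumes "\<And>k y. Suc k < b \<Longrightarrow> y \<in> circle \<Longrightarrow> has_circle_deriv ((circle_deriv ^^ k) \<omega>) ((circle_deriv ^^ Suc k) \<omega> y) y"
    and "\<And>k. k < b \<Longrightarrow> has_circle_deriv ((circle_deriv ^^ k) \<omega>) ((circle_deriv ^^ Suc k) \<omega> z) z" "z \<in> circle"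
  shows "(neg_euler ^^ b) \<omega> z = euler_weight \<omega> b z"
  using assms
proof (induction b arbitrary: z)
  case 0
  then show ?case by (simp add: euler_weight_def)
next
  case (Suc b)
  have "(neg_euler ^^ Suc b) \<omega> z = neg_euler ((neg_euler ^^ b) \<omega>) z" by simp
  also have "\<dots> = neg_euler (euler_weight \<omega> b) z"
  proof (rule neg_euler_cong[OF _ Suc.prems(3)])
    fix y :: complex assume "y \<in> circle"
    then show "(neg_euler ^^ b) \<omega> y = euler_weight \<omega> b y"
      by (intro Suc.IH) (use Suc.prems(1) in auto)
  qed
  also have "\<dots> = euler_weight \<omega> (Suc b) z"
    by (rule euler_weight_deriv[OF _ Suc.prems(3)]) (use Suc.prems(2) in auto)
  finally show ?case .
qed

lemma AE_neg_euler_iter: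
  assumes \<omega>: "\<omega> \<in> L1_cyclic_diff N" and b: "b < N"
  shows "AE z in circle_haar. (neg_euler ^^ b) \<omega> z = euler_weight \<omega> b z"
proof -
  have "AE z in circle_haar. \<forall>k<b. has_circle_deriv ((circle_deriv ^^ k) \<omega>) ((circle_deriv ^^ Suc k) \<omega> z) z"
    using L1_cyclic_diff_AE_deriv[OF \<omega>] b by (auto simp: AE_all_countable)
  then show ?thesis using AE_space
  proof eventually_elim
    case (elim z)
    show ?case by (rule neg_euler_iter) (use elim L1_cyclic_diff_deriv[OF \<omega>] b in auto)
  qed
qed

lemma
  assumes \<omega>: "\<omega> \<in> L1_cyclic_diff N" and b: "b < N"
  shows integrable_euler_weight: "integrable circle_haar (euler_weight \<omega> b)"
    and mellin_euler_weight: "mellin (euler_weight \<omega> b) s = of_int s ^ b * mellin \<omega> s"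
proof -
  have i: "integrable circle_haar (\<lambda>z. z ^ k * (circle_deriv ^^ k) \<omega> z)" if "k \<le> b" for k
    using that b by (intro integrable_circle_continuous_mult L1_cyclic_diff_integrable[OF \<omega>] continuous_intros) auto
  show "integrable circle_haar (euler_weight \<omega> b)"
    unfolding euler_weight_def[abs_def] by (rule integrable_diff_comb[OF i])
  have "mellin (euler_weight \<omega> b) s = diff_comb (\<lambda>_. 0) b (\<lambda>k. mellin ((circle_deriv ^^ k) \<omega>) (s + int k))"
    unfolding euler_weight_def[abs_def] by (simp add: mellin_diff_comb[OF i] mellin_powi_mult)
  then show "mellin (euler_weight \<omega> b) s = of_int s ^ b * mellin \<omega> s"
    by (simp add: diff_comb_mellin[OF \<omega> b])
qed

text \<open>All derivatives fall on the first factor: the j-th derivative is the convolution of the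
  j-th derivative of \<omega>' with \<omega>(t) / t^j. Continuity of the second factor makes all
  derivatives up to order N - 1 exist everywhere and be continuous, which improves on both
  factors.\<close>

lemma
  assumes \<omega>': "\<omega>' \<in> L1_cyclic_diff N" and \<omega>: "continuous_on circle \<omega>" and j: "j < N"
  shows has_circle_deriv_iter_conv: "z \<in> circle \<Longrightarrow> Suc j < N \<Longrightarrow>
      has_circle_deriv ((circle_deriv ^^ j) (circle_conv \<omega>' \<omega>)) ((circle_deriv ^^ Suc j) (circle_conv \<omega>' \<omega>) z) z"
    and continuous_on_circle_deriv_iter_conv: "continuous_on circle ((circle_deriv ^^ j) (circle_conv \<omega>' \<omega>))"
proof -
  have c: "continuous_on circle (\<lambda>t. \<omega> t / t ^ j)" for j
    by (intro continuous_intros \<omega>) auto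
  have d: "has_circle_deriv (circle_conv ((circle_deriv ^^ j) \<omega>') (\<lambda>t. \<omega> t / t ^ j))
      (circle_conv ((circle_deriv ^^ Suc j) \<omega>') (\<lambda>t. \<omega> t / t ^ Suc j) z) z" if "z \<in> circle" "Suc j < N" for z j
    using circle_conv_deriv[OF L1_cyclic_diff_ac[OF \<omega>'] c that(1), of j j] that by (simp add: mult.commute)
  have main: "\<forall>z\<in>circle. (circle_deriv ^^ j) (circle_conv \<omega>' \<omega>) z = circle_conv ((circle_deriv ^^ j) \<omega>') (\<lambda>t. \<omega> t / t ^ j) z"
    if "j < N" for j using that
  proof (induction j)
    case (Suc j)
    show ?case
    proof
      fix z :: complex assume z: "z \<in> circle"
      have "(circle_deriv ^^ Suc j) (circle_conv \<omega>' \<omega>) z = circle_deriv (circle_conv ((circle_deriv ^^ j) \<omega>') (\<lambda>t. \<omega> t / t ^ j)) z"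
        using Suc by (auto intro!: circle_deriv_cong[OF _ z])
      then show "(circle_deriv ^^ Suc j) (circle_conv \<omega>' \<omega>) z = circle_conv ((circle_deriv ^^ Suc j) \<omega>') (\<lambda>t. \<omega> t / t ^ Suc j) z"
        using circle_deriv_eq[OF d[OF z Suc.prems] z] by simp
    qed
  qed simp
  have eq: "(circle_deriv ^^ j) (circle_conv \<omega>' \<omega>) z = circle_conv ((circle_deriv ^^ j) \<omega>') (\<lambda>t. \<omega> t / t ^ j) z" if "z \<in> circle" for z
    using main[OF j] that by blast
  show "has_circle_deriv ((circle_deriv ^^ j) (circle_conv \<omega>' \<omega>)) ((circle_deriv ^^ Suc j) (circle_conv \<omega>' \<omega>) z) z"
    if z: "z \<in> circle" and "Suc j < N" for z
  proof -
    have "(circle_deriv ^^ Suc j) (circle_conv \<omega>' \<omega>) z = circle_conv ((circle_deriv ^^ Suc j) \<omega>') (\<lambda>t. \<omega> t / t ^ Suc j) z"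
      using main[OF that(2)] z by blast
    then show ?thesis using d[OF that] has_circle_deriv_cong[OF eq z] by simp
  qed
  have "continuous_on circle (circle_conv ((circle_deriv ^^ j) \<omega>') (\<lambda>t. \<omega> t / t ^ j))"
    by (rule continuous_on_circle_conv[OF L1_cyclic_diff_integrable[OF \<omega>' j] c])
  then show "continuous_on circle ((circle_deriv ^^ j) (circle_conv \<omega>' \<omega>))"
    by (rule iffD2[OF continuous_on_cong[OF refl eq], rotated])
qed

lemma circle_conv_L1_cyclic_diff:
  assumes \<omega>': "\<omega>' \<in> L1_cyclic_diff N" and \<omega>: "\<omega> \<in> L1_cyclic_diff N"
  shows "circle_conv \<omega>' \<omega> \<in> L1_cyclic_diff N"
proof -
  have 1: "circle_conv \<omega>' \<omega> \<in> L1_cyclic N"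
    using assms by (intro circle_conv_L1_cyclic L1_cyclic_diff_L1_cyclic)
  show ?thesis
  proof (cases "2 \<le> N")
    case True
    then have c: "continuous_on circle \<omega>" using L1_cyclic_diff_continuous[OF \<omega>, of 0] by simp
    note C = continuous_on_circle_deriv_iter_conv[OF \<omega>' c] and D = has_circle_deriv_iter_conv[OF \<omega>' c]
    let ?o = "circle_conv \<omega>' \<omega>"
    have ac: "circle_ac ((circle_deriv ^^ (N - 2)) ?o) ((circle_deriv ^^ (N - 1)) ?o)"
    proof (rule C1_circle_ac)
      show "continuous_on circle ((circle_deriv ^^ (N - 1)) ?o)" by (rule C) (use True in simp)
      have "Suc (N - 2) = N - 1" using True by simp
      then show "has_circle_deriv ((circle_deriv ^^ (N - 2)) ?o) ((circle_deriv ^^ (N - 1)) ?o z) z" if "z \<in> circle" for z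
        using D[of "N - 2" z] that True by simp
    qed
    show ?thesis unfolding L1_cyclic_diff_def
    proof (intro CollectI conjI allI impI 1 ballI)
      show "integrable circle_haar ((circle_deriv ^^ j) ?o)" if "j < N" for j
        using C[OF that] by (rule integrable_circle_continuous)
      show "continuous_on circle ((circle_deriv ^^ j) ?o)" if "j + 2 \<le> N" for j using C[of j] that by simp
      show "has_circle_deriv ((circle_deriv ^^ j) ?o) ((circle_deriv ^^ (j + 1)) ?o z) z" if "j + 3 \<le> N" "z \<in> circle" for j z
        using D[of j z] that by simp
      have "Suc (N - 2) = N - 1" using True by simp
      then show "AE z in circle_haar. has_circle_deriv ((circle_deriv ^^ (N - 2)) ?o) ((circle_deriv ^^ (N - 1)) ?o z) z"
        using D[of "N - 2"] True by (intro AE_I2) simp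
      show "(circle_deriv ^^ (N - 2)) ?o (cis t) - (circle_deriv ^^ (N - 2)) ?o (cis s)
           = (LBINT \<theta>:{s..t}. \<i> * cis \<theta> * (circle_deriv ^^ (N - 1)) ?o (cis \<theta>))" if "s \<le> t" for s t
        using ac that unfolding circle_ac_def by blast
    qed
  next
    \<comment> \<open>For N at most 1 the space imposes no differentiability, and \<omega> need not
      be continuous.\<close>
    case False
    then have "N = 0 \<or> N = 1" by auto
    with 1 show ?thesis by (auto simp: L1_cyclic_diff_def L1_cyclic_def)
  qed
qed

subsection \<open>Confluent determinants\<close>

definition falling :: "int \<Rightarrow> nat \<Rightarrow> complex" where
  "falling m r = (\<Prod>i<r. of_int m - of_nat i)"

lemma falling_0 [simp]: "falling m 0 = 1"
  by (simp add: falling_def)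

lemma falling_Suc: "falling m (Suc r) = (of_int m - of_nat r) * falling m r"
  by (simp add: falling_def)

lemma falling_Suc': "falling m (Suc r) = of_int m * falling (m - 1) r"
  unfolding falling_def by (subst prod.lessThan_Suc_shift) (simp add: algebra_simps)

lemma falling_difference: "falling (m + 1) (Suc r) - falling m (Suc r) = of_nat (Suc r) * falling m r"
  using falling_Suc'[of "m + 1" r] falling_Suc[of m r] by (simp add: algebra_simps)

text \<open>The \<open>r\<close>-th derivative of \<open>y\<^sup>-\<^sup>k p(y)\<close> at \<open>x\<close>.\<close>

definition deriv_functional :: "nat \<Rightarrow> complex \<Rightarrow> nat \<Rightarrow> complex poly \<Rightarrow> complex" where
  "deriv_functional k x r p
    = (\<Sum>i\<le>degree p. coeff p i * (falling (int i - int k) r * x powi (int i - int k - int r)))"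

lemma deriv_functional_sum:
  assumes "degree p \<le> n"
  shows "deriv_functional k x r p = (\<Sum>i\<le>n. coeff p i * (falling (int i - int k) r * x powi (int i - int k - int r)))"
  unfolding deriv_functional_def
  by (rule sum.mono_neutral_left) (use assms in \<open>auto simp: coeff_eq_0\<close>)

lemma deriv_functional_add: "deriv_functional k x r (p + q) = deriv_functional k x r p + deriv_functional k x r q"
proof -
  let ?n = "max (degree p) (degree q)"
  have "degree (p + q) \<le> ?n" by (rule degree_add_le_max)
  then show ?thesis
    by (simp add: deriv_functional_sum[of _ ?n] sum.distrib distrib_right)
qed

lemma deriv_functional_smult: "deriv_functional k x r (smult c p) = c * deriv_functional k x r p"
  by (simp add: deriv_functional_sum[of "smult c p" "degree p"] degree_smult_le deriv_functional_def sum_distrib_left mult_ac)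

lemma deriv_functional_monom: "deriv_functional k x r (monom 1 m) = falling (int m - int k) r * x powi (int m - int k - int r)"
proof -
  have "deriv_functional k x r (monom 1 m) = (\<Sum>i\<le>m. if i = m then falling (int m - int k) r * x powi (int m - int k - int r) else 0)"
    unfolding deriv_functional_sum[OF degree_monom_le] by (rule sum.cong) auto
  then show ?thesis by simp
qed

text \<open>Leibniz's rule for the factor y - x: it vanishes at x and has derivative 1, so a single
  term remains.\<close>

lemma deriv_functional_linear_factor:
  assumes "x \<noteq> 0"
  shows "deriv_functional k x r ([:- x, 1:] * q) = (case r of 0 \<Rightarrow> 0 | Suc l \<Rightarrow> of_nat r * deriv_functional k x l q)"
proof -
  let ?f = "\<lambda>r i. falling (int i - int k) r * x powi (int i - int k - int r)"
  have "[:- x, 1:] * q = pCons 0 q + smult (- x) q" by simp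
  then have "deriv_functional k x r ([:- x, 1:] * q) = deriv_functional k x r (pCons 0 q) - x * deriv_functional k x r q"
    by (simp only: deriv_functional_add deriv_functional_smult) simp
  also have "deriv_functional k x r (pCons 0 q) = (\<Sum>i\<le>Suc (degree q). coeff (pCons 0 q) i * ?f r i)"
    by (rule deriv_functional_sum) (rule degree_pCons_le)
  also have "\<dots> = (\<Sum>i\<le>degree q. coeff q i * ?f r (Suc i))"
    by (subst sum.atMost_Suc_shift) simp
  finally have "deriv_functional k x r ([:- x, 1:] * q) = (\<Sum>i\<le>degree q. coeff q i * (?f r (Suc i) - x * ?f r i))"
    by (simp add: deriv_functional_def sum_distrib_left sum_subtractf algebra_simps)
  also have "(\<lambda>i. ?f r (Suc i) - x * ?f r i) = (\<lambda>i. case r of 0 \<Rightarrow> 0 | Suc l \<Rightarrow> of_nat r * ?f l i)"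
  proof
    fix i
    have 1: "x * x powi m = x powi (m + 1)" for m using assms by (simp add: power_int_add)
    have "?f r (Suc i) - x * ?f r i = (falling (int i - int k + 1) r - falling (int i - int k) r) * x powi (int i - int k - int r + 1)"
      using 1[of "int i - int k - int r"] by (simp add: algebra_simps)
    also have "\<dots> = (case r of 0 \<Rightarrow> 0 | Suc l \<Rightarrow> of_nat r * ?f l i)"
      by (cases r) (simp_all only: falling_difference, simp_all add: algebra_simps)
    finally show "?f r (Suc i) - x * ?f r i = (case r of 0 \<Rightarrow> 0 | Suc l \<Rightarrow> of_nat r * ?f l i)" .
  qed
  finally show ?thesis
    by (cases r) (simp_all add: deriv_functional_def sum_distrib_left mult_ac)
qed

lemma deriv_functional_power:
  assumes "x \<noteq> 0" "r < m"
  shows "deriv_functional k x r ([:- x, 1:] ^ m * q) = 0"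
  using assms(2)
proof (induction m arbitrary: r)
  case (Suc m)
  have "deriv_functional k x r ([:- x, 1:] ^ Suc m * q) = deriv_functional k x r ([:- x, 1:] * ([:- x, 1:] ^ m * q))"
    by (simp only: power_Suc mult.assoc)
  also have "\<dots> = 0"
    using Suc by (subst deriv_functional_linear_factor[OF assms(1)]) (auto split: nat.split)
  finally show ?case .
qed simp

lemma deriv_functional_power_eq:
  assumes "x \<noteq> 0"
  shows "deriv_functional 0 x r ([:- x, 1:] ^ r * q) = fact r * poly q x"
proof (induction r)
  case 0
  then show ?case by (simp add: deriv_functional_def poly_altdef)
next
  case (Suc r)
  have "deriv_functional 0 x (Suc r) ([:- x, 1:] ^ Suc r * q) = deriv_functional 0 x (Suc r) ([:- x, 1:] * ([:- x, 1:] ^ r * q))"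
    by (simp only: power_Suc mult.assoc)
  also have "\<dots> = of_nat (Suc r) * deriv_functional 0 x r ([:- x, 1:] ^ r * q)"
    by (subst deriv_functional_linear_factor[OF assms]) simp
  finally show ?case using Suc by simp
qed

lemma prod_linear_factors_split:
  fixes x :: "'n::finite \<Rightarrow> complex"
  shows "(\<Prod>c\<in>A. [:- x c, 1:]) = [:- v, 1:] ^ card {c\<in>A. x c = v} * (\<Prod>c\<in>{c\<in>A. x c \<noteq> v}. [:- x c, 1:])"
proof -
  have "A = {c\<in>A. x c = v} \<union> {c\<in>A. x c \<noteq> v}" by auto
  then have "(\<Prod>c\<in>A. [:- x c, 1:]) = (\<Prod>c\<in>{c\<in>A. x c = v}. [:- x c, 1:]) * (\<Prod>c\<in>{c\<in>A. x c \<noteq> v}. [:- x c, 1:])"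
    by (subst prod.union_disjoint[symmetric]) auto
  also have "(\<Prod>c\<in>{c\<in>A. x c = v}. [:- x c, 1:]) = (\<Prod>c\<in>{c\<in>A. x c = v}. [:- v, 1:])"
    by (intro prod.cong) auto
  finally show ?thesis by simp
qed

text \<open>The index b itself precedes a and adds one occurrence to those counted by
  \<open>repetition x b\<close>.\<close>

lemma repetition_less: "b < a \<Longrightarrow> repetition x b < card {c. c < a \<and> x c = x b}"
  unfolding repetition_def by (rule psubset_card_mono) (auto intro: order.strict_trans)

lemma repetition_less_card: "repetition (x :: 'n::{finite,linorder} \<Rightarrow> complex) b < CARD('n)"
  unfolding repetition_def by (rule psubset_card_mono) auto

text \<open>Column b holds a derivative of y^(s a - k) at \<open>x b\<close>, of order the number of
  earlier occurrences of this node. The case k = 0, s = \<open>pos\<close> is the confluent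
  Vandermonde determinant; k accounts for powers of the conjugate determinant.\<close>

definition confluent_det :: "nat \<Rightarrow> ('n::{finite,linorder} \<Rightarrow> complex) \<Rightarrow> ('n \<Rightarrow> nat) \<Rightarrow> complex" where
  "confluent_det k x s = det (\<chi> a b. falling (int (s a) - int k) (repetition x b) * x b powi (int (s a) - int k - int (repetition x b)))"

lemma confluent_det_eq: "confluent_det k x s = det (\<chi> a b. deriv_functional k (x b) (repetition x b) (monom 1 (s a)))"
  by (simp add: confluent_det_def deriv_functional_monom)

text \<open>Each node is a root of the full product with multiplicity larger than the order of the
  derivative taken there, so the functionals vanish on multiples of that product, whatever the shift
  k.\<close>

lemma confluent_det_schur:
  fixes x :: "'n::{finite,linorder} \<Rightarrow> complex"
  assumes "\<And>b. x b \<noteq> 0"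
  shows "confluent_det k x s = schur s x * confluent_det k x pos"
  unfolding confluent_det_eq
proof (rule det_functionals_eq_schur)
  fix b and p :: "complex poly"
  assume "(\<Prod>a\<in>UNIV. [:- x a, 1:]) dvd p"
  then obtain q where q: "p = (\<Prod>a\<in>UNIV. [:- x a, 1:]) * q" by (rule dvdE)
  have "repetition x b < card {c\<in>UNIV. x c = x b}"
    unfolding repetition_def by (rule psubset_card_mono) auto
  then show "deriv_functional k (x b) (repetition x b) p = 0"
    unfolding q prod_linear_factors_split[of x UNIV "x b"] mult.assoc
    by (rule deriv_functional_power[OF assms])
qed (rule deriv_functional_add deriv_functional_smult)+

text \<open>In the Newton basis the determinant is a product of factorials and of differences
  between distinct nodes.\<close>

lemma confluent_det_nonzero:
  fixes x :: "'n::{finite,linorder} \<Rightarrow> complex"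
  assumes "\<And>b. x b \<noteq> 0"
  shows "confluent_det 0 x pos \<noteq> 0"
proof -
  have "confluent_det 0 x pos = (\<Prod>a\<in>UNIV. deriv_functional 0 (x a) (repetition x a) (\<Prod>c\<in>{c. c < a}. [:- x c, 1:]))"
    unfolding confluent_det_eq
  proof (rule det_newton_functionals)
    fix a b :: 'n assume "b < a"
    then show "deriv_functional 0 (x b) (repetition x b) (\<Prod>c\<in>{c. c < a}. [:- x c, 1:]) = 0"
      unfolding prod_linear_factors_split[of x "{c. c < a}" "x b"]
      by (intro deriv_functional_power assms) (simp add: repetition_less)
  qed (rule deriv_functional_add deriv_functional_smult)+
  moreover have "deriv_functional 0 (x a) (repetition x a) (\<Prod>c\<in>{c. c < a}. [:- x c, 1:]) \<noteq> 0" for a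
  proof -
    have "deriv_functional 0 (x a) (repetition x a) (\<Prod>c\<in>{c. c < a}. [:- x c, 1:])
        = fact (repetition x a) * (\<Prod>c\<in>{c\<in>{c. c < a}. x c \<noteq> x a}. x a - x c)"
      unfolding prod_linear_factors_split[of x "{c. c < a}" "x a"]
      using deriv_functional_power_eq[OF assms, of a "repetition x a"]
      by (simp add: repetition_def poly_prod)
    then show ?thesis by auto
  qed
  ultimately show ?thesis by simp
qed

lemma schur_shift:
  fixes x :: "'n::{finite,linorder} \<Rightarrow> complex"
  assumes "x \<in> space torus_haar"
  shows "schur (\<lambda>a. pos a + k) x = (\<Prod>b\<in>UNIV. x b) ^ k"
proof (rule torus_dense[OF continuous_on_schur _ _ assms])
  show "continuous_on UNIV (\<lambda>x :: 'n \<Rightarrow> complex. (\<Prod>b\<in>UNIV. x b) ^ k)"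
    by (intro continuous_intros continuous_on_product_coordinates)
  fix z :: "'n \<Rightarrow> complex" assume "inj z"
  have "alternant (\<lambda>a. pos a + k) z = det (\<chi> a b. z b ^ k * z b ^ pos a)"
    by (simp add: alternant_def power_add mult.commute)
  also have "\<dots> = (\<Prod>b\<in>UNIV. z b) ^ k * vandermonde z"
    by (simp add: det_scale_columns vandermonde_det prod_power_distrib)
  finally show "schur (\<lambda>a. pos a + k) z = (\<Prod>b\<in>UNIV. z b) ^ k"
    using \<open>inj z\<close> by (simp add: alternant_eq_schur vandermonde_eq_0_iff)
qed

text \<open>The right-hand side is the moment of a random conjugate of a fixed matrix with spectrum
  x, now as a quotient of determinants that makes sense for repeated eigenvalues.\<close>

lemma confluent_det_ratio:
  fixes x :: "'n::{finite,linorder} \<Rightarrow> complex"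
  assumes x: "x \<in> space torus_haar"
  shows "confluent_det k x s / confluent_det 0 x pos = cnj (\<Prod>b\<in>UNIV. x b) ^ k * schur s x"
proof -
  have nz: "x b \<noteq> 0" for b using mem_torusD[OF x, of b] by auto
  let ?P = "\<Prod>b\<in>UNIV. x b"
  \<comment> \<open>Only the differences \<open>s a - k\<close> enter, so raising all exponents by k
    undoes the shift.\<close>
  have "confluent_det 0 x pos = confluent_det k x (\<lambda>a. pos a + k)" by (simp add: confluent_det_def)
  also have "\<dots> = ?P ^ k * confluent_det k x pos"
    by (simp add: confluent_det_schur[where x = x and s = "\<lambda>a. pos a + k", OF nz] schur_shift[OF x])
  finally have 0: "confluent_det 0 x pos = ?P ^ k * confluent_det k x pos" .
  have "cmod ?P = 1" using mem_torusD[OF x] by (simp add: prod_norm[symmetric])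
  then have "cnj ?P * ?P = 1" by (metis complex_norm_square mult.commute of_real_1 one_power2)
  then have "cnj ?P ^ k * ?P ^ k = 1" by (metis power_mult_distrib power_one)
  then have "cnj ?P ^ k * confluent_det 0 x pos = confluent_det k x pos"
    unfolding 0 by (simp add: mult.assoc[symmetric])
  moreover have "confluent_det 0 x pos \<noteq> 0" by (rule confluent_det_nonzero[where x = x, OF nz])
  ultimately show ?thesis
    by (simp add: confluent_det_schur[where x = x and s = s, OF nz] field_simps)
qed

subsection \<open>Derivatives with respect to the spectrum of the fixed matrix\<close>

lemma filterlim_circle_sequence:
  assumes "x \<in> circle"
  shows "filterlim (\<lambda>n. x * cis (inverse (real (Suc n)))) (at x within circle) sequentially"
  unfolding filterlim_at
proof (intro conjI always_eventually allI)
  show "(\<lambda>n. x * cis (inverse (real (Suc n)))) \<longlonglongrightarrow> x"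
  proof -
    have "isCont cis 0" using has_vector_derivative_continuous[OF cis_has_vector_derivative[of 0 UNIV]] .
    then have "(\<lambda>n. cis (inverse (real (Suc n)))) \<longlonglongrightarrow> cis 0"
      by (rule isCont_tendsto_compose) (rule LIMSEQ_inverse_real_of_nat)
    then show ?thesis using tendsto_mult[OF tendsto_const[of x]] by force
  qed
  fix n
  show "x * cis (inverse (real (Suc n))) \<in> circle" using assms by (simp add: norm_mult)
  have "inverse (real (Suc n)) \<le> 1" by (simp add: field_simps)
  then have "inverse (real (Suc n)) < pi" using pi_gt3 by linarith
  then have "sin (inverse (real (Suc n))) > 0" by (intro sin_gt_zero) auto
  then have "cis (inverse (real (Suc n))) \<noteq> 1" by (auto simp: complex_eq_iff)
  then show "x * cis (inverse (real (Suc n))) \<noteq> x" using assms by auto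
qed

text \<open>Points without derivative are sorted out by a Cauchy criterion, whose inner conditions are
  closed.\<close>

lemma measurable_circle_deriv_param:
  assumes x: "x \<in> circle" and c: "\<And>y. y \<in> circle \<Longrightarrow> continuous_on circle (\<lambda>z. H z y)"
  shows "(\<lambda>z. circle_deriv (H z) x) \<in> borel_measurable circle_haar"
proof -
  let ?I = "\<lambda>j. inverse (real (Suc j))"
  define q where "q z y = (H z y - H z x) / (y - x)" for z y
  define Y where "Y n = x * cis (?I n)" for n
  note Y = filterlim_circle_sequence[OF x, folded Y_def]
  have Yc: "Y n \<in> circle" for n using x by (simp add: Y_def norm_mult)
  have d: "has_circle_deriv (H z) D x \<longleftrightarrow> (q z \<longlongrightarrow> D) (at x within circle)" for z D
    by (simp add: has_circle_deriv_def has_field_derivative_iff q_def[abs_def])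
  have qc: "continuous_on circle (\<lambda>z. q z y)" if "y \<in> circle" for y
    unfolding q_def divide_inverse by (intro continuous_intros c that x)
  define near where "near j = {y \<in> circle. y \<noteq> x \<and> dist y x < ?I j}" for j
  define C where "C z \<longleftrightarrow> (\<forall>i. \<exists>j. \<forall>y\<in>near j. \<forall>y'\<in>near j. dist (q z y) (q z y') \<le> ?I i)" for z
  have Ynear: "\<forall>\<^sub>F n in sequentially. Y n \<in> near j" for j
  proof -
    have "\<forall>\<^sub>F y in at x within circle. y \<in> near j"
      unfolding eventually_at near_def by (intro exI[of _ "?I j"]) auto
    then show ?thesis using Y by (rule eventually_compose_filterlim)
  qed
  have iff: "(\<exists>D. has_circle_deriv (H z) D x) \<longleftrightarrow> C z" for z
  proof
    assume "\<exists>D. has_circle_deriv (H z) D x"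
    then obtain D where D: "(q z \<longlongrightarrow> D) (at x within circle)" using d by blast
    show "C z" unfolding C_def
    proof
      fix i
      have "\<forall>\<^sub>F y in at x within circle. dist (q z y) D < ?I i / 2" by (rule tendstoD[OF D]) simp
      then obtain e where e: "0 < e" "\<And>y. y \<in> circle \<Longrightarrow> y \<noteq> x \<Longrightarrow> dist y x < e \<Longrightarrow> dist (q z y) D < ?I i / 2"
        unfolding eventually_at by blast
      obtain j where j: "?I j < e" using reals_Archimedean[OF e(1)] by blast
      have near: "dist (q z y) D < ?I i / 2" if "y \<in> near j" for y
        using that j e(2)[of y] by (auto simp: near_def)
      show "\<exists>j. \<forall>y\<in>near j. \<forall>y'\<in>near j. dist (q z y) (q z y') \<le> ?I i"
      proof (intro exI[of _ j] ballI)
        fix y y' assume "y \<in> near j" "y' \<in> near j"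
        then show "dist (q z y) (q z y') \<le> ?I i"
          using dist_triangle2[of "q z y" "q z y'" D] near[of y] near[of y'] by linarith
      qed
    qed
  next
    assume "C z"
    have "Cauchy (\<lambda>n. q z (Y n))"
      unfolding Cauchy_def
    proof (intro allI impI)
      fix e :: real assume "0 < e"
      then obtain i where i: "?I i < e" using reals_Archimedean by blast
      obtain j where j: "\<forall>y\<in>near j. \<forall>y'\<in>near j. dist (q z y) (q z y') \<le> ?I i" using \<open>C z\<close> C_def by metis
      obtain M where "\<And>n. n \<ge> M \<Longrightarrow> Y n \<in> near j" using Ynear[of j] unfolding eventually_sequentially by blast
      then show "\<exists>M. \<forall>m\<ge>M. \<forall>n\<ge>M. dist (q z (Y m)) (q z (Y n)) < e" using j i by (meson le_less_trans)
    qed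
    then obtain L where L: "(\<lambda>n. q z (Y n)) \<longlonglongrightarrow> L" using Cauchy_convergent convergent_def by blast
    have "(q z \<longlongrightarrow> L) (at x within circle)" unfolding tendsto_iff
    proof (intro allI impI)
      fix e :: real assume "0 < e"
      then obtain i where i: "?I i < e" using reals_Archimedean by blast
      obtain j where j: "\<forall>y\<in>near j. \<forall>y'\<in>near j. dist (q z y) (q z y') \<le> ?I i" using \<open>C z\<close> C_def by metis
      have "dist (q z y) L \<le> ?I i" if y: "y \<in> near j" for y
      proof (rule tendsto_le[OF _ tendsto_const tendsto_dist[OF tendsto_const L]])
        show "\<forall>\<^sub>F n in sequentially. dist (q z y) (q z (Y n)) \<le> ?I i"
          using Ynear[of j] by eventually_elim (use j y in blast)
      qed simp
      then show "\<forall>\<^sub>F y in at x within circle. dist (q z y) L < e"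
        unfolding eventually_at using i by (intro exI[of _ "?I j"]) (force simp: near_def)
    qed
    then show "\<exists>D. has_circle_deriv (H z) D x" using d by blast
  qed
  have val: "circle_deriv (H z) x = (if C z then lim (\<lambda>n. q z (Y n)) else 0)" for z
  proof (cases "C z")
    case True
    then obtain D where D: "has_circle_deriv (H z) D x" using iff by blast
    then have "(\<lambda>n. q z (Y n)) \<longlonglongrightarrow> D" using filterlim_compose[OF _ Y] d by blast
    then show ?thesis using circle_deriv_eq[OF D x] True by (simp add: limI)
  next
    case False
    then have "\<not> (\<exists>D. has_circle_deriv (H z) D x)" using iff by blast
    then show ?thesis using False unfolding circle_deriv_def by simp
  qed
  \<comment> \<open>The quantifiers over y and y' are uncountable, but intersections of closed sets
    are closed; the conditions use \<le> for this reason. The remaining quantifiers over i and j are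
    countable.\<close>
  have "Measurable.pred circle_haar (\<lambda>z. \<forall>y\<in>near j. \<forall>y'\<in>near j. dist (q z y) (q z y') \<le> ?I i)" for i j
  proof -
    have "{z \<in> circle. \<forall>y\<in>near j. \<forall>y'\<in>near j. dist (q z y) (q z y') \<le> ?I i}
        = circle \<inter> (\<Inter>y\<in>near j. \<Inter>y'\<in>near j. {z \<in> circle. dist (q z y) (q z y') \<le> ?I i})" by auto
    also have "closed \<dots>"
      by (intro closed_Int closed_INT ballI continuous_on_closed_Collect_le continuous_on_dist qc continuous_on_const closed_sphere)
        (auto simp: near_def)
    finally have "{z \<in> circle. \<forall>y\<in>near j. \<forall>y'\<in>near j. dist (q z y) (q z y') \<le> ?I i} \<in> sets (restrict_space borel circle)"
      by (subst sets_restrict_space_iff) auto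
    then show ?thesis unfolding pred_def by (simp add: sets_circle_haar)
  qed
  then have [measurable]: "Measurable.pred circle_haar C" unfolding C_def[abs_def] by (intro pred_intros_countable)
  have [measurable]: "(\<lambda>z. q z (Y n)) \<in> borel_measurable circle_haar" for n
    by (rule borel_measurable_circle_continuous[OF qc[OF Yc]])
  have [measurable]: "(\<lambda>z. lim (\<lambda>n. q z (Y n))) \<in> borel_measurable circle_haar"
    by (rule borel_measurable_lim_metric) measurable
  show ?thesis unfolding val by measurable
qed

text \<open>The r-th derivative of \<omega>(z/y) in y, written out. Each differentiation either acts
  on the power of y or produces a further derivative of \<omega> with the factor - z / y^2; the
  exponent k + r records both.\<close>

definition quotient_weight :: "(complex \<Rightarrow> complex) \<Rightarrow> nat \<Rightarrow> complex \<Rightarrow> complex \<Rightarrow> complex" where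
  "quotient_weight \<omega> r z y = diff_comb of_nat r (\<lambda>k. z ^ k * (circle_deriv ^^ k) \<omega> (z / y) / y ^ (k + r))"

lemma quotient_weight_0: "quotient_weight \<omega> 0 z y = \<omega> (z / y)"
  by (simp add: quotient_weight_def)

lemma has_circle_deriv_quotient:
  assumes "has_circle_deriv f D (z / y)" "z \<in> circle" "y \<in> circle"
  shows "has_circle_deriv (\<lambda>y. f (z / y)) (- D * z / y ^ 2) y"
proof -
  have y: "y \<noteq> 0" using assms by auto
  have "(\<lambda>y. z / y) ` circle \<subseteq> circle" using assms(2) by (auto simp: norm_divide)
  then have "(f has_field_derivative D) (at (z / y) within (\<lambda>y. z / y) ` circle)"
    using assms(1) unfolding has_circle_deriv_def by (rule DERIV_subset[rotated])
  moreover have "((\<lambda>y. z / y) has_field_derivative - z / y ^ 2) (at y within circle)"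
    using y by (auto intro!: derivative_eq_intros simp: power2_eq_square)
  ultimately have "(f \<circ> (\<lambda>y. z / y) has_field_derivative D * (- z / y ^ 2)) (at y within circle)"
    by (rule DERIV_image_chain)
  then show ?thesis by (simp add: has_circle_deriv_def comp_def)
qed

lemma quotient_weight_deriv:
  assumes "\<And>k. k \<le> r \<Longrightarrow> has_circle_deriv ((circle_deriv ^^ k) \<omega>) ((circle_deriv ^^ Suc k) \<omega> (z / y)) (z / y)"
    and z: "z \<in> circle" and y: "y \<in> circle"
  shows "has_circle_deriv (quotient_weight \<omega> r z) (quotient_weight \<omega> (Suc r) z y) y"
proof -
  let ?w = "\<lambda>k. (circle_deriv ^^ k) \<omega> (z / y)"
  have y0: "y \<noteq> 0" using y by auto
  let ?X = "\<lambda>k. z ^ k * ?w k / y ^ (k + Suc r)"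
  have "has_circle_deriv (\<lambda>y. quotient_weight \<omega> r z y)
      (diff_comb of_nat r (\<lambda>k. - (of_nat k + of_nat r) * ?X k - ?X (Suc k))) y"
    unfolding quotient_weight_def
  proof (rule has_circle_deriv_diff_comb)
    fix k assume "k \<le> r"
    from has_circle_deriv_quotient[OF assms(1)[OF this] z y]
    have "((\<lambda>y. (circle_deriv ^^ k) \<omega> (z / y)) has_field_derivative - ?w (Suc k) * z / y ^ 2) (at y within circle)"
      by (simp add: has_circle_deriv_def)
    then have 1: "((\<lambda>y. z ^ k * (circle_deriv ^^ k) \<omega> (z / y)) has_field_derivative z ^ k * (- ?w (Suc k) * z / y ^ 2)) (at y within circle)"
      by (rule DERIV_cmult)
    have 2: "((\<lambda>y. y ^ (k + r)) has_field_derivative of_nat (k + r) * y ^ (k + r - 1)) (at y within circle)"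
      by (auto intro!: derivative_eq_intros)
    have 3: "((\<lambda>y. z ^ k * (circle_deriv ^^ k) \<omega> (z / y) / y ^ (k + r)) has_field_derivative
        (z ^ k * (- ?w (Suc k) * z / y ^ 2) * y ^ (k + r) - z ^ k * ?w k * (of_nat (k + r) * y ^ (k + r - 1))) / (y ^ (k + r) * y ^ (k + r)))
        (at y within circle)"
      by (rule DERIV_divide[OF 1 2]) (use y0 in simp)
    have 4: "(z ^ k * (- ?w (Suc k) * z / y ^ 2) * y ^ (k + r) - z ^ k * ?w k * (of_nat (k + r) * y ^ (k + r - 1))) / (y ^ (k + r) * y ^ (k + r))
        = - (of_nat k + of_nat r) * ?X k - ?X (Suc k)"
    proof -
      have a: "z ^ k * (- W * z / y ^ 2) * Y / (Y * Y) = - (z ^ Suc k * W / (Y * y ^ 2))" if "Y \<noteq> 0" for W Y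
        using that y0 by (simp add: field_simps)
      have b: "z ^ k * W * (of_nat m * y ^ (m - 1)) / (y ^ m * y ^ m) = of_nat m * (z ^ k * W / y ^ Suc m)" for W m
        using y0 by (cases m) (simp_all add: field_simps)
      have c: "- (of_nat k + of_nat r) * ?X k = - (of_nat (k + r) * ?X k)"
        by (simp only: of_nat_add mult_minus_left)
      have d: "y ^ (k + r) \<noteq> 0" using y0 by simp
      show ?thesis unfolding diff_divide_distrib c a[OF d] b
        by (simp add: power2_eq_square mult_ac)
    qed
    show "has_circle_deriv (\<lambda>y. z ^ k * (circle_deriv ^^ k) \<omega> (z / y) / y ^ (k + r)) (- (of_nat k + of_nat r) * ?X k - ?X (Suc k)) y"
      using 3 unfolding 4 has_circle_deriv_def .
  qed
  then show ?thesis unfolding quotient_weight_def[of \<omega> "Suc r"] diff_comb_Suc .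
qed

lemma circle_deriv_iter_quotient:
  assumes "\<And>k y. Suc k < r \<Longrightarrow> y \<in> circle \<Longrightarrow> has_circle_deriv ((circle_deriv ^^ k) \<omega>) ((circle_deriv ^^ Suc k) \<omega> y) y"
    and "\<And>k. k < r \<Longrightarrow> has_circle_deriv ((circle_deriv ^^ k) \<omega>) ((circle_deriv ^^ Suc k) \<omega> (z / y)) (z / y)"
    and "z \<in> circle" "y \<in> circle"
  shows "(circle_deriv ^^ r) (\<lambda>y. \<omega> (z / y)) y = quotient_weight \<omega> r z y"
  using assms
proof (induction r arbitrary: y)
  case 0
  then show ?case by (simp add: quotient_weight_0)
next
  case (Suc r)
  have "(circle_deriv ^^ Suc r) (\<lambda>y. \<omega> (z / y)) y = circle_deriv ((circle_deriv ^^ r) (\<lambda>y. \<omega> (z / y))) y" by simp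
  also have "\<dots> = circle_deriv (quotient_weight \<omega> r z) y"
  proof (rule circle_deriv_cong[OF _ Suc.prems(4)])
    fix y :: complex assume y: "y \<in> circle"
    then show "(circle_deriv ^^ r) (\<lambda>y. \<omega> (z / y)) y = quotient_weight \<omega> r z y"
      using circle_divide[OF Suc.prems(3) y] Suc.prems(3)
      by (intro Suc.IH) (use Suc.prems(1) in auto)
  qed
  also have "\<dots> = quotient_weight \<omega> (Suc r) z y"
    by (intro circle_deriv_eq quotient_weight_deriv Suc.prems) (use Suc.prems(2) in auto)
  finally show ?case .
qed

lemma mellin_rotate:
  assumes x: "x \<in> circle" and f: "f \<in> borel_measurable circle_haar"
  shows "mellin (\<lambda>z. f (z / x)) s = x powi s * mellin f s"
proof -
  have x0: "x \<noteq> 0" using x by auto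
  have m: "(\<lambda>z. (x * z) powi s * f z) \<in> borel_measurable circle_haar"
    by (intro borel_measurable_times f borel_measurable_circle_continuous continuous_on_power_int continuous_intros)
      (use x0 in auto)
  have "mellin (\<lambda>z. f (z / x)) s = (\<integral>z. (x * ((1 / x) * z)) powi s * f ((1 / x) * z) \<partial>circle_haar)"
    using x0 by (simp add: mellin_def)
  also have "\<dots> = (\<integral>z. (x * z) powi s * f z \<partial>circle_haar)"
    by (rule circle_integral_rotate[OF circle_inverse[OF x] m])
  also have "\<dots> = (\<integral>z. x powi s * (z powi s * f z) \<partial>circle_haar)"
    by (simp add: power_int_mult_distrib mult.assoc)
  finally show ?thesis by (simp add: mellin_def)
qed

lemma integrable_circle_rotate:
  assumes "x \<in> circle" "integrable circle_haar f"
  shows "integrable circle_haar (\<lambda>z. f (z / x) :: complex)"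
  using circle_integrable_rotate[OF circle_inverse[OF assms(1)], of f] assms(2) by simp

text \<open>The Mellin transform of \<omega>(z/x) is x^s times that of \<omega>, and the formula is
  its r-th derivative in x. Computing it from the explicit combination avoids an interchange of
  derivative and integral.\<close>

lemma
  assumes \<omega>: "\<omega> \<in> L1_cyclic_diff N" and r: "r < N" and x: "x \<in> circle"
  shows integrable_quotient_weight: "integrable circle_haar (\<lambda>z. quotient_weight \<omega> r z x)"
    and mellin_quotient_weight: "mellin (\<lambda>z. quotient_weight \<omega> r z x) s = mellin \<omega> s * (falling s r * x powi (s - int r))"
proof -
  have x0: "x \<noteq> 0" using x by auto
  have ik: "integrable circle_haar (\<lambda>z. (circle_deriv ^^ k) \<omega> (z / x))" if "k \<le> r" for k
    using that r by (intro integrable_circle_rotate[OF x] L1_cyclic_diff_integrable[OF \<omega>]) simp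
  have i: "integrable circle_haar (\<lambda>z. z ^ k * (circle_deriv ^^ k) \<omega> (z / x) / x ^ (k + r))" if "k \<le> r" for k
    by (intro integrable_divide integrable_circle_continuous_mult ik[OF that] continuous_intros)
  show "integrable circle_haar (\<lambda>z. quotient_weight \<omega> r z x)"
    unfolding quotient_weight_def by (rule integrable_diff_comb[OF i])
  have mk: "mellin (\<lambda>z. z ^ k * (circle_deriv ^^ k) \<omega> (z / x) / x ^ (k + r)) s
      = x powi (s - int r) * mellin ((circle_deriv ^^ k) \<omega>) (s + int k)" if "k \<le> r" for k
  proof -
    have "mellin (\<lambda>z. z ^ k * (circle_deriv ^^ k) \<omega> (z / x) / x ^ (k + r)) s
        = mellin (\<lambda>z. z ^ k * (circle_deriv ^^ k) \<omega> (z / x)) s / x ^ (k + r)"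
      by (simp add: mellin_def)
    also have "\<dots> = x powi (s + int k) * mellin ((circle_deriv ^^ k) \<omega>) (s + int k) / x ^ (k + r)"
      using that r L1_cyclic_diff_integrable[OF \<omega>, of k]
      by (simp add: mellin_powi_mult[of k "\<lambda>z. (circle_deriv ^^ k) \<omega> (z / x)"] mellin_rotate[OF x])
    also have "x powi (s + int k) = x powi (s - int r) * x ^ (k + r)"
      using x0 power_int_add[of x "s - int r" "int (k + r)"] unfolding power_int_of_nat by simp
    finally show ?thesis using x0 by simp
  qed
  have "mellin (\<lambda>z. quotient_weight \<omega> r z x) s
      = diff_comb of_nat r (\<lambda>k. mellin (\<lambda>z. z ^ k * (circle_deriv ^^ k) \<omega> (z / x) / x ^ (k + r)) s)"
    unfolding quotient_weight_def by (rule mellin_diff_comb[OF i])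
  also have "\<dots> = diff_comb of_nat r (\<lambda>k. x powi (s - int r) * mellin ((circle_deriv ^^ k) \<omega>) (s + int k))"
    unfolding diff_comb_def by (intro sum.cong refl) (simp only: mk atMost_iff)
  also have "\<dots> = mellin \<omega> s * (falling s r * x powi (s - int r))"
    by (simp add: diff_comb_cmult diff_comb_mellin[OF \<omega> r] falling_def)
  finally show "mellin (\<lambda>z. quotient_weight \<omega> r z x) s = mellin \<omega> s * (falling s r * x powi (s - int r))" .
qed

lemma circle_deriv_iter_quotient_eq:
  assumes \<omega>: "\<omega> \<in> L1_cyclic_diff N" and r: "r + 2 \<le> N" and z: "z \<in> circle" and y: "y \<in> circle"
  shows "(circle_deriv ^^ r) (\<lambda>y. \<omega> (z / y)) y = quotient_weight \<omega> r z y"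
  using r by (intro circle_deriv_iter_quotient z y L1_cyclic_diff_deriv[OF \<omega>] circle_divide) auto

lemma continuous_on_quotient_weight:
  assumes \<omega>: "\<omega> \<in> L1_cyclic_diff N" and r: "r + 2 \<le> N" and y: "y \<in> circle"
  shows "continuous_on circle (\<lambda>z. quotient_weight \<omega> r z y)"
  unfolding quotient_weight_def
proof (rule continuous_on_diff_comb)
  fix k assume "k \<le> r"
  then have "continuous_on circle ((circle_deriv ^^ k) \<omega>)" using r by (intro L1_cyclic_diff_continuous[OF \<omega>]) simp
  then have "continuous_on circle (\<lambda>z. (circle_deriv ^^ k) \<omega> (z / y))"
    by (rule continuous_on_compose2) (use y in \<open>auto intro!: continuous_intros simp: norm_divide\<close>)
  then show "continuous_on circle (\<lambda>z. z ^ k * (circle_deriv ^^ k) \<omega> (z / y) / y ^ (k + r))"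
    by (intro continuous_intros) (use y in auto)
qed

text \<open>An almost everywhere formula gives no measurability, as the measure lives on the Borel
  sets. The derivative of order r - 1 is known everywhere and is continuous in z, and the criterion
  for derivatives with a parameter takes the last step.\<close>

lemma measurable_circle_deriv_iter_quotient:
  assumes \<omega>: "\<omega> \<in> L1_cyclic_diff N" and r: "r < N" and x: "x \<in> circle"
  shows "(\<lambda>z. (circle_deriv ^^ r) (\<lambda>y. \<omega> (z / y)) x) \<in> borel_measurable circle_haar"
proof (cases r)
  case 0
  then show ?thesis
    using integrable_circle_rotate[OF x, of \<omega>] L1_cyclic_diff_integrable[OF \<omega>, of 0] r by auto
next
  case (Suc l)
  have "continuous_on circle (\<lambda>z. (circle_deriv ^^ l) (\<lambda>y. \<omega> (z / y)) y)" if y: "y \<in> circle" for y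
    using continuous_on_quotient_weight[OF \<omega> _ y, of l] Suc r circle_deriv_iter_quotient_eq[OF \<omega> _ _ y, of l]
    by (subst continuous_on_cong[OF refl, of _ _ "\<lambda>z. quotient_weight \<omega> l z y"]) auto
  from measurable_circle_deriv_param[OF x this] show ?thesis by (simp add: Suc)
qed

lemma AE_circle_deriv_iter_quotient:
  assumes \<omega>: "\<omega> \<in> L1_cyclic_diff N" and r: "r < N" and x: "x \<in> circle"
  shows "AE z in circle_haar. (circle_deriv ^^ r) (\<lambda>y. \<omega> (z / y)) x = quotient_weight \<omega> r z x"
proof -
  have "AE z in circle_haar. \<forall>k<r. has_circle_deriv ((circle_deriv ^^ k) \<omega>) ((circle_deriv ^^ Suc k) \<omega> z) z"
    using L1_cyclic_diff_AE_deriv[OF \<omega>] r by (auto simp: AE_all_countable)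
  from circle_AE_rotate[OF circle_inverse[OF x] this]
  have "AE z in circle_haar. \<forall>k<r. has_circle_deriv ((circle_deriv ^^ k) \<omega>) ((circle_deriv ^^ Suc k) \<omega> (z / x)) (z / x)"
    by simp
  then show ?thesis using AE_space
  proof eventually_elim
    case (elim z)
    show ?case by (rule circle_deriv_iter_quotient) (use elim L1_cyclic_diff_deriv[OF \<omega>] r x in auto)
  qed
qed

lemma
  assumes \<omega>: "\<omega> \<in> L1_cyclic_diff N" and r: "r < N" and x: "x \<in> circle"
  shows integrable_circle_deriv_iter_quotient:
      "integrable circle_haar (\<lambda>z. (circle_deriv ^^ r) (\<lambda>y. \<omega> (z / y)) x)"
    and mellin_circle_deriv_iter_quotient:
      "mellin (\<lambda>z. (circle_deriv ^^ r) (\<lambda>y. \<omega> (z / y)) x) s = mellin \<omega> s * (falling s r * x powi (s - int r))"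
proof -
  note m = measurable_circle_deriv_iter_quotient[OF assms] and ae = AE_circle_deriv_iter_quotient[OF assms]
    and i = integrable_quotient_weight[OF assms]
  show I: "integrable circle_haar (\<lambda>z. (circle_deriv ^^ r) (\<lambda>y. \<omega> (z / y)) x)"
    using i integrable_cong_AE[OF m _ ae] by auto
  have "mellin (\<lambda>z. (circle_deriv ^^ r) (\<lambda>y. \<omega> (z / y)) x) s = mellin (\<lambda>z. quotient_weight \<omega> r z x) s"
    unfolding mellin_def
    by (rule integral_cong_AE) (use integrable_circle_powi[OF I] integrable_circle_powi[OF i] ae in \<open>auto elim: eventually_mono\<close>)
  then show "mellin (\<lambda>z. (circle_deriv ^^ r) (\<lambda>y. \<omega> (z / y)) x) s = mellin \<omega> s * (falling s r * x powi (s - int r))"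
    by (simp add: mellin_quotient_weight[OF assms])
qed

lemma circle_deriv_iter_power:
  assumes "y \<in> circle"
  shows "(circle_deriv ^^ r) (\<lambda>y. y ^ m) y = falling (int m) r * y powi (int m - int r)"
  using assms
proof (induction r arbitrary: y)
  case (Suc r)
  have "(circle_deriv ^^ Suc r) (\<lambda>y. y ^ m) y = circle_deriv (\<lambda>y. falling (int m) r * y powi (int m - int r)) y"
    using Suc by (auto intro!: circle_deriv_cong)
  also have "\<dots> = falling (int m) r * (of_int (int m - int r) * y powi (int m - int r - 1))"
    using has_circle_deriv_powi[OF Suc.prems]
    by (intro circle_deriv_eq[OF _ Suc.prems]) (simp only: has_circle_deriv_def DERIV_cmult)
  finally show ?case by (simp add: falling_Suc algebra_simps)
qed simp

subsection \<open>Moments of the ensembles\<close>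

lemma root_coeff_permute: "p permutes UNIV \<Longrightarrow> root_coeff (z \<circ> p) = root_coeff z"
  unfolding root_coeff_def using prod.permute[of p UNIV "\<lambda>a. [:- z a, 1:]"] by (simp add: comp_def fun_eq_iff)

lemma class_moment_density:
  fixes U :: "'a \<Rightarrow> 'n::{finite,linorder} cmat"
  assumes M: "prob_space M" and U: "U \<in> measurable M unitary_space" and d: "eigenvalue_density M U p"
  shows "class_moment M U k s = (\<integral>z. cnj (\<Prod>i\<in>UNIV. z i) ^ k * schur s z * p z \<partial>torus_haar)"
proof -
  let ?g = "\<lambda>z :: 'n \<Rightarrow> complex. cnj (\<Prod>i\<in>UNIV. z i) ^ k * schur s z"
  obtain B where B: "\<forall>z\<in>space torus_haar. cmod (schur s z) \<le> B" using schur_bounded by blast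
  have eq: "?g (some_spectrum (U \<xi>)) = cnj (det (U \<xi>)) ^ k * schur_mat s (U \<xi>)" if "\<xi> \<in> space M" for \<xi>
  proof -
    have "U \<xi> \<in> unitary_group" using measurable_space[OF U that] by simp
    then have "is_spectrum (U \<xi>) (some_spectrum (U \<xi>))" by (rule is_spectrum_some_spectrum)
    then show ?thesis by (simp add: schur_mat_spectrum det_spectrum)
  qed
  have m: "(\<lambda>\<xi>. cnj (det (U \<xi>)) ^ k * schur_mat s (U \<xi>)) \<in> borel_measurable M"
    using integrable_det_matpoly[OF M U matpoly_schur_mat] by (rule borel_measurable_integrable)
  have "class_moment M U k s = (\<integral>\<xi>. ?g (some_spectrum (U \<xi>)) \<partial>M)"
    unfolding class_moment_def by (rule Bochner_Integration.integral_cong[OF refl]) (rule eq[symmetric])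
  also have "\<dots> = (\<integral>z. ?g z * p z \<partial>torus_haar)"
  proof (rule eigenvalue_density_expectation[OF M U d, where B = B])
    show "?g \<in> borel_measurable torus_haar"
      by (intro borel_measurable_torus_continuous continuous_intros continuous_on_product_coordinates continuous_on_schur)
    show "symmetric_on_torus ?g"
      unfolding symmetric_on_torus_def
    proof (intro allI impI ballI)
      fix \<pi> :: "'n \<Rightarrow> 'n" and z assume "bij \<pi>"
      then have p: "\<pi> permutes UNIV" by (intro bij_imp_permutes) auto
      show "?g (z \<circ> \<pi>) = ?g z"
        using prod.permute[OF p, of z] by (simp add: schur_def root_coeff_permute[OF p])
    qed
    show "cmod (?g z) \<le> B" if "z \<in> space torus_haar" for z
      using B that by (simp add: norm_mult norm_power mem_torusD[OF that] flip: prod_norm)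
    show "(\<lambda>\<xi>. ?g (some_spectrum (U \<xi>))) \<in> borel_measurable M"
      using m by (rule measurable_cong[THEN iffD2, rotated]) (rule eq)
  qed
  finally show ?thesis .
qed

text \<open>The common shape of the polynomial, Polya and conditional densities, so that moments are
  compared once for all of them.\<close>

definition det_density ::
  "complex \<Rightarrow> ('n::{finite,linorder} \<Rightarrow> complex \<Rightarrow> complex) \<Rightarrow> ('n \<Rightarrow> complex) \<Rightarrow> complex" where
  "det_density c \<psi> z = c * vandermonde z * det (\<chi> (a::'n) b. \<psi> b (z a))"

lemma symmetric_det_density: "symmetric_on_torus (det_density c \<psi>)"
  unfolding symmetric_on_torus_def
proof (intro allI impI ballI)
  fix \<pi> :: "'a \<Rightarrow> 'a" and z :: "'a \<Rightarrow> complex" assume "bij \<pi>"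
  then have p: "\<pi> permutes UNIV" by (intro bij_imp_permutes) auto
  have s: "of_int (sign \<pi>) * of_int (sign \<pi>) = (1::complex)"
    using sign_idempotent[of \<pi>] by (metis of_int_1 of_int_mult)
  have "det_density c \<psi> (z \<circ> \<pi>) = c * vandermonde z * det (\<chi> (a::'a) b. \<psi> b (z a)) * (of_int (sign \<pi>) * of_int (sign \<pi>))"
    using det_permute_rows[OF p, of "\<chi> a b. \<psi> b (z a)"]
    by (simp only: det_density_def vandermonde_permute[OF p]) simp
  then show "det_density c \<psi> (z \<circ> \<pi>) = det_density c \<psi> z" by (simp only: s det_density_def) simp
qed

lemma measurable_torus_component: "(\<lambda>z. z i) \<in> measurable torus_haar circle_haar"
  unfolding torus_haar_def by measurable

lemma measurable_det_density:
  assumes "\<And>b. \<psi> b \<in> borel_measurable circle_haar"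
  shows "det_density c \<psi> \<in> borel_measurable torus_haar"
proof -
  have [measurable]: "(\<lambda>z. \<psi> b (z a)) \<in> borel_measurable torus_haar" for a b
    by (rule measurable_compose[OF measurable_torus_component assms])
  have [measurable]: "(\<lambda>z. vandermonde z) \<in> borel_measurable torus_haar"
    unfolding vandermonde_def case_prod_unfold by measurable
  show ?thesis unfolding det_density_def[abs_def] det_def by simp measurable
qed

lemma AE_torus_component: "AE x in circle_haar. P x \<Longrightarrow> AE z in torus_haar. P (z i)"
  unfolding torus_haar_def
  by (rule AE_PiM_component) (auto intro: circle_haar.prob_space_axioms)

lemma AE_det_density_cong:
  fixes \<psi> \<psi>' :: "'n::{finite,linorder} \<Rightarrow> complex \<Rightarrow> complex"
  assumes "\<And>b. AE z in circle_haar. \<psi> b z = \<psi>' b z"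
  shows "AE z in torus_haar. det_density c \<psi> z = det_density c \<psi>' z"
proof -
  have "AE z in torus_haar. \<psi> b (z a) = \<psi>' b (z a)" for a b :: 'n
    by (rule AE_torus_component[OF assms])
  then have "AE z in torus_haar. \<forall>(a :: 'n) (b :: 'n). \<psi> b (z a) = \<psi>' b (z a)"
    unfolding AE_all_countable by (intro allI)
  then show ?thesis by eventually_elim (simp add: det_density_def)
qed

text \<open>The integrable weights \<open>\<psi>\<close> represent the weights
  \<open>\<psi>'\<close> of the density almost everywhere; for Polya ensembles they are the explicit
  combinations replacing iterated derivatives.\<close>

lemma det_density_class_moment:
  fixes U :: "'a \<Rightarrow> 'n::{finite,linorder} cmat"
  assumes "prob_space M" "U \<in> measurable M unitary_space" and d: "eigenvalue_density M U (det_density c \<psi>')"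
    and \<psi>: "\<And>b. integrable circle_haar (\<psi> b)" "\<And>b. AE z in circle_haar. \<psi>' b z = \<psi> b z"
  shows "class_moment M U k s = c * fact CARD('n) * det (\<chi> a b. mellin (\<psi> b) (int (s a) - int k))"
proof -
  have m: "det_density c \<psi>' \<in> borel_measurable torus_haar" using d by (simp add: eigenvalue_density_def)
  have "AE z in torus_haar. det_density c \<psi>' z = c * vandermonde z * det (\<chi> a b. \<psi> b (z a))"
    using AE_det_density_cong[where \<psi> = \<psi>' and \<psi>' = \<psi> and c = c, OF \<psi>(2)] by (simp only: det_density_def[of c \<psi>])
  from vandermonde_density_moment(2)[OF \<psi>(1) m this] show ?thesis
    unfolding class_moment_density[OF assms(1-3)] .
qed

text \<open>The converse direction: to identify an ensemble it remains to recognise determinants of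
  Mellin transforms in its moments.\<close>

lemma det_densityI:
  fixes U :: "'a \<Rightarrow> 'n::{finite,linorder} cmat"
  assumes M: "prob_space M" "U \<in> measurable M unitary_space"
    and \<psi>: "\<And>b. integrable circle_haar (\<psi> b)"
    and moments: "\<And>k s. class_moment M U k s = c * fact CARD('n) * det (\<chi> a b. mellin (\<psi> b) (int (s a) - int k))"
  shows "eigenvalue_density M U (det_density c \<psi>)"
proof -
  have m: "det_density c \<psi> \<in> borel_measurable torus_haar"
    using \<psi> by (intro measurable_det_density) auto
  have "AE z in torus_haar. det_density c \<psi> z = c * vandermonde z * det (\<chi> a b. \<psi> b (z a))"
    by (simp add: det_density_def)
  note v = vandermonde_density_moment[OF \<psi> m this]
  show ?thesis
    by (rule eigenvalue_densityI[OF M v(1) symmetric_det_density])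
      (use moments v(2) in \<open>simp add: class_moment_def\<close>)
qed

lemma cyclic_density_eq:
  "cyclic_density w = det_density (1 / (cyclic_const w * fact CARD('n) * \<i> ^ (CARD('n) * (CARD('n) - 1) div 2))) (w :: 'n::{finite,linorder} \<Rightarrow> _)"
  by (simp add: fun_eq_iff cyclic_density_def det_density_def)

lemma polya_density_eq:
  "polya_density \<omega> = det_density (1 / (fact CARD('n) * (\<Prod>j<CARD('n). fact j * mellin \<omega> (int j))))
    (\<lambda>b :: 'n::{finite,linorder}. (neg_euler ^^ pos b) \<omega>)"
  by (simp add: fun_eq_iff polya_density_def det_density_def)

lemma det_scale_rows:
  fixes c :: "'n::finite \<Rightarrow> complex"
  shows "det (\<chi> a b. c a * f a b) = (\<Prod>a\<in>UNIV. c a) * det (\<chi> a b. f a b)"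
  using det_rows_mul[of c "\<lambda>a. \<chi> b. f a b"] by (simp add: vector_scalar_mult_def)

lemma det_transposed_vandermonde:
  fixes y :: "'n::{finite,linorder} \<Rightarrow> complex"
  shows "det (\<chi> a b. y a ^ pos (b::'n)) = vandermonde y"
  using det_transpose[of "\<chi> a b. y b ^ pos (a::'n)"] by (simp add: transpose_def vandermonde_det)

text \<open>With m = s a - k the entries are the Mellin transform at m times m^b: one factor per row
  and a Vandermonde determinant in the numbers m, in which the shift by k cancels.\<close>

lemma euler_weight_det:
  fixes s :: "'n::{finite,linorder} \<Rightarrow> nat"
  assumes \<omega>: "\<omega> \<in> L1_cyclic_diff CARD('n)"
  shows "det (\<chi> a b. mellin (euler_weight \<omega> (pos (b::'n))) (int (s a) - int k))
    = (\<Prod>a\<in>UNIV. mellin \<omega> (int (s a) - int k)) * vandermonde (\<lambda>a. of_nat (s a))"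
proof -
  have "(\<lambda>a b. mellin (euler_weight \<omega> (pos (b::'n))) (int (s a) - int k))
      = (\<lambda>a b. mellin \<omega> (int (s a) - int k) * (of_nat (s a) - of_nat k) ^ pos b)"
    by (simp add: fun_eq_iff mellin_euler_weight[OF \<omega> pos_less_card])
  from arg_cong[where f = "\<lambda>f. det (\<chi> a b. f a b)", OF this]
  have "det (\<chi> a b. mellin (euler_weight \<omega> (pos (b::'n))) (int (s a) - int k))
      = (\<Prod>a\<in>UNIV. mellin \<omega> (int (s a) - int k)) * vandermonde (\<lambda>a. of_nat (s a) - of_nat k)"
    by (simp only: det_scale_rows det_transposed_vandermonde)
  then show ?thesis by (simp add: vandermonde_def)
qed

lemma vandermonde_pos: "vandermonde (\<lambda>a::'n::{finite,linorder}. of_nat (pos a)) = (\<Prod>j<CARD('n). fact j)"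
proof -
  have "vandermonde (\<lambda>a::'n. of_nat (pos a)) = (\<Prod>a\<in>UNIV. \<Prod>c\<in>{c. c < a}. of_nat (pos (a::'n)) - of_nat (pos c))"
    by (rule vandermonde_nested_prod)
  also have "\<dots> = (\<Prod>a\<in>UNIV. fact (pos (a::'n)))"
  proof (rule prod.cong[OF refl])
    fix a :: 'n
    have "bij_betw pos {c. c < a} {..<pos a}"
      unfolding bij_betw_def
    proof (intro conjI card_subset_eq)
      show inj: "inj_on pos {c. c < a}" using inj_pos by (rule inj_on_subset) simp
      show "pos ` {c. c < a} \<subseteq> {..<pos a}" by auto
      show "card (pos ` {c. c < a}) = card {..<pos a}" using card_image[OF inj] by (simp add: pos_def)
    qed simp
    then have "(\<Prod>c\<in>{c. c < a}. of_nat (pos a) - of_nat (pos c) :: complex) = (\<Prod>i<pos a. of_nat (pos a) - of_nat i)"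
      by (rule prod.reindex_bij_betw)
    also have "\<dots> = of_nat (\<Prod>i<pos a. pos a - i)" by (simp add: of_nat_diff)
    also have "(\<Prod>i<m. m - i) = fact m" for m :: nat
      by (simp add: fact_prod_rev lessThan_atLeast0)
    finally show "(\<Prod>c\<in>{c. c < a}. of_nat (pos a) - of_nat (pos c) :: complex) = fact (pos a)" by simp
  qed
  also have "\<dots> = (\<Prod>j<CARD('n). fact j)" by (rule prod_over_pos)
  finally show ?thesis .
qed

text \<open>The Vandermonde determinant of the exponents, divided by the product of factorials in
  the normalisation, is the Schur function at the identity matrix.\<close>

lemma polya_class_moment:
  fixes U :: "'a \<Rightarrow> 'n::{finite,linorder} cmat"
  assumes M: "prob_space M" and U: "cyclic_polya_ensemble M U \<omega>"
  shows "class_moment M U k s = (\<Prod>a\<in>UNIV. mellin \<omega> (int (s a) - int k)) / (\<Prod>j<CARD('n). mellin \<omega> (int j))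
    * schur_mat s (mat 1 :: 'n cmat)"
proof -
  have \<omega>: "\<omega> \<in> L1_cyclic_diff CARD('n)" and U': "U \<in> measurable M unitary_space"
    and d: "eigenvalue_density M U (polya_density \<omega>)"
    using U by (auto simp: cyclic_polya_ensemble_def unitarily_invariant_def)
  let ?F = "\<Prod>j<CARD('n). fact j :: complex"
  have F: "?F \<noteq> 0" by simp
  have "is_spectrum (mat 1 :: 'n cmat) (\<lambda>_. 1)"
    using is_spectrum_diag[of "\<lambda>_ :: 'n. 1"] by (simp add: diag_mat_def mat_def)
  then have "schur_mat s (mat 1 :: 'n cmat) * ?F = vandermonde (\<lambda>a. of_nat (s a))"
    using schur_one[of s] by (simp add: schur_mat_spectrum vandermonde_pos)
  then have one: "schur_mat s (mat 1 :: 'n cmat) = vandermonde (\<lambda>a. of_nat (s a)) / ?F"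
    using F by (simp add: field_simps)
  have "class_moment M U k s = 1 / (fact CARD('n) * (\<Prod>j<CARD('n). fact j * mellin \<omega> (int j))) * fact CARD('n)
      * det (\<chi> a b. mellin (euler_weight \<omega> (pos (b::'n))) (int (s a) - int k))"
    by (rule det_density_class_moment[OF M U' d[unfolded polya_density_eq]])
      (auto intro!: integrable_euler_weight[OF \<omega>] AE_neg_euler_iter[OF \<omega>] pos_less_card)
  then show ?thesis unfolding euler_weight_det[OF \<omega>] one by (simp add: prod.distrib mult_ac)
qed

text \<open>The Schur function at the identity occurs in the product formula and in the Polya
  moment, and cancels. It is zero only for repeated exponents, where all moments vanish.\<close>

lemma class_moment_polya_mult:
  fixes U1 U2 :: "'a \<Rightarrow> 'n::{finite,linorder} cmat"
  assumes M: "prob_space M" and U1: "cyclic_polya_ensemble M U1 \<omega>" and U2: "unitarily_invariant M U2"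
    and indep: "prob_space.indep_var M unitary_space U1 unitary_space U2"
  shows "class_moment M (\<lambda>\<xi>. U1 \<xi> ** U2 \<xi>) k s
    = (\<Prod>a\<in>UNIV. mellin \<omega> (int (s a) - int k)) / (\<Prod>j<CARD('n). mellin \<omega> (int j)) * class_moment M U2 k s"
proof (cases "schur_mat s (mat 1 :: 'n cmat) = 0")
  case False
  have "unitarily_invariant M U1" using U1 by (simp add: cyclic_polya_ensemble_def)
  from class_moment_mult[OF M this U2 indep, of k s]
  have "class_moment M (\<lambda>\<xi>. U1 \<xi> ** U2 \<xi>) k s * schur_mat s (mat 1 :: 'n cmat)
      = ((\<Prod>a\<in>UNIV. mellin \<omega> (int (s a) - int k)) / (\<Prod>j<CARD('n). mellin \<omega> (int j)) * class_moment M U2 k s)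
        * schur_mat s (mat 1 :: 'n cmat)"
    unfolding polya_class_moment[OF M U1] by (simp only: mult_ac)
  with False show ?thesis by (simp only: mult_right_cancel simp_thms)
next
  case True
  have "is_spectrum (mat 1 :: 'n cmat) (\<lambda>_. 1)"
    using is_spectrum_diag[of "\<lambda>_ :: 'n. 1"] by (simp add: diag_mat_def mat_def)
  then have "vandermonde (\<lambda>a. of_nat (s a) :: complex) = 0"
    using schur_one[of s] True by (simp add: schur_mat_spectrum)
  then have "\<not> inj s" unfolding vandermonde_eq_0_iff by (auto simp: inj_def)
  then have "schur_mat s A = 0" for A :: "'n cmat" by (simp add: schur_mat_def schur_coeff_not_inj)
  then show ?thesis by (simp add: class_moment_def)
qed

subsection \<open>Products with a cyclic Polya ensemble\<close>

lemma cyclic_const_eq: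
  "cyclic_const (w :: 'n::{finite,linorder} \<Rightarrow> _)
    = (\<Prod>a\<in>UNIV. (- \<i>) ^ pos (a::'n)) * det (\<chi> (a::'n) b. mellin (w b) (int (pos a)))"
proof -
  have "(\<integral>z. (- \<i> * z) ^ m * f z \<partial>circle_haar) = (- \<i>) ^ m * mellin f (int m)" for m f
    by (simp only: power_mult_distrib mellin_def power_int_of_nat mult.assoc integral_mult_right_zero)
  then show ?thesis unfolding cyclic_const_def by (simp only: det_scale_rows)
qed

lemma complex_pos_cancel: "0 < a * (b::complex) \<Longrightarrow> 0 < a \<Longrightarrow> 0 < b"
  by (auto simp: less_complex_def zero_less_mult_iff)

lemma prod_fact_mult:
  fixes f :: "nat \<Rightarrow> complex"
  shows "0 < (\<Prod>j<n. fact j * f j) \<longleftrightarrow> 0 < (\<Prod>j<n. f j)"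
proof -
  have F: "(0::complex) < (\<Prod>j<n. fact j)"
  proof -
    have "(\<Prod>j<n. fact j :: complex) = of_real (\<Prod>j<n. fact j)" by simp
    moreover have "(0::real) < (\<Prod>j<n. fact j)" by (simp add: prod_pos)
    ultimately show ?thesis by (simp only: less_complex_def Re_complex_of_real Im_complex_of_real) simp
  qed
  show ?thesis unfolding prod.distrib
    using complex_pos_cancel[OF _ F] F by (auto simp: less_complex_def)
qed

text \<open>The Mellin transform of \<omega> at s a - k is the same in every column, hence a row
  factor of the determinant for the convolved weights. With s = \<open>pos\<close> the same holds
  for the normalisation, which therefore matches and stays positive.\<close>

lemma cyclic_polynomial_mult:
  fixes U1 U2 :: "'a \<Rightarrow> 'n::{finite,linorder} cmat"
  assumes M: "prob_space M" and U1: "cyclic_polya_ensemble M U1 \<omega>" and U2: "cyclic_polynomial_ensemble M U2 w"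
    and indep: "prob_space.indep_var M unitary_space U1 unitary_space U2"
  shows "cyclic_polynomial_ensemble M (\<lambda>\<xi>. U1 \<xi> ** U2 \<xi>) (\<lambda>j. circle_conv (w j) \<omega>)"
proof -
  let ?w = "\<lambda>j. circle_conv (w j) \<omega>" and ?P = "\<Prod>j<CARD('n). mellin \<omega> (int j)"
  have \<omega>: "\<omega> \<in> L1_cyclic_diff CARD('n)" and i1: "unitarily_invariant M U1"
    and P: "0 < ?P"
    using U1 by (auto simp: cyclic_polya_ensemble_def prod_fact_mult)
  have i2: "unitarily_invariant M U2" and w: "\<And>b. w b \<in> L1_cyclic CARD('n)" and C: "0 < cyclic_const w"
    and d: "eigenvalue_density M U2 (cyclic_density w)"
    using U2 by (auto simp: cyclic_polynomial_ensemble_def)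
  have \<omega>L: "\<omega> \<in> L1_cyclic CARD('n)" by (rule L1_cyclic_diff_L1_cyclic[OF \<omega>])
  then have wi: "\<And>b. integrable circle_haar (w b)" and \<omega>i: "integrable circle_haar \<omega>"
    using w by (auto simp: L1_cyclic_def)
  have det: "det (\<chi> (a::'n) b. mellin (?w b) (e a)) = (\<Prod>a\<in>UNIV. mellin \<omega> (e a)) * det (\<chi> a b. mellin (w b) (e a))"
    for e :: "'n \<Rightarrow> int"
    by (simp only: mellin_circle_conv[OF wi \<omega>i] mult.commute[of _ "mellin \<omega> _"] det_scale_rows)
  have const: "cyclic_const ?w = ?P * cyclic_const w"
    unfolding cyclic_const_eq det using prod_over_pos[of "\<lambda>j. mellin \<omega> (int j)", where 'n = 'n]
    by (simp only: mult_ac)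
  have "0 < cyclic_const ?w" unfolding const using P C by (simp add: less_complex_def)
  moreover have inv: "unitarily_invariant M (\<lambda>\<xi>. U1 \<xi> ** U2 \<xi>)"
    by (rule unitarily_invariant_mult[OF M i1 i2 indep])
  moreover have "eigenvalue_density M (\<lambda>\<xi>. U1 \<xi> ** U2 \<xi>) (cyclic_density ?w)"
    unfolding cyclic_density_eq
  proof (rule det_densityI[OF M _ integrable_circle_conv[OF wi \<omega>i]])
    show "(\<lambda>\<xi>. U1 \<xi> ** U2 \<xi>) \<in> measurable M unitary_space" using inv by (simp add: unitarily_invariant_def)
    fix k s
    let ?I = "\<i> ^ (CARD('n) * (CARD('n) - 1) div 2)" and ?D = "det (\<chi> a b. mellin (w b) (int (s a) - int k))"
      and ?Q = "\<Prod>a\<in>UNIV. mellin \<omega> (int (s a) - int k)"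
    have "class_moment M U2 k s = 1 / (cyclic_const w * fact CARD('n) * ?I) * fact CARD('n) * ?D"
      by (rule det_density_class_moment[OF M _ d[unfolded cyclic_density_eq] wi])
        (use i2 in \<open>auto simp: unitarily_invariant_def\<close>)
    then show "class_moment M (\<lambda>\<xi>. U1 \<xi> ** U2 \<xi>) k s
        = 1 / (cyclic_const ?w * fact CARD('n) * ?I) * fact CARD('n) * det (\<chi> a b. mellin (?w b) (int (s a) - int k))"
      unfolding class_moment_polya_mult[OF M U1 i2 indep] det const by (simp add: mult_ac)
  qed
  ultimately show ?thesis
    unfolding cyclic_polynomial_ensemble_def using circle_conv_L1_cyclic[OF w \<omega>L] by blast
qed

lemma eigenvalue_density_cong:
  assumes "eigenvalue_density M U p" "\<And>z. z \<in> space torus_haar \<Longrightarrow> p z = q z"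
  shows "eigenvalue_density M U q"
proof -
  have m: "p \<in> borel_measurable torus_haar \<longleftrightarrow> q \<in> borel_measurable torus_haar"
    by (rule measurable_cong[OF assms(2)])
  have ae: "(AE z in torus_haar. 0 \<le> p z) \<longleftrightarrow> (AE z in torus_haar. 0 \<le> q z)"
    by (rule AE_cong) (simp add: assms(2))
  have s: "symmetric_on_torus p \<longleftrightarrow> symmetric_on_torus q"
    unfolding symmetric_on_torus_def using assms(2) torus_permute by metis
  have i: "(\<integral>\<^sup>+z. f z * ennreal (Re (p z)) \<partial>torus_haar) = (\<integral>\<^sup>+z. f z * ennreal (Re (q z)) \<partial>torus_haar)" for f
    by (rule nn_integral_cong) (simp add: assms(2))
  show ?thesis using assms(1) unfolding eigenvalue_density_def m ae s i .
qed

text \<open>The moments are first matched with a density in the explicit combinations of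
  derivatives. As a convolution is differentiable everywhere to the required order, these agree with
  the iterated Euler operator at every point of the torus, not merely almost everywhere.\<close>

lemma cyclic_polya_mult:
  fixes U1 U2 :: "'a \<Rightarrow> 'n::{finite,linorder} cmat"
  assumes M: "prob_space M" and U1: "cyclic_polya_ensemble M U1 \<omega>" and U2: "cyclic_polya_ensemble M U2 \<omega>'"
    and indep: "prob_space.indep_var M unitary_space U1 unitary_space U2"
  shows "cyclic_polya_ensemble M (\<lambda>\<xi>. U1 \<xi> ** U2 \<xi>) (circle_conv \<omega>' \<omega>)"
proof -
  let ?w = "circle_conv \<omega>' \<omega>"
  have \<omega>: "\<omega> \<in> L1_cyclic_diff CARD('n)" "\<omega>' \<in> L1_cyclic_diff CARD('n)"
    and i: "unitarily_invariant M U1" "unitarily_invariant M U2"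
    and P: "0 < (\<Prod>j<CARD('n). mellin \<omega> (int j))" "0 < (\<Prod>j<CARD('n). mellin \<omega>' (int j))"
    using U1 U2 by (auto simp: cyclic_polya_ensemble_def prod_fact_mult)
  have \<omega>i: "integrable circle_haar \<omega>" "integrable circle_haar \<omega>'"
    using L1_cyclic_diff_integrable[OF \<omega>(1), of 0] L1_cyclic_diff_integrable[OF \<omega>(2), of 0] by auto
  note mel = mellin_circle_conv[OF \<omega>i(2,1)]
  have w: "?w \<in> L1_cyclic_diff CARD('n)" by (rule circle_conv_L1_cyclic_diff[OF \<omega>(2,1)])
  have "0 < (\<Prod>j<CARD('n). mellin ?w (int j))"
    unfolding mel prod.distrib using P by (simp add: less_complex_def)
  then have pos: "0 < (\<Prod>j<CARD('n). fact j * mellin ?w (int j))" by (simp add: prod_fact_mult)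
  have inv: "unitarily_invariant M (\<lambda>\<xi>. U1 \<xi> ** U2 \<xi>)"
    by (rule unitarily_invariant_mult[OF M i indep])
  have eq: "(neg_euler ^^ b) ?w z = euler_weight ?w b z" if "b < CARD('n)" "z \<in> circle" for b z
  proof (cases "b = 0")
    case False
    then have "continuous_on circle \<omega>" using L1_cyclic_diff_continuous[OF \<omega>(1), of 0] that by simp
    note D = has_circle_deriv_iter_conv[OF \<omega>(2) this]
    show ?thesis
    proof (rule neg_euler_iter[OF _ _ that(2)])
      show "has_circle_deriv ((circle_deriv ^^ k) ?w) ((circle_deriv ^^ Suc k) ?w y) y" if "Suc k < b" "y \<in> circle" for k y
        by (rule D) (use that \<open>b < CARD('n)\<close> in auto)
      show "has_circle_deriv ((circle_deriv ^^ k) ?w) ((circle_deriv ^^ Suc k) ?w z) z" if "k < b" for k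
        by (rule D) (use that \<open>b < CARD('n)\<close> \<open>z \<in> circle\<close> in auto)
    qed
  qed (simp add: euler_weight_def)
  let ?c = "1 / (fact CARD('n) * (\<Prod>j<CARD('n). fact j * mellin ?w (int j)))"
  have "eigenvalue_density M (\<lambda>\<xi>. U1 \<xi> ** U2 \<xi>) (det_density ?c (\<lambda>b::'n. euler_weight ?w (pos b)))"
  proof (rule det_densityI[OF M _ integrable_euler_weight[OF w pos_less_card]])
    show "(\<lambda>\<xi>. U1 \<xi> ** U2 \<xi>) \<in> measurable M unitary_space" using inv by (simp add: unitarily_invariant_def)
  next
    fix k s
    have "class_moment M U2 k s = 1 / (fact CARD('n) * (\<Prod>j<CARD('n). fact j * mellin \<omega>' (int j))) * fact CARD('n)
      * det (\<chi> a b. mellin (euler_weight \<omega>' (pos (b::'n))) (int (s a) - int k))"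
      by (rule det_density_class_moment[OF M _ _ integrable_euler_weight[OF \<omega>(2) pos_less_card] AE_neg_euler_iter[OF \<omega>(2) pos_less_card]])
        (use U2 i in \<open>auto simp: cyclic_polya_ensemble_def unitarily_invariant_def polya_density_eq\<close>)
    then show "class_moment M (\<lambda>\<xi>. U1 \<xi> ** U2 \<xi>) k s
        = ?c * fact CARD('n) * det (\<chi> a b. mellin (euler_weight ?w (pos (b::'n))) (int (s a) - int k))"
      unfolding class_moment_polya_mult[OF M U1 i(2) indep] euler_weight_det[OF \<omega>(2)] euler_weight_det[OF w] mel
      by (simp add: prod.distrib mult_ac)
  qed
  moreover have "det_density ?c (\<lambda>b::'n. euler_weight ?w (pos b)) z = polya_density ?w z" if "z \<in> space torus_haar" for z
    unfolding polya_density_eq det_density_def using mem_torusD[OF that] by (simp add: eq pos_less_card)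
  ultimately have "eigenvalue_density M (\<lambda>\<xi>. U1 \<xi> ** U2 \<xi>) (polya_density ?w)"
    using eigenvalue_density_cong by blast
  then show ?thesis unfolding cyclic_polya_ensemble_def using inv w pos by blast
qed

subsection \<open>The conditional density\<close>

lemma haar_conjugate_class_moment:
  fixes U2 :: "'n::{finite,linorder} cmat"
  assumes M: "prob_space M" and V: "V \<in> measurable M unitary_space" and x: "is_spectrum U2 x"
  shows "class_moment M (\<lambda>\<xi>. V \<xi> ** U2 ** dagger (V \<xi>)) k s = cnj (\<Prod>i\<in>UNIV. x i) ^ k * schur s x"
proof -
  interpret M: prob_space M by fact
  have "cnj (det (V \<xi> ** U2 ** dagger (V \<xi>))) ^ k * schur_mat s (V \<xi> ** U2 ** dagger (V \<xi>))
      = cnj (\<Prod>i\<in>UNIV. x i) ^ k * schur s x" if "\<xi> \<in> space M" for \<xi>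
  proof -
    have "V \<xi> \<in> unitary_group" using measurable_space[OF V that] by simp
    then have "V \<xi> ** dagger (V \<xi>) = mat 1" by (simp add: unitary_group_def)
    from is_spectrum_conj[OF x this] show ?thesis by (simp only: schur_mat_spectrum det_spectrum)
  qed
  then have "class_moment M (\<lambda>\<xi>. V \<xi> ** U2 ** dagger (V \<xi>)) k s
      = (\<integral>\<xi>. cnj (\<Prod>i\<in>UNIV. x i) ^ k * schur s x \<partial>M)"
    unfolding class_moment_def by (rule Bochner_Integration.integral_cong[OF refl])
  then show ?thesis by (simp add: M.prob_space)
qed

lemma conditional_density_lhopital_eq:
  assumes "x \<in> space torus_haar"
  shows "conditional_density_lhopital \<omega> x
    = det_density (1 / (fact CARD('n) * (\<Prod>j<CARD('n). mellin \<omega> (int j)) * confluent_det 0 x pos))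
      (\<lambda>b z. (circle_deriv ^^ repetition x b) (\<lambda>y. \<omega> (z / y)) (x (b :: 'n::{finite,linorder})))"
proof -
  have "x b \<in> circle" for b using mem_torusD[OF assms] by simp
  then have "(\<chi> (a::'n) b. (circle_deriv ^^ repetition x b) (\<lambda>y. y ^ pos a) (x b))
      = (\<chi> a b. falling (int (pos a) - int 0) (repetition x b) * x b powi (int (pos a) - int 0 - int (repetition x b)))"
    by (simp only: circle_deriv_iter_power) simp
  then have "det (\<chi> (a::'n) b. (circle_deriv ^^ repetition x b) (\<lambda>y. y ^ pos a) (x b)) = confluent_det 0 x pos"
    by (simp only: confluent_det_def)
  then show ?thesis by (simp add: fun_eq_iff conditional_density_lhopital_def det_density_def)
qed

text \<open>The random conjugate of the fixed matrix has a deterministic spectrum, so its moment is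
  the value at x, a quotient of confluent determinants. Differentiating the weights in the nodes
  produces the numerator, with the Mellin transform of \<omega> as row factors.\<close>

lemma eigenvalue_density_lhopital:
  fixes U1 :: "'a \<Rightarrow> 'n::{finite,linorder} cmat"
  assumes M: "prob_space M" and U1: "cyclic_polya_ensemble M U1 \<omega>" and U2: "U2 \<in> unitary_group" "is_spectrum U2 x"
    and V: "haar_distributed M V" and indep: "prob_space.indep_var M unitary_space U1 unitary_space V"
  shows "eigenvalue_density M (\<lambda>\<xi>. U1 \<xi> ** V \<xi> ** U2 ** dagger (V \<xi>)) (conditional_density_lhopital \<omega> x)"
proof -
  let ?Y = "\<lambda>\<xi>. V \<xi> ** U2 ** dagger (V \<xi>)"
  have x: "x \<in> space torus_haar" by (rule is_spectrum_torus[OF U2])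
  then have xc: "x b \<in> circle" for b using mem_torusD by auto
  have \<omega>: "\<omega> \<in> L1_cyclic_diff CARD('n)" and i1: "unitarily_invariant M U1"
    using U1 by (auto simp: cyclic_polya_ensemble_def)
  note Y = haar_conjugate[OF M U2(1) V indep]
  let ?c = "1 / (fact CARD('n) * (\<Prod>j<CARD('n). mellin \<omega> (int j)) * confluent_det 0 x pos)"
  let ?\<psi> = "\<lambda>b z. (circle_deriv ^^ repetition x b) (\<lambda>y. \<omega> (z / y)) (x b)"
  have "eigenvalue_density M (\<lambda>\<xi>. U1 \<xi> ** ?Y \<xi>) (det_density ?c ?\<psi>)"
  proof (rule det_densityI[OF M])
    show "(\<lambda>\<xi>. U1 \<xi> ** ?Y \<xi>) \<in> measurable M unitary_space"
      using unitarily_invariant_mult[OF M i1 Y] by (simp add: unitarily_invariant_def)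
    show "integrable circle_haar (?\<psi> b)" for b
      by (rule integrable_circle_deriv_iter_quotient[OF \<omega> repetition_less_card xc])
    fix k s
    have "det (\<chi> a b. mellin (?\<psi> b) (int (s a) - int k))
        = (\<Prod>a\<in>UNIV. mellin \<omega> (int (s a) - int k)) * confluent_det k x s"
      by (simp only: mellin_circle_deriv_iter_quotient[OF \<omega> repetition_less_card xc] det_scale_rows confluent_det_def)
    moreover have "class_moment M (\<lambda>\<xi>. U1 \<xi> ** ?Y \<xi>) k s
        = (\<Prod>a\<in>UNIV. mellin \<omega> (int (s a) - int k)) / (\<Prod>j<CARD('n). mellin \<omega> (int j))
          * (confluent_det k x s / confluent_det 0 x pos)"
      unfolding class_moment_polya_mult[OF M U1 Y] confluent_det_ratio[OF x]
      using V by (simp add: haar_conjugate_class_moment[OF M _ U2(2)] haar_distributed_def)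
    ultimately show "class_moment M (\<lambda>\<xi>. U1 \<xi> ** ?Y \<xi>) k s
        = ?c * fact CARD('n) * det (\<chi> a b. mellin (?\<psi> b) (int (s a) - int k))" by simp
  qed
  then show ?thesis unfolding conditional_density_lhopital_eq[OF x] by (simp only: matrix_mul_assoc)
qed

lemma conditional_density_eq_lhopital:
  assumes "inj x"
  shows "conditional_density_lhopital \<omega> x = conditional_density \<omega> (x :: 'n::{finite,linorder} \<Rightarrow> complex)"
proof -
  have "repetition x b = 0" for b using assms by (auto simp: repetition_def inj_def)
  then show ?thesis
    by (simp add: fun_eq_iff conditional_density_lhopital_def conditional_density_def vandermonde_det)
qed

section \<open>Normalisation of the conditional density as a cyclic polynomial ensemble\<close>

lemma sum_pos_eq: "(\<Sum>a\<in>UNIV. pos (a::'n::{finite,linorder})) = CARD('n) * (CARD('n) - 1) div 2"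
  using sum_over_pos[of "\<lambda>k. k", where 'n = 'n] Sum_Ico_nat[of 0 "CARD('n)"] by (simp add: lessThan_atLeast0)

lemma cyclic_const_quotient:
  fixes x :: "'n::{finite,linorder} \<Rightarrow> complex"
  assumes \<omega>: "integrable circle_haar \<omega>" and x: "\<And>b. x b \<in> circle"
  shows "cyclic_const (\<lambda>j z. c j * \<omega> (z / x j))
    = (\<Prod>j\<in>UNIV. c j) * ((- \<i>) ^ (CARD('n) * (CARD('n) - 1) div 2) * (\<Prod>j<CARD('n). mellin \<omega> (int j)) * vandermonde x)"
proof -
  have m: "\<omega> \<in> borel_measurable circle_haar" using \<omega> by auto
  have "mellin (\<lambda>z. c b * \<omega> (z / x b)) (int k) = c b * (mellin \<omega> (int k) * x b ^ k)" for b k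
  proof -
    have "mellin (\<lambda>z. c b * \<omega> (z / x b)) (int k) = c b * mellin (\<lambda>z. \<omega> (z / x b)) (int k)"
      by (simp add: mellin_def mult.left_commute)
    then show ?thesis by (simp add: mellin_rotate[OF x m])
  qed
  moreover have "(\<Prod>a\<in>UNIV. (- \<i>) ^ pos (a::'n)) = (- \<i>) ^ (CARD('n) * (CARD('n) - 1) div 2)"
    by (simp only: power_sum[symmetric] sum_pos_eq)
  ultimately show ?thesis
    using prod_over_pos[of "\<lambda>j. mellin \<omega> (int j)", where 'n = 'n]
    by (simp only: cyclic_const_eq det_scale_rows det_scale_columns vandermonde_det) simp
qed

lemma cyclic_density_quotient:
  fixes x :: "'n::{finite,linorder} \<Rightarrow> complex"
  assumes \<omega>: "integrable circle_haar \<omega>" and x: "\<And>b. x b \<in> circle" and c: "\<And>j. c j \<noteq> 0"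
  shows "cyclic_density (\<lambda>j z. c j * \<omega> (z / x j)) = conditional_density \<omega> x"
proof
  fix z
  let ?n = "CARD('n) * (CARD('n) - 1) div 2"
  have "(- \<i>) ^ ?n * \<i> ^ ?n = 1" by (simp flip: power_mult_distrib)
  then have i: "(- \<i>) ^ ?n = 1 / \<i> ^ ?n" by (simp add: field_simps)
  have "(\<Prod>j\<in>UNIV. c j) \<noteq> 0" using c by simp
  then show "cyclic_density (\<lambda>j z. c j * \<omega> (z / x j)) z = conditional_density \<omega> x z"
    unfolding cyclic_density_def cyclic_const_quotient[OF assms(1,2)] conditional_density_def det_scale_columns i
    by simp
qed

lemma prod_pairs:
  fixes f :: "'n::{finite,linorder} \<Rightarrow> complex"
  shows "(\<Prod>(a, b)\<in>{(a, b). a < b}. f a * f b) = (\<Prod>a\<in>UNIV. f a ^ (CARD('n) - 1))"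
proof -
  let ?A = "{(a::'n, b). a < b}" and ?B = "{(a::'n, b). b < a}"
  have "(\<Prod>(a, b)\<in>?A. f b) = (\<Prod>(a, b)\<in>?B. f a)"
    by (rule prod.reindex_bij_witness[of _ "\<lambda>(a,b). (b,a)" "\<lambda>(a,b). (b,a)"]) auto
  then have "(\<Prod>(a, b)\<in>?A. f a * f b) = (\<Prod>(a, b)\<in>?A. f a) * (\<Prod>(a, b)\<in>?B. f a)"
    by (simp add: case_prod_unfold prod.distrib)
  also have "\<dots> = (\<Prod>(a, b)\<in>?A \<union> ?B. f a)" by (rule prod.union_disjoint[symmetric]) auto
  also have "?A \<union> ?B = Sigma UNIV (\<lambda>a. UNIV - {a})" by auto
  also have "(\<Prod>(a, b)\<in>\<dots>. f a) = (\<Prod>a\<in>UNIV. \<Prod>b\<in>UNIV - {a}. f a)"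
    by (rule prod.Sigma[symmetric]) auto
  finally show ?thesis by (simp add: card_Diff_singleton)
qed

lemma card_pairs: "card {(a::'n::{finite,linorder}, b). a < b} = CARD('n) * (CARD('n) - 1) div 2"
proof -
  have "card {(a::'n, b). a < b} = card (Sigma UNIV (\<lambda>b::'n. {a. a < b}))"
    by (rule bij_betw_same_card[of "\<lambda>(a,b). (b,a)"]) (auto simp: bij_betw_def inj_on_def)
  then show ?thesis using sum_pos_eq[where 'n = 'n] by (simp add: pos_def)
qed

text \<open>For unimodular numbers (x_b - x_a)^2 = - |x_b - x_a|^2 x_a x_b, and every index occurs
  in N - 1 pairs.\<close>

lemma vandermonde_square_circle:
  fixes x :: "'n::{finite,linorder} \<Rightarrow> complex"
  assumes x: "\<And>b. x b \<in> circle"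
  shows "vandermonde x ^ 2 = (- 1) ^ (CARD('n) * (CARD('n) - 1) div 2) * of_real (cmod (vandermonde x) ^ 2) * (\<Prod>a\<in>UNIV. x a ^ (CARD('n) - 1))"
proof -
  have pair: "(x b - x a) ^ 2 = - 1 * of_real (cmod (x b - x a) ^ 2) * (x a * x b)" for a b
  proof -
    have c: "cnj (x d) = 1 / x d" "x d \<noteq> 0" for d
      using x[of d] by (auto simp: divide_conv_cnj)
    have "of_real (cmod (x b - x a) ^ 2) = (x b - x a) * cnj (x b - x a)" by (rule complex_norm_square)
    then show ?thesis using c(2)[of a] c(2)[of b] by (simp add: c(1) field_simps power2_eq_square)
  qed
  let ?S = "{(a::'n, b). a < b}"
  have distrib: "(\<Prod>p\<in>?S. - 1 * of_real (f p ^ 2) * g p) = (\<Prod>p\<in>?S. - 1) * of_real (\<Prod>p\<in>?S. f p) ^ 2 * (\<Prod>p\<in>?S. g p)"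
    for f :: "_ \<Rightarrow> real" and g :: "_ \<Rightarrow> complex"
    by (simp only: prod.distrib of_real_prod of_real_power prod_power_distrib)
  have "vandermonde x ^ 2 = (\<Prod>p\<in>?S. (x (snd p) - x (fst p)) ^ 2)"
    by (simp add: vandermonde_def case_prod_unfold prod_power_distrib)
  also have "\<dots> = (\<Prod>p\<in>?S. - 1) * of_real (\<Prod>p\<in>?S. cmod (x (snd p) - x (fst p))) ^ 2
      * (\<Prod>p\<in>?S. x (fst p) * x (snd p))"
    unfolding pair by (rule distrib)
  also have "(\<Prod>p\<in>?S. x (fst p) * x (snd p)) = (\<Prod>a\<in>UNIV. x a ^ (CARD('n) - 1))"
    using prod_pairs[of x] by (simp only: case_prod_unfold)
  also have "(\<Prod>p\<in>?S. cmod (x (snd p) - x (fst p))) = cmod (vandermonde x)"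
    by (simp add: vandermonde_def case_prod_unfold prod_norm)
  also have "(\<Prod>p\<in>?S. - 1 :: complex) = (- 1) ^ (CARD('n) * (CARD('n) - 1) div 2)"
    by (simp only: prod_constant card_pairs)
  finally show ?thesis by simp
qed

text \<open>The reflection symmetry of the rotated weight determines the square of each phase. With
  any such choice the square of the constant is positive, so the constant is real and nonzero; the
  free sign of one phase makes it positive.\<close>

lemma exists_phases:
  fixes x :: "'n::{finite,linorder} \<Rightarrow> complex"
  assumes \<omega>: "\<omega> \<in> L1_cyclic CARD('n)" and P: "0 < (\<Prod>j<CARD('n). mellin \<omega> (int j))"
    and x: "\<And>b. x b \<in> circle" and inj: "inj x"
  obtains c :: "'n \<Rightarrow> complex" where "\<And>j. cmod (c j) = 1" "\<And>j. (\<lambda>z. c j * \<omega> (z / x j)) \<in> L1_cyclic CARD('n)"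
    "0 < cyclic_const (\<lambda>j z. c j * \<omega> (z / x j))"
proof -
  let ?N = "CARD('n)" and ?P = "\<Prod>j<CARD('n). mellin \<omega> (int j)"
  let ?n = "?N * (?N - 1) div 2"
  have \<omega>i: "integrable circle_haar \<omega>" and \<omega>c: "AE z in circle_haar. cnj (\<omega> z) = z ^ (?N - 1) * \<omega> z"
    using \<omega> by (auto simp: L1_cyclic_def)
  have x0: "x j \<noteq> 0" for j using x[of j] by auto
  \<comment> \<open>Rotation by \<open>x j\<close> introduces the factor x_j^(1-N) into the
    reflection symmetry; conjugating a square root of it compensates this factor.\<close>
  define c where "c j = csqrt (1 / x j ^ (?N - 1))" for j
  have c2: "c j ^ 2 * x j ^ (?N - 1) = 1" for j using x0[of j] by (simp add: c_def)
  have norm: "cmod (c j) = 1" for j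
    using x[of j] by (simp add: c_def norm_divide norm_power)
  have cyclic: "(\<lambda>z. u * \<omega> (z / x j)) \<in> L1_cyclic ?N" if u: "cmod u = 1" "u ^ 2 * x j ^ (?N - 1) = 1" for u j
  proof -
    have a: "AE z in circle_haar. cnj (\<omega> (z / x j)) = (z / x j) ^ (?N - 1) * \<omega> (z / x j)"
      using circle_AE_rotate[OF circle_inverse[OF x] \<omega>c, of j] by simp
    have b: "cnj u = u * x j ^ (?N - 1)"
    proof -
      have "cnj u * u = 1" using u(1) by (metis complex_norm_square mult.commute of_real_1 one_power2)
      then have "cnj u = cnj u * (u ^ 2 * x j ^ (?N - 1))" using u(2) by simp
      also have "\<dots> = (cnj u * u) * (u * x j ^ (?N - 1))" by (simp add: power2_eq_square mult_ac)
      finally show ?thesis using \<open>cnj u * u = 1\<close> by simp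
    qed
    from a have "AE z in circle_haar. cnj (u * \<omega> (z / x j)) = z ^ (?N - 1) * (u * \<omega> (z / x j))"
      by eventually_elim (use x0[of j] in \<open>simp add: b power_divide\<close>)
    then show ?thesis
      using integrable_circle_rotate[OF x \<omega>i] by (simp add: L1_cyclic_def)
  qed
  let ?K = "\<lambda>c. cyclic_const (\<lambda>j z. c j * \<omega> (z / x j))"
  note K = cyclic_const_quotient[OF \<omega>i x]
  have "?K c ^ 2 = ?P ^ 2 * of_real (cmod (vandermonde x) ^ 2)"
  proof -
    have m: "((- \<i>) ^ ?n) ^ 2 * (- 1) ^ ?n = 1"
      by (simp add: power2_eq_square flip: power_mult_distrib)
    have p: "(\<Prod>j\<in>UNIV. c j) ^ 2 * (\<Prod>a\<in>UNIV. x a ^ (?N - 1)) = 1"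
      by (simp only: prod_power_distrib prod.distrib[symmetric] c2 prod.neutral_const)
    have "?K c ^ 2 = ((\<Prod>j\<in>UNIV. c j) ^ 2 * (\<Prod>a\<in>UNIV. x a ^ (?N - 1))) * (((- \<i>) ^ ?n) ^ 2 * (- 1) ^ ?n)
        * (?P ^ 2 * of_real (cmod (vandermonde x) ^ 2))"
      unfolding K power_mult_distrib vandermonde_square_circle[OF x] by (simp only: mult_ac)
    then show ?thesis unfolding m p by simp
  qed
  moreover have "0 < ?P ^ 2 * of_real (cmod (vandermonde x) ^ 2)"
  proof -
    have "0 < cmod (vandermonde x) ^ 2" using inj by (simp add: vandermonde_eq_0_iff)
    then have "(0::complex) < of_real (cmod (vandermonde x) ^ 2)" by (simp only: less_complex_def Re_complex_of_real Im_complex_of_real) simp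
    moreover have "0 < ?P ^ 2" using P by (simp add: less_complex_def power2_eq_square)
    ultimately show ?thesis by (auto simp: less_complex_def)
  qed
  ultimately have "0 < ?K c ^ 2" by simp
  then consider "0 < ?K c" | "0 < - ?K c"
    by (auto simp: less_complex_def power2_eq_square zero_less_mult_iff)
  then show thesis
  proof cases
    case 1
    show thesis by (rule that[OF norm cyclic[OF norm c2] 1])
  next
    case 2
    \<comment> \<open>Any index serves: changing the sign of one phase reverses the sign of the
      constant and preserves the squares.\<close>
    define j0 :: 'n where "j0 = undefined"
    define d where "d = c(j0 := - c j0)"
    have "(\<Prod>j\<in>UNIV. d j) = - (\<Prod>j\<in>UNIV. c j)"
      by (subst (1 2) prod.remove[of UNIV j0]) (auto simp: d_def intro!: prod.cong)
    then have "?K d = - ?K c" unfolding K by simp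
    with 2 have "0 < ?K d" by simp
    moreover have "cmod (d j) = 1" "d j ^ 2 * x j ^ (?N - 1) = 1" for j using norm c2 by (auto simp: d_def)
    ultimately show thesis using that cyclic by blast
  qed
qed

theorem theorem7:
  fixes M :: "'a measure"
    and U1 :: "'a \<Rightarrow> 'n::{finite,linorder} cmat"
    and \<omega> :: "complex \<Rightarrow> complex"
  assumes "prob_space M"
    and "cyclic_polya_ensemble M U1 \<omega>"
  shows
    "(\<forall>(U2 :: 'a \<Rightarrow> 'n cmat) (w :: 'n \<Rightarrow> complex \<Rightarrow> complex).
        cyclic_polynomial_ensemble M U2 w \<longrightarrow>
        prob_space.indep_var M unitary_space U1 unitary_space U2 \<longrightarrow>
        cyclic_polynomial_ensemble M (\<lambda>\<xi>. U1 \<xi> ** U2 \<xi>) (\<lambda>j. circle_conv (w j) \<omega>))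
     \<and>
     (\<forall>(U2 :: 'a \<Rightarrow> 'n cmat) (\<omega>' :: complex \<Rightarrow> complex).
        cyclic_polya_ensemble M U2 \<omega>' \<longrightarrow>
        prob_space.indep_var M unitary_space U1 unitary_space U2 \<longrightarrow>
        cyclic_polya_ensemble M (\<lambda>\<xi>. U1 \<xi> ** U2 \<xi>) (circle_conv \<omega>' \<omega>))
     \<and>
     (\<forall>(U2 :: 'n cmat) (x :: 'n \<Rightarrow> complex) (V :: 'a \<Rightarrow> 'n cmat).
        U2 \<in> unitary_group \<longrightarrow> is_spectrum U2 x \<longrightarrow>
        haar_distributed M V \<longrightarrow>
        prob_space.indep_var M unitary_space U1 unitary_space V \<longrightarrow>
        (inj x \<longrightarrow>
           (\<exists>c :: 'n \<Rightarrow> complex. (\<forall>j. cmod (c j) = 1) \<and>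
              cyclic_polynomial_ensemble M (\<lambda>\<xi>. U1 \<xi> ** V \<xi> ** U2 ** dagger (V \<xi>))
                (\<lambda>j z. c j * \<omega> (z / x j))) \<and>
           cyclic_const (\<lambda>j z. \<omega> (z / x j)) \<noteq> 0 \<and>
           eigenvalue_density M (\<lambda>\<xi>. U1 \<xi> ** V \<xi> ** U2 ** dagger (V \<xi>))
             (cyclic_density (\<lambda>j z. \<omega> (z / x j))) \<and>
           eigenvalue_density M (\<lambda>\<xi>. U1 \<xi> ** V \<xi> ** U2 ** dagger (V \<xi>))
             (conditional_density \<omega> x)) \<and>
        eigenvalue_density M (\<lambda>\<xi>. U1 \<xi> ** V \<xi> ** U2 ** dagger (V \<xi>))
          (conditional_density_lhopital \<omega> x))"
proof (intro conjI allI impI)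
  show "cyclic_polynomial_ensemble M (\<lambda>\<xi>. U1 \<xi> ** U2 \<xi>) (\<lambda>j. circle_conv (w j) \<omega>)"
    if "cyclic_polynomial_ensemble M U2 w" "prob_space.indep_var M unitary_space U1 unitary_space U2" for U2 w
    by (rule cyclic_polynomial_mult[OF assms that])
  show "cyclic_polya_ensemble M (\<lambda>\<xi>. U1 \<xi> ** U2 \<xi>) (circle_conv \<omega>' \<omega>)"
    if "cyclic_polya_ensemble M U2 \<omega>'" "prob_space.indep_var M unitary_space U1 unitary_space U2" for U2 \<omega>'
    by (rule cyclic_polya_mult[OF assms that])
next
  fix U2 :: "'n cmat" and x :: "'n \<Rightarrow> complex" and V :: "'a \<Rightarrow> 'n cmat"
  assume U2: "U2 \<in> unitary_group" "is_spectrum U2 x" and V: "haar_distributed M V"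
    and indep: "prob_space.indep_var M unitary_space U1 unitary_space V"
  let ?U = "\<lambda>\<xi>. U1 \<xi> ** V \<xi> ** U2 ** dagger (V \<xi>)"
  show lh: "eigenvalue_density M ?U (conditional_density_lhopital \<omega> x)"
    by (rule eigenvalue_density_lhopital[OF assms U2 V indep])
  assume inj: "inj x"
  have d: "eigenvalue_density M ?U (conditional_density \<omega> x)"
    using lh by (simp only: conditional_density_eq_lhopital[OF inj])
  then show "eigenvalue_density M ?U (conditional_density \<omega> x)" .
  have x: "x b \<in> circle" for b using mem_torusD[OF is_spectrum_torus[OF U2]] by simp
  have \<omega>: "\<omega> \<in> L1_cyclic CARD('n)" and i1: "unitarily_invariant M U1" and P: "0 < (\<Prod>j<CARD('n). mellin \<omega> (int j))"
    using assms(2) L1_cyclic_diff_L1_cyclic by (auto simp: cyclic_polya_ensemble_def prod_fact_mult)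
  then have \<omega>i: "integrable circle_haar \<omega>" by (simp add: L1_cyclic_def)
  \<comment> \<open>Unit constants bring the unscaled weights into the form treated with
    phases.\<close>
  have one: "(\<lambda>j z. \<omega> (z / x j)) = (\<lambda>j z. 1 * \<omega> (z / x j))" by simp
  show "cyclic_const (\<lambda>j z. \<omega> (z / x j)) \<noteq> 0"
  proof -
    have "(\<Prod>j<CARD('n). mellin \<omega> (int j)) \<noteq> 0" using P by (metis less_irrefl)
    then show ?thesis unfolding one cyclic_const_quotient[OF \<omega>i x] using inj by (simp add: vandermonde_eq_0_iff)
  qed
  show "eigenvalue_density M ?U (cyclic_density (\<lambda>j z. \<omega> (z / x j)))"
    unfolding one using d by (subst cyclic_density_quotient[OF \<omega>i x]) auto
  obtain c :: "'n \<Rightarrow> complex" where c: "\<And>j. cmod (c j) = 1" "\<And>j. (\<lambda>z. c j * \<omega> (z / x j)) \<in> L1_cyclic CARD('n)"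
    "0 < cyclic_const (\<lambda>j z. c j * \<omega> (z / x j))"
    using exists_phases[OF \<omega> P x inj] by blast
  have "unitarily_invariant M ?U"
    using unitarily_invariant_mult[OF assms(1) i1 haar_conjugate[OF assms(1) U2(1) V indep]] by (simp only: matrix_mul_assoc)
  moreover have "c j \<noteq> 0" for j using c(1)[of j] by auto
  then have "eigenvalue_density M ?U (cyclic_density (\<lambda>j z. c j * \<omega> (z / x j)))"
    using d by (subst cyclic_density_quotient[OF \<omega>i x])
  ultimately have "cyclic_polynomial_ensemble M ?U (\<lambda>j z. c j * \<omega> (z / x j))"
    unfolding cyclic_polynomial_ensemble_def using c by blast
  then show "\<exists>c :: 'n \<Rightarrow> complex. (\<forall>j. cmod (c j) = 1) \<and> cyclic_polynomial_ensemble M ?U (\<lambda>j z. c j * \<omega> (z / x j))"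
    using c(1) by blast
qed

end
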